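(* Let $(\mathbb X,\mathbb T)$ be a tangentad in a 2-category $\mathbf K$ and suppose that the following exist in $\mathbf K$ (all described in the context): the inserter $\mathbb I'^k_0$ and equifiers $\mathbb E'^k_1,\dots,\mathbb E'^k_4$ (whence $\mathsf{VAC}(\mathbb X,\mathbb T)=(\mathbb E'^k_4,\mathbb T'^k_4)$ is the tangentad of vertical affine connections), the inserter $\mathbb I'^h_0$ and equifiers $\mathbb E'^h_1,\dots,\mathbb E'^h_4$ (whence $\mathsf{HAC}(\mathbb X,\mathbb T)=(\mathbb E'^h_4,\mathbb T'^h_4)$ is the tangentad of horizontal affine connections), the 2-pullback $\mathsf{AC}_0(\mathbb X,\mathbb T)$ of the forgetful 1-morphisms $U^{\mathsf{VAC}}:\mathsf{VAC}(\mathbb X,\mathbb T)\to(\mathbb X,\mathbb T)$ and $U^{\mathsf{HAC}}:\mathsf{HAC}(\mathbb X,\mathbb T)\to(\mathbb X,\mathbb T)$, and the equifiers $\mathbb E'^{(k,h)}_1$ and $\mathbb E'^{(k,h)}_2$. Then $(\mathbb X,\mathbb T)$ admits the construction of affine connections. Moreover, the tangentad $\mathsf{AC}(\mathbb X,\mathbb T)$ of affine connections of $(\mathbb X,\mathbb T)$ is the equifier $(\mathbb E'^{(k,h)}_2,\mathbb T'^{(k,h)}_2)$.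
   Context: Composition $\circ$ is in the usual order; $F\varphi,\varphi_F$ denote whiskering. A limit in a hom-category of $\mathbf K$ is pointwise if preserved by precomposition with 1-morphisms. A tangentad $(\mathbb X,\mathbb T)$ in $\mathbf K$ is an object with a 1-morphism $T:\mathbb X\to\mathbb X$ and 2-morphisms $p:T\Rightarrow\mathrm{id}$, $z:\mathrm{id}\Rightarrow T$, $s:T_2\Rightarrow T$, $l:T\Rightarrow T^2$, $c:T^2\Rightarrow T^2$, where $T_n$ is the pointwise $n$-fold pullback of $p$ along itself (required to exist, preserved by all $T^m$), such that: $(p,z,s)$ is a commutative monoid over $\mathrm{id}_{\mathbb X}$; $Tp\circ l=z\circ p$, $l\circ z=Tz\circ z$, $l\circ s=Ts\circ\langle l\pi_1,l\pi_2\rangle$; $p_T\circ c=Tp$, $c\circ Tz=z_T$, $c\circ Ts=s_T\circ\langle c\,T\pi_1,c\,T\pi_2\rangle$; $Tl\circ l=l_T\circ l$, $c\circ l=l$, $c_T\circ Tc\circ l_T=Tl\circ c$; $c\circ c=\mathrm{id}$, $Tc\circ c_T\circ Tc=c_T\circ Tc\circ c_T$; and the square with top $Ts\circ\langle z_T\pi_1,l\pi_2\rangle:T_2\Rightarrow T^2$, left $p\pi_1$, right $Tp$, bottom $z$ is a pointwise pullback. Tangentads in $\mathsf{Cat}$ are tangent categories. A lax tangent morphism $(F,\alpha):(\mathbb X',\mathbb T')\to(\mathbb X,\mathbb T)$ is a 1-morphism with $\alpha:FT'\Rightarrow TF$ such that $p_F\circ\alpha=Fp'$, $\alpha\circ Fz'=z_F$,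 $\alpha\circ Fs'=s_F\circ\langle\alpha F\pi_1,\alpha F\pi_2\rangle$, $l_F\circ\alpha=T\alpha\circ\alpha_{T'}\circ Fl'$, $c_F\circ T\alpha\circ\alpha_{T'}=T\alpha\circ\alpha_{T'}\circ Fc'$ (strict if $\alpha=\mathrm{id}$). Tangent 2-morphisms $\varphi:(F,\alpha)\Rightarrow(G,\beta)$ satisfy $T\varphi\circ\alpha=\beta\circ\varphi_{T'}$. The hom-category $[\mathbb X',\mathbb T'\mid\mathbb X,\mathbb T]$ is a tangent category with $\bar T(F,\alpha)=(TF,c_F\circ T\alpha)$, $\bar T\varphi=T\varphi$, $\bar p_{(F,\alpha)}=p_F$, etc. For an object $M$ of a tangent category, $k:T^2M\to TM$ and $h:T_2M\to T^2M$, consider: (V1) $k\circ l_M=\mathrm{id}_{TM}$; (V2) $p_M\circ k=p_M\circ p_{TM}$; (V3) $l_M\circ k=Tk\circ l_{TM}$; (V4) $l_M\circ k=Tk\circ c_{TM}\circ Tl_M$; (H1) $Tp_M\circ h=\pi_2$; (H2) $p_{TM}\circ h=\pi_1$; (H3) $l_{TM}\circ h=Th\circ(z_{TM}\times_{z_M}l_M)$; (H4) $c_{TM}\circ Tl_M\circ h=Th\circ(l_M\times_{z_M}z_{TM})$; (A1) $k\circ h=z_M\circ p_M\circ\pi_1$; (A2) $s_{TM}\circ\langle\xi\circ\langle k,p_{TM}\rangle,h\circ\langle p_{TM},Tp_M\rangle\rangle=\mathrm{id}_{T^2M}$, where $\xi=Ts_M\circ\langle l_M\pi_1,z_{TM}\pi_2\rangle:T_2M\to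 T^2M$. $k$ is a vertical affine connection if (V1)-(V4) hold, $h$ a horizontal affine connection if (H1)-(H4) hold, and $(k,h)$ an affine connection if all ten hold. $\mathsf{AC}[\mathbb X',\mathbb T'\mid\mathbb X,\mathbb T]$ is the tangent category of triples $(M;k,h)$ with $(k,h)$ an affine connection on an object $M$ of the tangent category $[\mathbb X',\mathbb T'\mid\mathbb X,\mathbb T]$ (with respect to $\bar T$), with morphisms $f$ such that $k'\circ\bar T^2f=\bar Tf\circ k$ and $h'\circ\bar T_2f=\bar T^2f\circ h$, and tangent functor $(M;k,h)\mapsto(TM;\;c_M\circ Tk\circ c_{TM}\circ Tc_M,\;Tc_M\circ c_{TM}\circ Th\circ(c_M\times c_M))$ (written with $\bar T,\bar c$ in place of $T,c$). $(\mathbb X,\mathbb T)$ admits the construction of affine connections if there are a tangentad $\mathsf{AC}(\mathbb X,\mathbb T)$, a tangent morphism $U:\mathsf{AC}(\mathbb X,\mathbb T)\to(\mathbb X,\mathbb T)$ and an affine connection on $U$ in $[\mathsf{AC}(\mathbb X,\mathbb T)\mid\mathbb X,\mathbb T]$ such that for every tangentad $(\mathbb X',\mathbb T')$ precomposition is an isomorphism of tangent categories $[\mathbb X',\mathbb T'\mid\mathsf{AC}(\mathbb X,\mathbb T)]\cong\mathsf{AC}[\mathbb X',\mathbb T'\mid\mathbb X,\mathbb T]$. Limits used. $\mathbb I'^k_0$ is the inserter in $\mathbf K$ of $T^2,T:\mathbb X\to\mathbb X$, with universal $V_0$ and $K_0:T^2V_0\Rightarrow TV_0$; $\mathbb E'^k_1,\dots,\mathbb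 E'^k_4$ are the successive equifiers imposing (V1),…,(V4) on (the restriction of) $K_0$. $\mathbb I'^h_0$ is the inserter of $T_2,T^2:\mathbb X\to\mathbb X$, with universal $H_0:T_2V^h_0\Rightarrow T^2V^h_0$; $\mathbb E'^h_1,\dots,\mathbb E'^h_4$ are the successive equifiers imposing (H1),…,(H4) on $H_0$. $U^{\mathsf{VAC}},U^{\mathsf{HAC}}$ are the resulting 1-morphisms to $\mathbb X$. On $\mathsf{AC}_0(\mathbb X,\mathbb T)$ one has $k$ and $h$ obtained by precomposition with the two projections; $\mathbb E'^{(k,h)}_1$ is the equifier over $\mathsf{AC}_0(\mathbb X,\mathbb T)$ imposing (A1), and $\mathbb E'^{(k,h)}_2$ the equifier over $\mathbb E'^{(k,h)}_1$ imposing (A2). All carry the induced tangent structures for which the universal 1-morphisms are strict tangent morphisms and the universal 2-morphisms are tangent 2-morphisms. *)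

theory Defs
  imports Main
begin

section \<open>Categories\<close>

record ('a, 'f) cat =
  Ob :: "'a set"
  Ar :: "'f set"
  Dom :: "'f \<Rightarrow> 'a"
  Cod :: "'f \<Rightarrow> 'a"
  Idn :: "'a \<Rightarrow> 'f"
  Comp :: "'f \<Rightarrow> 'f \<Rightarrow> 'f"  (infixr "\<cdot>\<index>" 65)

definition Hom :: "('a, 'f, 'x) cat_scheme \<Rightarrow> 'a \<Rightarrow> 'a \<Rightarrow> 'f set" where
  "Hom C A B = {f \<in> Ar C. Dom C f = A \<and> Cod C f = B}"

locale category =
  fixes C :: "('a, 'f, 'x) cat_scheme" (structure)
  assumes Dom_Ob: "f \<in> Ar C \<Longrightarrow> Dom C f \<in> Ob C"
    and Cod_Ob: "f \<in> Ar C \<Longrightarrow> Cod C f \<in> Ob C"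
    and Idn_Hom: "A \<in> Ob C \<Longrightarrow> Idn C A \<in> Hom C A A"
    and Comp_Hom: "f \<in> Hom C A B \<Longrightarrow> g \<in> Hom C B E \<Longrightarrow> g \<cdot> f \<in> Hom C A E"
    and Idn_right: "f \<in> Hom C A B \<Longrightarrow> f \<cdot> Idn C A = f"
    and Idn_left: "f \<in> Hom C A B \<Longrightarrow> Idn C B \<cdot> f = f"
    and Comp_assoc: "f \<in> Hom C A B \<Longrightarrow> g \<in> Hom C B E \<Longrightarrow> h \<in> Hom C E F \<Longrightarrow>
                       (h \<cdot> g) \<cdot> f = h \<cdot> (g \<cdot> f)"

context
  fixes C :: "('a, 'f, 'x) cat_scheme" (structure)
begin

definition is_iso :: "'f \<Rightarrow> bool" where
  "is_iso f \<longleftrightarrow> f \<in> Ar C \<and>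
     (\<exists>g \<in> Hom C (Cod C f) (Dom C f). g \<cdot> f = Idn C (Dom C f) \<and> f \<cdot> g = Idn C (Cod C f))"

definition is_pullback :: "'f \<Rightarrow> 'f \<Rightarrow> 'a \<Rightarrow> 'f \<Rightarrow> 'f \<Rightarrow> bool" where
  "is_pullback f g P a b \<longleftrightarrow>
     f \<in> Ar C \<and> g \<in> Ar C \<and> Cod C f = Cod C g \<and>
     a \<in> Hom C P (Dom C f) \<and> b \<in> Hom C P (Dom C g) \<and> f \<cdot> a = g \<cdot> b \<and>
     (\<forall>Q u v. u \<in> Hom C Q (Dom C f) \<and> v \<in> Hom C Q (Dom C g) \<and> f \<cdot> u = g \<cdot> v \<longrightarrow>
        (\<exists>!w. w \<in> Hom C Q P \<and> a \<cdot> w = u \<and> b \<cdot> w = v))"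

text \<open>\<open>P\<close>, with projections \<open>r 0, \<dots>, r (n - 1)\<close> and diagonal \<open>q\<close>, is the \<open>n\<close>-fold pullback
  of \<open>a\<close> along itself. The diagonal matters only for \<open>n = 0\<close>.\<close>

definition is_fold_pullback :: "'f \<Rightarrow> nat \<Rightarrow> 'a \<Rightarrow> (nat \<Rightarrow> 'f) \<Rightarrow> 'f \<Rightarrow> bool" where
  "is_fold_pullback a n P r q \<longleftrightarrow>
     a \<in> Ar C \<and> q \<in> Hom C P (Cod C a) \<and>
     (\<forall>i<n. r i \<in> Hom C P (Dom C a) \<and> a \<cdot> r i = q) \<and>
     (\<forall>Q v w. v \<in> Hom C Q (Cod C a) \<and> (\<forall>i<n. w i \<in> Hom C Q (Dom C a) \<and> a \<cdot> w i = v) \<longrightarrow>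
        (\<exists>!u. u \<in> Hom C Q P \<and> q \<cdot> u = v \<and> (\<forall>i<n. r i \<cdot> u = w i)))"

text \<open>The arrow \<open>\<langle>u, v\<rangle>\<close> into an object \<open>P\<close> with projections \<open>a\<close> and \<open>b\<close>; meaningful only
  when \<open>P\<close> is a pullback and \<open>u\<close>, \<open>v\<close> agree over its base.\<close>

definition pairing :: "'a \<Rightarrow> 'f \<Rightarrow> 'f \<Rightarrow> 'f \<Rightarrow> 'f \<Rightarrow> 'f" where
  "pairing P a b u v = (THE w. w \<in> Hom C (Dom C u) P \<and> a \<cdot> w = u \<and> b \<cdot> w = v)"

end


section \<open>Strict 2-categories\<close>

record ('o, 'm, 'c) two_cat =
  Cell0 :: "'o set"
  Cell1 :: "'m set"
  Cell2 :: "'c set"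
  src :: "'m \<Rightarrow> 'o"
  tgt :: "'m \<Rightarrow> 'o"
  dom2 :: "'c \<Rightarrow> 'm"
  cod2 :: "'c \<Rightarrow> 'm"
  id1 :: "'o \<Rightarrow> 'm"
  comp1 :: "'m \<Rightarrow> 'm \<Rightarrow> 'm"  (infixr "\<odot>\<index>" 75)
  id2 :: "'m \<Rightarrow> 'c"
  vcomp :: "'c \<Rightarrow> 'c \<Rightarrow> 'c"  (infixr "\<bullet>\<index>" 65)
  hcomp :: "'c \<Rightarrow> 'c \<Rightarrow> 'c"  (infixr "\<star>\<index>" 70)

definition hom1 :: "('o, 'm, 'c) two_cat \<Rightarrow> 'o \<Rightarrow> 'o \<Rightarrow> 'm set" where
  "hom1 K A B = {F \<in> Cell1 K. src K F = A \<and> tgt K F = B}"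

definition hom2 :: "('o, 'm, 'c) two_cat \<Rightarrow> 'm \<Rightarrow> 'm \<Rightarrow> 'c set" where
  "hom2 K F G = {\<phi> \<in> Cell2 K. dom2 K \<phi> = F \<and> cod2 K \<phi> = G}"

definition hom_cat :: "('o, 'm, 'c) two_cat \<Rightarrow> 'o \<Rightarrow> 'o \<Rightarrow> ('m, 'c) cat" where
  "hom_cat K A B =
     \<lparr> Ob = hom1 K A B,
       Ar = {\<phi> \<in> Cell2 K. dom2 K \<phi> \<in> hom1 K A B \<and> cod2 K \<phi> \<in> hom1 K A B},
       Dom = dom2 K, Cod = cod2 K, Idn = id2 K, Comp = vcomp K \<rparr>"

locale two_category =
  fixes K :: "('o, 'm, 'c) two_cat" (structure)
  assumes src_Cell0: "F \<in> Cell1 K \<Longrightarrow> src K F \<in> Cell0 K"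
    and tgt_Cell0: "F \<in> Cell1 K \<Longrightarrow> tgt K F \<in> Cell0 K"
    and id1_hom1: "A \<in> Cell0 K \<Longrightarrow> id1 K A \<in> hom1 K A A"
    and comp1_hom1: "F \<in> hom1 K A B \<Longrightarrow> G \<in> hom1 K B C \<Longrightarrow> G \<odot> F \<in> hom1 K A C"
    and id1_right: "F \<in> hom1 K A B \<Longrightarrow> F \<odot> id1 K A = F"
    and id1_left: "F \<in> hom1 K A B \<Longrightarrow> id1 K B \<odot> F = F"
    and comp1_assoc: "F \<in> hom1 K A B \<Longrightarrow> G \<in> hom1 K B C \<Longrightarrow> H \<in> hom1 K C D \<Longrightarrow>
                        (H \<odot> G) \<odot> F = H \<odot> (G \<odot> F)"
    and dom2_Cell1: "\<phi> \<in> Cell2 K \<Longrightarrow> dom2 K \<phi> \<in> Cell1 K"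
    and cod2_parallel: "\<phi> \<in> Cell2 K \<Longrightarrow> cod2 K \<phi> \<in> hom1 K (src K (dom2 K \<phi>)) (tgt K (dom2 K \<phi>))"
    and category_hom_cat: "A \<in> Cell0 K \<Longrightarrow> B \<in> Cell0 K \<Longrightarrow> category (hom_cat K A B)"
    and hcomp_hom2: "F \<in> hom1 K A B \<Longrightarrow> H \<in> hom1 K B C \<Longrightarrow>
                       \<phi> \<in> hom2 K F G \<Longrightarrow> \<psi> \<in> hom2 K H J \<Longrightarrow> \<psi> \<star> \<phi> \<in> hom2 K (H \<odot> F) (J \<odot> G)"
    and hcomp_id2: "F \<in> hom1 K A B \<Longrightarrow> H \<in> hom1 K B C \<Longrightarrow> id2 K H \<star> id2 K F = id2 K (H \<odot> F)"
    and interchange: "F \<in> hom1 K A B \<Longrightarrow> H \<in> hom1 K B C \<Longrightarrow>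
                        \<phi> \<in> hom2 K F F' \<Longrightarrow> \<phi>' \<in> hom2 K F' F'' \<Longrightarrow>
                        \<psi> \<in> hom2 K H H' \<Longrightarrow> \<psi>' \<in> hom2 K H' H'' \<Longrightarrow>
                        (\<psi>' \<bullet> \<psi>) \<star> (\<phi>' \<bullet> \<phi>) = (\<psi>' \<star> \<phi>') \<bullet> (\<psi> \<star> \<phi>)"
    and hcomp_id1_right: "F \<in> hom1 K A B \<Longrightarrow> \<phi> \<in> hom2 K F G \<Longrightarrow> \<phi> \<star> id2 K (id1 K A) = \<phi>"
    and hcomp_id1_left: "F \<in> hom1 K A B \<Longrightarrow> \<phi> \<in> hom2 K F G \<Longrightarrow> id2 K (id1 K B) \<star> \<phi> = \<phi>"
    and hcomp_assoc: "F \<in> hom1 K A B \<Longrightarrow> G \<in> hom1 K B C \<Longrightarrow> H \<in> hom1 K C D \<Longrightarrow>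
                        \<phi> \<in> hom2 K F F' \<Longrightarrow> \<psi> \<in> hom2 K G G' \<Longrightarrow> \<chi> \<in> hom2 K H H' \<Longrightarrow>
                        (\<chi> \<star> \<psi>) \<star> \<phi> = \<chi> \<star> (\<psi> \<star> \<phi>)"

text \<open>\<open>F \<rhd> \<phi>\<close> is the whiskering usually written \<open>F\<phi>\<close>, and \<open>\<phi> \<lhd> F\<close> is \<open>\<phi>\<^sub>F\<close>.\<close>

definition lwhisk :: "('o, 'm, 'c) two_cat \<Rightarrow> 'm \<Rightarrow> 'c \<Rightarrow> 'c"  (infixr "\<rhd>\<index>" 72) where
  "F \<rhd>\<^bsub>K\<^esub> \<phi> = id2 K F \<star>\<^bsub>K\<^esub> \<phi>"

definition rwhisk :: "('o, 'm, 'c) two_cat \<Rightarrow> 'c \<Rightarrow> 'm \<Rightarrow> 'c"  (infixl "\<lhd>\<index>" 73) where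
  "\<phi> \<lhd>\<^bsub>K\<^esub> F = \<phi> \<star>\<^bsub>K\<^esub> id2 K F"

context
  fixes K :: "('o, 'm, 'c) two_cat" (structure)
begin

subsection \<open>Strict 2-limits\<close>

definition is_inserter :: "'m \<Rightarrow> 'm \<Rightarrow> 'o \<Rightarrow> 'm \<Rightarrow> 'c \<Rightarrow> bool" where
  "is_inserter F G I V \<kappa> \<longleftrightarrow>
     F \<in> Cell1 K \<and> G \<in> hom1 K (src K F) (tgt K F) \<and>
     V \<in> hom1 K I (src K F) \<and> \<kappa> \<in> hom2 K (F \<odot> V) (G \<odot> V) \<and>
     (\<forall>Y W \<mu>. W \<in> hom1 K Y (src K F) \<and> \<mu> \<in> hom2 K (F \<odot> W) (G \<odot> W) \<longrightarrow>
        (\<exists>!H. H \<in> hom1 K Y I \<and> V \<odot> H = W \<and> \<kappa> \<lhd> H = \<mu>)) \<and>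
     (\<forall>Y H J \<theta>. H \<in> hom1 K Y I \<and> J \<in> hom1 K Y I \<and> \<theta> \<in> hom2 K (V \<odot> H) (V \<odot> J) \<and>
          (G \<rhd> \<theta>) \<bullet> (\<kappa> \<lhd> H) = (\<kappa> \<lhd> J) \<bullet> (F \<rhd> \<theta>) \<longrightarrow>
        (\<exists>!\<theta>'. \<theta>' \<in> hom2 K H J \<and> V \<rhd> \<theta>' = \<theta>))"

definition is_equifier :: "'c \<times> 'c \<Rightarrow> 'o \<Rightarrow> 'm \<Rightarrow> bool" where
  "is_equifier \<phi>\<psi> E e \<longleftrightarrow> (case \<phi>\<psi> of (\<phi>, \<psi>) \<Rightarrow>
     \<phi> \<in> Cell2 K \<and> \<psi> \<in> hom2 K (dom2 K \<phi>) (cod2 K \<phi>) \<and>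
     e \<in> hom1 K E (src K (dom2 K \<phi>)) \<and> \<phi> \<lhd> e = \<psi> \<lhd> e \<and>
     (\<forall>Y W. W \<in> hom1 K Y (src K (dom2 K \<phi>)) \<and> \<phi> \<lhd> W = \<psi> \<lhd> W \<longrightarrow>
        (\<exists>!H. H \<in> hom1 K Y E \<and> e \<odot> H = W)) \<and>
     (\<forall>Y H J \<theta>. H \<in> hom1 K Y E \<and> J \<in> hom1 K Y E \<and> \<theta> \<in> hom2 K (e \<odot> H) (e \<odot> J) \<longrightarrow>
        (\<exists>!\<theta>'. \<theta>' \<in> hom2 K H J \<and> e \<rhd> \<theta>' = \<theta>)))"

definition is_two_pullback :: "'m \<Rightarrow> 'm \<Rightarrow> 'o \<Rightarrow> 'm \<Rightarrow> 'm \<Rightarrow> bool" where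
  "is_two_pullback F G P a b \<longleftrightarrow>
     F \<in> Cell1 K \<and> G \<in> Cell1 K \<and> tgt K F = tgt K G \<and>
     a \<in> hom1 K P (src K F) \<and> b \<in> hom1 K P (src K G) \<and> F \<odot> a = G \<odot> b \<and>
     (\<forall>Y u v. u \<in> hom1 K Y (src K F) \<and> v \<in> hom1 K Y (src K G) \<and> F \<odot> u = G \<odot> v \<longrightarrow>
        (\<exists>!H. H \<in> hom1 K Y P \<and> a \<odot> H = u \<and> b \<odot> H = v)) \<and>
     (\<forall>Y H J \<theta> \<eta>. H \<in> hom1 K Y P \<and> J \<in> hom1 K Y P \<and>
          \<theta> \<in> hom2 K (a \<odot> H) (a \<odot> J) \<and> \<eta> \<in> hom2 K (b \<odot> H) (b \<odot> J) \<and> F \<rhd> \<theta> = G \<rhd> \<eta> \<longrightarrow>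
        (\<exists>!\<zeta>. \<zeta> \<in> hom2 K H J \<and> a \<rhd> \<zeta> = \<theta> \<and> b \<rhd> \<zeta> = \<eta>))"

end


section \<open>Tangentads\<close>

text \<open>A choice of \<open>T\<^sub>2\<close> and its projections belongs to the data, since \<open>s\<close> has domain \<open>T\<^sub>2\<close>;
  the other \<open>T\<^sub>n\<close> are only required to exist. The fields \<open>tan\<close>, \<open>prj\<close>, \<open>zer\<close>, \<open>pls\<close>, \<open>lft\<close>,
  \<open>flp\<close> are \<open>T\<close>, \<open>p\<close>, \<open>z\<close>, \<open>s\<close>, \<open>l\<close>, \<open>c\<close>.\<close>

record ('o, 'm, 'c) tangentad =
  base :: 'o
  tan :: 'm
  tan2 :: 'm
  prA :: 'c
  prB :: 'c
  prj :: 'c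
  zer :: 'c
  pls :: 'c
  lft :: 'c
  flp :: 'c

context
  fixes K :: "('o, 'm, 'c) two_cat" (structure)
begin

definition tan_pow :: "('o, 'm, 'c) tangentad \<Rightarrow> nat \<Rightarrow> 'm" where
  "tan_pow X m = ((\<lambda>F. tan X \<odot> F) ^^ m) (id1 K (base X))"

text \<open>\<open>P\<close> is a pointwise \<open>n\<close>-fold pullback of \<open>p\<close> along itself which is preserved by all \<open>T\<^sup>m\<close>.\<close>

definition is_tan_fold :: "('o, 'm, 'c) tangentad \<Rightarrow> nat \<Rightarrow> 'm \<Rightarrow> (nat \<Rightarrow> 'c) \<Rightarrow> 'c \<Rightarrow> bool" where
  "is_tan_fold X n P r q \<longleftrightarrow>
     P \<in> hom1 K (base X) (base X) \<and>
     q \<in> hom2 K P (id1 K (base X)) \<and> (\<forall>i<n. r i \<in> hom2 K P (tan X)) \<and>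
     (\<forall>m Y f. f \<in> hom1 K Y (base X) \<longrightarrow>
        is_fold_pullback (hom_cat K Y (base X))
          ((tan_pow X m \<rhd> prj X) \<lhd> f) n
          (tan_pow X m \<odot> P \<odot> f) (\<lambda>i. (tan_pow X m \<rhd> r i) \<lhd> f) ((tan_pow X m \<rhd> q) \<lhd> f))"

text \<open>Associativity of \<open>s\<close> is stated on any \<open>T\<^sub>3\<close>.\<close>

definition is_tangentad :: "('o, 'm, 'c) tangentad \<Rightarrow> bool" where
  "is_tangentad X \<longleftrightarrow>
    (let X0 = base X; T = tan X; T2 = tan2 X; a = prA X; b = prB X;
         p = prj X; z = zer X; s = pls X; l = lft X; c = flp X;
         into_T2 = pairing (hom_cat K X0 X0) T2 a b;
         into_T2T = pairing (hom_cat K X0 X0) (T2 \<odot> T) (a \<lhd> T) (b \<lhd> T);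
         into_TT2 = pairing (hom_cat K X0 X0) (T \<odot> T2) (T \<rhd> a) (T \<rhd> b)
     in X0 \<in> Cell0 K \<and> T \<in> hom1 K X0 X0 \<and> T2 \<in> hom1 K X0 X0 \<and>
        a \<in> hom2 K T2 T \<and> b \<in> hom2 K T2 T \<and>
        p \<in> hom2 K T (id1 K X0) \<and> z \<in> hom2 K (id1 K X0) T \<and> s \<in> hom2 K T2 T \<and>
        l \<in> hom2 K T (T \<odot> T) \<and> c \<in> hom2 K (T \<odot> T) (T \<odot> T) \<and>
        is_tan_fold X 2 T2 (\<lambda>i. if i = 0 then a else b) (p \<bullet> a) \<and>
        (\<forall>n. \<exists>P r q. is_tan_fold X n P r q) \<and>
        p \<bullet> z = id2 K (id1 K X0) \<and>
        p \<bullet> s = p \<bullet> a \<and>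
        s \<bullet> into_T2 (z \<bullet> p) (id2 K T) = id2 K T \<and>
        s \<bullet> into_T2 b a = s \<and>
        (\<forall>P r q. is_tan_fold X 3 P r q \<longrightarrow>
           s \<bullet> into_T2 (s \<bullet> into_T2 (r 0) (r 1)) (r 2) = s \<bullet> into_T2 (r 0) (s \<bullet> into_T2 (r 1) (r 2))) \<and>
        (T \<rhd> p) \<bullet> l = z \<bullet> p \<and>
        l \<bullet> z = (T \<rhd> z) \<bullet> z \<and>
        l \<bullet> s = (T \<rhd> s) \<bullet> into_TT2 (l \<bullet> a) (l \<bullet> b) \<and>
        (p \<lhd> T) \<bullet> c = T \<rhd> p \<and>
        c \<bullet> (T \<rhd> z) = z \<lhd> T \<and>
        c \<bullet> (T \<rhd> s) = (s \<lhd> T) \<bullet> into_T2T (c \<bullet> (T \<rhd> a)) (c \<bullet> (T \<rhd> b)) \<and>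
        (T \<rhd> l) \<bullet> l = (l \<lhd> T) \<bullet> l \<and>
        c \<bullet> l = l \<and>
        (c \<lhd> T) \<bullet> (T \<rhd> c) \<bullet> (l \<lhd> T) = (T \<rhd> l) \<bullet> c \<and>
        c \<bullet> c = id2 K (T \<odot> T) \<and>
        (T \<rhd> c) \<bullet> (c \<lhd> T) \<bullet> (T \<rhd> c) = (c \<lhd> T) \<bullet> (T \<rhd> c) \<bullet> (c \<lhd> T) \<and>
        (\<forall>Y f. f \<in> hom1 K Y X0 \<longrightarrow>
           is_pullback (hom_cat K Y X0) (z \<lhd> f) ((T \<rhd> p) \<lhd> f) (T2 \<odot> f)
             ((p \<bullet> a) \<lhd> f)
             (((T \<rhd> s) \<bullet> into_TT2 ((z \<lhd> T) \<bullet> a) (l \<bullet> b)) \<lhd> f)))"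

definition lax_tangent_morphism ::
  "('o, 'm, 'c) tangentad \<Rightarrow> ('o, 'm, 'c) tangentad \<Rightarrow> 'm \<times> 'c \<Rightarrow> bool" where
  "lax_tangent_morphism X' X M \<longleftrightarrow> (case M of (F, \<alpha>) \<Rightarrow>
     F \<in> hom1 K (base X') (base X) \<and>
     \<alpha> \<in> hom2 K (F \<odot> tan X') (tan X \<odot> F) \<and>
     (prj X \<lhd> F) \<bullet> \<alpha> = F \<rhd> prj X' \<and>
     \<alpha> \<bullet> (F \<rhd> zer X') = zer X \<lhd> F \<and>
     \<alpha> \<bullet> (F \<rhd> pls X') =
       (pls X \<lhd> F) \<bullet> pairing (hom_cat K (base X') (base X)) (tan2 X \<odot> F) (prA X \<lhd> F) (prB X \<lhd> F)
         (\<alpha> \<bullet> (F \<rhd> prA X')) (\<alpha> \<bullet> (F \<rhd> prB X')) \<and>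
     (lft X \<lhd> F) \<bullet> \<alpha> = (tan X \<rhd> \<alpha>) \<bullet> (\<alpha> \<lhd> tan X') \<bullet> (F \<rhd> lft X') \<and>
     (flp X \<lhd> F) \<bullet> (tan X \<rhd> \<alpha>) \<bullet> (\<alpha> \<lhd> tan X') = (tan X \<rhd> \<alpha>) \<bullet> (\<alpha> \<lhd> tan X') \<bullet> (F \<rhd> flp X'))"

definition strict_tangent_morphism ::
  "('o, 'm, 'c) tangentad \<Rightarrow> ('o, 'm, 'c) tangentad \<Rightarrow> 'm \<Rightarrow> bool" where
  "strict_tangent_morphism X' X F \<longleftrightarrow>
     F \<odot> tan X' = tan X \<odot> F \<and> lax_tangent_morphism X' X (F, id2 K (tan X \<odot> F))"

definition tangent_two_morphism ::
  "('o, 'm, 'c) tangentad \<Rightarrow> ('o, 'm, 'c) tangentad \<Rightarrow> 'm \<times> 'c \<Rightarrow> 'c \<Rightarrow> 'm \<times> 'c \<Rightarrow> bool" where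
  "tangent_two_morphism X' X M \<phi> N \<longleftrightarrow>
     lax_tangent_morphism X' X M \<and> lax_tangent_morphism X' X N \<and>
     \<phi> \<in> hom2 K (fst M) (fst N) \<and>
     (tan X \<rhd> \<phi>) \<bullet> snd M = snd N \<bullet> (\<phi> \<lhd> tan X')"

definition lax_comp :: "'m \<times> 'c \<Rightarrow> 'm \<times> 'c \<Rightarrow> 'm \<times> 'c" where
  "lax_comp N M = (case N of (G, \<beta>) \<Rightarrow> case M of (F, \<alpha>) \<Rightarrow> (G \<odot> F, (\<beta> \<lhd> F) \<bullet> (G \<rhd> \<alpha>)))"

end


section \<open>Tangent categories\<close>

text \<open>The data of a tangent category in components: \<open>pt\<close>, \<open>zt\<close>, \<open>st\<close>, \<open>lt\<close>, \<open>ct\<close> are the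
  components of \<open>p\<close>, \<open>z\<close>, \<open>s\<close>, \<open>l\<close>, \<open>c\<close>, and \<open>pr1\<close>, \<open>pr2\<close> those of the projections of \<open>T\<^sub>2\<close>.\<close>

record ('a, 'f) tcat = "('a, 'f) cat" +
  Tob :: "'a \<Rightarrow> 'a"
  Tar :: "'f \<Rightarrow> 'f"
  T2ob :: "'a \<Rightarrow> 'a"
  pr1 :: "'a \<Rightarrow> 'f"
  pr2 :: "'a \<Rightarrow> 'f"
  pt :: "'a \<Rightarrow> 'f"
  zt :: "'a \<Rightarrow> 'f"
  st :: "'a \<Rightarrow> 'f"
  lt :: "'a \<Rightarrow> 'f"
  ct :: "'a \<Rightarrow> 'f"

subsection \<open>Lax tangent functors and isomorphisms of tangent categories\<close>

text \<open>The component-wise reading of a lax tangent morphism \<open>(F, \<alpha>)\<close> in \<open>Cat\<close>, where \<open>F0\<close>, \<open>F1\<close> are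
  the object and arrow parts of \<open>F\<close> and \<open>\<alpha> M : F (T' M) \<rightarrow> T (F M)\<close>. It is an isomorphism
  precisely when \<open>F\<close> is an isomorphism of categories and \<open>\<alpha>\<close> is invertible.\<close>

definition lax_tangent_functor ::
  "('a, 'f) tcat \<Rightarrow> ('b, 'g) tcat \<Rightarrow> ('a \<Rightarrow> 'b) \<Rightarrow> ('f \<Rightarrow> 'g) \<Rightarrow> ('a \<Rightarrow> 'g) \<Rightarrow> bool" where
  "lax_tangent_functor C D F0 F1 \<alpha> \<longleftrightarrow>
     (\<forall>M \<in> Ob C. F0 M \<in> Ob D \<and> F1 (Idn C M) = Idn D (F0 M)) \<and>
     (\<forall>f \<in> Ar C. F1 f \<in> Hom D (F0 (Dom C f)) (F0 (Cod C f))) \<and>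
     (\<forall>f \<in> Ar C. \<forall>g \<in> Ar C. Cod C f = Dom C g \<longrightarrow> F1 (g \<cdot>\<^bsub>C\<^esub> f) = F1 g \<cdot>\<^bsub>D\<^esub> F1 f) \<and>
     (\<forall>M \<in> Ob C. \<alpha> M \<in> Hom D (F0 (Tob C M)) (Tob D (F0 M))) \<and>
     (\<forall>f \<in> Ar C. Tar D (F1 f) \<cdot>\<^bsub>D\<^esub> \<alpha> (Dom C f) = \<alpha> (Cod C f) \<cdot>\<^bsub>D\<^esub> F1 (Tar C f)) \<and>
     (\<forall>M \<in> Ob C.
        pt D (F0 M) \<cdot>\<^bsub>D\<^esub> \<alpha> M = F1 (pt C M) \<and>
        \<alpha> M \<cdot>\<^bsub>D\<^esub> F1 (zt C M) = zt D (F0 M) \<and>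
        \<alpha> M \<cdot>\<^bsub>D\<^esub> F1 (st C M) =
          st D (F0 M) \<cdot>\<^bsub>D\<^esub> pairing D (T2ob D (F0 M)) (pr1 D (F0 M)) (pr2 D (F0 M))
            (\<alpha> M \<cdot>\<^bsub>D\<^esub> F1 (pr1 C M)) (\<alpha> M \<cdot>\<^bsub>D\<^esub> F1 (pr2 C M)) \<and>
        lt D (F0 M) \<cdot>\<^bsub>D\<^esub> \<alpha> M = Tar D (\<alpha> M) \<cdot>\<^bsub>D\<^esub> \<alpha> (Tob C M) \<cdot>\<^bsub>D\<^esub> F1 (lt C M) \<and>
        ct D (F0 M) \<cdot>\<^bsub>D\<^esub> Tar D (\<alpha> M) \<cdot>\<^bsub>D\<^esub> \<alpha> (Tob C M) =
          Tar D (\<alpha> M) \<cdot>\<^bsub>D\<^esub> \<alpha> (Tob C M) \<cdot>\<^bsub>D\<^esub> F1 (ct C M))"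

definition tangent_isomorphism ::
  "('a, 'f) tcat \<Rightarrow> ('b, 'g) tcat \<Rightarrow> ('a \<Rightarrow> 'b) \<Rightarrow> ('f \<Rightarrow> 'g) \<Rightarrow> ('a \<Rightarrow> 'g) \<Rightarrow> bool" where
  "tangent_isomorphism C D F0 F1 \<alpha> \<longleftrightarrow>
     lax_tangent_functor C D F0 F1 \<alpha> \<and>
     bij_betw F0 (Ob C) (Ob D) \<and> bij_betw F1 (Ar C) (Ar D) \<and> (\<forall>M \<in> Ob C. is_iso D (\<alpha> M))"

subsection \<open>Affine connections in a tangent category\<close>

context
  fixes D :: "('a, 'f) tcat" (structure)
begin

definition into_T2 :: "'a \<Rightarrow> 'f \<Rightarrow> 'f \<Rightarrow> 'f" where
  "into_T2 M = pairing D (T2ob D M) (pr1 D M) (pr2 D M)"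

definition into_TT2 :: "'a \<Rightarrow> 'f \<Rightarrow> 'f \<Rightarrow> 'f" where
  "into_TT2 M = pairing D (Tob D (T2ob D M)) (Tar D (pr1 D M)) (Tar D (pr2 D M))"

definition into_TTT2 :: "'a \<Rightarrow> 'f \<Rightarrow> 'f \<Rightarrow> 'f" where
  "into_TTT2 M = pairing D (Tob D (Tob D (T2ob D M)))
                   (Tar D (Tar D (pr1 D M))) (Tar D (Tar D (pr2 D M)))"

definition T2ar :: "'f \<Rightarrow> 'f" where
  "T2ar f = into_T2 (Cod D f) (Tar D f \<cdot> pr1 D (Dom D f)) (Tar D f \<cdot> pr2 D (Dom D f))"

text \<open>The axioms of an affine connection \<open>(k, h)\<close> on \<open>M\<close>, each given as the pair of its two sides,
  so that it can be required to hold or be imposed by an equifier.\<close>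

definition axV1 :: "'a \<Rightarrow> 'f \<Rightarrow> 'f \<times> 'f" where
  "axV1 M k = (k \<cdot> lt D M, Idn D (Tob D M))"

definition axV2 :: "'a \<Rightarrow> 'f \<Rightarrow> 'f \<times> 'f" where
  "axV2 M k = (pt D M \<cdot> k, pt D M \<cdot> pt D (Tob D M))"

definition axV3 :: "'a \<Rightarrow> 'f \<Rightarrow> 'f \<times> 'f" where
  "axV3 M k = (lt D M \<cdot> k, Tar D k \<cdot> lt D (Tob D M))"

definition axV4 :: "'a \<Rightarrow> 'f \<Rightarrow> 'f \<times> 'f" where
  "axV4 M k = (lt D M \<cdot> k, Tar D k \<cdot> ct D (Tob D M) \<cdot> Tar D (lt D M))"

definition axH1 :: "'a \<Rightarrow> 'f \<Rightarrow> 'f \<times> 'f" where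
  "axH1 M h = (Tar D (pt D M) \<cdot> h, pr2 D M)"

definition axH2 :: "'a \<Rightarrow> 'f \<Rightarrow> 'f \<times> 'f" where
  "axH2 M h = (pt D (Tob D M) \<cdot> h, pr1 D M)"

definition axH3 :: "'a \<Rightarrow> 'f \<Rightarrow> 'f \<times> 'f" where
  "axH3 M h = (lt D (Tob D M) \<cdot> h,
               Tar D h \<cdot> into_TT2 M (zt D (Tob D M) \<cdot> pr1 D M) (lt D M \<cdot> pr2 D M))"

definition axH4 :: "'a \<Rightarrow> 'f \<Rightarrow> 'f \<times> 'f" where
  "axH4 M h = (ct D (Tob D M) \<cdot> Tar D (lt D M) \<cdot> h,
               Tar D h \<cdot> into_TT2 M (lt D M \<cdot> pr1 D M) (zt D (Tob D M) \<cdot> pr2 D M))"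

definition axA1 :: "'a \<Rightarrow> 'f \<Rightarrow> 'f \<Rightarrow> 'f \<times> 'f" where
  "axA1 M k h = (k \<cdot> h, zt D M \<cdot> pt D M \<cdot> pr1 D M)"

definition xi :: "'a \<Rightarrow> 'f" where
  "xi M = Tar D (st D M) \<cdot> into_TT2 M (lt D M \<cdot> pr1 D M) (zt D (Tob D M) \<cdot> pr2 D M)"

definition axA2 :: "'a \<Rightarrow> 'f \<Rightarrow> 'f \<Rightarrow> 'f \<times> 'f" where
  "axA2 M k h =
     (st D (Tob D M) \<cdot> into_T2 (Tob D M)
        (xi M \<cdot> into_T2 M k (pt D (Tob D M)))
        (h \<cdot> into_T2 M (pt D (Tob D M)) (Tar D (pt D M))),
      Idn D (Tob D (Tob D M)))"

definition vertical_affine_connection :: "'a \<Rightarrow> 'f \<Rightarrow> bool" where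
  "vertical_affine_connection M k \<longleftrightarrow>
     M \<in> Ob D \<and> k \<in> Hom D (Tob D (Tob D M)) (Tob D M) \<and>
     (\<forall>ax \<in> {axV1, axV2, axV3, axV4}. fst (ax M k) = snd (ax M k))"

definition horizontal_affine_connection :: "'a \<Rightarrow> 'f \<Rightarrow> bool" where
  "horizontal_affine_connection M h \<longleftrightarrow>
     M \<in> Ob D \<and> h \<in> Hom D (T2ob D M) (Tob D (Tob D M)) \<and>
     (\<forall>ax \<in> {axH1, axH2, axH3, axH4}. fst (ax M h) = snd (ax M h))"

definition affine_connection :: "'a \<Rightarrow> 'f \<Rightarrow> 'f \<Rightarrow> bool" where
  "affine_connection M k h \<longleftrightarrow>
     vertical_affine_connection M k \<and> horizontal_affine_connection M h \<and>
     (\<forall>ax \<in> {axA1, axA2}. fst (ax M k h) = snd (ax M k h))"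

subsection \<open>The tangent category of affine connections\<close>

definition AC_tan :: "'a \<times> 'f \<times> 'f \<Rightarrow> 'a \<times> 'f \<times> 'f" where
  "AC_tan A = (case A of (M, k, h) \<Rightarrow>
     (Tob D M,
      ct D M \<cdot> Tar D k \<cdot> ct D (Tob D M) \<cdot> Tar D (ct D M),
      Tar D (ct D M) \<cdot> ct D (Tob D M) \<cdot> Tar D h \<cdot>
        into_TT2 M (ct D M \<cdot> pr1 D (Tob D M)) (ct D M \<cdot> pr2 D (Tob D M))))"

text \<open>The pullback \<open>T\<^sub>2\<close> in the category of affine connections is lifted from the ambient tangent
  category; the connection on \<open>T\<^sub>2 M\<close> is the only one making both projections to \<open>T M\<close>
  morphisms of connections.\<close>

definition AC_tan2 :: "'a \<times> 'f \<times> 'f \<Rightarrow> 'a \<times> 'f \<times> 'f" where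
  "AC_tan2 A = (case A of (M, k, h) \<Rightarrow> case AC_tan A of (_, kT, hT) \<Rightarrow>
     (T2ob D M,
      into_TT2 M (kT \<cdot> Tar D (Tar D (pr1 D M))) (kT \<cdot> Tar D (Tar D (pr2 D M))),
      into_TTT2 M (hT \<cdot> T2ar (pr1 D M)) (hT \<cdot> T2ar (pr2 D M))))"

text \<open>Arrows carry their domain and codomain, as one arrow of \<open>D\<close> may underlie several.\<close>

definition AC_cat :: "('a \<times> 'f \<times> 'f, ('a \<times> 'f \<times> 'f) \<times> 'f \<times> ('a \<times> 'f \<times> 'f)) tcat" where
  "AC_cat =
     \<lparr> Ob = {(M, k, h). affine_connection M k h},
       Ar = {((M, k, h), f, (M', k', h')).
               affine_connection M k h \<and> affine_connection M' k' h' \<and> f \<in> Hom D M M' \<and>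
               k' \<cdot> Tar D (Tar D f) = Tar D f \<cdot> k \<and>
               h' \<cdot> T2ar f = Tar D (Tar D f) \<cdot> h},
       Dom = (\<lambda>(A, f, B). A),
       Cod = (\<lambda>(A, f, B). B),
       Idn = (\<lambda>A. (A, Idn D (fst A), A)),
       Comp = (\<lambda>(A', g, B') (A, f, B). (A, g \<cdot> f, B')),
       Tob = AC_tan,
       Tar = (\<lambda>(A, f, B). (AC_tan A, Tar D f, AC_tan B)),
       T2ob = AC_tan2,
       pr1 = (\<lambda>A. (AC_tan2 A, pr1 D (fst A), AC_tan A)),
       pr2 = (\<lambda>A. (AC_tan2 A, pr2 D (fst A), AC_tan A)),
       pt = (\<lambda>A. (AC_tan A, pt D (fst A), A)),
       zt = (\<lambda>A. (A, zt D (fst A), AC_tan A)),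
       st = (\<lambda>A. (AC_tan2 A, st D (fst A), AC_tan A)),
       lt = (\<lambda>A. (AC_tan A, lt D (fst A), AC_tan (AC_tan A))),
       ct = (\<lambda>A. (AC_tan (AC_tan A), ct D (fst A), AC_tan (AC_tan A))) \<rparr>"

end


section \<open>Hom tangent categories\<close>

context
  fixes K :: "('o, 'm, 'c) two_cat" (structure)
begin

text \<open>Postcomposition with a tangent structure on \<open>X\<close> acts on the hom-category of all
  1-morphisms from \<open>Y\<close> to \<open>X\<close>.\<close>

definition hom_tcat :: "'o \<Rightarrow> ('o, 'm, 'c) tangentad \<Rightarrow> ('m, 'c) tcat" where
  "hom_tcat Y X =
     \<lparr> Ob = Ob (hom_cat K Y (base X)),
       Ar = Ar (hom_cat K Y (base X)),
       Dom = dom2 K,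
       Cod = cod2 K,
       Idn = id2 K,
       Comp = vcomp K,
       Tob = (\<lambda>F. tan X \<odot> F),
       Tar = (\<lambda>\<phi>. tan X \<rhd> \<phi>),
       T2ob = (\<lambda>F. tan2 X \<odot> F),
       pr1 = (\<lambda>F. prA X \<lhd> F),
       pr2 = (\<lambda>F. prB X \<lhd> F),
       pt = (\<lambda>F. prj X \<lhd> F),
       zt = (\<lambda>F. zer X \<lhd> F),
       st = (\<lambda>F. pls X \<lhd> F),
       lt = (\<lambda>F. lft X \<lhd> F),
       ct = (\<lambda>F. flp X \<lhd> F) \<rparr>"

definition lax_tan :: "('o, 'm, 'c) tangentad \<Rightarrow> 'm \<times> 'c \<Rightarrow> 'm \<times> 'c" where
  "lax_tan X M = (case M of (F, \<alpha>) \<Rightarrow> (tan X \<odot> F, (flp X \<lhd> F) \<bullet> (tan X \<rhd> \<alpha>)))"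

text \<open>The distributive law on \<open>T\<^sub>2 F\<close> is the only one making both projections to \<open>T F\<close>
  tangent 2-morphisms.\<close>

definition lax_tan2 ::
  "('o, 'm, 'c) tangentad \<Rightarrow> ('o, 'm, 'c) tangentad \<Rightarrow> 'm \<times> 'c \<Rightarrow> 'm \<times> 'c" where
  "lax_tan2 X' X M = (case M of (F, \<alpha>) \<Rightarrow>
     (tan2 X \<odot> F,
      into_TT2 (hom_tcat (base X') X) F
        (snd (lax_tan X M) \<bullet> (prA X \<lhd> (F \<odot> tan X')))
        (snd (lax_tan X M) \<bullet> (prB X \<lhd> (F \<odot> tan X')))))"

text \<open>The hom tangent category of lax tangent morphisms and tangent 2-morphisms between
  tangentads. Arrows carry their domain and codomain.\<close>

definition lax_hom ::
  "('o, 'm, 'c) tangentad \<Rightarrow> ('o, 'm, 'c) tangentad \<Rightarrow>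
     ('m \<times> 'c, ('m \<times> 'c) \<times> 'c \<times> ('m \<times> 'c)) tcat" where
  "lax_hom X' X =
     \<lparr> Ob = {M. lax_tangent_morphism K X' X M},
       Ar = {(M, \<phi>, N). tangent_two_morphism K X' X M \<phi> N},
       Dom = (\<lambda>(M, \<phi>, N). M),
       Cod = (\<lambda>(M, \<phi>, N). N),
       Idn = (\<lambda>M. (M, id2 K (fst M), M)),
       Comp = (\<lambda>(M', \<psi>, N') (M, \<phi>, N). (M, \<psi> \<bullet> \<phi>, N')),
       Tob = lax_tan X,
       Tar = (\<lambda>(M, \<phi>, N). (lax_tan X M, tan X \<rhd> \<phi>, lax_tan X N)),
       T2ob = lax_tan2 X' X,
       pr1 = (\<lambda>M. (lax_tan2 X' X M, prA X \<lhd> fst M, lax_tan X M)),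
       pr2 = (\<lambda>M. (lax_tan2 X' X M, prB X \<lhd> fst M, lax_tan X M)),
       pt = (\<lambda>M. (lax_tan X M, prj X \<lhd> fst M, M)),
       zt = (\<lambda>M. (M, zer X \<lhd> fst M, lax_tan X M)),
       st = (\<lambda>M. (lax_tan2 X' X M, pls X \<lhd> fst M, lax_tan X M)),
       lt = (\<lambda>M. (lax_tan X M, lft X \<lhd> fst M, lax_tan X (lax_tan X M))),
       ct = (\<lambda>M. (lax_tan X (lax_tan X M), flp X \<lhd> fst M, lax_tan X (lax_tan X M))) \<rparr>"


section \<open>The construction of affine connections\<close>

text \<open>Precomposition of \<open>(U; k, h)\<close> with a lax tangent morphism \<open>M\<close>, and the induced lax tangent
  functor: for \<open>U = (G, \<beta>)\<close> and \<open>M = (F, \<alpha>)\<close> its comparison arrow is \<open>\<beta>\<^sub>F\<close>.\<close>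

definition lax_whisk ::
  "('m \<times> 'c) \<times> 'c \<times> ('m \<times> 'c) \<Rightarrow> 'm \<times> 'c \<Rightarrow> ('m \<times> 'c) \<times> 'c \<times> ('m \<times> 'c)" where
  "lax_whisk f M = (case f of (A, \<phi>, B) \<Rightarrow> (lax_comp K A M, \<phi> \<lhd> fst M, lax_comp K B M))"

definition precomp_ob where
  "precomp_ob U k h M = (lax_comp K U M, lax_whisk k M, lax_whisk h M)"

definition precomp_ar where
  "precomp_ar U k h f = (case f of (M, \<phi>, N) \<Rightarrow>
     (precomp_ob U k h M, (lax_comp K U M, fst U \<rhd> \<phi>, lax_comp K U N), precomp_ob U k h N))"

definition precomp_lax where
  "precomp_lax X' A X U k h M =
     (precomp_ob U k h (lax_tan A M),
      (lax_comp K U (lax_tan A M), snd U \<lhd> fst M, lax_tan X (lax_comp K U M)),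
      AC_tan (lax_hom X' X) (precomp_ob U k h M))"

definition is_AC_construction ::
  "('o, 'm, 'c) tangentad \<Rightarrow> ('o, 'm, 'c) tangentad \<Rightarrow> 'm \<times> 'c \<Rightarrow>
     ('m \<times> 'c) \<times> 'c \<times> ('m \<times> 'c) \<Rightarrow> ('m \<times> 'c) \<times> 'c \<times> ('m \<times> 'c) \<Rightarrow> bool" where
  "is_AC_construction X A U k h \<longleftrightarrow>
     is_tangentad K A \<and> lax_tangent_morphism K A X U \<and>
     affine_connection (lax_hom A X) U k h \<and>
     (\<forall>X'. is_tangentad K X' \<longrightarrow>
        tangent_isomorphism (lax_hom X' A) (AC_cat (lax_hom X' X))
          (precomp_ob U k h) (precomp_ar U k h) (precomp_lax X' A X U k h))"

definition admits_AC :: "('o, 'm, 'c) tangentad \<Rightarrow> bool" where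
  "admits_AC X \<longleftrightarrow> (\<exists>A U k h. is_AC_construction X A U k h)"

text \<open>The tangentad \<open>E\<close> carries the tangent structure induced along \<open>U\<close>, \<open>k\<close>, \<open>h\<close>: the 1-morphism
  \<open>U\<close> is strict and the 2-morphisms \<open>k : T\<^sup>2 U \<Rightarrow> T U\<close> and \<open>h : T\<^sub>2 U \<Rightarrow> T\<^sup>2 U\<close> are tangent.\<close>

definition strict_lax :: "('o, 'm, 'c) tangentad \<Rightarrow> 'm \<Rightarrow> 'm \<times> 'c" where
  "strict_lax X U = (U, id2 K (tan X \<odot> U))"

definition vert_arrow where
  "vert_arrow X U k = (let M = strict_lax X U in (lax_tan X (lax_tan X M), k, lax_tan X M))"

definition horiz_arrow where
  "horiz_arrow E X U h = (let M = strict_lax X U in (lax_tan2 E X M, h, lax_tan X (lax_tan X M)))"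

definition is_induced_tangentad ::
  "('o, 'm, 'c) tangentad \<Rightarrow> 'm \<Rightarrow> 'c \<Rightarrow> 'c \<Rightarrow> ('o, 'm, 'c) tangentad \<Rightarrow> bool" where
  "is_induced_tangentad X U k h E \<longleftrightarrow>
     is_tangentad K E \<and> strict_tangent_morphism K E X U \<and>
     vert_arrow X U k \<in> Ar (lax_hom E X) \<and> horiz_arrow E X U h \<in> Ar (lax_hom E X)"

end

end

theory Submission
  imports Defs
begin

text \<open>
  Why the theorem holds. Let \<open>G\<close> be the top of the tower of limits, with its 1-morphism \<open>U\<close> to the base
  of \<open>X\<close> and the restrictions \<open>k\<close>, \<open>h\<close> of the universal 2-morphisms. For each object \<open>Y\<close> the category
  of 1-morphisms from \<open>Y\<close> to the base of \<open>X\<close> is a tangent category, and the universal properties of the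
  limits say together that \<open>G\<close> \<^emph>\<open>represents\<close> affine connections: precomposing \<open>(U; k, h)\<close> identifies
  1-morphisms \<open>Y \<rightarrow> G\<close> with affine connections on 1-morphisms from \<open>Y\<close> to the base of \<open>X\<close>, and
  2-morphisms with connection morphisms (\<open>represents\<close>, and the locale \<open>affine_object\<close>).

  Everything else rests on a fact about a single tangent category. A strong tangent functor carries
  affine connections to affine connections (\<open>affine_connection_image\<close>), and a transformation that
  respects the comparisons of two such functors is a connection morphism (\<open>image_morphism\<close>). The fibred
  powers \<open>T\<^sub>n\<close> of the tangent functor are strong, with comparisons made from the flip (\<open>tangent_fold\<close>), and
  all structure maps respect the comparisons. Hence \<open>T\<^sub>n U\<close> carries an affine connection, which is
  classified by a 1-morphism \<open>G \<rightarrow> G\<close>, and the structure maps lift along \<open>U\<close>. This puts a tangent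
  structure on \<open>G\<close> (\<open>induced_exists\<close>). Its equations hold since \<open>U\<close> is faithful on 2-morphisms. Its
  limits are lifted along \<open>U\<close>: a 2-morphism is a connection morphism if its composites with a family are,
  provided that the images of the family under \<open>T\<close> and \<open>T\<^sup>2\<close> are jointly monic (\<open>lift_jointly_monic\<close>). For
  the fibred powers this holds by the definition of a tangentad. For the universality of the vertical
  lift it holds because the image under \<open>T\<close> of the vertical lift at \<open>M\<close> is isomorphic to the vertical lift
  at \<open>T M\<close> (\<open>T_vl_monic\<close>).

  For the universal property, let \<open>(W, \<mu>)\<close> be a lax tangent morphism with an affine connection. The
  underlying connection on \<open>W\<close> is classified by a unique \<open>F\<close> with \<open>U F = W\<close>. That the arrows of the
  connection are tangent 2-morphisms means that \<open>\<mu>\<close> is a connection morphism from the restriction along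
  the tangent functor of the source to the tangent connection, so \<open>\<mu>\<close> lifts uniquely to a distributive law
  on \<open>F\<close>. Thus precomposition is bijective on objects and on arrows (\<open>bij_pre_ob\<close>, \<open>bij_precomp_ar\<close>), and it
  commutes with the tangent functors strictly, with an identity as comparison.
\<close>

section \<open>Arrows acting on generalized elements\<close>

text \<open>
  An arrow acts on generalized elements of its domain, that is, on arrows into it; an ill-typed
  action gives \<open>None\<close>. The point is that composites act by nested application,
  \<open>(g \<cdot> f) \<ast> x = g \<ast> f \<ast> x\<close>, so an equation between composites becomes a word problem in which
  associativity is built in. An axiom \<open>g \<cdot> f = h\<close> then is a rewrite rule that also fires in the
  middle of a longer composite.
\<close>

definition act :: "('a, 'f, 'x) cat_scheme \<Rightarrow> 'f \<Rightarrow> 'f option \<Rightarrow> 'f option"  (infixr "\<ast>\<index>" 60) where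
  "f \<ast>\<^bsub>C\<^esub> x = (case x of None \<Rightarrow> None
     | Some g \<Rightarrow> if g \<in> Ar C \<and> f \<in> Ar C \<and> Cod C g = Dom C f then Some (f \<cdot>\<^bsub>C\<^esub> g) else None)"

lemma Hom_iff: "f \<in> Hom C A B \<longleftrightarrow> f \<in> Ar C \<and> Dom C f = A \<and> Cod C f = B"
  by (simp add: Hom_def)

context category
begin

lemma comp_Ar [simp]:
  assumes "f \<in> Ar C" "g \<in> Ar C" "Cod C f = Dom C g"
  shows "g \<cdot> f \<in> Ar C" "Dom C (g \<cdot> f) = Dom C f" "Cod C (g \<cdot> f) = Cod C g"
  using Comp_Hom[of f "Dom C f" "Dom C g" g "Cod C g"] assms by (auto simp: Hom_iff)

lemma Idn_Ar [simp]:
  assumes "A \<in> Ob C"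
  shows "Idn C A \<in> Ar C" "Dom C (Idn C A) = A" "Cod C (Idn C A) = A"
  using Idn_Hom[OF assms] by (auto simp: Hom_iff)

lemma Dom_Cod_Ob [simp]: "f \<in> Ar C \<Longrightarrow> Dom C f \<in> Ob C" "f \<in> Ar C \<Longrightarrow> Cod C f \<in> Ob C"
  by (simp_all add: Dom_Ob Cod_Ob)

lemma comp_Idn [simp]:
  "f \<in> Ar C \<Longrightarrow> Dom C f = A \<Longrightarrow> f \<cdot> Idn C A = f"
  "f \<in> Ar C \<Longrightarrow> Cod C f = A \<Longrightarrow> Idn C A \<cdot> f = f"
  using Idn_right[of f A "Cod C f"] Idn_left[of f "Dom C f" A] by (auto simp: Hom_iff)

lemma comp_assoc:
  "f \<in> Ar C \<Longrightarrow> g \<in> Ar C \<Longrightarrow> h \<in> Ar C \<Longrightarrow> Cod C f = Dom C g \<Longrightarrow> Cod C g = Dom C h \<Longrightarrow>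
    (h \<cdot> g) \<cdot> f = h \<cdot> (g \<cdot> f)"
  using Comp_assoc[of f "Dom C f" "Dom C g" g "Dom C h" h "Cod C h"] by (auto simp: Hom_iff)

lemma act_comp [simp]:
  assumes "f \<in> Ar C" "g \<in> Ar C" "Cod C f = Dom C g"
  shows "(g \<cdot> f) \<ast> x = g \<ast> f \<ast> x"
  using assms by (auto simp: act_def comp_assoc split: option.splits)

lemma act_Idn [simp]:
  "f \<in> Ar C \<Longrightarrow> Cod C f = A \<Longrightarrow> Idn C A \<ast> f \<ast> x = f \<ast> x"
  "f \<in> Ar C \<Longrightarrow> Dom C f = A \<Longrightarrow> f \<ast> Idn C A \<ast> x = f \<ast> x"
  by (auto simp: act_def Idn_Ar Cod_Ob Dom_Ob split: option.splits)

text \<open>Two parallel arrows are equal as soon as they act equally, because their actions on the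
  identity give them back.\<close>

lemma act_ext:
  assumes "f \<in> Ar C" "g \<in> Ar C" "Dom C f = Dom C g" "\<And>x. f \<ast> x = g \<ast> x"
  shows "f = g"
  using assms(4)[of "Some (Idn C (Dom C f))"] assms(1-3) by (auto simp: act_def)

text \<open>This turns an equation of arrows into a rewrite rule on generalized elements.\<close>

lemma act_cong: "f = g \<Longrightarrow> f \<ast> x = g \<ast> x"
  by simp

lemma iso_obtain:
  assumes "is_iso C f"
  obtains g where "g \<in> Ar C" "Dom C g = Cod C f" "Cod C g = Dom C f"
    "g \<cdot> f = Idn C (Dom C f)" "f \<cdot> g = Idn C (Cod C f)" "f \<in> Ar C"
  using assms unfolding is_iso_def by (auto simp: Hom_iff)

lemma isoI:
  assumes "f \<in> Ar C" "g \<in> Ar C" "Dom C g = Cod C f" "Cod C g = Dom C f"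
    "g \<cdot> f = Idn C (Dom C f)" "f \<cdot> g = Idn C (Cod C f)"
  shows "is_iso C f"
  using assms unfolding is_iso_def by (auto simp: Hom_iff)

lemma iso_epi:
  assumes "is_iso C w" "u \<in> Ar C" "v \<in> Ar C" "Dom C u = Cod C w" "Dom C v = Cod C w" "u \<cdot> w = v \<cdot> w"
  shows "u = v"
proof -
  obtain g where g: "g \<in> Ar C" "Dom C g = Cod C w" "Cod C g = Dom C w"
    "w \<cdot> g = Idn C (Cod C w)" "w \<in> Ar C"
    using iso_obtain[OF assms(1)] by metis
  have "(u \<cdot> w) \<cdot> g = (v \<cdot> w) \<cdot> g"
    using assms(6) by simp
  then show ?thesis
    using assms(2-5) g by (simp add: comp_assoc)
qed

lemma iso_comp:
  assumes "is_iso C f" "is_iso C g" "Cod C f = Dom C g"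
  shows "is_iso C (g \<cdot> f)"
proof -
  obtain f' where f: "f' \<in> Ar C" "Dom C f' = Cod C f" "Cod C f' = Dom C f"
    "f' \<cdot> f = Idn C (Dom C f)" "f \<cdot> f' = Idn C (Cod C f)" "f \<in> Ar C"
    using iso_obtain[OF assms(1)] .
  obtain g' where g: "g' \<in> Ar C" "Dom C g' = Cod C g" "Cod C g' = Dom C g"
    "g' \<cdot> g = Idn C (Dom C g)" "g \<cdot> g' = Idn C (Cod C g)" "g \<in> Ar C"
    using iso_obtain[OF assms(2)] .
  note fx = act_cong[OF f(4)] act_cong[OF f(5)] act_cong[OF g(4)] act_cong[OF g(5)]
  show ?thesis
  proof (rule isoI[of _ "f' \<cdot> g'"])
    have "(f' \<cdot> g') \<cdot> (g \<cdot> f) = f' \<cdot> ((g' \<cdot> g) \<cdot> f)"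
      using f(1-3,6) g(1-3,6) assms(3) by (simp add: comp_assoc)
    then show "(f' \<cdot> g') \<cdot> (g \<cdot> f) = Idn C (Dom C (g \<cdot> f))"
      using f g assms(3) by simp
    have "(g \<cdot> f) \<cdot> (f' \<cdot> g') = g \<cdot> ((f \<cdot> f') \<cdot> g')"
      using f(1-3,6) g(1-3,6) assms(3) by (simp add: comp_assoc)
    then show "(g \<cdot> f) \<cdot> (f' \<cdot> g') = Idn C (Cod C (g \<cdot> f))"
      using f g assms(3) by simp
  qed (use f g assms(3) in simp_all)
qed

subsection \<open>Pullbacks and fibred powers\<close>

text \<open>The universal properties are restated with explicit domains and codomains, the form in which
  the simplifier can discharge the typing conditions.\<close>

lemma pullback_univ:
  assumes "is_pullback C f g P a b" "u \<in> Hom C Q (Dom C f)" "v \<in> Hom C Q (Dom C g)" "f \<cdot> u = g \<cdot> v"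
  shows "\<exists>!w. w \<in> Hom C Q P \<and> a \<cdot> w = u \<and> b \<cdot> w = v"
  using assms(1) unfolding is_pullback_def
  by (elim conjE allE[of _ Q] allE[of _ u] allE[of _ v] impE) (intro conjI assms(2-4))

lemma pullback_Ar:
  assumes "is_pullback C f g P a b"
  shows "f \<in> Ar C" "g \<in> Ar C" "a \<in> Ar C" "Dom C a = P" "Cod C a = Dom C f"
    "b \<in> Ar C" "Dom C b = P" "Cod C b = Dom C g" "Cod C g = Cod C f" "f \<cdot> a = g \<cdot> b"
  using assms unfolding is_pullback_def Hom_iff by (elim conjE; simp)+

lemma pairing_pullback:
  assumes "is_pullback C f g P a b" "u \<in> Ar C" "v \<in> Ar C" "Dom C u = Dom C v"
    "Cod C u = Dom C f" "Cod C v = Dom C g" "f \<cdot> u = g \<cdot> v"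
  shows "pairing C P a b u v \<in> Ar C" "Dom C (pairing C P a b u v) = Dom C u"
    "Cod C (pairing C P a b u v) = P"
    "a \<cdot> pairing C P a b u v = u" "b \<cdot> pairing C P a b u v = v"
proof -
  have "\<exists>!w. w \<in> Hom C (Dom C u) P \<and> a \<cdot> w = u \<and> b \<cdot> w = v"
    by (rule pullback_univ[OF assms(1)]) (use assms(2-7) in \<open>simp_all add: Hom_iff\<close>)
  from theI'[OF this] show "pairing C P a b u v \<in> Ar C" "Dom C (pairing C P a b u v) = Dom C u"
    "Cod C (pairing C P a b u v) = P"
    "a \<cdot> pairing C P a b u v = u" "b \<cdot> pairing C P a b u v = v"
    by (simp_all add: pairing_def Hom_iff)
qed

lemma pullback_eqI:
  assumes "is_pullback C f g P a b" "u \<in> Ar C" "v \<in> Ar C" "Dom C u = Dom C v"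
    "Cod C u = P" "Cod C v = P" "a \<cdot> u = a \<cdot> v" "b \<cdot> u = b \<cdot> v"
  shows "u = v"
proof -
  note ab = pullback_Ar[OF assms(1)]
  have "f \<cdot> (a \<cdot> u) = g \<cdot> (b \<cdot> u)"
    using ab assms(2,5) comp_assoc[of u a f] comp_assoc[of u b g] by simp
  then have "\<exists>!w. w \<in> Hom C (Dom C u) P \<and> a \<cdot> w = a \<cdot> u \<and> b \<cdot> w = b \<cdot> u"
    by (intro pullback_univ[OF assms(1)]) (use ab assms(2-6) in \<open>simp_all add: Hom_iff\<close>)
  moreover have "u \<in> Hom C (Dom C u) P" "v \<in> Hom C (Dom C u) P"
    using assms by (simp_all add: Hom_iff)
  ultimately show ?thesis
    using assms(7,8) by metis
qed

lemma pairing_eqI: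
  assumes "is_pullback C f g P a b" "w \<in> Ar C" "Cod C w = P" "a \<cdot> w = u" "b \<cdot> w = v"
  shows "pairing C P a b u v = w"
proof -
  note ab = pullback_Ar[OF assms(1)]
  have D: "Dom C u = Dom C w" "Dom C v = Dom C w" "u \<in> Ar C" "v \<in> Ar C"
    "Cod C u = Dom C f" "Cod C v = Dom C g"
    using assms(2-5) ab by auto
  have "f \<cdot> u = g \<cdot> v"
    using ab assms(2-5) comp_assoc[of w a f] comp_assoc[of w b g] by simp
  note P = pairing_pullback[OF assms(1) D(3,4) _ D(5,6) this]
  show ?thesis
    by (rule pullback_eqI[OF assms(1)]) (use P D assms in simp_all)
qed

lemma fold_univ:
  assumes "is_fold_pullback C p n P r q" "v \<in> Hom C Q (Cod C p)"
    "\<forall>i<n. w i \<in> Hom C Q (Dom C p) \<and> p \<cdot> w i = v"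
  shows "\<exists>!u. u \<in> Hom C Q P \<and> q \<cdot> u = v \<and> (\<forall>i<n. r i \<cdot> u = w i)"
  using assms(1) unfolding is_fold_pullback_def
  by (elim conjE allE[of _ Q] allE[of _ v] allE[of _ w] impE) (intro conjI assms(2,3))

lemma fold_Ar:
  assumes "is_fold_pullback C p n P r q"
  shows "p \<in> Ar C" "q \<in> Ar C" "Dom C q = P" "Cod C q = Cod C p"
    "i < n \<Longrightarrow> r i \<in> Ar C" "i < n \<Longrightarrow> Dom C (r i) = P" "i < n \<Longrightarrow> Cod C (r i) = Dom C p"
    "i < n \<Longrightarrow> p \<cdot> r i = q"
  using assms unfolding is_fold_pullback_def Hom_iff by (elim conjE; simp)+

lemma fold_eqI:
  assumes "is_fold_pullback C p n P r q" "u \<in> Ar C" "v \<in> Ar C" "Dom C u = Dom C v"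
    "Cod C u = P" "Cod C v = P" "q \<cdot> u = q \<cdot> v" "\<And>i. i < n \<Longrightarrow> r i \<cdot> u = r i \<cdot> v"
  shows "u = v"
proof -
  note ar = fold_Ar[OF assms(1)]
  have "p \<cdot> (r i \<cdot> u) = q \<cdot> u" if "i < n" for i
    using ar(5-8)[OF that] ar(1-4) assms(2,5) comp_assoc[of u "r i" p] by simp
  then have "\<exists>!w. w \<in> Hom C (Dom C u) P \<and> q \<cdot> w = q \<cdot> u \<and> (\<forall>i<n. r i \<cdot> w = r i \<cdot> u)"
    by (intro fold_univ[OF assms(1)]) (use ar assms(2-6) in \<open>simp_all add: Hom_iff\<close>)
  moreover have "u \<in> Hom C (Dom C u) P" "v \<in> Hom C (Dom C u) P"
    using assms by (simp_all add: Hom_iff)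
  ultimately show ?thesis
    using assms(7,8) by metis
qed

lemma fold_obtain:
  assumes "is_fold_pullback C p n P r q" "v \<in> Ar C" "Cod C v = Cod C p"
    "\<And>i. i < n \<Longrightarrow> w i \<in> Ar C \<and> Dom C (w i) = Dom C v \<and> Cod C (w i) = Dom C p \<and> p \<cdot> w i = v"
  obtains u where "u \<in> Ar C" "Dom C u = Dom C v" "Cod C u = P" "q \<cdot> u = v"
    "\<And>i. i < n \<Longrightarrow> r i \<cdot> u = w i"
proof -
  have "\<exists>!u. u \<in> Hom C (Dom C v) P \<and> q \<cdot> u = v \<and> (\<forall>i<n. r i \<cdot> u = w i)"
    by (intro fold_univ[OF assms(1)]) (use assms(2-4) in \<open>simp_all add: Hom_iff\<close>)
  then obtain u where "u \<in> Hom C (Dom C v) P" "q \<cdot> u = v" "\<forall>i<n. r i \<cdot> u = w i"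
    by (elim ex1E conjE)
  then show ?thesis
    using that unfolding Hom_iff by blast
qed

end

section \<open>Tangent categories\<close>

text \<open>
  The part of the definition of a tangent category on which the transport of affine connections
  rests. Two kinds of tangent categories will be instances: the 1-morphisms into the base of a
  tangentad, and the lax tangent morphisms between two tangentads.
\<close>

locale tangent_calculus = category D for D :: "('a, 'f) tcat" (structure) +
  assumes T_Ob: "M \<in> Ob D \<Longrightarrow> Tob D M \<in> Ob D"
    and T2_Ob: "M \<in> Ob D \<Longrightarrow> T2ob D M \<in> Ob D"
    and T_Hom: "f \<in> Hom D A B \<Longrightarrow> Tar D f \<in> Hom D (Tob D A) (Tob D B)"
    and T_Idn: "M \<in> Ob D \<Longrightarrow> Tar D (Idn D M) = Idn D (Tob D M)"
    and T_Comp: "f \<in> Hom D A B \<Longrightarrow> g \<in> Hom D B E \<Longrightarrow> Tar D (g \<cdot> f) = Tar D g \<cdot> Tar D f"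
    and a_Hom: "M \<in> Ob D \<Longrightarrow> pr1 D M \<in> Hom D (T2ob D M) (Tob D M)"
    and b_Hom: "M \<in> Ob D \<Longrightarrow> pr2 D M \<in> Hom D (T2ob D M) (Tob D M)"
    and p_Hom: "M \<in> Ob D \<Longrightarrow> pt D M \<in> Hom D (Tob D M) M"
    and z_Hom: "M \<in> Ob D \<Longrightarrow> zt D M \<in> Hom D M (Tob D M)"
    and s_Hom: "M \<in> Ob D \<Longrightarrow> st D M \<in> Hom D (T2ob D M) (Tob D M)"
    and l_Hom: "M \<in> Ob D \<Longrightarrow> lt D M \<in> Hom D (Tob D M) (Tob D (Tob D M))"
    and c_Hom: "M \<in> Ob D \<Longrightarrow> ct D M \<in> Hom D (Tob D (Tob D M)) (Tob D (Tob D M))"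
    and T2_pullback: "M \<in> Ob D \<Longrightarrow>
      is_pullback D ((Tar D ^^ m) (pt D M)) ((Tar D ^^ m) (pt D M))
        ((Tob D ^^ m) (T2ob D M)) ((Tar D ^^ m) (pr1 D M)) ((Tar D ^^ m) (pr2 D M))"
    and p_nat: "f \<in> Hom D A B \<Longrightarrow> pt D B \<cdot> Tar D f = f \<cdot> pt D A"
    and z_nat: "f \<in> Hom D A B \<Longrightarrow> zt D B \<cdot> f = Tar D f \<cdot> zt D A"
    and s_nat: "f \<in> Hom D A B \<Longrightarrow> st D B \<cdot> T2ar D f = Tar D f \<cdot> st D A"
    and l_nat: "f \<in> Hom D A B \<Longrightarrow> lt D B \<cdot> Tar D f = Tar D (Tar D f) \<cdot> lt D A"
    and c_nat: "f \<in> Hom D A B \<Longrightarrow> ct D B \<cdot> Tar D (Tar D f) = Tar D (Tar D f) \<cdot> ct D A"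
    and p_z: "M \<in> Ob D \<Longrightarrow> pt D M \<cdot> zt D M = Idn D M"
    and p_s: "M \<in> Ob D \<Longrightarrow> pt D M \<cdot> st D M = pt D M \<cdot> pr1 D M"
    and s_unit: "M \<in> Ob D \<Longrightarrow> st D M \<cdot> into_T2 D M (zt D M \<cdot> pt D M) (Idn D (Tob D M)) = Idn D (Tob D M)"
    and Tp_l: "M \<in> Ob D \<Longrightarrow> Tar D (pt D M) \<cdot> lt D M = zt D M \<cdot> pt D M"
    and p_c: "M \<in> Ob D \<Longrightarrow> pt D (Tob D M) \<cdot> ct D M = Tar D (pt D M)"
    and c_Tz: "M \<in> Ob D \<Longrightarrow> ct D M \<cdot> Tar D (zt D M) = zt D (Tob D M)"
    and c_Ts: "M \<in> Ob D \<Longrightarrow> ct D M \<cdot> Tar D (st D M) =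
      st D (Tob D M) \<cdot> into_T2 D (Tob D M) (ct D M \<cdot> Tar D (pr1 D M)) (ct D M \<cdot> Tar D (pr2 D M))"
    and c_l: "M \<in> Ob D \<Longrightarrow> ct D M \<cdot> lt D M = lt D M"
    and cTcl: "M \<in> Ob D \<Longrightarrow>
      ct D (Tob D M) \<cdot> Tar D (ct D M) \<cdot> lt D (Tob D M) = Tar D (lt D M) \<cdot> ct D M"
    and c_c: "M \<in> Ob D \<Longrightarrow> ct D M \<cdot> ct D M = Idn D (Tob D (Tob D M))"
    and c_braid: "M \<in> Ob D \<Longrightarrow> Tar D (ct D M) \<cdot> ct D (Tob D M) \<cdot> Tar D (ct D M) =
      ct D (Tob D M) \<cdot> Tar D (ct D M) \<cdot> ct D (Tob D M)"
begin

abbreviation "To \<equiv> Tob D"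
abbreviation "T \<equiv> Tar D"
abbreviation "T2o \<equiv> T2ob D"
abbreviation "T2 \<equiv> T2ar D"
abbreviation "a \<equiv> pr1 D"
abbreviation "b \<equiv> pr2 D"
abbreviation "p \<equiv> pt D"
abbreviation "z \<equiv> zt D"
abbreviation "s \<equiv> st D"
abbreviation "l \<equiv> lt D"
abbreviation "c \<equiv> ct D"

subsection \<open>Typing\<close>

lemma Ob_closed [simp]: "M \<in> Ob D \<Longrightarrow> To M \<in> Ob D" "M \<in> Ob D \<Longrightarrow> T2o M \<in> Ob D"
  by (simp_all add: T_Ob T2_Ob)

lemma T_Ar [simp]:
  "f \<in> Ar D \<Longrightarrow> T f \<in> Ar D" "f \<in> Ar D \<Longrightarrow> Dom D (T f) = To (Dom D f)"
  "f \<in> Ar D \<Longrightarrow> Cod D (T f) = To (Cod D f)"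
  using T_Hom[of f "Dom D f" "Cod D f"] by (auto simp: Hom_iff)

lemma T_comp [simp]:
  "f \<in> Ar D \<Longrightarrow> g \<in> Ar D \<Longrightarrow> Cod D f = Dom D g \<Longrightarrow> T (g \<cdot> f) = T g \<cdot> T f"
  using T_Comp[of f "Dom D f" "Cod D f" g "Cod D g"] by (auto simp: Hom_iff)

lemma structure_Ar [simp]:
  assumes "M \<in> Ob D"
  shows "p M \<in> Ar D" "Dom D (p M) = To M" "Cod D (p M) = M"
    "z M \<in> Ar D" "Dom D (z M) = M" "Cod D (z M) = To M"
    "s M \<in> Ar D" "Dom D (s M) = T2o M" "Cod D (s M) = To M"
    "l M \<in> Ar D" "Dom D (l M) = To M" "Cod D (l M) = To (To M)"
    "c M \<in> Ar D" "Dom D (c M) = To (To M)" "Cod D (c M) = To (To M)"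
    "a M \<in> Ar D" "Dom D (a M) = T2o M" "Cod D (a M) = To M"
    "b M \<in> Ar D" "Dom D (b M) = T2o M" "Cod D (b M) = To M"
  using assms p_Hom z_Hom s_Hom l_Hom c_Hom a_Hom b_Hom by (auto simp: Hom_iff)

lemma T_Idn' [simp]: "M \<in> Ob D \<Longrightarrow> T (Idn D M) = Idn D (To M)"
  by (rule T_Idn)

subsection \<open>Pairings\<close>

lemma pullback0: "M \<in> Ob D \<Longrightarrow> is_pullback D (p M) (p M) (T2o M) (a M) (b M)"
  using T2_pullback[of M 0] by simp

lemma pullback1: "M \<in> Ob D \<Longrightarrow> is_pullback D (T (p M)) (T (p M)) (To (T2o M)) (T (a M)) (T (b M))"
  using T2_pullback[of M 1] by simp

lemma pullback2: "M \<in> Ob D \<Longrightarrow>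
  is_pullback D (T (T (p M))) (T (T (p M))) (To (To (T2o M))) (T (T (a M))) (T (T (b M)))"
  using T2_pullback[of M 2] by (simp add: numeral_2_eq_2)

lemma p_b: "M \<in> Ob D \<Longrightarrow> p M \<cdot> b M = p M \<cdot> a M"
  using pullback_Ar(10)[OF pullback0] by simp

lemma into_T2:
  assumes "M \<in> Ob D" "u \<in> Ar D" "v \<in> Ar D" "Dom D u = Dom D v" "Cod D u = To M" "Cod D v = To M"
    "p M \<cdot> u = p M \<cdot> v"
  shows "into_T2 D M u v \<in> Ar D" "Dom D (into_T2 D M u v) = Dom D v" "Cod D (into_T2 D M u v) = T2o M"
    "a M \<cdot> into_T2 D M u v = u" "b M \<cdot> into_T2 D M u v = v"
  using pairing_pullback[OF pullback0[OF assms(1)] assms(2-4)] assms by (simp_all add: into_T2_def)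

lemma into_TT2:
  assumes "M \<in> Ob D" "u \<in> Ar D" "v \<in> Ar D" "Dom D u = Dom D v" "Cod D u = To (To M)"
    "Cod D v = To (To M)" "T (p M) \<cdot> u = T (p M) \<cdot> v"
  shows "into_TT2 D M u v \<in> Ar D" "Dom D (into_TT2 D M u v) = Dom D v"
    "Cod D (into_TT2 D M u v) = To (T2o M)"
    "T (a M) \<cdot> into_TT2 D M u v = u" "T (b M) \<cdot> into_TT2 D M u v = v"
  using pairing_pullback[OF pullback1[OF assms(1)] assms(2-4)] assms by (simp_all add: into_TT2_def)

lemma into_TTT2:
  assumes "M \<in> Ob D" "u \<in> Ar D" "v \<in> Ar D" "Dom D u = Dom D v" "Cod D u = To (To (To M))"
    "Cod D v = To (To (To M))" "T (T (p M)) \<cdot> u = T (T (p M)) \<cdot> v"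
  shows "into_TTT2 D M u v \<in> Ar D" "Dom D (into_TTT2 D M u v) = Dom D v"
    "Cod D (into_TTT2 D M u v) = To (To (T2o M))"
    "T (T (a M)) \<cdot> into_TTT2 D M u v = u" "T (T (b M)) \<cdot> into_TTT2 D M u v = v"
  using pairing_pullback[OF pullback2[OF assms(1)] assms(2-4)] assms by (simp_all add: into_TTT2_def)

lemma T2_eqI:
  assumes "M \<in> Ob D" "u \<in> Ar D" "v \<in> Ar D" "Dom D u = Dom D v" "Cod D u = T2o M" "Cod D v = T2o M"
    "\<And>x. a M \<ast> u \<ast> x = a M \<ast> v \<ast> x" "\<And>x. b M \<ast> u \<ast> x = b M \<ast> v \<ast> x"
  shows "u = v"
  by (rule pullback_eqI[OF pullback0[OF assms(1)] assms(2-6)]; rule act_ext) (use assms in simp_all)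

lemma TT2_eqI:
  assumes "M \<in> Ob D" "u \<in> Ar D" "v \<in> Ar D" "Dom D u = Dom D v"
    "Cod D u = To (T2o M)" "Cod D v = To (T2o M)"
    "\<And>x. T (a M) \<ast> u \<ast> x = T (a M) \<ast> v \<ast> x" "\<And>x. T (b M) \<ast> u \<ast> x = T (b M) \<ast> v \<ast> x"
  shows "u = v"
  by (rule pullback_eqI[OF pullback1[OF assms(1)] assms(2-6)]; rule act_ext) (use assms in simp_all)

lemma TTT2_eqI:
  assumes "M \<in> Ob D" "u \<in> Ar D" "v \<in> Ar D" "Dom D u = Dom D v"
    "Cod D u = To (To (T2o M))" "Cod D v = To (To (T2o M))"
    "\<And>x. T (T (a M)) \<ast> u \<ast> x = T (T (a M)) \<ast> v \<ast> x" "\<And>x. T (T (b M)) \<ast> u \<ast> x = T (T (b M)) \<ast> v \<ast> x"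
  shows "u = v"
  by (rule pullback_eqI[OF pullback2[OF assms(1)] assms(2-6)]; rule act_ext) (use assms in simp_all)

lemma into_T2_eqI:
  assumes "M \<in> Ob D" "w \<in> Ar D" "Cod D w = T2o M" "a M \<cdot> w = u" "b M \<cdot> w = v"
  shows "into_T2 D M u v = w"
  unfolding into_T2_def by (rule pairing_eqI[OF pullback0[OF assms(1)] assms(2-)])

lemma into_TT2_eqI:
  assumes "M \<in> Ob D" "w \<in> Ar D" "Cod D w = To (T2o M)" "T (a M) \<cdot> w = u" "T (b M) \<cdot> w = v"
  shows "into_TT2 D M u v = w"
  unfolding into_TT2_def by (rule pairing_eqI[OF pullback1[OF assms(1)] assms(2-)])

lemma into_TTT2_eqI:
  assumes "M \<in> Ob D" "w \<in> Ar D" "Cod D w = To (To (T2o M))" "T (T (a M)) \<cdot> w = u" "T (T (b M)) \<cdot> w = v"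
  shows "into_TTT2 D M u v = w"
  unfolding into_TTT2_def by (rule pairing_eqI[OF pullback2[OF assms(1)] assms(2-)])

subsection \<open>Rewrite rules on generalized elements\<close>

text \<open>
  Naturality squares are oriented so that structure arrows move to the right, past images of
  arrows under \<open>T\<close>. The codomain is kept as a variable with its own premise because the
  simplifier has to match it up to previously rewritten typing facts.
\<close>

lemma p_act: "f \<in> Ar D \<Longrightarrow> Cod D f = B \<Longrightarrow> p B \<ast> T f \<ast> x = f \<ast> p (Dom D f) \<ast> x"
  using act_cong[OF p_nat[of f "Dom D f" B], of x] by (auto simp: Hom_iff)

lemma z_act: "f \<in> Ar D \<Longrightarrow> Cod D f = B \<Longrightarrow> z B \<ast> f \<ast> x = T f \<ast> z (Dom D f) \<ast> x"
  using act_cong[OF z_nat[of f "Dom D f" B], of x] by (auto simp: Hom_iff)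

lemma l_act: "f \<in> Ar D \<Longrightarrow> Cod D f = B \<Longrightarrow> l B \<ast> T f \<ast> x = T (T f) \<ast> l (Dom D f) \<ast> x"
  using act_cong[OF l_nat[of f "Dom D f" B], of x] by (auto simp: Hom_iff)

lemma c_act: "f \<in> Ar D \<Longrightarrow> Cod D f = B \<Longrightarrow> c B \<ast> T (T f) \<ast> x = T (T f) \<ast> c (Dom D f) \<ast> x"
  using act_cong[OF c_nat[of f "Dom D f" B], of x] by (auto simp: Hom_iff)

lemma Tp_act: "f \<in> Ar D \<Longrightarrow> Cod D f = B \<Longrightarrow> T (p B) \<ast> T (T f) \<ast> x = T f \<ast> T (p (Dom D f)) \<ast> x"
  using act_cong[OF arg_cong[OF p_nat[of f "Dom D f" B], of T], of x] by (auto simp: Hom_iff)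

lemma Tz_act: "f \<in> Ar D \<Longrightarrow> Cod D f = B \<Longrightarrow> T (z B) \<ast> T f \<ast> x = T (T f) \<ast> T (z (Dom D f)) \<ast> x"
  using act_cong[OF arg_cong[OF z_nat[of f "Dom D f" B], of T], of x] by (auto simp: Hom_iff)

lemma Tl_act: "f \<in> Ar D \<Longrightarrow> Cod D f = B \<Longrightarrow> T (l B) \<ast> T (T f) \<ast> x = T (T (T f)) \<ast> T (l (Dom D f)) \<ast> x"
  using act_cong[OF arg_cong[OF l_nat[of f "Dom D f" B], of T], of x] by (auto simp: Hom_iff)

lemma Tc_act: "f \<in> Ar D \<Longrightarrow> Cod D f = B \<Longrightarrow>
    T (c B) \<ast> T (T (T f)) \<ast> x = T (T (T f)) \<ast> T (c (Dom D f)) \<ast> x"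
  using act_cong[OF arg_cong[OF c_nat[of f "Dom D f" B], of T], of x] by (auto simp: Hom_iff)

lemmas naturality = p_act z_act l_act c_act Tp_act Tz_act Tl_act Tc_act

lemma T2_Ar [simp]:
  assumes "f \<in> Ar D"
  shows "T2 f \<in> Ar D" "Dom D (T2 f) = T2o (Dom D f)" "Cod D (T2 f) = T2o (Cod D f)"
    "Cod D f = B \<Longrightarrow> a B \<ast> T2 f \<ast> x = T f \<ast> a (Dom D f) \<ast> x"
    "Cod D f = B \<Longrightarrow> b B \<ast> T2 f \<ast> x = T f \<ast> b (Dom D f) \<ast> x"
proof -
  have ar: "Dom D f \<in> Ob D" "Cod D f \<in> Ob D"
    using assms by simp_all
  have "p (Cod D f) \<cdot> (T f \<cdot> a (Dom D f)) = p (Cod D f) \<cdot> (T f \<cdot> b (Dom D f))"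
    by (rule act_ext) (use assms ar act_cong[OF p_b[OF ar(1)]] in \<open>simp_all add: naturality\<close>)
  note P = into_T2[OF ar(2) _ _ _ _ _ this]
  show "T2 f \<in> Ar D" "Dom D (T2 f) = T2o (Dom D f)" "Cod D (T2 f) = T2o (Cod D f)"
    unfolding T2ar_def using P(1-3) assms ar by simp_all
  show "Cod D f = B \<Longrightarrow> a B \<ast> T2 f \<ast> x = T f \<ast> a (Dom D f) \<ast> x"
    "Cod D f = B \<Longrightarrow> b B \<ast> T2 f \<ast> x = T f \<ast> b (Dom D f) \<ast> x"
    unfolding T2ar_def using act_cong[OF P(4)] act_cong[OF P(5)] P(1-3) assms ar by auto
qed

text \<open>The action of \<open>T\<^sub>2\<close> on arrows is functorial because it is determined by its two projections.\<close>

lemma T2_eqI':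
  assumes "f \<in> Ar D" "g \<in> Ar D" "Dom D g = T2o (Dom D f)" "Cod D g = T2o (Cod D f)"
    "\<And>x. a (Cod D f) \<ast> g \<ast> x = T f \<ast> a (Dom D f) \<ast> x"
    "\<And>x. b (Cod D f) \<ast> g \<ast> x = T f \<ast> b (Dom D f) \<ast> x"
  shows "T2 f = g"
  by (rule T2_eqI[of "Cod D f"]) (use assms in simp_all)

lemma T2_comp [simp]:
  "f \<in> Ar D \<Longrightarrow> g \<in> Ar D \<Longrightarrow> Cod D f = Dom D g \<Longrightarrow> T2 (g \<cdot> f) = T2 g \<cdot> T2 f"
  by (rule T2_eqI') simp_all

lemma T2_Idn [simp]: "M \<in> Ob D \<Longrightarrow> T2 (Idn D M) = Idn D (T2o M)"
  by (rule T2_eqI') simp_all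

lemma T_proj_T2 [simp]:
  assumes "f \<in> Ar D"
  shows "Cod D f = B \<Longrightarrow> T (a B) \<ast> T (T2 f) \<ast> x = T (T f) \<ast> T (a (Dom D f)) \<ast> x"
    "Cod D f = B \<Longrightarrow> T (b B) \<ast> T (T2 f) \<ast> x = T (T f) \<ast> T (b (Dom D f)) \<ast> x"
proof -
  have "a (Cod D f) \<cdot> T2 f = T f \<cdot> a (Dom D f)" "b (Cod D f) \<cdot> T2 f = T f \<cdot> b (Dom D f)"
    by (rule act_ext; use assms in simp)+
  from act_cong[OF arg_cong[OF this(1), of T]] act_cong[OF arg_cong[OF this(2), of T]]
  show "Cod D f = B \<Longrightarrow> T (a B) \<ast> T (T2 f) \<ast> x = T (T f) \<ast> T (a (Dom D f)) \<ast> x"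
    "Cod D f = B \<Longrightarrow> T (b B) \<ast> T (T2 f) \<ast> x = T (T f) \<ast> T (b (Dom D f)) \<ast> x"
    using assms by auto
qed

lemma s_act: "f \<in> Ar D \<Longrightarrow> Cod D f = B \<Longrightarrow> s B \<ast> T2 f \<ast> x = T f \<ast> s (Dom D f) \<ast> x"
  using act_cong[OF s_nat[of f "Dom D f" B], of x] by (auto simp: Hom_iff)

context
  fixes M
  assumes M [simp]: "M \<in> Ob D"
begin

lemma structure_act:
  "p M \<ast> z M \<ast> x = Idn D M \<ast> x"
  "p M \<ast> s M \<ast> x = p M \<ast> a M \<ast> x"
  "p M \<ast> b M \<ast> x = p M \<ast> a M \<ast> x"
  "T (p M) \<ast> l M \<ast> x = z M \<ast> p M \<ast> x"
  "p (To M) \<ast> c M \<ast> x = T (p M) \<ast> x"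
  "c M \<ast> T (z M) \<ast> x = z (To M) \<ast> x"
  "c M \<ast> l M \<ast> x = l M \<ast> x"
  "c M \<ast> c M \<ast> x = Idn D (To (To M)) \<ast> x"
  using act_cong[OF p_z, of M x] act_cong[OF p_s, of M x] act_cong[OF p_b, of M x]
    act_cong[OF Tp_l, of M x] act_cong[OF p_c, of M x] act_cong[OF c_Tz, of M x]
    act_cong[OF c_l, of M x] act_cong[OF c_c, of M x] by simp_all

lemma T_structure_act:
  "T (p M) \<ast> T (z M) \<ast> x = Idn D (To M) \<ast> x"
  "T (p M) \<ast> T (s M) \<ast> x = T (p M) \<ast> T (a M) \<ast> x"
  "T (p M) \<ast> T (b M) \<ast> x = T (p M) \<ast> T (a M) \<ast> x"
  "T (T (p M)) \<ast> T (l M) \<ast> x = T (z M) \<ast> T (p M) \<ast> x"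
  "T (p (To M)) \<ast> T (c M) \<ast> x = T (T (p M)) \<ast> x"
  "T (c M) \<ast> T (T (z M)) \<ast> x = T (z (To M)) \<ast> x"
  "T (c M) \<ast> T (l M) \<ast> x = T (l M) \<ast> x"
  "T (c M) \<ast> T (c M) \<ast> x = Idn D (To (To (To M))) \<ast> x"
  using act_cong[OF arg_cong[OF p_z, of M T], of x] act_cong[OF arg_cong[OF p_s, of M T], of x]
    act_cong[OF arg_cong[OF p_b, of M T], of x] act_cong[OF arg_cong[OF Tp_l, of M T], of x]
    act_cong[OF arg_cong[OF p_c, of M T], of x] act_cong[OF arg_cong[OF c_Tz, of M T], of x]
    act_cong[OF arg_cong[OF c_l, of M T], of x] act_cong[OF arg_cong[OF c_c, of M T], of x]
  by simp_all

lemma Tp_c: "T (p M) \<ast> c M \<ast> x = p (To M) \<ast> x"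
  using structure_act(5)[of "c M \<ast> x"] by (simp add: structure_act(8))

lemma p_l: "p (To M) \<ast> l M \<ast> x = z M \<ast> p M \<ast> x"
proof -
  have "p (To M) \<ast> l M \<ast> x = p (To M) \<ast> c M \<ast> l M \<ast> x"
    by (simp add: structure_act(7))
  then show ?thesis
    by (simp add: structure_act(4,5))
qed

lemma cTcl_act: "c (To M) \<ast> T (c M) \<ast> l (To M) \<ast> x = T (l M) \<ast> c M \<ast> x"
  using act_cong[OF cTcl[OF M]] by simp

text \<open>The axiom relating \<open>c\<close> and \<open>l\<close>, solved for \<open>l \<cdot> c\<close> with the help of \<open>c \<cdot> c = id\<close>.\<close>

lemma l_c: "l (To M) \<ast> c M \<ast> x = T (c M) \<ast> c (To M) \<ast> T (l M) \<ast> x"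
proof -
  have "T (c M) \<ast> c (To M) \<ast> T (l M) \<ast> x = T (c M) \<ast> c (To M) \<ast> T (l M) \<ast> c M \<ast> c M \<ast> x"
    by (simp add: structure_act(8))
  also have "\<dots> = T (c M) \<ast> c (To M) \<ast> c (To M) \<ast> T (c M) \<ast> l (To M) \<ast> c M \<ast> x"
    by (simp only: cTcl_act)
  finally show ?thesis
    using act_cong[OF c_c[of "To M"]] by (simp add: T_structure_act(8))
qed

lemma braid_act: "T (c M) \<ast> c (To M) \<ast> T (c M) \<ast> x = c (To M) \<ast> T (c M) \<ast> c (To M) \<ast> x"
  using act_cong[OF c_braid[OF M]] by simp

end

end

section \<open>Affine connections in a tangent category\<close>

context tangent_calculus
begin

lemma affine_connection_iff:
  "affine_connection D M k h \<longleftrightarrow>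
     M \<in> Ob D \<and> k \<in> Ar D \<and> Dom D k = To (To M) \<and> Cod D k = To M \<and>
     h \<in> Ar D \<and> Dom D h = T2o M \<and> Cod D h = To (To M) \<and>
     k \<cdot> l M = Idn D (To M) \<and> p M \<cdot> k = p M \<cdot> p (To M) \<and>
     l M \<cdot> k = T k \<cdot> l (To M) \<and> l M \<cdot> k = T k \<cdot> c (To M) \<cdot> T (l M) \<and>
     T (p M) \<cdot> h = b M \<and> p (To M) \<cdot> h = a M \<and>
     l (To M) \<cdot> h = T h \<cdot> into_TT2 D M (z (To M) \<cdot> a M) (l M \<cdot> b M) \<and>
     c (To M) \<cdot> T (l M) \<cdot> h = T h \<cdot> into_TT2 D M (l M \<cdot> a M) (z (To M) \<cdot> b M) \<and>
     k \<cdot> h = z M \<cdot> p M \<cdot> a M \<and>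
     s (To M) \<cdot> into_T2 D (To M) (xi D M \<cdot> into_T2 D M k (p (To M)))
        (h \<cdot> into_T2 D M (p (To M)) (T (p M))) = Idn D (To (To M))"
  unfolding affine_connection_def vertical_affine_connection_def horizontal_affine_connection_def
    axV1_def axV2_def axV3_def axV4_def axH1_def axH2_def axH3_def axH4_def axA1_def axA2_def Hom_iff
  by auto

text \<open>The arrows \<open>T\<^sub>2 M \<rightarrow> T T\<^sub>2 M\<close> written \<open>z \<times> l\<close> and \<open>l \<times> z\<close> in the horizontal axioms.\<close>

definition zl :: "'a \<Rightarrow> 'f" where "zl M = into_TT2 D M (z (To M) \<cdot> a M) (l M \<cdot> b M)"
definition lz :: "'a \<Rightarrow> 'f" where "lz M = into_TT2 D M (l M \<cdot> a M) (z (To M) \<cdot> b M)"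

lemma zl_lz [simp]:
  assumes [simp]: "M \<in> Ob D"
  shows "zl M \<in> Ar D" "Dom D (zl M) = T2o M" "Cod D (zl M) = To (T2o M)"
    "lz M \<in> Ar D" "Dom D (lz M) = T2o M" "Cod D (lz M) = To (T2o M)"
    "T (a M) \<ast> zl M \<ast> x = z (To M) \<ast> a M \<ast> x" "T (b M) \<ast> zl M \<ast> x = l M \<ast> b M \<ast> x"
    "T (a M) \<ast> lz M \<ast> x = l M \<ast> a M \<ast> x" "T (b M) \<ast> lz M \<ast> x = z (To M) \<ast> b M \<ast> x"
proof -
  have 1: "T (p M) \<cdot> (z (To M) \<cdot> a M) = T (p M) \<cdot> (l M \<cdot> b M)"
    by (rule act_ext) (simp_all add: structure_act z_act[of "p M" M, simplified, symmetric])
  have 2: "T (p M) \<cdot> (l M \<cdot> a M) = T (p M) \<cdot> (z (To M) \<cdot> b M)"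
    by (rule act_ext) (simp_all add: structure_act z_act[of "p M" M, simplified, symmetric])
  note P = into_TT2[OF assms _ _ _ _ _ 1] and Q = into_TT2[OF assms _ _ _ _ _ 2]
  show "zl M \<in> Ar D" "Dom D (zl M) = T2o M" "Cod D (zl M) = To (T2o M)"
    "lz M \<in> Ar D" "Dom D (lz M) = T2o M" "Cod D (lz M) = To (T2o M)"
    "T (a M) \<ast> zl M \<ast> x = z (To M) \<ast> a M \<ast> x" "T (b M) \<ast> zl M \<ast> x = l M \<ast> b M \<ast> x"
    "T (a M) \<ast> lz M \<ast> x = l M \<ast> a M \<ast> x" "T (b M) \<ast> lz M \<ast> x = z (To M) \<ast> b M \<ast> x"
    unfolding zl_def lz_def
    using P(1-3) Q(1-3) act_cong[OF P(4), of x] act_cong[OF P(5), of x]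
      act_cong[OF Q(4), of x] act_cong[OF Q(5), of x] by simp_all
qed

lemma xi_alt: "xi D M = T (s M) \<cdot> lz M"
  by (simp add: xi_def lz_def)

lemma xi_Ar [simp]:
  assumes "M \<in> Ob D"
  shows "xi D M \<in> Ar D" "Dom D (xi D M) = T2o M" "Cod D (xi D M) = To (To M)"
  using assms by (simp_all add: xi_alt)

text \<open>The unit law of the addition, for an arbitrary generalized element whose first component is
  a zero vector.\<close>

lemma s_unit': 
  assumes [simp]: "M \<in> Ob D" "u \<in> Ar D" "Cod D u = T2o M"
    and "a M \<cdot> u = z M \<cdot> p M \<cdot> (b M \<cdot> u)"
  shows "s M \<cdot> u = b M \<cdot> u"
proof -
  have 1: "p M \<cdot> (z M \<cdot> p M) = p M \<cdot> Idn D (To M)"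
    by (rule act_ext) (simp_all add: structure_act)
  note P = into_T2[OF _ _ _ _ _ _ 1, simplified]
  have "u = into_T2 D M (z M \<cdot> p M) (Idn D (To M)) \<cdot> (b M \<cdot> u)"
    by (rule T2_eqI[of M]) (use act_cong[OF assms(4)] act_cong[OF P(4)] act_cong[OF P(5)] P(1-3) in simp_all)
  then have "s M \<cdot> u = s M \<cdot> (into_T2 D M (z M \<cdot> p M) (Idn D (To M)) \<cdot> (b M \<cdot> u))"
    by simp
  also have "\<dots> = (s M \<cdot> into_T2 D M (z M \<cdot> p M) (Idn D (To M))) \<cdot> (b M \<cdot> u)"
    by (rule comp_assoc[symmetric]) (use P(1-3) in simp_all)
  finally show ?thesis
    by (simp add: s_unit)
qed

text \<open>The vertical lift \<open>\<xi>\<close> of a vector at a point has that point as its base point; this is what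
  makes the outer pairing in the last axiom well formed.\<close>

lemma p_xi: 
  assumes [simp]: "M \<in> Ob D"
  shows "p (To M) \<ast> xi D M \<ast> x = b M \<ast> x"
proof -
  let ?u = "p (T2o M) \<cdot> lz M"
  have p_ab: "a M \<ast> p (T2o M) \<ast> y = p (To M) \<ast> T (a M) \<ast> y"
    "b M \<ast> p (T2o M) \<ast> y = p (To M) \<ast> T (b M) \<ast> y" for y
    by (simp_all add: p_act)
  have "s M \<cdot> ?u = b M \<cdot> ?u"
    by (rule s_unit'; (rule act_ext)?) (simp_all add: structure_act p_l p_ab)
  moreover have "b M \<ast> ?u \<ast> x = b M \<ast> x"
    by (simp add: structure_act p_ab)
  ultimately have "s M \<ast> ?u \<ast> x = b M \<ast> x"
    by (metis act_comp comp_Ar structure_Ar zl_lz Ob_closed assms)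
  then show ?thesis
    by (simp add: xi_alt p_act)
qed

text \<open>The three pairings of the last axiom are pairings over the base only thanks to the axioms
  on the projections of \<open>k\<close> and \<open>h\<close>.\<close>

lemma A2_Ar:
  assumes [simp]: "M \<in> Ob D" "k \<in> Ar D" "Dom D k = To (To M)" "Cod D k = To M"
    "h \<in> Ar D" "Dom D h = T2o M" "Cod D h = To (To M)"
    and V2: "p M \<cdot> k = p M \<cdot> p (To M)" and H2: "p (To M) \<cdot> h = a M"
  defines "u \<equiv> into_T2 D M k (p (To M))" and "v \<equiv> into_T2 D M (p (To M)) (T (p M))"
  defines "w \<equiv> into_T2 D (To M) (xi D M \<cdot> u) (h \<cdot> v)"
  shows "u \<in> Ar D" "Dom D u = To (To M)" "Cod D u = T2o M"
    "a M \<ast> u \<ast> x = k \<ast> x" "b M \<ast> u \<ast> x = p (To M) \<ast> x"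
    "v \<in> Ar D" "Dom D v = To (To M)" "Cod D v = T2o M"
    "a M \<ast> v \<ast> x = p (To M) \<ast> x" "b M \<ast> v \<ast> x = T (p M) \<ast> x"
    "w \<in> Ar D" "Dom D w = To (To M)" "Cod D w = T2o (To M)"
    "a (To M) \<ast> w \<ast> x = xi D M \<ast> u \<ast> x" "b (To M) \<ast> w \<ast> x = h \<ast> v \<ast> x"
proof -
  note P = into_T2[OF _ _ _ _ _ _ V2, simplified, folded u_def]
  have 1: "p M \<cdot> p (To M) = p M \<cdot> T (p M)"
    by (rule act_ext) (simp_all add: p_act)
  note Q = into_T2[OF _ _ _ _ _ _ 1, simplified, folded v_def]
  have 2: "p (To M) \<cdot> (xi D M \<cdot> u) = p (To M) \<cdot> (h \<cdot> v)"
    by (rule act_ext) (use P(1-3) Q(1-3) act_cong[OF P(5)] act_cong[OF Q(4)] act_cong[OF H2] in \<open>simp_all add: p_xi\<close>)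
  note R = into_T2[OF _ _ _ _ _ _ 2, folded w_def]
  show "u \<in> Ar D" "Dom D u = To (To M)" "Cod D u = T2o M"
    "a M \<ast> u \<ast> x = k \<ast> x" "b M \<ast> u \<ast> x = p (To M) \<ast> x"
    "v \<in> Ar D" "Dom D v = To (To M)" "Cod D v = T2o M"
    "a M \<ast> v \<ast> x = p (To M) \<ast> x" "b M \<ast> v \<ast> x = T (p M) \<ast> x"
    using P(1-3) Q(1-3) act_cong[OF P(4), of x] act_cong[OF P(5), of x] act_cong[OF Q(4), of x]
      act_cong[OF Q(5), of x] by simp_all
  show "w \<in> Ar D" "Dom D w = To (To M)" "Cod D w = T2o (To M)"
    "a (To M) \<ast> w \<ast> x = xi D M \<ast> u \<ast> x" "b (To M) \<ast> w \<ast> x = h \<ast> v \<ast> x"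
    using P(1-3) Q(1-3) R(1-3) act_cong[OF R(4), of x] act_cong[OF R(5), of x] by simp_all
qed

end

section \<open>Transport along strong tangent functors\<close>

text \<open>
  An endofunctor \<open>S\<close> with an invertible comparison \<open>sg : S T \<rightarrow> T S\<close> compatible with \<open>p\<close>, such
  that the induced arrow \<open>S T\<^sub>2 \<rightarrow> T\<^sub>2 S\<close> is invertible too. This is the structure needed to transport
  the two arrows of a connection from \<open>M\<close> to \<open>S M\<close>; the axioms of a strong tangent functor, which
  make the result a connection again, are added in the locale \<open>strong\<close>.
\<close>

locale comparison = tangent_calculus D for D :: "('a, 'f) tcat" (structure) +
  fixes S0 :: "'a \<Rightarrow> 'a" and S1 :: "'f \<Rightarrow> 'f" and sg :: "'a \<Rightarrow> 'f"
  assumes S0_Ob [simp]: "M \<in> Ob D \<Longrightarrow> S0 M \<in> Ob D"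
    and S1_Hom: "f \<in> Hom D A B \<Longrightarrow> S1 f \<in> Hom D (S0 A) (S0 B)"
    and S1_Idn [simp]: "M \<in> Ob D \<Longrightarrow> S1 (Idn D M) = Idn D (S0 M)"
    and S1_Comp: "f \<in> Hom D A B \<Longrightarrow> g \<in> Hom D B E \<Longrightarrow> S1 (g \<cdot> f) = S1 g \<cdot> S1 f"
    and sg_Hom: "M \<in> Ob D \<Longrightarrow> sg M \<in> Hom D (S0 (Tob D M)) (Tob D (S0 M))"
    and sg_nat: "f \<in> Hom D A B \<Longrightarrow> Tar D (S1 f) \<cdot> sg A = sg B \<cdot> S1 (Tar D f)"
    and p_sg: "M \<in> Ob D \<Longrightarrow> pt D (S0 M) \<cdot> sg M = S1 (pt D M)"
    and sg_iso: "M \<in> Ob D \<Longrightarrow> is_iso D (sg M)"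
    and sg2_iso: "M \<in> Ob D \<Longrightarrow>
      is_iso D (into_T2 D (S0 M) (sg M \<cdot> S1 (pr1 D M)) (sg M \<cdot> S1 (pr2 D M)))"
begin

definition sg2 :: "'a \<Rightarrow> 'f" where
  "sg2 M = into_T2 D (S0 M) (sg M \<cdot> S1 (a M)) (sg M \<cdot> S1 (b M))"

definition sgTT :: "'a \<Rightarrow> 'f" where
  "sgTT M = T (sg M) \<cdot> sg (To M)"

text \<open>Here \<open>(k', h')\<close> results from \<open>(k, h)\<close> by applying the functor and conjugating with the
  comparison isomorphisms. A relation is more convenient than a function, since no inverses occur
  in it.\<close>

definition image :: "'a \<Rightarrow> 'f \<Rightarrow> 'f \<Rightarrow> 'f \<Rightarrow> 'f \<Rightarrow> bool" where
  "image M k h k' h' \<longleftrightarrow>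
     k' \<in> Hom D (To (To (S0 M))) (To (S0 M)) \<and> h' \<in> Hom D (T2o (S0 M)) (To (To (S0 M))) \<and>
     k' \<cdot> sgTT M = sg M \<cdot> S1 k \<and> h' \<cdot> sg2 M = sgTT M \<cdot> S1 h"

lemma S1_Ar [simp]:
  "f \<in> Ar D \<Longrightarrow> S1 f \<in> Ar D" "f \<in> Ar D \<Longrightarrow> Dom D (S1 f) = S0 (Dom D f)"
  "f \<in> Ar D \<Longrightarrow> Cod D (S1 f) = S0 (Cod D f)"
  using S1_Hom[of f "Dom D f" "Cod D f"] by (auto simp: Hom_iff)

lemma S1_comp [simp]:
  "f \<in> Ar D \<Longrightarrow> g \<in> Ar D \<Longrightarrow> Cod D f = Dom D g \<Longrightarrow> S1 (g \<cdot> f) = S1 g \<cdot> S1 f"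
  using S1_Comp[of f "Dom D f" "Cod D f" g "Cod D g"] by (auto simp: Hom_iff)

lemma sg_Ar [simp]:
  assumes "M \<in> Ob D"
  shows "sg M \<in> Ar D" "Dom D (sg M) = S0 (To M)" "Cod D (sg M) = To (S0 M)"
  using sg_Hom[OF assms] by (auto simp: Hom_iff)

lemma sg_act: "f \<in> Ar D \<Longrightarrow> Dom D f = A \<Longrightarrow> T (S1 f) \<ast> sg A \<ast> x = sg (Cod D f) \<ast> S1 (T f) \<ast> x"
  using act_cong[OF sg_nat[of f A "Cod D f"], of x] by (auto simp: Hom_iff)

lemma p_sg_act: "M \<in> Ob D \<Longrightarrow> p (S0 M) \<ast> sg M \<ast> x = S1 (p M) \<ast> x"
  using act_cong[OF p_sg] by simp

lemma Tp_sg_act: "M \<in> Ob D \<Longrightarrow> T (p (S0 M)) \<ast> T (sg M) \<ast> x = T (S1 (p M)) \<ast> x"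
  using act_cong[OF arg_cong[OF p_sg, of _ T]] by simp

lemma sgTT_Ar [simp]:
  assumes "M \<in> Ob D"
  shows "sgTT M \<in> Ar D" "Dom D (sgTT M) = S0 (To (To M))" "Cod D (sgTT M) = To (To (S0 M))"
    "sgTT M \<ast> x = T (sg M) \<ast> sg (To M) \<ast> x"
  using assms by (simp_all add: sgTT_def)

lemma T_iso: "is_iso D f \<Longrightarrow> is_iso D (T f)"
proof -
  assume "is_iso D f"
  from iso_obtain[OF this] obtain g where g: "g \<in> Ar D" "Dom D g = Cod D f" "Cod D g = Dom D f"
    "g \<cdot> f = Idn D (Dom D f)" "f \<cdot> g = Idn D (Cod D f)" "f \<in> Ar D" .
  have "T g \<cdot> T f = T (g \<cdot> f)" "T f \<cdot> T g = T (f \<cdot> g)"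
    using g(1-3,6) by simp_all
  then show ?thesis
    by (intro isoI[of _ "T g"]) (use g in simp_all)
qed

lemma sgTT_iso: "M \<in> Ob D \<Longrightarrow> is_iso D (sgTT M)"
  unfolding sgTT_def by (intro iso_comp T_iso sg_iso) simp_all

lemma sg2_Ar [simp]:
  assumes [simp]: "M \<in> Ob D"
  shows "sg2 M \<in> Ar D" "Dom D (sg2 M) = S0 (T2o M)" "Cod D (sg2 M) = T2o (S0 M)"
    "a (S0 M) \<ast> sg2 M \<ast> x = sg M \<ast> S1 (a M) \<ast> x" "b (S0 M) \<ast> sg2 M \<ast> x = sg M \<ast> S1 (b M) \<ast> x"
    "T (a (S0 M)) \<ast> T (sg2 M) \<ast> x = T (sg M) \<ast> T (S1 (a M)) \<ast> x"
    "T (b (S0 M)) \<ast> T (sg2 M) \<ast> x = T (sg M) \<ast> T (S1 (b M)) \<ast> x"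
proof -
  have 1: "p (S0 M) \<cdot> (sg M \<cdot> S1 (a M)) = p (S0 M) \<cdot> (sg M \<cdot> S1 (b M))"
    by (rule act_ext) (use act_cong[OF arg_cong[OF p_b, of M S1]] in \<open>simp_all add: p_sg_act\<close>)
  note P = into_T2[OF _ _ _ _ _ _ 1, simplified, folded sg2_def]
  show "sg2 M \<in> Ar D" "Dom D (sg2 M) = S0 (T2o M)" "Cod D (sg2 M) = T2o (S0 M)"
    "a (S0 M) \<ast> sg2 M \<ast> x = sg M \<ast> S1 (a M) \<ast> x" "b (S0 M) \<ast> sg2 M \<ast> x = sg M \<ast> S1 (b M) \<ast> x"
    "T (a (S0 M)) \<ast> T (sg2 M) \<ast> x = T (sg M) \<ast> T (S1 (a M)) \<ast> x"
    "T (b (S0 M)) \<ast> T (sg2 M) \<ast> x = T (sg M) \<ast> T (S1 (b M)) \<ast> x"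
    using P(1-3) act_cong[OF P(4), of x] act_cong[OF P(5), of x]
      act_cong[OF arg_cong[OF P(4), of T], of x] act_cong[OF arg_cong[OF P(5), of T], of x] by simp_all
qed

lemma sg2_iso': "M \<in> Ob D \<Longrightarrow> is_iso D (sg2 M)"
  unfolding sg2_def by (rule sg2_iso)

lemma image_exists:
  assumes [simp]: "M \<in> Ob D" and "k \<in> Hom D (To (To M)) (To M)" "h \<in> Hom D (T2o M) (To (To M))"
  obtains k' h' where "image M k h k' h'"
proof -
  have [simp]: "k \<in> Ar D" "Dom D k = To (To M)" "Cod D k = To M"
    "h \<in> Ar D" "Dom D h = T2o M" "Cod D h = To (To M)"
    using assms(2,3) by (auto simp: Hom_iff)
  obtain i where i: "i \<in> Ar D" "Dom D i = Cod D (sgTT M)" "Cod D i = Dom D (sgTT M)"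
    "i \<cdot> sgTT M = Idn D (Dom D (sgTT M))"
    using iso_obtain[OF sgTT_iso[OF assms(1)]] by metis
  obtain j where j: "j \<in> Ar D" "Dom D j = Cod D (sg2 M)" "Cod D j = Dom D (sg2 M)"
    "j \<cdot> sg2 M = Idn D (Dom D (sg2 M))"
    using iso_obtain[OF sg2_iso'[OF assms(1)]] by metis
  have "image M k h ((sg M \<cdot> S1 k) \<cdot> i) ((sgTT M \<cdot> S1 h) \<cdot> j)"
    unfolding image_def using i j by (simp add: Hom_iff comp_assoc)
  then show ?thesis
    by (rule that)
qed

end

locale strong = comparison +
  assumes sg_z: "M \<in> Ob D \<Longrightarrow> sg M \<cdot> S1 (zt D M) = zt D (S0 M)"
    and sg_s: "M \<in> Ob D \<Longrightarrow> sg M \<cdot> S1 (st D M) = st D (S0 M) \<cdot> sg2 M"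
    and l_sg: "M \<in> Ob D \<Longrightarrow> lt D (S0 M) \<cdot> sg M = Tar D (sg M) \<cdot> sg (Tob D M) \<cdot> S1 (lt D M)"
    and c_sg: "M \<in> Ob D \<Longrightarrow> ct D (S0 M) \<cdot> Tar D (sg M) \<cdot> sg (Tob D M) =
      Tar D (sg M) \<cdot> sg (Tob D M) \<cdot> S1 (ct D M)"
begin

lemma sg_structure_act:
  assumes [simp]: "M \<in> Ob D"
  shows "z (S0 M) \<ast> x = sg M \<ast> S1 (z M) \<ast> x"
    "s (S0 M) \<ast> sg2 M \<ast> x = sg M \<ast> S1 (s M) \<ast> x"
    "l (S0 M) \<ast> sg M \<ast> x = T (sg M) \<ast> sg (To M) \<ast> S1 (l M) \<ast> x"
    "c (S0 M) \<ast> T (sg M) \<ast> sg (To M) \<ast> x = T (sg M) \<ast> sg (To M) \<ast> S1 (c M) \<ast> x"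
    "T (s (S0 M)) \<ast> T (sg2 M) \<ast> x = T (sg M) \<ast> T (S1 (s M)) \<ast> x"
    "T (l (S0 M)) \<ast> T (sg M) \<ast> x = T (T (sg M)) \<ast> T (sg (To M)) \<ast> T (S1 (l M)) \<ast> x"
  using act_cong[OF sg_z, of M x] act_cong[OF sg_s, of M x] act_cong[OF l_sg, of M x]
    act_cong[OF c_sg, of M x] act_cong[OF arg_cong[OF sg_s, of M T], of x]
    act_cong[OF arg_cong[OF l_sg, of M T], of x]
  by (simp_all flip: act_comp)

lemma zl_lz_eq:
  assumes [simp]: "M \<in> Ob D"
  shows "T (a M) \<cdot> zl M = z (To M) \<cdot> a M" "T (b M) \<cdot> zl M = l M \<cdot> b M"
    "T (a M) \<cdot> lz M = l M \<cdot> a M" "T (b M) \<cdot> lz M = z (To M) \<cdot> b M"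
  by (rule act_ext; simp)+

lemma S1_zl_lz:
  assumes [simp]: "M \<in> Ob D"
  shows "S1 (T (a M)) \<ast> S1 (zl M) \<ast> x = S1 (z (To M)) \<ast> S1 (a M) \<ast> x"
    "S1 (T (b M)) \<ast> S1 (zl M) \<ast> x = S1 (l M) \<ast> S1 (b M) \<ast> x"
    "S1 (T (a M)) \<ast> S1 (lz M) \<ast> x = S1 (l M) \<ast> S1 (a M) \<ast> x"
    "S1 (T (b M)) \<ast> S1 (lz M) \<ast> x = S1 (z (To M)) \<ast> S1 (b M) \<ast> x"
  using zl_lz_eq[OF assms, THEN arg_cong[of _ _ S1], THEN act_cong[of _ _ x]] by simp_all

text \<open>The comparison arrows intertwine the two pairings of the horizontal axioms, because they
  intertwine \<open>z\<close> and \<open>l\<close>.\<close>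

lemma sg_zl: 
  assumes [simp]: "M \<in> Ob D"
  shows "zl (S0 M) \<cdot> sg2 M = T (sg2 M) \<cdot> sg (T2o M) \<cdot> S1 (zl M)"
    "lz (S0 M) \<cdot> sg2 M = T (sg2 M) \<cdot> sg (T2o M) \<cdot> S1 (lz M)"
  by (rule TT2_eqI[of "S0 M"];
      simp add: sg_structure_act sg_act S1_zl_lz z_act[of "sg M" "To (S0 M)"])+

lemma sg_zl_act:
  assumes [simp]: "M \<in> Ob D"
  shows "zl (S0 M) \<ast> sg2 M \<ast> x = T (sg2 M) \<ast> sg (T2o M) \<ast> S1 (zl M) \<ast> x"
    "lz (S0 M) \<ast> sg2 M \<ast> x = T (sg2 M) \<ast> sg (T2o M) \<ast> S1 (lz M) \<ast> x"
  using sg_zl[OF assms, THEN act_cong[of _ _ x]] by simp_all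

text \<open>All axioms for the transported connection are checked after precomposition with one of the
  comparison isomorphisms; there both sides become comparison arrows following the image of
  the axiom for the original connection.\<close>

theorem affine_connection_image:
  assumes AC: "affine_connection D M k h" and im: "image M k h k' h'"
  shows "affine_connection D (S0 M) k' h'"
proof -
  have [simp]: "M \<in> Ob D"
    and k [simp]: "k \<in> Ar D" "Dom D k = To (To M)" "Cod D k = To M"
    and h [simp]: "h \<in> Ar D" "Dom D h = T2o M" "Cod D h = To (To M)"
    and V1: "k \<cdot> l M = Idn D (To M)" and V2: "p M \<cdot> k = p M \<cdot> p (To M)"
    and V3: "l M \<cdot> k = T k \<cdot> l (To M)" and V4: "l M \<cdot> k = T k \<cdot> c (To M) \<cdot> T (l M)"
    and H1: "T (p M) \<cdot> h = b M" and H2: "p (To M) \<cdot> h = a M"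
    and H3: "l (To M) \<cdot> h = T h \<cdot> zl M" and H4: "c (To M) \<cdot> T (l M) \<cdot> h = T h \<cdot> lz M"
    and A1: "k \<cdot> h = z M \<cdot> p M \<cdot> a M"
    and A2: "s (To M) \<cdot> into_T2 D (To M) (xi D M \<cdot> into_T2 D M k (p (To M)))
        (h \<cdot> into_T2 D M (p (To M)) (T (p M))) = Idn D (To (To M))"
    using AC unfolding affine_connection_iff zl_def lz_def by blast+
  have k' [simp]: "k' \<in> Ar D" "Dom D k' = To (To (S0 M))" "Cod D k' = To (S0 M)"
    and h' [simp]: "h' \<in> Ar D" "Dom D h' = T2o (S0 M)" "Cod D h' = To (To (S0 M))"
    and kw: "k' \<cdot> sgTT M = sg M \<cdot> S1 k" and hw: "h' \<cdot> sg2 M = sgTT M \<cdot> S1 h"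
    using im by (auto simp: image_def Hom_iff)
  have kw: "k' \<ast> T (sg M) \<ast> sg (To M) \<ast> x = sg M \<ast> S1 k \<ast> x"
    and Tkw: "T k' \<ast> T (T (sg M)) \<ast> T (sg (To M)) \<ast> x = T (sg M) \<ast> T (S1 k) \<ast> x"
    and hw: "h' \<ast> sg2 M \<ast> x = T (sg M) \<ast> sg (To M) \<ast> S1 h \<ast> x"
    and Thw: "T h' \<ast> T (sg2 M) \<ast> x = T (T (sg M)) \<ast> T (sg (To M)) \<ast> T (S1 h) \<ast> x" for x
    using act_cong[OF kw, of x] act_cong[OF arg_cong[OF kw, of T], of x]
      act_cong[OF hw, of x] act_cong[OF arg_cong[OF hw, of T], of x] by (simp_all add: sgTT_def)
  note images = kw Tkw hw Thw
  note S1_axioms = V1[THEN arg_cong[of _ _ S1], THEN act_cong, simplified]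
    V2[THEN arg_cong[of _ _ S1], THEN act_cong, simplified]
    H1[THEN arg_cong[of _ _ S1], THEN act_cong, simplified]
    H2[THEN arg_cong[of _ _ S1], THEN act_cong, simplified]
    A1[THEN arg_cong[of _ _ S1], THEN act_cong, simplified]
  note S1_V3 = V3[THEN arg_cong[of _ _ S1], THEN act_cong, simplified]
    and S1_V4 = V4[THEN arg_cong[of _ _ S1], THEN act_cong, simplified]
    and S1_H3 = H3[THEN arg_cong[of _ _ S1], THEN act_cong, simplified]
    and S1_H4 = H4[THEN arg_cong[of _ _ S1], THEN act_cong, simplified]
  note epiTT = iso_epi[OF sgTT_iso[OF \<open>M \<in> Ob D\<close>], simplified]
    and epi2 = iso_epi[OF sg2_iso'[OF \<open>M \<in> Ob D\<close>], simplified]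
    and epi = iso_epi[OF sg_iso[OF \<open>M \<in> Ob D\<close>], simplified]
  have V1': "k' \<cdot> l (S0 M) = Idn D (To (S0 M))"
    by (rule epi, simp_all, rule act_ext)
      (simp_all add: sg_structure_act images S1_axioms)
  have V2': "p (S0 M) \<cdot> k' = p (S0 M) \<cdot> p (To (S0 M))"
    by (rule epiTT, simp_all, rule act_ext)
      (simp_all add: images S1_axioms p_sg_act p_act[of "sg M"])
  have V3': "l (S0 M) \<cdot> k' = T k' \<cdot> l (To (S0 M))"
    by (rule epiTT, simp_all, rule act_ext)
      (simp_all add: images sg_structure_act sg_act S1_V3 l_act[of "sg M"])
  have V4': "l (S0 M) \<cdot> k' = T k' \<cdot> c (To (S0 M)) \<cdot> T (l (S0 M))"
    by (rule epiTT, simp_all, rule act_ext)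
      (simp_all add: images sg_structure_act sg_act S1_V4 c_act[of "sg M"])
  have H1': "T (p (S0 M)) \<cdot> h' = b (S0 M)"
    by (rule epi2, simp_all, rule act_ext)
      (simp_all add: images S1_axioms Tp_sg_act sg_act)
  have H2': "p (To (S0 M)) \<cdot> h' = a (S0 M)"
    by (rule epi2, simp_all, rule act_ext)
      (simp_all add: images S1_axioms p_sg_act p_act[of "sg M"])
  have H3': "l (To (S0 M)) \<cdot> h' = T h' \<cdot> zl (S0 M)"
    by (rule epi2, simp_all, rule act_ext)
      (simp_all add: images sg_zl_act sg_structure_act sg_act S1_H3 l_act[of "sg M"])
  have H4': "c (To (S0 M)) \<cdot> T (l (S0 M)) \<cdot> h' = T h' \<cdot> lz (S0 M)"
    by (rule epi2, simp_all, rule act_ext)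
      (simp_all add: images sg_zl_act sg_structure_act sg_act c_act[of "sg M"] S1_H4[symmetric])
  have A1': "k' \<cdot> h' = z (S0 M) \<cdot> p (S0 M) \<cdot> a (S0 M)"
    by (rule epi2, simp_all, rule act_ext)
      (simp_all add: images S1_axioms p_sg_act sg_structure_act)
  note u = A2_Ar[OF \<open>M \<in> Ob D\<close> k h V2 H2] and u' = A2_Ar[OF _ k' h' V2' H2', simplified]
  let ?u = "into_T2 D M k (p (To M))" and ?v = "into_T2 D M (p (To M)) (T (p M))"
  let ?w = "into_T2 D (To M) (xi D M \<cdot> ?u) (h \<cdot> ?v)"
  let ?u' = "into_T2 D (S0 M) k' (p (To (S0 M)))"
  let ?v' = "into_T2 D (S0 M) (p (To (S0 M))) (T (p (S0 M)))"
  let ?w' = "into_T2 D (To (S0 M)) (xi D (S0 M) \<cdot> ?u') (h' \<cdot> ?v')"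
  note [simp] = u u'
  have S1uv: "S1 (a M) \<ast> S1 ?u \<ast> x = S1 k \<ast> x" "S1 (b M) \<ast> S1 ?u \<ast> x = S1 (p (To M)) \<ast> x"
    "S1 (a M) \<ast> S1 ?v \<ast> x = S1 (p (To M)) \<ast> x" "S1 (b M) \<ast> S1 ?v \<ast> x = S1 (T (p M)) \<ast> x"
    "S1 (a (To M)) \<ast> S1 ?w \<ast> x = S1 (xi D M) \<ast> S1 ?u \<ast> x"
    "S1 (b (To M)) \<ast> S1 ?w \<ast> x = S1 h \<ast> S1 ?v \<ast> x" for x
  proof -
    have "a M \<cdot> ?u = k" "b M \<cdot> ?u = p (To M)" "a M \<cdot> ?v = p (To M)" "b M \<cdot> ?v = T (p M)"
      "a (To M) \<cdot> ?w = xi D M \<cdot> ?u" "b (To M) \<cdot> ?w = h \<cdot> ?v"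
      by (rule act_ext; simp)+
    from this[THEN arg_cong[of _ _ S1], THEN act_cong[of _ _ x]]
    show "S1 (a M) \<ast> S1 ?u \<ast> x = S1 k \<ast> x" "S1 (b M) \<ast> S1 ?u \<ast> x = S1 (p (To M)) \<ast> x"
      "S1 (a M) \<ast> S1 ?v \<ast> x = S1 (p (To M)) \<ast> x" "S1 (b M) \<ast> S1 ?v \<ast> x = S1 (T (p M)) \<ast> x"
      "S1 (a (To M)) \<ast> S1 ?w \<ast> x = S1 (xi D M) \<ast> S1 ?u \<ast> x"
      "S1 (b (To M)) \<ast> S1 ?w \<ast> x = S1 h \<ast> S1 ?v \<ast> x"
      by simp_all
  qed
  \<comment> \<open>The pairings in the last axiom are transported one after the other, from the inside out.\<close>
  have "?u' \<cdot> sgTT M = sg2 M \<cdot> S1 ?u"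
    by (rule T2_eqI[of "S0 M"]) (simp_all add: images S1uv p_sg_act p_act[of "sg M"])
  note uw = act_cong[OF this, simplified]
  have "?v' \<cdot> sgTT M = sg2 M \<cdot> S1 ?v"
    by (rule T2_eqI[of "S0 M"]) (simp_all add: images S1uv p_sg_act Tp_sg_act sg_act p_act[of "sg M"])
  note vw = act_cong[OF this, simplified]
  have xi: "xi D (S0 M) \<ast> sg2 M \<ast> x = T (sg M) \<ast> sg (To M) \<ast> S1 (xi D M) \<ast> x" for x
    by (simp add: xi_alt sg_zl_act sg_structure_act sg_act)
  have "?w' \<cdot> sgTT M = T2 (sg M) \<cdot> sg2 (To M) \<cdot> S1 ?w"
    by (rule T2_eqI[of "To (S0 M)"]) (simp_all add: images S1uv uw vw xi)
  note ww = act_cong[OF this, simplified]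
  have A2': "s (To (S0 M)) \<cdot> ?w' = Idn D (To (To (S0 M)))"
    by (rule epiTT, simp_all, rule act_ext)
      (use A2[THEN arg_cong[of _ _ S1], THEN act_cong] in
        \<open>simp_all add: ww s_act sg_structure_act\<close>)
  show ?thesis
    unfolding affine_connection_iff
    by (intro conjI V1' V2' V3' V4' H1' H2' H3'[unfolded zl_def] H4'[unfolded lz_def] A1' A2') simp_all
qed

end

context comparison
begin

lemma S1_iso: "is_iso D f \<Longrightarrow> is_iso D (S1 f)"
proof -
  assume "is_iso D f"
  from iso_obtain[OF this] obtain g where g: "g \<in> Ar D" "Dom D g = Cod D f" "Cod D g = Dom D f"
    "g \<cdot> f = Idn D (Dom D f)" "f \<cdot> g = Idn D (Cod D f)" "f \<in> Ar D" .
  have "S1 g \<cdot> S1 f = S1 (g \<cdot> f)" "S1 f \<cdot> S1 g = S1 (f \<cdot> g)"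
    using g(1-3,6) by simp_all
  then show ?thesis
    by (intro isoI[of _ "S1 g"]) (use g in simp_all)
qed

end

context tangent_calculus
begin

text \<open>Transport along a composite functor is iterated transport. It is needed for \<open>T \<circ> T\<close>, the
  domain or codomain of \<open>l\<close> and \<open>c\<close>.\<close>

lemma comparison_comp:
  assumes S: "comparison D S0 S1 sg" and R: "comparison D R0 R1 rg"
  shows "comparison D (R0 \<circ> S0) (R1 \<circ> S1) (\<lambda>M. rg (S0 M) \<cdot> R1 (sg M))" (is "comparison D ?S0 ?S1 ?sg")
    and "M \<in> Ob D \<Longrightarrow> comparison.image D S0 S1 sg M k h k' h' \<Longrightarrow>
      comparison.image D R0 R1 rg (S0 M) k' h' k'' h'' \<Longrightarrow>
      k \<in> Hom D (To (To M)) (To M) \<Longrightarrow> h \<in> Hom D (T2o M) (To (To M)) \<Longrightarrow>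
      comparison.image D (R0 \<circ> S0) (R1 \<circ> S1) (\<lambda>M. rg (S0 M) \<cdot> R1 (sg M)) M k h k'' h''"
proof -
  interpret S: comparison D S0 S1 sg by (rule S)
  interpret R: comparison D R0 R1 rg by (rule R)
  have sg2: "into_T2 D (?S0 M) (?sg M \<cdot> ?S1 (a M)) (?sg M \<cdot> ?S1 (b M)) = R.sg2 (S0 M) \<cdot> R1 (S.sg2 M)"
    if [simp]: "M \<in> Ob D" for M
  proof (rule into_T2_eqI)
    have 1: "a (S0 M) \<cdot> S.sg2 M = sg M \<cdot> S1 (a M)" "b (S0 M) \<cdot> S.sg2 M = sg M \<cdot> S1 (b M)"
      by (rule act_ext; simp)+
    note [simp] = 1[THEN arg_cong[of _ _ R1], THEN act_cong, simplified]
    show "a (?S0 M) \<cdot> R.sg2 (S0 M) \<cdot> R1 (S.sg2 M) = ?sg M \<cdot> ?S1 (a M)"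
      "b (?S0 M) \<cdot> R.sg2 (S0 M) \<cdot> R1 (S.sg2 M) = ?sg M \<cdot> ?S1 (b M)"
      by (rule act_ext; simp)+
  qed simp_all
  show C: "comparison D ?S0 ?S1 ?sg"
  proof (unfold_locales, goal_cases)
    case (1 M) then show ?case by simp
  next
    case (2 f A B) then show ?case by (auto simp: Hom_iff)
  next
    case (3 M) then show ?case by simp
  next
    case (4 f A B g E) then show ?case by (auto simp: Hom_iff)
  next
    case (5 M) then show ?case by (simp add: Hom_iff)
  next
    case (6 f A B)
    then have [simp]: "f \<in> Ar D" and AB: "Dom D f = A" "Cod D f = B"
      by (auto simp: Hom_iff)
    have [simp]: "A \<in> Ob D" "B \<in> Ob D"
      using AB[symmetric] by simp_all
    note 1 = act_cong[OF arg_cong[OF S.sg_nat[of f A B], of R1]]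
    show ?case
      by (rule act_ext) (use 1 AB in \<open>simp_all add: R.sg_act Hom_iff\<close>)
  next
    case (7 M)
    then have [simp]: "M \<in> Ob D" .
    show ?case
      by (rule act_ext) (use act_cong[OF arg_cong[OF S.p_sg[of M], of R1]] in \<open>simp_all add: R.p_sg_act\<close>)
  next
    case (8 M)
    then show ?case by (intro iso_comp R.S1_iso S.sg_iso R.sg_iso) simp_all
  next
    case (9 M)
    then show ?case unfolding sg2[OF 9] by (intro iso_comp R.S1_iso S.sg2_iso' R.sg2_iso') simp_all
  qed
  interpret C: comparison D ?S0 ?S1 ?sg by (rule C)
  show "C.image M k h k'' h''" if [simp]: "M \<in> Ob D" and im: "S.image M k h k' h'" "R.image (S0 M) k' h' k'' h''"
    and kh: "k \<in> Hom D (To (To M)) (To M)" "h \<in> Hom D (T2o M) (To (To M))"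
  proof -
    have [simp]: "k \<in> Ar D" "Dom D k = To (To M)" "Cod D k = To M"
      "h \<in> Ar D" "Dom D h = T2o M" "Cod D h = To (To M)"
      "k' \<in> Ar D" "Dom D k' = To (To (S0 M))" "Cod D k' = To (S0 M)"
      "h' \<in> Ar D" "Dom D h' = T2o (S0 M)" "Cod D h' = To (To (S0 M))"
      "k'' \<in> Ar D" "Dom D k'' = To (To (R0 (S0 M)))" "Cod D k'' = To (R0 (S0 M))"
      "h'' \<in> Ar D" "Dom D h'' = T2o (R0 (S0 M))" "Cod D h'' = To (To (R0 (S0 M)))"
      using kh im unfolding S.image_def R.image_def by (auto simp: Hom_iff)
    have e: "k' \<cdot> S.sgTT M = sg M \<cdot> S1 k" "h' \<cdot> S.sg2 M = S.sgTT M \<cdot> S1 h"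
      "k'' \<cdot> R.sgTT (S0 M) = rg (S0 M) \<cdot> R1 k'" "h'' \<cdot> R.sg2 (S0 M) = R.sgTT (S0 M) \<cdot> R1 h'"
      using im unfolding S.image_def R.image_def by simp_all
    note e1 = e(1,2)[THEN arg_cong[of _ _ R1], THEN act_cong]
    note e2 = e(3,4)[THEN act_cong]
    have TT: "C.sgTT M = R.sgTT (S0 M) \<cdot> R1 (S.sgTT M)"
      by (rule act_ext) (simp_all add: C.sgTT_def S.sgTT_def R.sg_act)
    have "k'' \<cdot> C.sgTT M = ?sg M \<cdot> ?S1 k"
      by (rule act_ext) (use e1 e2 in \<open>simp_all add: TT S.sgTT_def\<close>)
    moreover have "h'' \<cdot> C.sg2 M = C.sgTT M \<cdot> ?S1 h"
      unfolding C.sg2_def sg2[OF that(1)]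
      by (rule act_ext) (use e1 e2 in \<open>simp_all add: TT S.sgTT_def\<close>)
    ultimately show ?thesis
      by (simp add: C.image_def Hom_iff)
  qed
qed

text \<open>
  A natural transformation that respects the comparison arrows takes one transported connection
  to the other: after precomposition with a comparison isomorphism, both sides pass through the
  image of \<open>k\<close> or \<open>h\<close>, and there naturality applies. All connection morphisms below arise this way.
\<close>

lemma image_morphism:
  assumes S: "comparison D S0 S1 sg" and R: "comparison D R0 R1 rg"
    and [simp]: "M \<in> Ob D" and k: "k \<in> Hom D (To (To M)) (To M)" and h: "h \<in> Hom D (T2o M) (To (To M))"
    and im: "comparison.image D S0 S1 sg M k h k1 h1" "comparison.image D R0 R1 rg M k h k2 h2"
    and th: "\<And>N. N \<in> Ob D \<Longrightarrow> th N \<in> Hom D (S0 N) (R0 N)"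
    and nat: "\<And>f A B. f \<in> Hom D A B \<Longrightarrow> R1 f \<cdot> th A = th B \<cdot> S1 f"
    and tan: "\<And>N. N \<in> Ob D \<Longrightarrow> T (th N) \<cdot> sg N = rg N \<cdot> th (To N)"
  shows "k2 \<cdot> T (T (th M)) = T (th M) \<cdot> k1" "h2 \<cdot> T2 (th M) = T (T (th M)) \<cdot> h1"
proof -
  interpret S: comparison D S0 S1 sg by (rule S)
  interpret R: comparison D R0 R1 rg by (rule R)
  have [simp]: "k \<in> Ar D" "Dom D k = To (To M)" "Cod D k = To M"
    "h \<in> Ar D" "Dom D h = T2o M" "Cod D h = To (To M)"
    "k1 \<in> Ar D" "Dom D k1 = To (To (S0 M))" "Cod D k1 = To (S0 M)"
    "h1 \<in> Ar D" "Dom D h1 = T2o (S0 M)" "Cod D h1 = To (To (S0 M))"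
    "k2 \<in> Ar D" "Dom D k2 = To (To (R0 M))" "Cod D k2 = To (R0 M)"
    "h2 \<in> Ar D" "Dom D h2 = T2o (R0 M)" "Cod D h2 = To (To (R0 M))"
    using k h im unfolding S.image_def R.image_def by (auto simp: Hom_iff)
  have e: "k1 \<cdot> S.sgTT M = sg M \<cdot> S1 k" "h1 \<cdot> S.sg2 M = S.sgTT M \<cdot> S1 h"
    "k2 \<cdot> R.sgTT M = rg M \<cdot> R1 k" "h2 \<cdot> R.sg2 M = R.sgTT M \<cdot> R1 h"
    using im unfolding S.image_def R.image_def by simp_all
  note e = e[THEN act_cong, simplified]
  have [simp]: "th N \<in> Ar D" "Dom D (th N) = S0 N" "Cod D (th N) = R0 N" if "N \<in> Ob D" for N
    using th[OF that] by (auto simp: Hom_iff)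
  have nat': "R1 f \<ast> th A \<ast> x = th (Cod D f) \<ast> S1 f \<ast> x" if "f \<in> Ar D" "Dom D f = A" for f A x
    using act_cong[OF nat[of f A "Cod D f"], of x] that by (auto simp: Hom_iff)
  have tan': "T (th N) \<ast> sg N \<ast> x = rg N \<ast> th (To N) \<ast> x"
    "T (T (th N)) \<ast> T (sg N) \<ast> x = T (rg N) \<ast> T (th (To N)) \<ast> x" if [simp]: "N \<in> Ob D" for N x
    using act_cong[OF tan[OF that], of x] act_cong[OF arg_cong[OF tan[OF that], of T], of x] by simp_all
  show "k2 \<cdot> T (T (th M)) = T (th M) \<cdot> k1"
    by (rule iso_epi[OF S.sgTT_iso, of M], simp_all, rule act_ext) (simp_all add: e tan' nat' S.sgTT_def)
  have "T2 (th M) \<cdot> S.sg2 M = R.sg2 M \<cdot> th (T2o M)"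
    by (rule T2_eqI[of "R0 M"]) (simp_all add: tan' nat')
  note 1 = act_cong[OF this, simplified]
  show "h2 \<cdot> T2 (th M) = T (T (th M)) \<cdot> h1"
    by (rule iso_epi[OF S.sg2_iso', of M], simp_all, rule act_ext) (simp_all add: e 1 tan' nat')
qed

subsection \<open>Iterated tangent functor\<close>

lemma T_pow [simp]:
  assumes "f \<in> Ar D"
  shows "(T ^^ m) f \<in> Ar D" "Dom D ((T ^^ m) f) = (To ^^ m) (Dom D f)"
    "Cod D ((T ^^ m) f) = (To ^^ m) (Cod D f)"
  using assms by (induction m) simp_all

lemma To_pow [simp]: "M \<in> Ob D \<Longrightarrow> (To ^^ m) M \<in> Ob D"
  by (induction m) simp_all

lemma T_pow_comp [simp]:
  "f \<in> Ar D \<Longrightarrow> g \<in> Ar D \<Longrightarrow> Cod D f = Dom D g \<Longrightarrow> (T ^^ m) (g \<cdot> f) = (T ^^ m) g \<cdot> (T ^^ m) f"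
  by (induction m) simp_all

lemma T_pow_Idn [simp]: "M \<in> Ob D \<Longrightarrow> (T ^^ m) (Idn D M) = Idn D ((To ^^ m) M)"
  by (induction m) simp_all

end

section \<open>Fibred powers of the tangent functor\<close>

text \<open>
  The \<open>n\<close>-fold pullback \<open>P\<close> of \<open>p\<close> along itself, with a comparison \<open>P T \<rightarrow> T P\<close> that is the flip on each
  projection. The cases \<open>n = 0, 1, 2\<close> are the identity, \<open>T\<close> and \<open>T\<^sub>2\<close>. Since \<open>T\<close> and \<open>T\<^sup>2\<close> preserve the
  pullback, an equation between arrows into it may be checked on the projections, where it
  becomes an equation between \<open>z\<close>, \<open>s\<close>, \<open>l\<close> and \<open>c\<close>. That is why \<open>P\<close> is a strong tangent functor.
\<close>

locale tangent_fold = tangent_calculus D for D :: "('a, 'f) tcat" (structure) +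
  fixes n :: nat and P0 :: "'a \<Rightarrow> 'a" and P1 :: "'f \<Rightarrow> 'f" and r :: "nat \<Rightarrow> 'a \<Rightarrow> 'f"
    and q :: "'a \<Rightarrow> 'f" and sg :: "'a \<Rightarrow> 'f"
  assumes P0_Ob [simp]: "M \<in> Ob D \<Longrightarrow> P0 M \<in> Ob D"
    and P1_Hom: "f \<in> Hom D A B \<Longrightarrow> P1 f \<in> Hom D (P0 A) (P0 B)"
    and P1_Idn [simp]: "M \<in> Ob D \<Longrightarrow> P1 (Idn D M) = Idn D (P0 M)"
    and P1_Comp: "f \<in> Hom D A B \<Longrightarrow> g \<in> Hom D B E \<Longrightarrow> P1 (g \<cdot> f) = P1 g \<cdot> P1 f"
    and q_nat: "f \<in> Hom D A B \<Longrightarrow> q B \<cdot> P1 f = f \<cdot> q A"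
    and r_nat: "i < n \<Longrightarrow> f \<in> Hom D A B \<Longrightarrow> r i B \<cdot> P1 f = Tar D f \<cdot> r i A"
    and fold: "M \<in> Ob D \<Longrightarrow> is_fold_pullback D ((Tar D ^^ m) (pt D M)) n ((Tob D ^^ m) (P0 M))
      (\<lambda>i. (Tar D ^^ m) (r i M)) ((Tar D ^^ m) (q M))"
    and sg_Hom: "M \<in> Ob D \<Longrightarrow> sg M \<in> Hom D (P0 (Tob D M)) (Tob D (P0 M))"
    and Tq_sg: "M \<in> Ob D \<Longrightarrow> Tar D (q M) \<cdot> sg M = q (Tob D M)"
    and Tr_sg: "i < n \<Longrightarrow> M \<in> Ob D \<Longrightarrow> Tar D (r i M) \<cdot> sg M = ct D M \<cdot> r i (Tob D M)"
begin

lemma P1_Ar [simp]: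
  "f \<in> Ar D \<Longrightarrow> P1 f \<in> Ar D" "f \<in> Ar D \<Longrightarrow> Dom D (P1 f) = P0 (Dom D f)"
  "f \<in> Ar D \<Longrightarrow> Cod D (P1 f) = P0 (Cod D f)"
  using P1_Hom[of f "Dom D f" "Cod D f"] by (auto simp: Hom_iff)

lemma P1_comp [simp]:
  "f \<in> Ar D \<Longrightarrow> g \<in> Ar D \<Longrightarrow> Cod D f = Dom D g \<Longrightarrow> P1 (g \<cdot> f) = P1 g \<cdot> P1 f"
  using P1_Comp[of f "Dom D f" "Cod D f" g "Cod D g"] by (auto simp: Hom_iff)

lemma qr_Ar [simp]:
  assumes "M \<in> Ob D"
  shows "q M \<in> Ar D" "Dom D (q M) = P0 M" "Cod D (q M) = M"
    "i < n \<Longrightarrow> r i M \<in> Ar D" "i < n \<Longrightarrow> Dom D (r i M) = P0 M" "i < n \<Longrightarrow> Cod D (r i M) = To M"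
  using assms fold_Ar[OF fold[OF assms, of 0]] by simp_all

lemma sg_Ar [simp]:
  assumes "M \<in> Ob D"
  shows "sg M \<in> Ar D" "Dom D (sg M) = P0 (To M)" "Cod D (sg M) = To (P0 M)"
  using sg_Hom[OF assms] by (auto simp: Hom_iff)

lemma fold_act_eqI:
  assumes "M \<in> Ob D" "u \<in> Ar D" "v \<in> Ar D" "Dom D u = Dom D v"
    "Cod D u = (To ^^ m) (P0 M)" "Cod D v = (To ^^ m) (P0 M)"
    "\<And>x. (T ^^ m) (q M) \<ast> u \<ast> x = (T ^^ m) (q M) \<ast> v \<ast> x"
    "\<And>i x. i < n \<Longrightarrow> (T ^^ m) (r i M) \<ast> u \<ast> x = (T ^^ m) (r i M) \<ast> v \<ast> x"
  shows "u = v"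
  by (rule fold_eqI[OF fold[OF assms(1)] assms(2-6)]; rule act_ext) (use assms in simp_all)

lemmas eqI0 = fold_act_eqI[where m = 0, simplified]
  and eqI1 = fold_act_eqI[where m = 1, simplified]
  and eqI2 = fold_act_eqI[where m = 2, simplified numeral_2_eq_2, simplified]

lemma qr_act:
  assumes "f \<in> Ar D" "Cod D f = B"
  shows "q B \<ast> P1 f \<ast> x = f \<ast> q (Dom D f) \<ast> x"
    "T (q B) \<ast> T (P1 f) \<ast> x = T f \<ast> T (q (Dom D f)) \<ast> x"
    "i < n \<Longrightarrow> r i B \<ast> P1 f \<ast> x = T f \<ast> r i (Dom D f) \<ast> x"
    "i < n \<Longrightarrow> T (r i B) \<ast> T (P1 f) \<ast> x = T (T f) \<ast> T (r i (Dom D f)) \<ast> x"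
proof -
  have f: "f \<in> Hom D (Dom D f) B" and [simp]: "B \<in> Ob D" "Dom D f \<in> Ob D" "f \<in> Ar D" "Cod D f = B"
    using assms by (auto simp: Hom_iff)
  show "q B \<ast> P1 f \<ast> x = f \<ast> q (Dom D f) \<ast> x"
    "T (q B) \<ast> T (P1 f) \<ast> x = T f \<ast> T (q (Dom D f)) \<ast> x"
    using act_cong[OF q_nat[OF f]] act_cong[OF arg_cong[OF q_nat[OF f], of T], of x] by simp_all
  show "r i B \<ast> P1 f \<ast> x = T f \<ast> r i (Dom D f) \<ast> x"
    "T (r i B) \<ast> T (P1 f) \<ast> x = T (T f) \<ast> T (r i (Dom D f)) \<ast> x" if "i < n"
    using act_cong[OF r_nat[OF that f]] act_cong[OF arg_cong[OF r_nat[OF that f], of T], of x] that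
    by simp_all
qed

lemma qr_sg_act:
  assumes [simp]: "M \<in> Ob D"
  shows "T (q M) \<ast> sg M \<ast> x = q (To M) \<ast> x"
    "T (T (q M)) \<ast> T (sg M) \<ast> x = T (q (To M)) \<ast> x"
    "i < n \<Longrightarrow> T (r i M) \<ast> sg M \<ast> x = c M \<ast> r i (To M) \<ast> x"
    "i < n \<Longrightarrow> T (T (r i M)) \<ast> T (sg M) \<ast> x = T (c M) \<ast> T (r i (To M)) \<ast> x"
    "i < n \<Longrightarrow> p M \<ast> r i M \<ast> x = q M \<ast> x"
    "i < n \<Longrightarrow> T (p M) \<ast> T (r i M) \<ast> x = T (q M) \<ast> x"
  using act_cong[OF Tq_sg, of M x] act_cong[OF arg_cong[OF Tq_sg, of M T], of x]
    act_cong[OF Tr_sg, of i M x] act_cong[OF arg_cong[OF Tr_sg, of i M T], of x]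
    act_cong[OF fold_Ar(8)[OF fold[OF assms, of 0], of i], of x]
    act_cong[OF arg_cong[OF fold_Ar(8)[OF fold[OF assms, of 0], of i], of T], of x]
  by simp_all

lemma sg_nat:
  assumes "f \<in> Hom D A B"
  shows "T (P1 f) \<cdot> sg A = sg B \<cdot> P1 (T f)"
proof -
  have [simp]: "f \<in> Ar D" "Dom D f = A" "Cod D f = B" "A \<in> Ob D" "B \<in> Ob D"
    using assms by (auto simp: Hom_iff)
  show ?thesis
    by (rule eqI1[of B]) (simp_all add: qr_act qr_sg_act c_act)
qed

lemma p_sg:
  assumes [simp]: "M \<in> Ob D"
  shows "p (P0 M) \<cdot> sg M = P1 (p M)"
proof (rule eqI0[of M])
  show "q M \<ast> (p (P0 M) \<cdot> sg M) \<ast> x = q M \<ast> P1 (p M) \<ast> x" for x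
    using qr_sg_act(1)[of M x] by (simp add: qr_act p_act[of "q M", symmetric, simplified])
  show "r i M \<ast> (p (P0 M) \<cdot> sg M) \<ast> x = r i M \<ast> P1 (p M) \<ast> x" if [simp]: "i < n" for i x
    by (simp add: qr_act qr_sg_act p_act[of "r i M" "To M", symmetric, simplified] structure_act)
qed simp_all

lemma sg_z:
  assumes [simp]: "M \<in> Ob D"
  shows "sg M \<cdot> P1 (z M) = z (P0 M)"
proof (rule eqI1[of M])
  show "T (r i M) \<ast> (sg M \<cdot> P1 (z M)) \<ast> x = T (r i M) \<ast> z (P0 M) \<ast> x" if [simp]: "i < n" for i x
    by (simp add: qr_act qr_sg_act z_act[of "r i M" "To M", symmetric, simplified] structure_act)
qed (simp_all add: qr_act qr_sg_act z_act[of "q M" M, symmetric, simplified])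

text \<open>On the projections, compatibility with \<open>l\<close> is the axiom relating \<open>l\<close> and \<open>c\<close>, and compatibility
  with \<open>c\<close> is the braid relation.\<close>

lemma l_sg:
  assumes [simp]: "M \<in> Ob D"
  shows "l (P0 M) \<cdot> sg M = T (sg M) \<cdot> sg (To M) \<cdot> P1 (l M)"
proof (rule eqI2[of M])
  show "T (T (r i M)) \<ast> (l (P0 M) \<cdot> sg M) \<ast> x = T (T (r i M)) \<ast> (T (sg M) \<cdot> sg (To M) \<cdot> P1 (l M)) \<ast> x"
    if [simp]: "i < n" for i x
    by (simp add: qr_act qr_sg_act l_act[of "r i M" "To M", symmetric, simplified] l_c)
qed (simp_all add: qr_act qr_sg_act l_act[of "q M" M, symmetric, simplified])

lemma c_sg:
  assumes [simp]: "M \<in> Ob D"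
  shows "c (P0 M) \<cdot> T (sg M) \<cdot> sg (To M) = T (sg M) \<cdot> sg (To M) \<cdot> P1 (c M)"
proof (rule eqI2[of M])
  show "T (T (r i M)) \<ast> (c (P0 M) \<cdot> T (sg M) \<cdot> sg (To M)) \<ast> x =
      T (T (r i M)) \<ast> (T (sg M) \<cdot> sg (To M) \<cdot> P1 (c M)) \<ast> x"
    if [simp]: "i < n" for i x
    by (simp add: qr_act qr_sg_act c_act[of "r i M" "To M", symmetric, simplified] braid_act)
qed (simp_all add: qr_act qr_sg_act c_act[of "q M" M, symmetric, simplified])

text \<open>The inverse of the comparison is the flip on each projection again, as \<open>c \<cdot> c = id\<close>.\<close>

lemma sg_iso:
  assumes [simp]: "M \<in> Ob D"
  shows "is_iso D (sg M)"
proof -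
  have 1: "T (q M) \<in> Ar D \<and> p (To M) \<cdot> (c M \<cdot> T (r i M)) = T (q M)" if [simp]: "i < n" for i
    by (intro conjI, simp, rule act_ext) (simp_all add: structure_act qr_sg_act)
  obtain u where u [simp]: "u \<in> Ar D" "Dom D u = To (P0 M)" "Cod D u = P0 (To M)"
    and qu: "q (To M) \<cdot> u = T (q M)" and ru: "\<And>i. i < n \<Longrightarrow> r i (To M) \<cdot> u = c M \<cdot> T (r i M)"
    by (rule fold_obtain[OF fold[of "To M" 0, simplified], of "T (q M)" "\<lambda>i. c M \<cdot> T (r i M)"])
      (use 1 in simp_all)
  note qu = act_cong[OF qu, simplified]
  have ru: "r i (To M) \<ast> u \<ast> x = c M \<ast> T (r i M) \<ast> x" if "i < n" for i x
    using act_cong[OF ru[OF that]] that by simp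
  show ?thesis
  proof (rule isoI[of _ u])
    show "u \<cdot> sg M = Idn D (Dom D (sg M))"
      by (rule eqI0[of "To M"]) (simp_all add: qu ru qr_sg_act structure_act)
    show "sg M \<cdot> u = Idn D (Cod D (sg M))"
      by (rule eqI1[of M]) (simp_all add: qu ru qr_sg_act structure_act)
  qed simp_all
qed

definition sg2' :: "'a \<Rightarrow> 'f" where
  "sg2' M = into_T2 D (P0 M) (sg M \<cdot> P1 (a M)) (sg M \<cdot> P1 (b M))"

lemma p_sg_act: "M \<in> Ob D \<Longrightarrow> p (P0 M) \<ast> sg M \<ast> x = P1 (p M) \<ast> x"
  using act_cong[OF p_sg] by simp

lemma sg2'_Ar [simp]:
  assumes [simp]: "M \<in> Ob D"
  shows "sg2' M \<in> Ar D" "Dom D (sg2' M) = P0 (T2o M)" "Cod D (sg2' M) = T2o (P0 M)"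
    "a (P0 M) \<ast> sg2' M \<ast> x = sg M \<ast> P1 (a M) \<ast> x" "b (P0 M) \<ast> sg2' M \<ast> x = sg M \<ast> P1 (b M) \<ast> x"
proof -
  have 1: "p (P0 M) \<cdot> (sg M \<cdot> P1 (a M)) = p (P0 M) \<cdot> (sg M \<cdot> P1 (b M))"
    by (rule act_ext) (use act_cong[OF arg_cong[OF p_b, of M P1]] in \<open>simp_all add: p_sg_act\<close>)
  note P = into_T2[OF _ _ _ _ _ _ 1, simplified, folded sg2'_def]
  show "sg2' M \<in> Ar D" "Dom D (sg2' M) = P0 (T2o M)" "Cod D (sg2' M) = T2o (P0 M)"
    "a (P0 M) \<ast> sg2' M \<ast> x = sg M \<ast> P1 (a M) \<ast> x" "b (P0 M) \<ast> sg2' M \<ast> x = sg M \<ast> P1 (b M) \<ast> x"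
    using P(1-3) act_cong[OF P(4), of x] act_cong[OF P(5), of x] by simp_all
qed

lemma sg_s:
  assumes [simp]: "M \<in> Ob D"
  shows "sg M \<cdot> P1 (s M) = s (P0 M) \<cdot> sg2' M"
proof -
  have 1: "p (To M) \<cdot> (c M \<cdot> T (a M)) = p (To M) \<cdot> (c M \<cdot> T (b M))"
    by (rule act_ext) (simp_all add: structure_act T_structure_act)
  note P = into_T2[OF _ _ _ _ _ _ 1, simplified]
  note [simp] = P(1-3)
  note [simp] = act_cong[OF P(4), simplified] act_cong[OF P(5), simplified]
  have cTs: "c M \<ast> T (s M) \<ast> x = s (To M) \<ast> into_T2 D (To M) (c M \<cdot> T (a M)) (c M \<cdot> T (b M)) \<ast> x" for x
    using act_cong[OF c_Ts, of M x] by simp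
  show ?thesis
  proof (rule eqI1[of M])
    have 2: "T2 (q M) \<cdot> sg2' M = q (T2o M)"
      by (rule T2_eqI[of M]) (simp_all add: qr_act qr_sg_act)
    show "T (q M) \<ast> (sg M \<cdot> P1 (s M)) \<ast> x = T (q M) \<ast> (s (P0 M) \<cdot> sg2' M) \<ast> x" for x
      using act_cong[OF 2, of x] by (simp add: qr_act qr_sg_act s_act[of "q M" M, symmetric, simplified])
    show "T (r i M) \<ast> (sg M \<cdot> P1 (s M)) \<ast> x = T (r i M) \<ast> (s (P0 M) \<cdot> sg2' M) \<ast> x" if [simp]: "i < n" for i x
    proof -
      have 2: "T2 (r i M) \<cdot> sg2' M = into_T2 D (To M) (c M \<cdot> T (a M)) (c M \<cdot> T (b M)) \<cdot> r i (T2o M)"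
        by (rule T2_eqI[of "To M"]) (simp_all add: qr_act qr_sg_act)
      show ?thesis
        using act_cong[OF 2, of x]
        by (simp add: qr_act qr_sg_act s_act[of "r i M" "To M", symmetric, simplified] cTs)
    qed
  qed simp_all
qed

text \<open>Both \<open>P T\<^sub>2\<close> and \<open>T\<^sub>2 P\<close> are limits of the same diagram, and the inverse is the canonical arrow
  \<open>T\<^sub>2 P \<rightarrow> P T\<^sub>2\<close> given on each projection by \<open>T\<^sub>2 T \<rightarrow> T T\<^sub>2\<close>.\<close>

lemma sg2_iso:
  assumes [simp]: "M \<in> Ob D"
  shows "is_iso D (sg2' M)"
proof -
  have 1: "T (p M) \<cdot> (c M \<cdot> a (To M)) = T (p M) \<cdot> (c M \<cdot> b (To M))"
    by (rule act_ext) (simp_all add: Tp_c structure_act)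
  note P = into_TT2[OF _ _ _ _ _ _ 1, simplified]
  let ?i = "into_TT2 D M (c M \<cdot> a (To M)) (c M \<cdot> b (To M))"
  note [simp] = P(1-3)
  note [simp] = act_cong[OF P(4), simplified] act_cong[OF P(5), simplified]
  have "p (T2o M) \<cdot> (?i \<cdot> T2 (r i M)) = T2 (q M)" if [simp]: "i < n" for i
  proof (rule T2_eqI[of M])
    fix x
    have "a M \<ast> p (T2o M) \<ast> y = p (To M) \<ast> T (a M) \<ast> y"
      "b M \<ast> p (T2o M) \<ast> y = p (To M) \<ast> T (b M) \<ast> y" for y
      by (simp_all add: p_act)
    then show "a M \<ast> (p (T2o M) \<cdot> (?i \<cdot> T2 (r i M))) \<ast> x = a M \<ast> T2 (q M) \<ast> x"
      "b M \<ast> (p (T2o M) \<cdot> (?i \<cdot> T2 (r i M))) \<ast> x = b M \<ast> T2 (q M) \<ast> x"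
      by (simp_all add: structure_act qr_sg_act)
  qed simp_all
  note 2 = this
  obtain u where u [simp]: "u \<in> Ar D" "Dom D u = T2o (P0 M)" "Cod D u = P0 (T2o M)"
    and qu: "q (T2o M) \<cdot> u = T2 (q M)" and ru: "\<And>i. i < n \<Longrightarrow> r i (T2o M) \<cdot> u = ?i \<cdot> T2 (r i M)"
    by (rule fold_obtain[OF fold[of "T2o M" 0, simplified], of "T2 (q M)" "\<lambda>i. ?i \<cdot> T2 (r i M)"])
      (use 2 in simp_all)
  note qu = act_cong[OF qu, simplified]
  have ru: "r i (T2o M) \<ast> u \<ast> x = ?i \<ast> T2 (r i M) \<ast> x" if "i < n" for i x
    using act_cong[OF ru[OF that]] that by simp
  show ?thesis
  proof (rule isoI[of _ u])
    have 3: "?i \<cdot> T2 (r i M) \<cdot> sg2' M = r i (T2o M)" if [simp]: "i < n" for i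
      by (rule TT2_eqI[of M]) (simp_all add: qr_sg_act structure_act qr_act)
    have 3: "?i \<ast> T2 (r i M) \<ast> sg2' M \<ast> x = r i (T2o M) \<ast> x" if "i < n" for i x
      using act_cong[OF 3[OF that], of x] that by simp
    have "T2 (q M) \<cdot> sg2' M = q (T2o M)"
      by (rule T2_eqI[of M]) (simp_all add: qr_act qr_sg_act)
    note 4 = act_cong[OF this, simplified]
    show "u \<cdot> sg2' M = Idn D (Dom D (sg2' M))"
      by (rule eqI0[of "T2o M"]) (simp_all add: qu ru 3 4)
    have "sg M \<cdot> P1 (a M) \<cdot> u = a (P0 M)" "sg M \<cdot> P1 (b M) \<cdot> u = b (P0 M)"
      by (rule eqI1[of M]; simp add: qu ru qr_act qr_sg_act structure_act)+
    note 5 = this[THEN act_cong, simplified]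
    show "sg2' M \<cdot> u = Idn D (Cod D (sg2' M))"
      by (rule T2_eqI[of "P0 M"]) (simp_all add: 5)
  qed simp_all
qed

sublocale F: comparison D P0 P1 sg
  by unfold_locales (use P1_Hom P1_Comp sg_Hom sg_nat p_sg sg_iso sg2_iso in \<open>simp_all add: sg2'_def\<close>)

sublocale F: strong D P0 P1 sg
  by unfold_locales (use sg_z sg_s l_sg c_sg in \<open>simp_all add: F.sg2_def sg2'_def\<close>)

end

lemma (in category) fold_pullbackI:
  assumes ty: "p \<in> Ar C" "q \<in> Ar C" "Dom C q = P" "Cod C q = Cod C p"
    "\<And>i. i < n \<Longrightarrow> r i \<in> Ar C \<and> Dom C (r i) = P \<and> Cod C (r i) = Dom C p \<and> p \<cdot> r i = q"
    and ex: "\<And>v w. v \<in> Ar C \<Longrightarrow> Cod C v = Cod C p \<Longrightarrow>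
      (\<And>i. i < n \<Longrightarrow> w i \<in> Ar C \<and> Dom C (w i) = Dom C v \<and> Cod C (w i) = Dom C p \<and> p \<cdot> w i = v) \<Longrightarrow>
      \<exists>u. u \<in> Ar C \<and> Dom C u = Dom C v \<and> Cod C u = P \<and> q \<cdot> u = v \<and> (\<forall>i<n. r i \<cdot> u = w i)"
    and un: "\<And>u u'. u \<in> Ar C \<Longrightarrow> u' \<in> Ar C \<Longrightarrow> Dom C u = Dom C u' \<Longrightarrow> Cod C u = P \<Longrightarrow> Cod C u' = P \<Longrightarrow>
      q \<cdot> u = q \<cdot> u' \<Longrightarrow> (\<And>i. i < n \<Longrightarrow> r i \<cdot> u = r i \<cdot> u') \<Longrightarrow> u = u'"
  shows "is_fold_pullback C p n P r q"
  unfolding is_fold_pullback_def Hom_iff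
proof (intro conjI allI impI)
  fix Q v w
  assume H: "(v \<in> Ar C \<and> Dom C v = Q \<and> Cod C v = Cod C p) \<and>
    (\<forall>i<n. (w i \<in> Ar C \<and> Dom C (w i) = Q \<and> Cod C (w i) = Dom C p) \<and> p \<cdot> w i = v)"
  then obtain u where "u \<in> Ar C" "Dom C u = Q" "Cod C u = P" "q \<cdot> u = v" "\<forall>i<n. r i \<cdot> u = w i"
    using ex[of v w] by auto
  then show "\<exists>!u. (u \<in> Ar C \<and> Dom C u = Q \<and> Cod C u = P) \<and> q \<cdot> u = v \<and> (\<forall>i<n. r i \<cdot> u = w i)"
    by (intro ex1I[of _ u]) (simp, rule un, simp_all)
qed (use ty in simp_all)

lemma (in category) pullback_fold2:
  assumes "is_pullback C f f P u v"
  shows "is_fold_pullback C f 2 P (\<lambda>i. if i = 0 then u else v) (f \<cdot> u)"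
proof -
  note ar = pullback_Ar[OF assms]
  have "\<exists>!w. w \<in> Hom C Q P \<and> (f \<cdot> u) \<cdot> w = y \<and> (\<forall>i<2. (if i = 0 then u else v) \<cdot> w = x i)"
    if y: "y \<in> Hom C Q (Cod C f)" and x: "\<forall>i<2::nat. x i \<in> Hom C Q (Dom C f) \<and> f \<cdot> x i = y" for Q x y
  proof -
    have "\<exists>!w. w \<in> Hom C Q P \<and> u \<cdot> w = x 0 \<and> v \<cdot> w = x 1"
      using pullback_univ[OF assms, of "x 0" Q "x 1"] x by simp
    moreover have "(w \<in> Hom C Q P \<and> u \<cdot> w = x 0 \<and> v \<cdot> w = x 1) \<longleftrightarrow>
        (w \<in> Hom C Q P \<and> (f \<cdot> u) \<cdot> w = y \<and> (\<forall>i<2. (if i = 0 then u else v) \<cdot> w = x i))" for w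
      using x ar by (auto simp: numeral_2_eq_2 less_Suc_eq Hom_iff comp_assoc)
    ultimately show ?thesis
      by simp
  qed
  then show ?thesis
    unfolding is_fold_pullback_def using ar by (auto simp: Hom_iff)
qed

context tangent_calculus
begin

subsection \<open>The identity, \<open>T\<close> and \<open>T\<^sub>2\<close>\<close>

lemma fold_Id: "tangent_fold D 0 (\<lambda>M. M) (\<lambda>f. f) r (Idn D) (\<lambda>M. Idn D (Tob D M))"
proof (unfold_locales, goal_cases)
  case (7 M m)
  then have [simp]: "M \<in> Ob D" .
  show ?case
  proof (rule fold_pullbackI)
    fix v and w :: "nat \<Rightarrow> 'f"
    assume "v \<in> Ar D" "Cod D v = Cod D ((T ^^ m) (p M))"
    then show "\<exists>u. u \<in> Ar D \<and> Dom D u = Dom D v \<and> Cod D u = (To ^^ m) M \<and>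
        (T ^^ m) (Idn D M) \<cdot> u = v \<and> (\<forall>i<0. (T ^^ m) (r i M) \<cdot> u = w i)"
      by (intro exI[of _ v]) simp
  qed simp_all
qed (auto simp: Hom_iff)

lemma fold_T: "tangent_fold D 1 (Tob D) (Tar D) (\<lambda>i M. Idn D (Tob D M)) (pt D) (ct D)"
proof (unfold_locales, goal_cases)
  case (2 f A B) then show ?case by (rule T_Hom)
next
  case (4 f A B g E) then show ?case by (auto simp: Hom_iff)
next
  case (5 f A B) then show ?case by (rule p_nat)
next
  case (7 M m)
  then have [simp]: "M \<in> Ob D" .
  show ?case
  proof (rule fold_pullbackI)
    fix v and w :: "nat \<Rightarrow> 'f"
    assume "v \<in> Ar D" "Cod D v = Cod D ((T ^^ m) (p M))" and
      w: "\<And>i. i < 1 \<Longrightarrow> w i \<in> Ar D \<and> Dom D (w i) = Dom D v \<and>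
        Cod D (w i) = Dom D ((T ^^ m) (p M)) \<and> (T ^^ m) (p M) \<cdot> w i = v"
    then show "\<exists>u. u \<in> Ar D \<and> Dom D u = Dom D v \<and> Cod D u = (To ^^ m) (To M) \<and>
        (T ^^ m) (p M) \<cdot> u = v \<and> (\<forall>i<1. (T ^^ m) (Idn D (To M)) \<cdot> u = w i)"
      using w[of 0] by (intro exI[of _ "w 0"]) simp
  qed simp_all
next
  case (9 M)
  then show ?case by (intro act_ext) (simp_all add: Tp_c)
qed (auto simp: Hom_iff)

text \<open>The flip on both components, the comparison \<open>T\<^sub>2 T \<rightarrow> T T\<^sub>2\<close>.\<close>

definition T2sg :: "'a \<Rightarrow> 'f" where
  "T2sg M = into_TT2 D M (c M \<cdot> a (To M)) (c M \<cdot> b (To M))"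

lemma T2sg_Ar [simp]:
  assumes [simp]: "M \<in> Ob D"
  shows "T2sg M \<in> Ar D" "Dom D (T2sg M) = T2o (To M)" "Cod D (T2sg M) = To (T2o M)"
    "T (a M) \<ast> T2sg M \<ast> x = c M \<ast> a (To M) \<ast> x" "T (b M) \<ast> T2sg M \<ast> x = c M \<ast> b (To M) \<ast> x"
proof -
  have 1: "T (p M) \<cdot> (c M \<cdot> a (To M)) = T (p M) \<cdot> (c M \<cdot> b (To M))"
    by (rule act_ext) (simp_all add: Tp_c structure_act)
  note P = into_TT2[OF _ _ _ _ _ _ 1, simplified, folded T2sg_def]
  show "T2sg M \<in> Ar D" "Dom D (T2sg M) = T2o (To M)" "Cod D (T2sg M) = To (T2o M)"
    "T (a M) \<ast> T2sg M \<ast> x = c M \<ast> a (To M) \<ast> x" "T (b M) \<ast> T2sg M \<ast> x = c M \<ast> b (To M) \<ast> x"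
    using P(1-3) act_cong[OF P(4), of x] act_cong[OF P(5), of x] by simp_all
qed

lemma fold_T2:
  "tangent_fold D 2 (T2ob D) (T2ar D) (\<lambda>i M. if i = 0 then a M else b M) (\<lambda>M. p M \<cdot> a M) T2sg"
proof (unfold_locales, goal_cases)
  case (2 f A B) then show ?case by (auto simp: Hom_iff)
next
  case (4 f A B g E) then show ?case by (auto simp: Hom_iff)
next
  case (5 f A B)
  then have "f \<in> Ar D" "Dom D f = A" "Cod D f = B" by (auto simp: Hom_iff)
  then show ?case by (intro act_ext) (auto simp: p_act)
next
  case (6 i f A B)
  then have "f \<in> Ar D" "Dom D f = A" "Cod D f = B" by (auto simp: Hom_iff)
  then show ?case by (intro act_ext) auto
next
  case (7 M m)
  then show ?case
    using pullback_fold2[OF T2_pullback[OF 7, of m]] by (simp add: if_distrib[of "T ^^ m"])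
next
  case (9 M)
  then show ?case by (intro act_ext) (simp_all add: Tp_c)
next
  case (10 i M)
  then show ?case by (intro act_ext) simp_all
qed (auto simp: Hom_iff)

subsection \<open>Connection morphisms\<close>

definition conn_mor :: "'a \<times> 'f \<times> 'f \<Rightarrow> 'f \<Rightarrow> 'a \<times> 'f \<times> 'f \<Rightarrow> bool" where
  "conn_mor A f B = (case A of (M, k, h) \<Rightarrow> case B of (M', k', h') \<Rightarrow>
     f \<in> Hom D M M' \<and> k' \<cdot> T (T f) = T f \<cdot> k \<and> h' \<cdot> T2 f = T (T f) \<cdot> h)"

text \<open>A pair of arrows of the type of a connection. Transport and the formula for the tangent
  connection make sense without the axioms.\<close>

definition pre_connection :: "'a \<times> 'f \<times> 'f \<Rightarrow> bool" where
  "pre_connection A = (case A of (M, k, h) \<Rightarrow>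
     M \<in> Ob D \<and> k \<in> Hom D (To (To M)) (To M) \<and> h \<in> Hom D (T2o M) (To (To M)))"

lemma affine_pre_connection: "affine_connection D M k h \<Longrightarrow> pre_connection (M, k, h)"
  unfolding affine_connection_iff pre_connection_def Hom_iff by simp

text \<open>Conjugating \<open>T k\<close> and \<open>T h\<close> with flips is transport along the strong functor \<open>(T, c)\<close>. Hence
  the tangent of an affine connection is an affine connection.\<close>

lemma AC_tan_image:
  assumes "pre_connection (M, k, h)"
  obtains k' h' where "AC_tan D (M, k, h) = (To M, k', h')"
    "comparison.image D (Tob D) (Tar D) (ct D) M k h k' h'"
proof -
  have [simp]: "M \<in> Ob D" "k \<in> Ar D" "Dom D k = To (To M)" "Cod D k = To M"
    "h \<in> Ar D" "Dom D h = T2o M" "Cod D h = To (To M)"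
    using assms by (auto simp: pre_connection_def Hom_iff)
  interpret F: tangent_fold D 1 To T "\<lambda>i M. Idn D (To M)" p c
    by (rule fold_T)
  have 1: "T2sg M \<cdot> F.F.sg2 M = Idn D (To (T2o M))"
    by (rule TT2_eqI[of M]) (simp_all add: structure_act)
  have "F.F.image M k h (c M \<cdot> T k \<cdot> c (To M) \<cdot> T (c M)) (T (c M) \<cdot> c (To M) \<cdot> T h \<cdot> T2sg M)"
    unfolding F.F.image_def Hom_iff
  proof (intro conjI)
    show "(c M \<cdot> T k \<cdot> c (To M) \<cdot> T (c M)) \<cdot> F.F.sgTT M = c M \<cdot> T k"
      by (rule act_ext) (simp_all add: F.F.sgTT_def structure_act T_structure_act)
    show "(T (c M) \<cdot> c (To M) \<cdot> T h \<cdot> T2sg M) \<cdot> F.F.sg2 M = F.F.sgTT M \<cdot> T h"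
      by (rule act_ext) (use act_cong[OF 1] in \<open>simp_all add: F.F.sgTT_def\<close>)
  qed simp_all
  then show ?thesis
    by (intro that[of "c M \<cdot> T k \<cdot> c (To M) \<cdot> T (c M)" "T (c M) \<cdot> c (To M) \<cdot> T h \<cdot> T2sg M"])
      (simp_all add: AC_tan_def T2sg_def)
qed

lemma AC_tan_pre_connection: "pre_connection A \<Longrightarrow> pre_connection (AC_tan D A)"
proof -
  assume "pre_connection A"
  moreover obtain M k h where A: "A = (M, k, h)" by (cases A)
  interpret F: tangent_fold D 1 To T "\<lambda>i M. Idn D (To M)" p c
    by (rule fold_T)
  from AC_tan_image[of M k h] calculation obtain k' h' where
    "AC_tan D (M, k, h) = (To M, k', h')" "F.F.image M k h k' h'" unfolding A by blast
  then show ?thesis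
    using calculation unfolding A F.F.image_def by (auto simp: pre_connection_def)
qed

lemma AC_tan_affine:
  assumes "affine_connection D M k h" "AC_tan D (M, k, h) = (M', k', h')"
  shows "affine_connection D M' k' h'"
proof -
  interpret F: tangent_fold D 1 To T "\<lambda>i M. Idn D (To M)" p c
    by (rule fold_T)
  show ?thesis
    using AC_tan_image[OF affine_pre_connection[OF assms(1)]] F.F.affine_connection_image[OF assms(1)]
      assms(2) by (metis prod.inject)
qed

lemma comparison_Id: "comparison D (\<lambda>M. M) (\<lambda>f. f) (\<lambda>M. Idn D (Tob D M))"
proof -
  interpret I: tangent_fold D 0 "\<lambda>M. M" "\<lambda>f. f" "\<lambda>i M. undefined" "Idn D" "\<lambda>M. Idn D (Tob D M)"
    by (rule fold_Id)
  show ?thesis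
    by (rule I.F.comparison_axioms)
qed

lemma image_Id:
  assumes "pre_connection (M, k, h)"
  shows "comparison.image D (\<lambda>M. M) (\<lambda>f. f) (\<lambda>M. Idn D (Tob D M)) M k h k h"
proof -
  have [simp]: "M \<in> Ob D" "k \<in> Ar D" "Dom D k = To (To M)" "Cod D k = To M"
    "h \<in> Ar D" "Dom D h = T2o M" "Cod D h = To (To M)"
    using assms by (auto simp: pre_connection_def Hom_iff)
  have "into_T2 D M (Idn D (To M) \<cdot> a M) (Idn D (To M) \<cdot> b M) = Idn D (T2o M)"
    by (rule into_T2_eqI) simp_all
  then show ?thesis
    by (simp add: comparison.image_def[OF comparison_Id] comparison.sgTT_def[OF comparison_Id]
        comparison.sg2_def[OF comparison_Id] Hom_iff)
qed

end

context tangent_fold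
begin

text \<open>The diagonal \<open>P \<rightarrow> id\<close> and the projections \<open>P \<rightarrow> T\<close> respect the comparison arrows by definition.\<close>

lemma proj_conn_mor:
  assumes A: "pre_connection (M, k, h)" and im: "F.image M k h k' h'"
  shows "i < n \<Longrightarrow> conn_mor (P0 M, k', h') (r i M) (AC_tan D (M, k, h))"
    "conn_mor (P0 M, k', h') (q M) (M, k, h)"
proof -
  have [simp]: "M \<in> Ob D" and kh: "k \<in> Hom D (To (To M)) (To M)" "h \<in> Hom D (T2o M) (To (To M))"
    using A by (auto simp: pre_connection_def)
  interpret T: tangent_fold D 1 To T "\<lambda>i M. Idn D (To M)" p c
    by (rule fold_T)
  show "conn_mor (P0 M, k', h') (r i M) (AC_tan D (M, k, h))" if i [simp]: "i < n"
  proof -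
    from AC_tan_image[OF A] obtain kT hT where AT: "AC_tan D (M, k, h) = (To M, kT, hT)"
      "T.F.image M k h kT hT" .
    have "kT \<cdot> T (T (r i M)) = T (r i M) \<cdot> k'" "hT \<cdot> T2 (r i M) = T (T (r i M)) \<cdot> h'"
      by (rule image_morphism[OF F.comparison_axioms T.F.comparison_axioms _ kh im AT(2), of "r i"];
          auto simp: Hom_iff r_nat Tr_sg)+
    then show ?thesis
      by (simp add: AT conn_mor_def Hom_iff)
  qed
  have "k \<cdot> T (T (q M)) = T (q M) \<cdot> k'" "h \<cdot> T2 (q M) = T (T (q M)) \<cdot> h'"
    by (rule image_morphism[OF F.comparison_axioms comparison_Id _ kh im image_Id[OF A], of q];
        auto simp: Hom_iff q_nat Tq_sg)+
  then show "conn_mor (P0 M, k', h') (q M) (M, k, h)"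
    by (simp add: conn_mor_def Hom_iff)
qed

end

context tangent_calculus
begin

text \<open>The connection on \<open>T\<^sub>2 M\<close> is determined by its projections to \<open>T M\<close>; as the connection transported
  along \<open>T\<^sub>2\<close> has connection morphisms as projections, the two agree.\<close>

lemma AC_tan2_image:
  assumes A: "pre_connection (M, k, h)"
  obtains k' h' where "AC_tan2 D (M, k, h) = (T2o M, k', h')"
    "comparison.image D (T2ob D) (T2ar D) T2sg M k h k' h'"
proof -
  interpret F: tangent_fold D 2 T2o T2 "\<lambda>i M. if i = 0 then a M else b M" "\<lambda>M. p M \<cdot> a M" T2sg
    by (rule fold_T2)
  have [simp]: "M \<in> Ob D" and kh: "k \<in> Hom D (To (To M)) (To M)" "h \<in> Hom D (T2o M) (To (To M))"
    using A by (auto simp: pre_connection_def)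
  obtain k' h' where im: "F.F.image M k h k' h'"
    using F.F.image_exists[OF _ kh] by auto
  obtain kT hT where AT: "AC_tan D (M, k, h) = (To M, kT, hT)"
    using AC_tan_image[OF A] by metis
  have ty: "k' \<in> Ar D" "Cod D k' = To (T2o M)" "h' \<in> Ar D" "Cod D h' = To (To (T2o M))"
    using im by (auto simp: F.F.image_def Hom_iff)
  have "kT \<cdot> T (T (a M)) = T (a M) \<cdot> k'" "hT \<cdot> T2 (a M) = T (T (a M)) \<cdot> h'"
    "kT \<cdot> T (T (b M)) = T (b M) \<cdot> k'" "hT \<cdot> T2 (b M) = T (T (b M)) \<cdot> h'"
    using F.proj_conn_mor(1)[OF A im, of 0] F.proj_conn_mor(1)[OF A im, of 1]
    by (simp_all add: AT conn_mor_def)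
  then have "AC_tan2 D (M, k, h) = (T2o M, k', h')"
    unfolding AC_tan2_def AT prod.case
    by (auto intro!: into_TT2_eqI into_TTT2_eqI ty)
  then show ?thesis
    using im by (rule that)
qed

lemma AC_tan2_affine:
  assumes "affine_connection D M k h" "AC_tan2 D (M, k, h) = (M', k', h')"
  shows "affine_connection D M' k' h'"
proof -
  interpret F: tangent_fold D 2 T2o T2 "\<lambda>i M. if i = 0 then a M else b M" "\<lambda>M. p M \<cdot> a M" T2sg
    by (rule fold_T2)
  show ?thesis
    using AC_tan2_image[OF affine_pre_connection[OF assms(1)]] F.F.affine_connection_image[OF assms(1)]
      assms(2) by (metis prod.inject)
qed

text \<open>The compatibility of \<open>z\<close> and \<open>s\<close> with the comparison arrows is the compatibility of the flip
  with them, read backwards through \<open>c \<cdot> c = id\<close>.\<close>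

lemma z_tangent:
  assumes [simp]: "N \<in> Ob D"
  shows "T (z N) = c N \<cdot> z (To N)"
proof (rule act_ext)
  have "c N \<ast> z (To N) \<ast> x = c N \<ast> c N \<ast> T (z N) \<ast> x" for x
    by (simp add: structure_act(6))
  then show "T (z N) \<ast> x = (c N \<cdot> z (To N)) \<ast> x" for x
    by (simp add: structure_act(8))
qed simp_all

lemma s_tangent:
  assumes [simp]: "N \<in> Ob D"
  shows "T (s N) \<cdot> T2sg N = c N \<cdot> s (To N)"
proof (rule act_ext)
  interpret T: tangent_fold D 1 To T "\<lambda>i M. Idn D (To M)" p c
    by (rule fold_T)
  fix x
  have "T.F.sg2 N \<cdot> T2sg N = Idn D (T2o (To N))"
    by (rule T2_eqI[of "To N"]) (simp_all add: structure_act)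
  note e = act_cong[OF this, of x, simplified]
  have "c N \<ast> T (s N) \<ast> T2sg N \<ast> x = s (To N) \<ast> T.F.sg2 N \<ast> T2sg N \<ast> x"
    using T.F.sg_structure_act(2)[of N "T2sg N \<ast> x"] by simp
  then have "c N \<ast> c N \<ast> T (s N) \<ast> T2sg N \<ast> x = c N \<ast> s (To N) \<ast> x"
    by (simp add: e)
  then show "(T (s N) \<cdot> T2sg N) \<ast> x = (c N \<cdot> s (To N)) \<ast> x"
    by (simp add: structure_act)
qed simp_all

text \<open>
  Each structure map is a transformation between the strong functors \<open>id\<close>, \<open>T\<close>, \<open>T\<^sub>2\<close>, \<open>T \<circ> T\<close>, and it
  respects their comparisons by the definition of these or by an axiom of a tangent category: for \<open>l\<close> it is the axiom
  relating \<open>l\<close> and \<open>c\<close>, for \<open>c\<close> the braid relation.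
\<close>

lemma structure_conn_mor:
  assumes A: "pre_connection A" and M: "M = fst A"
  shows "conn_mor (AC_tan D A) (p M) A" "conn_mor A (z M) (AC_tan D A)"
    "conn_mor (AC_tan2 D A) (a M) (AC_tan D A)" "conn_mor (AC_tan2 D A) (b M) (AC_tan D A)"
    "conn_mor (AC_tan2 D A) (s M) (AC_tan D A)"
    "conn_mor (AC_tan D A) (l M) (AC_tan D (AC_tan D A))"
    "conn_mor (AC_tan D (AC_tan D A)) (c M) (AC_tan D (AC_tan D A))"
proof -
  obtain k h where AM: "A = (M, k, h)"
    using M by (cases A) auto
  note A = A[unfolded AM]
  have [simp]: "M \<in> Ob D" and kh: "k \<in> Hom D (To (To M)) (To M)" "h \<in> Hom D (T2o M) (To (To M))"
    using A by (auto simp: pre_connection_def)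
  interpret F: tangent_fold D 2 T2o T2 "\<lambda>i M. if i = 0 then a M else b M" "\<lambda>M. p M \<cdot> a M" T2sg
    by (rule fold_T2)
  interpret T: tangent_fold D 1 To T "\<lambda>i M. Idn D (To M)" p c
    by (rule fold_T)
  obtain kT hT where AT: "AC_tan D A = (To M, kT, hT)" and imT: "T.F.image M k h kT hT"
    unfolding AM using AC_tan_image[OF A] .
  obtain k2 h2 where A2: "AC_tan2 D A = (T2o M, k2, h2)" and im2: "F.F.image M k h k2 h2"
    unfolding AM using AC_tan2_image[OF A] .
  have preT: "pre_connection (To M, kT, hT)"
    using imT by (simp add: T.F.image_def pre_connection_def)
  obtain kTT hTT where ATT: "AC_tan D (AC_tan D A) = (To (To M), kTT, hTT)"
    and imTT: "T.F.image (To M) kT hT kTT hTT"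
    unfolding AT using AC_tan_image[OF preT] .
  note TT = comparison_comp[OF T.F.comparison_axioms T.F.comparison_axioms]
  note imTT = TT(2)[OF _ imT imTT kh, simplified]
  show "conn_mor (AC_tan D A) (p M) A"
    using T.proj_conn_mor(2)[OF A imT] by (simp add: AM AT[unfolded AM])
  show "conn_mor (AC_tan2 D A) (a M) (AC_tan D A)" "conn_mor (AC_tan2 D A) (b M) (AC_tan D A)"
    using F.proj_conn_mor(1)[OF A im2, of 0] F.proj_conn_mor(1)[OF A im2, of 1] A2 by (simp_all add: AM)
  have "kT \<cdot> T (T (z M)) = T (z M) \<cdot> k" "hT \<cdot> T2 (z M) = T (T (z M)) \<cdot> h"
    by (rule image_morphism[OF comparison_Id T.F.comparison_axioms _ kh image_Id[OF A] imT, of z];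
        use z_tangent z_nat[symmetric] in \<open>auto simp: Hom_iff\<close>)+
  then show "conn_mor A (z M) (AC_tan D A)"
    by (simp add: AM[symmetric] AT conn_mor_def[of A] Hom_iff) (simp add: AM)
  have "kT \<cdot> T (T (s M)) = T (s M) \<cdot> k2" "hT \<cdot> T2 (s M) = T (T (s M)) \<cdot> h2"
    by (rule image_morphism[OF F.F.comparison_axioms T.F.comparison_axioms _ kh im2 imT, of s];
        use s_tangent s_nat[symmetric] in \<open>auto simp: Hom_iff\<close>)+
  then show "conn_mor (AC_tan2 D A) (s M) (AC_tan D A)"
    by (simp add: AT A2 conn_mor_def Hom_iff)
  have "kTT \<cdot> T (T (l M)) = T (l M) \<cdot> kT" "hTT \<cdot> T2 (l M) = T (T (l M)) \<cdot> hT"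
    by (rule image_morphism[OF T.F.comparison_axioms TT(1) _ kh imT imTT, of l];
        use l_nat[symmetric] in \<open>auto simp: Hom_iff cTcl_act intro!: act_ext\<close>)+
  then show "conn_mor (AC_tan D A) (l M) (AC_tan D (AC_tan D A))"
    by (simp only: AT) (simp add: ATT[unfolded AT] conn_mor_def Hom_iff)
  have "kTT \<cdot> T (T (c M)) = T (c M) \<cdot> kTT" "hTT \<cdot> T2 (c M) = T (T (c M)) \<cdot> hTT"
    by (rule image_morphism[OF TT(1) TT(1) _ kh imTT imTT, of c];
        use c_nat[symmetric] in \<open>auto simp: Hom_iff braid_act intro!: act_ext\<close>)+
  then show "conn_mor (AC_tan D (AC_tan D A)) (c M) (AC_tan D (AC_tan D A))"
    by (simp add: ATT conn_mor_def Hom_iff)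
qed

end

section \<open>Functors preserving the tangent structure strictly\<close>

locale strict_functor = C: tangent_calculus C + D: tangent_calculus D
  for C :: "('a, 'f) tcat" and D :: "('b, 'g) tcat" +
  fixes F0 :: "'a \<Rightarrow> 'b" and F1 :: "'f \<Rightarrow> 'g"
  assumes F0_Ob [simp]: "M \<in> Ob C \<Longrightarrow> F0 M \<in> Ob D"
    and F1_Hom: "f \<in> Hom C A B \<Longrightarrow> F1 f \<in> Hom D (F0 A) (F0 B)"
    and F1_Idn [simp]: "M \<in> Ob C \<Longrightarrow> F1 (Idn C M) = Idn D (F0 M)"
    and F1_Comp: "f \<in> Hom C A B \<Longrightarrow> g \<in> Hom C B E \<Longrightarrow> F1 (g \<cdot>\<^bsub>C\<^esub> f) = F1 g \<cdot>\<^bsub>D\<^esub> F1 f"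
    and F0_T [simp]: "M \<in> Ob C \<Longrightarrow> F0 (Tob C M) = Tob D (F0 M)"
    and F0_T2 [simp]: "M \<in> Ob C \<Longrightarrow> F0 (T2ob C M) = T2ob D (F0 M)"
    and F1_T [simp]: "f \<in> Ar C \<Longrightarrow> F1 (Tar C f) = Tar D (F1 f)"
    and F1_structure [simp]: "M \<in> Ob C \<Longrightarrow> F1 (pr1 C M) = pr1 D (F0 M)"
      "M \<in> Ob C \<Longrightarrow> F1 (pr2 C M) = pr2 D (F0 M)" "M \<in> Ob C \<Longrightarrow> F1 (pt C M) = pt D (F0 M)"
      "M \<in> Ob C \<Longrightarrow> F1 (zt C M) = zt D (F0 M)" "M \<in> Ob C \<Longrightarrow> F1 (st C M) = st D (F0 M)"
      "M \<in> Ob C \<Longrightarrow> F1 (lt C M) = lt D (F0 M)" "M \<in> Ob C \<Longrightarrow> F1 (ct C M) = ct D (F0 M)"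
begin

lemma F1_Ar [simp]:
  "f \<in> Ar C \<Longrightarrow> F1 f \<in> Ar D" "f \<in> Ar C \<Longrightarrow> Dom D (F1 f) = F0 (Dom C f)"
  "f \<in> Ar C \<Longrightarrow> Cod D (F1 f) = F0 (Cod C f)"
  using F1_Hom[of f "Dom C f" "Cod C f"] by (auto simp: Hom_iff)

lemma F1_comp [simp]:
  "f \<in> Ar C \<Longrightarrow> g \<in> Ar C \<Longrightarrow> Cod C f = Dom C g \<Longrightarrow> F1 (g \<cdot>\<^bsub>C\<^esub> f) = F1 g \<cdot>\<^bsub>D\<^esub> F1 f"
  using F1_Comp[of f "Dom C f" "Cod C f" g "Cod C g"] by (auto simp: Hom_iff)

text \<open>Preserving the projections of a pullback strictly implies preserving pairings, so the two sides
  of every axiom of a connection are preserved.\<close>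

lemma F1_into_T2:
  assumes "M \<in> Ob C" "u \<in> Ar C" "v \<in> Ar C" "Dom C u = Dom C v" "Cod C u = Tob C M" "Cod C v = Tob C M"
    "pt C M \<cdot>\<^bsub>C\<^esub> u = pt C M \<cdot>\<^bsub>C\<^esub> v"
  shows "F1 (into_T2 C M u v) = into_T2 D (F0 M) (F1 u) (F1 v)"
  by (rule D.into_T2_eqI[symmetric])
    (use assms(1-6) C.into_T2(1-3)[OF assms] C.into_T2(4,5)[OF assms, THEN arg_cong[of _ _ F1]] in simp_all)

lemma F1_zl_lz [simp]:
  assumes [simp]: "M \<in> Ob C"
  shows "F1 (C.zl M) = D.zl (F0 M)" "F1 (C.lz M) = D.lz (F0 M)"
proof -
  have "C.T (C.a M) \<cdot>\<^bsub>C\<^esub> C.zl M = C.z (C.To M) \<cdot>\<^bsub>C\<^esub> C.a M" "C.T (C.b M) \<cdot>\<^bsub>C\<^esub> C.zl M = C.l M \<cdot>\<^bsub>C\<^esub> C.b M"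
    "C.T (C.a M) \<cdot>\<^bsub>C\<^esub> C.lz M = C.l M \<cdot>\<^bsub>C\<^esub> C.a M" "C.T (C.b M) \<cdot>\<^bsub>C\<^esub> C.lz M = C.z (C.To M) \<cdot>\<^bsub>C\<^esub> C.b M"
    by (rule C.act_ext; simp)+
  note e = this[THEN arg_cong[of _ _ F1], simplified]
  show "F1 (C.zl M) = D.zl (F0 M)"
    unfolding D.zl_def by (rule D.into_TT2_eqI[symmetric]) (use e in simp_all)
  show "F1 (C.lz M) = D.lz (F0 M)"
    unfolding D.lz_def by (rule D.into_TT2_eqI[symmetric]) (use e in simp_all)
qed

lemma F1_T2sg [simp]:
  assumes [simp]: "M \<in> Ob C"
  shows "F1 (C.T2sg M) = D.T2sg (F0 M)"
proof -
  have "C.T (C.a M) \<cdot>\<^bsub>C\<^esub> C.T2sg M = C.c M \<cdot>\<^bsub>C\<^esub> C.a (C.To M)" "C.T (C.b M) \<cdot>\<^bsub>C\<^esub> C.T2sg M = C.c M \<cdot>\<^bsub>C\<^esub> C.b (C.To M)"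
    by (rule C.act_ext; simp)+
  note e = this[THEN arg_cong[of _ _ F1], simplified]
  show ?thesis
    unfolding D.T2sg_def by (rule D.into_TT2_eqI[symmetric]) (use e in simp_all)
qed

lemma F1_xi [simp]: "M \<in> Ob C \<Longrightarrow> F1 (xi C M) = xi D (F0 M)"
  by (simp add: C.xi_alt D.xi_alt)

lemma image_vertical_axioms:
  assumes [simp]: "M \<in> Ob C" and "k \<in> Hom C (C.To (C.To M)) (C.To M)"
  shows "axV1 D (F0 M) (F1 k) = map_prod F1 F1 (axV1 C M k)"
    "axV2 D (F0 M) (F1 k) = map_prod F1 F1 (axV2 C M k)"
    "axV3 D (F0 M) (F1 k) = map_prod F1 F1 (axV3 C M k)"
    "axV4 D (F0 M) (F1 k) = map_prod F1 F1 (axV4 C M k)"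
proof -
  have [simp]: "k \<in> Ar C" "Dom C k = C.To (C.To M)" "Cod C k = C.To M"
    using assms(2) by (auto simp: Hom_iff)
  show "axV1 D (F0 M) (F1 k) = map_prod F1 F1 (axV1 C M k)"
    "axV2 D (F0 M) (F1 k) = map_prod F1 F1 (axV2 C M k)"
    "axV3 D (F0 M) (F1 k) = map_prod F1 F1 (axV3 C M k)"
    "axV4 D (F0 M) (F1 k) = map_prod F1 F1 (axV4 C M k)"
    by (simp_all add: axV1_def axV2_def axV3_def axV4_def)
qed

lemma image_horizontal_axioms:
  assumes [simp]: "M \<in> Ob C" and "h \<in> Hom C (C.T2o M) (C.To (C.To M))"
  shows "axH1 D (F0 M) (F1 h) = map_prod F1 F1 (axH1 C M h)"
    "axH2 D (F0 M) (F1 h) = map_prod F1 F1 (axH2 C M h)"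
    "axH3 D (F0 M) (F1 h) = map_prod F1 F1 (axH3 C M h)"
    "axH4 D (F0 M) (F1 h) = map_prod F1 F1 (axH4 C M h)"
proof -
  have [simp]: "h \<in> Ar C" "Dom C h = C.T2o M" "Cod C h = C.To (C.To M)"
    using assms(2) by (auto simp: Hom_iff)
  show "axH1 D (F0 M) (F1 h) = map_prod F1 F1 (axH1 C M h)"
    "axH2 D (F0 M) (F1 h) = map_prod F1 F1 (axH2 C M h)"
    "axH3 D (F0 M) (F1 h) = map_prod F1 F1 (axH3 C M h)"
    "axH4 D (F0 M) (F1 h) = map_prod F1 F1 (axH4 C M h)"
    by (simp_all add: axH1_def axH2_def axH3_def axH4_def flip: C.zl_def C.lz_def D.zl_def D.lz_def)
qed

lemma image_A1:
  assumes [simp]: "M \<in> Ob C" and "k \<in> Hom C (C.To (C.To M)) (C.To M)" "h \<in> Hom C (C.T2o M) (C.To (C.To M))"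
  shows "axA1 D (F0 M) (F1 k) (F1 h) = map_prod F1 F1 (axA1 C M k h)"
  using assms(2,3) by (simp add: axA1_def Hom_iff)

text \<open>The pairings in the last axiom are determined by their projections only if \<open>k\<close> and \<open>h\<close> lie over
  the right arrows; this is the content of the two extra hypotheses.\<close>

lemma image_A2:
  assumes [simp]: "M \<in> Ob C" and kh: "k \<in> Hom C (C.To (C.To M)) (C.To M)" "h \<in> Hom C (C.T2o M) (C.To (C.To M))"
    and V2: "fst (axV2 C M k) = snd (axV2 C M k)" and H2: "fst (axH2 C M h) = snd (axH2 C M h)"
  shows "axA2 D (F0 M) (F1 k) (F1 h) = map_prod F1 F1 (axA2 C M k h)"
proof -
  have t [simp]: "k \<in> Ar C" "Dom C k = C.To (C.To M)" "Cod C k = C.To M"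
    "h \<in> Ar C" "Dom C h = C.T2o M" "Cod C h = C.To (C.To M)"
    using kh by (auto simp: Hom_iff)
  have V2: "C.p M \<cdot>\<^bsub>C\<^esub> k = C.p M \<cdot>\<^bsub>C\<^esub> C.p (C.To M)" and H2: "C.p (C.To M) \<cdot>\<^bsub>C\<^esub> h = C.a M"
    using V2 H2 by (simp_all add: axV2_def axH2_def)
  note u = C.A2_Ar[OF assms(1) t V2 H2]
  let ?u = "into_T2 C M k (C.p (C.To M))" and ?v = "into_T2 C M (C.p (C.To M)) (C.T (C.p M))"
  have "C.p M \<cdot>\<^bsub>C\<^esub> C.p (C.To M) = C.p M \<cdot>\<^bsub>C\<^esub> C.T (C.p M)"
    by (rule C.act_ext) (simp_all add: C.p_act)
  then have 1: "F1 ?u = into_T2 D (F0 M) (F1 k) (D.p (D.To (F0 M)))"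
    "F1 ?v = into_T2 D (F0 M) (D.p (D.To (F0 M))) (D.T (D.p (F0 M)))"
    using V2 by (simp_all add: F1_into_T2)
  have "C.p (C.To M) \<cdot>\<^bsub>C\<^esub> (xi C M \<cdot>\<^bsub>C\<^esub> ?u) = C.p (C.To M) \<cdot>\<^bsub>C\<^esub> (h \<cdot>\<^bsub>C\<^esub> ?v)"
    by (rule C.act_ext) (use u C.act_cong[OF H2] in \<open>simp_all add: C.p_xi\<close>)
  then have "F1 (into_T2 C (C.To M) (xi C M \<cdot>\<^bsub>C\<^esub> ?u) (h \<cdot>\<^bsub>C\<^esub> ?v)) =
      into_T2 D (F0 (C.To M)) (F1 (xi C M \<cdot>\<^bsub>C\<^esub> ?u)) (F1 (h \<cdot>\<^bsub>C\<^esub> ?v))"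
    by (intro F1_into_T2) (use u in simp_all)
  then show ?thesis
    using u by (simp add: axA2_def 1)
qed

lemma image_affine_connection:
  assumes "affine_connection C M k h"
  shows "affine_connection D (F0 M) (F1 k) (F1 h)"
proof -
  have M: "M \<in> Ob C" and kh: "k \<in> Hom C (C.To (C.To M)) (C.To M)" "h \<in> Hom C (C.T2o M) (C.To (C.To M))"
    and ax: "fst (axV1 C M k) = snd (axV1 C M k)" "fst (axV2 C M k) = snd (axV2 C M k)"
    "fst (axV3 C M k) = snd (axV3 C M k)" "fst (axV4 C M k) = snd (axV4 C M k)"
    "fst (axH1 C M h) = snd (axH1 C M h)" "fst (axH2 C M h) = snd (axH2 C M h)"
    "fst (axH3 C M h) = snd (axH3 C M h)" "fst (axH4 C M h) = snd (axH4 C M h)"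
    "fst (axA1 C M k h) = snd (axA1 C M k h)" "fst (axA2 C M k h) = snd (axA2 C M k h)"
    using assms unfolding affine_connection_def vertical_affine_connection_def
      horizontal_affine_connection_def by auto
  show ?thesis
    unfolding affine_connection_def vertical_affine_connection_def horizontal_affine_connection_def
    using ax M kh F1_Hom[OF kh(1)] F1_Hom[OF kh(2)]
    by (simp add: image_vertical_axioms image_horizontal_axioms image_A1 image_A2)
qed

lemma image_AC_tan:
  assumes "C.pre_connection (M, k, h)" "AC_tan C (M, k, h) = (M', k', h')"
  shows "AC_tan D (F0 M, F1 k, F1 h) = (F0 M', F1 k', F1 h')"
proof -
  have [simp]: "M \<in> Ob C" "k \<in> Ar C" "Dom C k = C.To (C.To M)" "Cod C k = C.To M"
    "h \<in> Ar C" "Dom C h = C.T2o M" "Cod C h = C.To (C.To M)"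
    using assms(1) by (auto simp: C.pre_connection_def Hom_iff)
  show ?thesis
    using assms(2) by (auto simp: AC_tan_def simp flip: C.T2sg_def D.T2sg_def)
qed

end

context tangent_calculus
begin

text \<open>Enough well-typedness to know over which object the equifier of an axiom lives. For the last
  axiom only the right-hand side is a well-formed arrow without further assumptions.\<close>

lemma axiom_Ar:
  assumes [simp]: "M \<in> Ob D" and k: "k \<in> Hom D (To (To M)) (To M)" and h: "h \<in> Hom D (T2o M) (To (To M))"
  shows "fst (axV1 D M k) \<in> Ar D" "fst (axV2 D M k) \<in> Ar D" "fst (axV3 D M k) \<in> Ar D" "fst (axV4 D M k) \<in> Ar D"
    "fst (axH1 D M h) \<in> Ar D" "fst (axH2 D M h) \<in> Ar D" "fst (axH3 D M h) \<in> Ar D" "fst (axH4 D M h) \<in> Ar D"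
    "fst (axA1 D M k h) \<in> Ar D"
    "snd (axA2 D M k h) \<in> Ar D"
  using k h by (simp_all add: Hom_iff axV1_def axV2_def axV3_def axV4_def axH1_def axH2_def axH3_def
      axH4_def axA1_def axA2_def)

end

text \<open>Being an affine connection is a conjunction of equations between parallel arrows, so a
  faithful strict functor reflects it.\<close>

locale strict_faithful_functor = strict_functor +
  assumes faithful: "f \<in> Ar C \<Longrightarrow> g \<in> Ar C \<Longrightarrow> Dom C f = Dom C g \<Longrightarrow> Cod C f = Cod C g \<Longrightarrow> F1 f = F1 g \<Longrightarrow> f = g"
begin

lemma reflect_affine_connection:
  assumes pre: "C.pre_connection (M, k, h)" and AC: "affine_connection D (F0 M) (F1 k) (F1 h)"
  shows "affine_connection C M k h"
proof -
  have M [simp]: "M \<in> Ob C" and kh: "k \<in> Hom C (C.To (C.To M)) (C.To M)" "h \<in> Hom C (C.T2o M) (C.To (C.To M))"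
    and t [simp]: "k \<in> Ar C" "Dom C k = C.To (C.To M)" "Cod C k = C.To M"
    "h \<in> Ar C" "Dom C h = C.T2o M" "Cod C h = C.To (C.To M)"
    using pre by (auto simp: C.pre_connection_def Hom_iff)
  have ax: "fst (axV1 D (F0 M) (F1 k)) = snd (axV1 D (F0 M) (F1 k))"
    "fst (axV2 D (F0 M) (F1 k)) = snd (axV2 D (F0 M) (F1 k))"
    "fst (axV3 D (F0 M) (F1 k)) = snd (axV3 D (F0 M) (F1 k))"
    "fst (axV4 D (F0 M) (F1 k)) = snd (axV4 D (F0 M) (F1 k))"
    "fst (axH1 D (F0 M) (F1 h)) = snd (axH1 D (F0 M) (F1 h))"
    "fst (axH2 D (F0 M) (F1 h)) = snd (axH2 D (F0 M) (F1 h))"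
    "fst (axH3 D (F0 M) (F1 h)) = snd (axH3 D (F0 M) (F1 h))"
    "fst (axH4 D (F0 M) (F1 h)) = snd (axH4 D (F0 M) (F1 h))"
    "fst (axA1 D (F0 M) (F1 k) (F1 h)) = snd (axA1 D (F0 M) (F1 k) (F1 h))"
    "fst (axA2 D (F0 M) (F1 k) (F1 h)) = snd (axA2 D (F0 M) (F1 k) (F1 h))"
    using AC unfolding affine_connection_def vertical_affine_connection_def
      horizontal_affine_connection_def by auto
  have V: "fst (axV1 C M k) = snd (axV1 C M k)" "fst (axV2 C M k) = snd (axV2 C M k)"
    "fst (axV3 C M k) = snd (axV3 C M k)" "fst (axV4 C M k) = snd (axV4 C M k)"
    using ax(1-4) by (intro faithful; simp add: image_vertical_axioms kh; simp add: axV1_def axV2_def axV3_def axV4_def)+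
  have H: "fst (axH1 C M h) = snd (axH1 C M h)" "fst (axH2 C M h) = snd (axH2 C M h)"
    "fst (axH3 C M h) = snd (axH3 C M h)" "fst (axH4 C M h) = snd (axH4 C M h)"
    using ax(5-8) by (intro faithful; simp add: image_horizontal_axioms kh;
      simp add: axH1_def axH2_def axH3_def axH4_def flip: C.zl_def C.lz_def)+
  have A1: "fst (axA1 C M k h) = snd (axA1 C M k h)"
    using ax(9) by (intro faithful; simp add: image_A1 kh; simp add: axA1_def)
  have V2: "C.p M \<cdot>\<^bsub>C\<^esub> k = C.p M \<cdot>\<^bsub>C\<^esub> C.p (C.To M)" and H2: "C.p (C.To M) \<cdot>\<^bsub>C\<^esub> h = C.a M"
    using V(2) H(2) by (simp_all add: axV2_def axH2_def)
  have A2: "fst (axA2 C M k h) = snd (axA2 C M k h)"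
    using ax(10) C.A2_Ar[OF M t V2 H2]
    by (intro faithful; simp add: image_A2 kh V H; simp add: axA2_def)
  show ?thesis
    unfolding affine_connection_def vertical_affine_connection_def horizontal_affine_connection_def
    using V H A1 A2 kh by simp
qed

end

section \<open>Pairings of connection morphisms\<close>

context tangent_calculus
begin

lemma AC_Ar_iff:
  "(A, f, B) \<in> Ar (AC_cat D) \<longleftrightarrow> A \<in> Ob (AC_cat D) \<and> B \<in> Ob (AC_cat D) \<and> conn_mor A f B"
  by (cases A; cases B) (auto simp: AC_cat_def conn_mor_def)

lemma AC_Ob_iff: "(M, k, h) \<in> Ob (AC_cat D) \<longleftrightarrow> affine_connection D M k h"
  by (simp add: AC_cat_def)

lemma AC_Ob_tan: "A \<in> Ob (AC_cat D) \<Longrightarrow> AC_tan D A \<in> Ob (AC_cat D)" 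
  "A \<in> Ob (AC_cat D) \<Longrightarrow> AC_tan2 D A \<in> Ob (AC_cat D)"
  by (metis AC_Ob_iff AC_tan_affine AC_tan2_affine prod_cases3)+

text \<open>The pairing of two connection morphisms into \<open>T M\<close> is a connection morphism into \<open>T\<^sub>2 M\<close>, since
  \<open>T\<close> and \<open>T\<^sup>2\<close> preserve the joint monicity of the projections. So pairings of affine connections
  are computed in the ambient category.\<close>

lemma AC_pairing:
  assumes A: "A \<in> Ob (AC_cat D)" and u: "(B, u, AC_tan D A) \<in> Ar (AC_cat D)" 
    and v: "(B, v, AC_tan D A) \<in> Ar (AC_cat D)" and uv: "p (fst A) \<cdot> u = p (fst A) \<cdot> v"
  shows "pairing (AC_cat D) (T2ob (AC_cat D) A) (pr1 (AC_cat D) A) (pr2 (AC_cat D) A)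
      (B, u, AC_tan D A) (B, v, AC_tan D A) = (B, into_T2 D (fst A) u v, AC_tan2 D A)"
proof -
  obtain M k h where AM: "A = (M, k, h)" by (cases A)
  obtain N kN hN where BN: "B = (N, kN, hN)" by (cases B)
  have AC: "affine_connection D M k h" and pre: "pre_connection A"
    using A affine_pre_connection by (auto simp: AM AC_Ob_iff)
  have BO: "B \<in> Ob (AC_cat D)" and AO: "AC_tan2 D A \<in> Ob (AC_cat D)"
    using u AC_Ob_tan[OF A] by (simp_all add: AC_Ar_iff)
  then have [simp]: "N \<in> Ob D" "kN \<in> Ar D" "Dom D kN = To (To N)" "Cod D kN = To N"
      "hN \<in> Ar D" "Dom D hN = T2o N" "Cod D hN = To (To N)"
    unfolding BN AC_Ob_iff affine_connection_iff by simp_all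
  obtain kT hT where AT: "AC_tan D A = (To M, kT, hT)"
    unfolding AM using AC_tan_image[OF pre[unfolded AM]] by metis
  have preT: "pre_connection (To M, kT, hT)"
    using AC_tan_pre_connection[OF pre] by (simp add: AT)
  have T2im: "AC_tan2 D A \<in> Ob (AC_cat D)" using AO .
  obtain k2 h2 where A2: "AC_tan2 D A = (T2o M, k2, h2)"
    unfolding AM using AC_tan2_image[OF pre[unfolded AM]] by metis
  have [simp]: "M \<in> Ob D" "kT \<in> Ar D" "Dom D kT = To (To (To M))" "Cod D kT = To (To M)"
      "hT \<in> Ar D" "Dom D hT = T2o (To M)" "Cod D hT = To (To (To M))"
      "k2 \<in> Ar D" "Dom D k2 = To (To (T2o M))" "Cod D k2 = To (T2o M)"
      "h2 \<in> Ar D" "Dom D h2 = T2o (T2o M)" "Cod D h2 = To (To (T2o M))"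
    using preT AO[unfolded A2 AC_Ob_iff affine_connection_iff] AC[unfolded affine_connection_iff]
    by (simp_all add: pre_connection_def Hom_iff)
  have uu: "u \<in> Ar D" "Dom D u = N" "Cod D u = To M" "kT \<cdot> T (T u) = T u \<cdot> kN" "hT \<cdot> T2 u = T (T u) \<cdot> hN"
    and vv: "v \<in> Ar D" "Dom D v = N" "Cod D v = To M" "kT \<cdot> T (T v) = T v \<cdot> kN" "hT \<cdot> T2 v = T (T v) \<cdot> hN"
    using u v by (auto simp: AC_Ar_iff conn_mor_def BN AT Hom_iff)
  note [simp] = uu(1-3) vv(1-3)
  let ?w = "into_T2 D M u v"
  have ab: "kT \<cdot> T (T (a M)) = T (a M) \<cdot> k2" "hT \<cdot> T2 (a M) = T (T (a M)) \<cdot> h2"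
    "kT \<cdot> T (T (b M)) = T (b M) \<cdot> k2" "hT \<cdot> T2 (b M) = T (T (b M)) \<cdot> h2"
    using structure_conn_mor(3,4)[OF pre, of M] by (simp_all add: conn_mor_def AT A2 AM[symmetric]) (simp_all add: AM)
  note w = into_T2[OF _ _ _ _ _ _ uv, simplified AM fst_conv, simplified]
  note [simp] = w(1-3)
  have Tw: "T (a M) \<cdot> T ?w = T u" "T (b M) \<cdot> T ?w = T v" 
    "T (T (a M)) \<cdot> T (T ?w) = T (T u)" "T (T (b M)) \<cdot> T (T ?w) = T (T v)"
    "T2 (a M) \<cdot> T2 ?w = T2 u" "T2 (b M) \<cdot> T2 ?w = T2 v"
    by (simp_all add: w flip: T_comp T2_comp)
  have e1: "k2 \<cdot> T (T ?w) = T ?w \<cdot> kN"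
    by (rule TT2_eqI[of M]; use Tw[THEN act_cong] ab[THEN act_cong, symmetric] uu(4)[THEN act_cong] vv(4)[THEN act_cong] in simp)
  have e2: "h2 \<cdot> T2 ?w = T (T ?w) \<cdot> hN"
    by (rule TTT2_eqI[of M]; use Tw[THEN act_cong] ab[THEN act_cong, symmetric] uu(5)[THEN act_cong] vv(5)[THEN act_cong] in simp)
  have W: "(B, ?w, AC_tan2 D A) \<in> Ar (AC_cat D)"
    using BO AO e1 e2 by (simp add: AC_Ar_iff conn_mor_def A2 BN Hom_iff)
  have eq: "X = B \<and> Y = AC_tan2 D A \<and> g = ?w"
    if "(X, g, Y) \<in> Hom (AC_cat D) B (AC_tan2 D A)" "a M \<cdot> g = u" "b M \<cdot> g = v" for X g Y
  proof -
    have XY: "X = B" "Y = AC_tan2 D A" "conn_mor B g (AC_tan2 D A)"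
      using that(1) by (auto simp: Hom_iff AC_Ar_iff) (simp_all add: AC_cat_def)
    then have "?w = g"
      by (intro into_T2_eqI) (use that in \<open>simp_all add: conn_mor_def BN A2 Hom_iff\<close>)
    then show ?thesis using XY by simp
  qed
  show ?thesis
    unfolding pairing_def AM fst_conv
  proof (rule the_equality)
    show "(B, ?w, AC_tan2 D (M, k, h)) \<in> Hom (AC_cat D) (Dom (AC_cat D) (B, u, AC_tan D (M, k, h))) (T2ob (AC_cat D) (M, k, h)) \<and>
      pr1 (AC_cat D) (M, k, h) \<cdot>\<^bsub>AC_cat D\<^esub> (B, ?w, AC_tan2 D (M, k, h)) = (B, u, AC_tan D (M, k, h)) \<and>
      pr2 (AC_cat D) (M, k, h) \<cdot>\<^bsub>AC_cat D\<^esub> (B, ?w, AC_tan2 D (M, k, h)) = (B, v, AC_tan D (M, k, h))"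
      using W w by (simp add: Hom_iff AM) (simp add: AC_cat_def)
  next
    fix W
    assume "W \<in> Hom (AC_cat D) (Dom (AC_cat D) (B, u, AC_tan D (M, k, h))) (T2ob (AC_cat D) (M, k, h)) \<and>
      pr1 (AC_cat D) (M, k, h) \<cdot>\<^bsub>AC_cat D\<^esub> W = (B, u, AC_tan D (M, k, h)) \<and>
      pr2 (AC_cat D) (M, k, h) \<cdot>\<^bsub>AC_cat D\<^esub> W = (B, v, AC_tan D (M, k, h))"
    moreover obtain X g Y where "W = (X, g, Y)" by (cases W)
    ultimately show "W = (B, ?w, AC_tan2 D (M, k, h))"
      using eq[of X g Y] by (auto simp: AM AC_cat_def)
  qed
qed

end

section \<open>Whiskering in a 2-category\<close>

lemma hom1_iff: "F \<in> hom1 K A B \<longleftrightarrow> F \<in> Cell1 K \<and> src K F = A \<and> tgt K F = B"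
  by (simp add: hom1_def)

lemma hom2_iff: "\<phi> \<in> hom2 K F G \<longleftrightarrow> \<phi> \<in> Cell2 K \<and> dom2 K \<phi> = F \<and> cod2 K \<phi> = G"
  by (simp add: hom2_def)

lemma hom_cat_simps [simp]:
  "Ob (hom_cat K A B) = hom1 K A B" "Dom (hom_cat K A B) = dom2 K" "Cod (hom_cat K A B) = cod2 K"
  "Idn (hom_cat K A B) = id2 K" "Comp (hom_cat K A B) = vcomp K"
  "\<phi> \<in> Ar (hom_cat K A B) \<longleftrightarrow> \<phi> \<in> Cell2 K \<and> dom2 K \<phi> \<in> hom1 K A B \<and> cod2 K \<phi> \<in> hom1 K A B"
  by (simp_all add: hom_cat_def)

context two_category
begin

lemma src_tgt [simp]: "F \<in> Cell1 K \<Longrightarrow> src K F \<in> Cell0 K" "F \<in> Cell1 K \<Longrightarrow> tgt K F \<in> Cell0 K"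
  by (simp_all add: src_Cell0 tgt_Cell0)

lemma hom1_Cell0: "F \<in> hom1 K A B \<Longrightarrow> A \<in> Cell0 K" "F \<in> hom1 K A B \<Longrightarrow> B \<in> Cell0 K"
  by (auto simp: hom1_iff)

lemma id1_simps [simp]:
  assumes "A \<in> Cell0 K"
  shows "id1 K A \<in> Cell1 K" "src K (id1 K A) = A" "tgt K (id1 K A) = A"
  using id1_hom1[OF assms] by (simp_all add: hom1_iff)

lemma comp1_simps [simp]:
  assumes "F \<in> Cell1 K" "G \<in> Cell1 K" "tgt K F = src K G"
  shows "G \<odot> F \<in> Cell1 K" "src K (G \<odot> F) = src K F" "tgt K (G \<odot> F) = tgt K G"
  using comp1_hom1[of F "src K F" "tgt K F" G "tgt K G"] assms by (auto simp: hom1_iff)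

lemma comp1_id1 [simp]:
  "F \<in> Cell1 K \<Longrightarrow> src K F = A \<Longrightarrow> F \<odot> id1 K A = F"
  "F \<in> Cell1 K \<Longrightarrow> tgt K F = A \<Longrightarrow> id1 K A \<odot> F = F"
  using id1_right[of F A "tgt K F"] id1_left[of F "src K F" A] by (auto simp: hom1_iff)

lemma comp1_assoc' [simp]:
  "F \<in> Cell1 K \<Longrightarrow> G \<in> Cell1 K \<Longrightarrow> H \<in> Cell1 K \<Longrightarrow> tgt K F = src K G \<Longrightarrow> tgt K G = src K H \<Longrightarrow>
    (H \<odot> G) \<odot> F = H \<odot> G \<odot> F"
  using comp1_assoc[of F "src K F" "src K G" G "src K H" H "tgt K H"] by (auto simp: hom1_iff)

lemma dom_cod2 [simp]:
  assumes "\<phi> \<in> Cell2 K"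
  shows "dom2 K \<phi> \<in> Cell1 K" "cod2 K \<phi> \<in> Cell1 K"
    "src K (cod2 K \<phi>) = src K (dom2 K \<phi>)" "tgt K (cod2 K \<phi>) = tgt K (dom2 K \<phi>)"
  using dom2_Cell1[OF assms] cod2_parallel[OF assms] by (simp_all add: hom1_iff)

lemma hom_category: "F \<in> Cell1 K \<Longrightarrow> category (hom_cat K (src K F) (tgt K F))"
  by (simp add: category_hom_cat)

lemma id2_simps [simp]:
  assumes "F \<in> Cell1 K"
  shows "id2 K F \<in> Cell2 K" "dom2 K (id2 K F) = F" "cod2 K (id2 K F) = F"
  using category.Idn_Hom[OF hom_category[OF assms], of F] assms by (auto simp: Hom_iff hom1_iff)

lemma vcomp_simps [simp]:
  assumes "\<phi> \<in> Cell2 K" "\<psi> \<in> Cell2 K" "cod2 K \<phi> = dom2 K \<psi>"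
  shows "\<psi> \<bullet> \<phi> \<in> Cell2 K" "dom2 K (\<psi> \<bullet> \<phi>) = dom2 K \<phi>" "cod2 K (\<psi> \<bullet> \<phi>) = cod2 K \<psi>"
proof -
  have "src K (dom2 K \<psi>) = src K (dom2 K \<phi>)" "tgt K (dom2 K \<psi>) = tgt K (dom2 K \<phi>)"
    using assms dom_cod2[of \<phi>] by auto
  then show "\<psi> \<bullet> \<phi> \<in> Cell2 K" "dom2 K (\<psi> \<bullet> \<phi>) = dom2 K \<phi>" "cod2 K (\<psi> \<bullet> \<phi>) = cod2 K \<psi>"
    using category.Comp_Hom[OF hom_category[of "dom2 K \<phi>"], of \<phi> "dom2 K \<phi>" "cod2 K \<phi>" \<psi> "cod2 K \<psi>"] assms
    by (auto simp: Hom_iff hom1_iff)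
qed

lemma vcomp_id2 [simp]:
  "\<phi> \<in> Cell2 K \<Longrightarrow> dom2 K \<phi> = F \<Longrightarrow> \<phi> \<bullet> id2 K F = \<phi>"
  "\<phi> \<in> Cell2 K \<Longrightarrow> cod2 K \<phi> = F \<Longrightarrow> id2 K F \<bullet> \<phi> = \<phi>"
  using category.Idn_right[OF hom_category[of "dom2 K \<phi>"], of \<phi> "dom2 K \<phi>" "cod2 K \<phi>"]
    category.Idn_left[OF hom_category[of "dom2 K \<phi>"], of \<phi> "dom2 K \<phi>" "cod2 K \<phi>"]
  by (auto simp: Hom_iff hom1_iff)

lemma vcomp_assoc [simp]:
  assumes "\<phi> \<in> Cell2 K" "\<psi> \<in> Cell2 K" "\<chi> \<in> Cell2 K" "cod2 K \<phi> = dom2 K \<psi>" "cod2 K \<psi> = dom2 K \<chi>"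
  shows "(\<chi> \<bullet> \<psi>) \<bullet> \<phi> = \<chi> \<bullet> \<psi> \<bullet> \<phi>"
proof -
  have "src K (dom2 K \<psi>) = src K (dom2 K \<phi>)" "tgt K (dom2 K \<psi>) = tgt K (dom2 K \<phi>)"
    "src K (dom2 K \<chi>) = src K (dom2 K \<psi>)" "tgt K (dom2 K \<chi>) = tgt K (dom2 K \<psi>)"
    using assms dom_cod2[of \<phi>] dom_cod2[of \<psi>] by auto
  then show ?thesis
    using category.Comp_assoc[OF hom_category[of "dom2 K \<phi>"], of \<phi> "dom2 K \<phi>" "cod2 K \<phi>" \<psi> "cod2 K \<psi>" \<chi> "cod2 K \<chi>"]
      assms by (auto simp: Hom_iff hom1_iff)
qed

lemma hcomp_simps:
  assumes "\<phi> \<in> Cell2 K" "\<psi> \<in> Cell2 K" "tgt K (dom2 K \<phi>) = src K (dom2 K \<psi>)"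
  shows "\<psi> \<star> \<phi> \<in> Cell2 K" "dom2 K (\<psi> \<star> \<phi>) = dom2 K \<psi> \<odot> dom2 K \<phi>" "cod2 K (\<psi> \<star> \<phi>) = cod2 K \<psi> \<odot> cod2 K \<phi>"
  using hcomp_hom2[of "dom2 K \<phi>" "src K (dom2 K \<phi>)" "tgt K (dom2 K \<phi>)" "dom2 K \<psi>" "tgt K (dom2 K \<psi>)"
      \<phi> "cod2 K \<phi>" \<psi> "cod2 K \<psi>"] assms by (auto simp: hom1_iff hom2_iff)

text \<open>
  Whiskering is rewritten to a normal form: composites of 1-morphisms are nested to the right,
  whiskerings on the left are pulled outwards and iterated, whiskerings on the right are collected
  into a single one. Together with right-nested vertical composites, only interchange is left to
  be applied by hand.
\<close>

lemma lwhisk_simps [simp]: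
  assumes "F \<in> Cell1 K" "\<phi> \<in> Cell2 K" "tgt K (dom2 K \<phi>) = src K F"
  shows "F \<rhd> \<phi> \<in> Cell2 K" "dom2 K (F \<rhd> \<phi>) = F \<odot> dom2 K \<phi>" "cod2 K (F \<rhd> \<phi>) = F \<odot> cod2 K \<phi>"
  using hcomp_simps[of \<phi> "id2 K F"] assms by (simp_all add: lwhisk_def)

lemma rwhisk_simps [simp]:
  assumes "F \<in> Cell1 K" "\<phi> \<in> Cell2 K" "src K (dom2 K \<phi>) = tgt K F"
  shows "\<phi> \<lhd> F \<in> Cell2 K" "dom2 K (\<phi> \<lhd> F) = dom2 K \<phi> \<odot> F" "cod2 K (\<phi> \<lhd> F) = cod2 K \<phi> \<odot> F"
  using hcomp_simps[of "id2 K F" \<phi>] assms by (simp_all add: rwhisk_def)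

lemma interchange':
  assumes "\<phi> \<in> Cell2 K" "\<phi>' \<in> Cell2 K" "cod2 K \<phi> = dom2 K \<phi>'" "\<psi> \<in> Cell2 K" "\<psi>' \<in> Cell2 K"
    "cod2 K \<psi> = dom2 K \<psi>'" "tgt K (dom2 K \<phi>) = src K (dom2 K \<psi>)"
  shows "(\<psi>' \<bullet> \<psi>) \<star> (\<phi>' \<bullet> \<phi>) = (\<psi>' \<star> \<phi>') \<bullet> (\<psi> \<star> \<phi>)"
  by (rule interchange[of "dom2 K \<phi>" "src K (dom2 K \<phi>)" "src K (dom2 K \<psi>)" "dom2 K \<psi>" "tgt K (dom2 K \<psi>)"
      _ "cod2 K \<phi>" _ "cod2 K \<phi>'" _ "cod2 K \<psi>" _ "cod2 K \<psi>'"]) (use assms in \<open>simp_all add: hom1_iff hom2_iff\<close>)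

lemma whisk_vcomp [simp]:
  assumes "F \<in> Cell1 K" "\<phi> \<in> Cell2 K" "\<psi> \<in> Cell2 K" "cod2 K \<phi> = dom2 K \<psi>"
  shows "tgt K (dom2 K \<phi>) = src K F \<Longrightarrow> F \<rhd> (\<psi> \<bullet> \<phi>) = (F \<rhd> \<psi>) \<bullet> (F \<rhd> \<phi>)"
    "src K (dom2 K \<phi>) = tgt K F \<Longrightarrow> (\<psi> \<bullet> \<phi>) \<lhd> F = (\<psi> \<lhd> F) \<bullet> (\<phi> \<lhd> F)"
  using interchange'[of \<phi> \<psi> "id2 K F" "id2 K F"] interchange'[of "id2 K F" "id2 K F" \<phi> \<psi>] assms
  by (simp_all add: lwhisk_def rwhisk_def)

lemma whisk_id2 [simp]:
  assumes "F \<in> Cell1 K" "G \<in> Cell1 K" "tgt K G = src K F"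
  shows "F \<rhd> id2 K G = id2 K (F \<odot> G)" "id2 K F \<lhd> G = id2 K (F \<odot> G)"
  using hcomp_id2[of G "src K G" "src K F" F "tgt K F"] assms
  by (simp_all add: lwhisk_def rwhisk_def hom1_iff)

lemma whisk_id1 [simp]:
  "\<phi> \<in> Cell2 K \<Longrightarrow> tgt K (dom2 K \<phi>) = A \<Longrightarrow> id1 K A \<rhd> \<phi> = \<phi>"
  "\<phi> \<in> Cell2 K \<Longrightarrow> src K (dom2 K \<phi>) = A \<Longrightarrow> \<phi> \<lhd> id1 K A = \<phi>"
  using hcomp_id1_left[of "dom2 K \<phi>" "src K (dom2 K \<phi>)" A \<phi> "cod2 K \<phi>"]
    hcomp_id1_right[of "dom2 K \<phi>" A "tgt K (dom2 K \<phi>)" \<phi> "cod2 K \<phi>"]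
  by (auto simp: lwhisk_def rwhisk_def hom1_iff hom2_iff)

lemma hcomp_assoc':
  assumes "\<phi> \<in> Cell2 K" "\<psi> \<in> Cell2 K" "\<chi> \<in> Cell2 K" "tgt K (dom2 K \<phi>) = src K (dom2 K \<psi>)"
    "tgt K (dom2 K \<psi>) = src K (dom2 K \<chi>)"
  shows "(\<chi> \<star> \<psi>) \<star> \<phi> = \<chi> \<star> (\<psi> \<star> \<phi>)"
  by (rule hcomp_assoc[of "dom2 K \<phi>" "src K (dom2 K \<phi>)" "src K (dom2 K \<psi>)" "dom2 K \<psi>" "src K (dom2 K \<chi>)"
     "dom2 K \<chi>" "tgt K (dom2 K \<chi>)" _ "cod2 K \<phi>" _ "cod2 K \<psi>" _ "cod2 K \<chi>"])
    (use assms in \<open>simp_all add: hom1_iff hom2_iff\<close>)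

lemma whisk_comp1 [simp]:
  assumes "F \<in> Cell1 K" "G \<in> Cell1 K" "\<phi> \<in> Cell2 K"
  shows "tgt K (dom2 K \<phi>) = src K G \<Longrightarrow> tgt K G = src K F \<Longrightarrow> (F \<odot> G) \<rhd> \<phi> = F \<rhd> (G \<rhd> \<phi>)"
    "src K (dom2 K \<phi>) = tgt K F \<Longrightarrow> tgt K G = src K F \<Longrightarrow> \<phi> \<lhd> F \<lhd> G = \<phi> \<lhd> (F \<odot> G)"
    "tgt K (dom2 K \<phi>) = src K F \<Longrightarrow> src K (dom2 K \<phi>) = tgt K G \<Longrightarrow> (F \<rhd> \<phi>) \<lhd> G = F \<rhd> (\<phi> \<lhd> G)"
proof -
  show "tgt K (dom2 K \<phi>) = src K G \<Longrightarrow> tgt K G = src K F \<Longrightarrow> (F \<odot> G) \<rhd> \<phi> = F \<rhd> (G \<rhd> \<phi>)"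
    using hcomp_assoc'[of \<phi> "id2 K G" "id2 K F"] hcomp_id2[of G "src K G" "src K F" F "tgt K F"] assms
    by (simp add: lwhisk_def hom1_iff)
  show "src K (dom2 K \<phi>) = tgt K F \<Longrightarrow> tgt K G = src K F \<Longrightarrow> \<phi> \<lhd> F \<lhd> G = \<phi> \<lhd> (F \<odot> G)"
    using hcomp_assoc'[of "id2 K G" "id2 K F" \<phi>] hcomp_id2[of G "src K G" "src K F" F "tgt K F"] assms
    by (simp add: rwhisk_def hom1_iff)
  show "tgt K (dom2 K \<phi>) = src K F \<Longrightarrow> src K (dom2 K \<phi>) = tgt K G \<Longrightarrow> (F \<rhd> \<phi>) \<lhd> G = F \<rhd> (\<phi> \<lhd> G)"
    using hcomp_assoc'[of "id2 K G" \<phi> "id2 K F"] assms by (simp add: lwhisk_def rwhisk_def)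
qed

lemma whisk_exchange:
  assumes "\<phi> \<in> Cell2 K" "\<psi> \<in> Cell2 K" "tgt K (dom2 K \<psi>) = src K (dom2 K \<phi>)"
    "dom2 K \<phi> = F" "cod2 K \<phi> = F'" "dom2 K \<psi> = G" "cod2 K \<psi> = G'"
  shows "(\<phi> \<lhd> G') \<bullet> (F \<rhd> \<psi>) = (F' \<rhd> \<psi>) \<bullet> (\<phi> \<lhd> G)"
  using interchange'[of \<psi> "id2 K G'" "id2 K F" \<phi>] interchange'[of "id2 K G" \<psi> \<phi> "id2 K F'"] assms
  by (auto simp: lwhisk_def rwhisk_def)

end

section \<open>The hom tangent categories of a tangentad\<close>

lemma hom_tcat_simps [simp]:
  "Ob (hom_tcat K Y X) = hom1 K Y (base X)" "Dom (hom_tcat K Y X) = dom2 K" "Cod (hom_tcat K Y X) = cod2 K"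
  "Idn (hom_tcat K Y X) = id2 K" "Comp (hom_tcat K Y X) = vcomp K"
  "\<phi> \<in> Ar (hom_tcat K Y X) \<longleftrightarrow>
     \<phi> \<in> Cell2 K \<and> dom2 K \<phi> \<in> hom1 K Y (base X) \<and> cod2 K \<phi> \<in> hom1 K Y (base X)"
  "Tob (hom_tcat K Y X) F = tan X \<odot>\<^bsub>K\<^esub> F" "Tar (hom_tcat K Y X) \<phi> = tan X \<rhd>\<^bsub>K\<^esub> \<phi>"
  "T2ob (hom_tcat K Y X) F = tan2 X \<odot>\<^bsub>K\<^esub> F"
  "pr1 (hom_tcat K Y X) F = prA X \<lhd>\<^bsub>K\<^esub> F" "pr2 (hom_tcat K Y X) F = prB X \<lhd>\<^bsub>K\<^esub> F"
  "pt (hom_tcat K Y X) F = prj X \<lhd>\<^bsub>K\<^esub> F" "zt (hom_tcat K Y X) F = zer X \<lhd>\<^bsub>K\<^esub> F"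
  "st (hom_tcat K Y X) F = pls X \<lhd>\<^bsub>K\<^esub> F" "lt (hom_tcat K Y X) F = lft X \<lhd>\<^bsub>K\<^esub> F"
  "ct (hom_tcat K Y X) F = flp X \<lhd>\<^bsub>K\<^esub> F"
  by (simp_all add: hom_tcat_def)

lemma hom_tcat_hom_cat:
  "pairing (hom_tcat K Y X) = pairing (hom_cat K Y (base X))"
  "is_pullback (hom_tcat K Y X) = is_pullback (hom_cat K Y (base X))"
  "is_fold_pullback (hom_tcat K Y X) = is_fold_pullback (hom_cat K Y (base X))"
  by (intro ext; simp add: pairing_def is_pullback_def is_fold_pullback_def Hom_iff)+

lemma is_fold_pullback_cong:
  assumes "\<And>i. i < n \<Longrightarrow> r i = r' i"
  shows "is_fold_pullback C p n P r q \<longleftrightarrow> is_fold_pullback C p n P r' q"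
  unfolding is_fold_pullback_def using assms by simp

lemma (in category) fold2_pullback:
  assumes "is_fold_pullback C f 2 P (\<lambda>i. if i = 0 then u else v) q"
  shows "is_pullback C f f P u v"
proof -
  note ar = fold_Ar[OF assms]
  note ar' = ar(5-8)[of 0, simplified] ar(5-8)[of 1, simplified]
  show ?thesis
    unfolding is_pullback_def
  proof (intro conjI allI impI)
    fix Q x y
    assume H: "x \<in> Hom C Q (Dom C f) \<and> y \<in> Hom C Q (Dom C f) \<and> f \<cdot> x = f \<cdot> y"
    have "\<exists>!w. w \<in> Hom C Q P \<and> q \<cdot> w = f \<cdot> x \<and> (\<forall>i<2::nat. (if i = 0 then u else v) \<cdot> w = (if i = 0 then x else y))"
      by (rule fold_univ[OF assms]) (use H ar in \<open>auto simp: Hom_iff\<close>)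
    moreover have "(w \<in> Hom C Q P \<and> q \<cdot> w = f \<cdot> x \<and> (\<forall>i<2::nat. (if i = 0 then u else v) \<cdot> w = (if i = 0 then x else y)))
      \<longleftrightarrow> (w \<in> Hom C Q P \<and> u \<cdot> w = x \<and> v \<cdot> w = y)" for w
    proof -
      have "q \<cdot> w = f \<cdot> (u \<cdot> w)" if "w \<in> Hom C Q P"
        using that ar ar' comp_assoc[of w u f] by (auto simp: Hom_iff)
      then show ?thesis
        by (auto simp: numeral_2_eq_2 less_Suc_eq)
    qed
    ultimately show "\<exists>!w. w \<in> Hom C Q P \<and> u \<cdot> w = x \<and> v \<cdot> w = y"
      by simp
  qed (use ar ar' in \<open>simp_all add: Hom_iff\<close>)
qed

locale tangentad = two_category K for K :: "('o, 'm, 'c) two_cat" (structure) +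
  fixes X :: "('o, 'm, 'c) tangentad"
  assumes is_tangentad: "is_tangentad K X"
begin

lemma tangentad_Cell [simp]:
  "base X \<in> Cell0 K" "tan X \<in> Cell1 K" "src K (tan X) = base X" "tgt K (tan X) = base X"
  "tan2 X \<in> Cell1 K" "src K (tan2 X) = base X" "tgt K (tan2 X) = base X"
  "prA X \<in> Cell2 K" "dom2 K (prA X) = tan2 X" "cod2 K (prA X) = tan X"
  "prB X \<in> Cell2 K" "dom2 K (prB X) = tan2 X" "cod2 K (prB X) = tan X"
  "prj X \<in> Cell2 K" "dom2 K (prj X) = tan X" "cod2 K (prj X) = id1 K (base X)"
  "zer X \<in> Cell2 K" "dom2 K (zer X) = id1 K (base X)" "cod2 K (zer X) = tan X"
  "pls X \<in> Cell2 K" "dom2 K (pls X) = tan2 X" "cod2 K (pls X) = tan X"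
  "lft X \<in> Cell2 K" "dom2 K (lft X) = tan X" "cod2 K (lft X) = tan X \<odot> tan X"
  "flp X \<in> Cell2 K" "dom2 K (flp X) = tan X \<odot> tan X" "cod2 K (flp X) = tan X \<odot> tan X"
  using is_tangentad unfolding is_tangentad_def Let_def hom1_iff hom2_iff by blast+

abbreviation "iT2 \<equiv> pairing (hom_cat K (base X) (base X)) (tan2 X) (prA X) (prB X)"
abbreviation "iT2T \<equiv> pairing (hom_cat K (base X) (base X)) (tan2 X \<odot> tan X) (prA X \<lhd> tan X) (prB X \<lhd> tan X)"
abbreviation "iTT2 \<equiv> pairing (hom_cat K (base X) (base X)) (tan X \<odot> tan2 X) (tan X \<rhd> prA X) (tan X \<rhd> prB X)"

lemma tangentad_axioms:
  "is_tan_fold K X 2 (tan2 X) (\<lambda>i. if i = 0 then prA X else prB X) (prj X \<bullet> prA X)"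
  "\<exists>P r q. is_tan_fold K X n P r q"
  "prj X \<bullet> zer X = id2 K (id1 K (base X))"
  "prj X \<bullet> pls X = prj X \<bullet> prA X"
  "pls X \<bullet> iT2 (zer X \<bullet> prj X) (id2 K (tan X)) = id2 K (tan X)"
  "pls X \<bullet> iT2 (prB X) (prA X) = pls X"
  "is_tan_fold K X 3 P r q \<Longrightarrow> pls X \<bullet> iT2 (pls X \<bullet> iT2 (r 0) (r 1)) (r 2) = pls X \<bullet> iT2 (r 0) (pls X \<bullet> iT2 (r 1) (r 2))"
  "(tan X \<rhd> prj X) \<bullet> lft X = zer X \<bullet> prj X"
  "lft X \<bullet> zer X = (tan X \<rhd> zer X) \<bullet> zer X"
  "lft X \<bullet> pls X = (tan X \<rhd> pls X) \<bullet> iTT2 (lft X \<bullet> prA X) (lft X \<bullet> prB X)"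
  "(prj X \<lhd> tan X) \<bullet> flp X = tan X \<rhd> prj X"
  "flp X \<bullet> (tan X \<rhd> zer X) = zer X \<lhd> tan X"
  "flp X \<bullet> (tan X \<rhd> pls X) = (pls X \<lhd> tan X) \<bullet> iT2T (flp X \<bullet> (tan X \<rhd> prA X)) (flp X \<bullet> (tan X \<rhd> prB X))"
  "(tan X \<rhd> lft X) \<bullet> lft X = (lft X \<lhd> tan X) \<bullet> lft X"
  "flp X \<bullet> lft X = lft X"
  "(flp X \<lhd> tan X) \<bullet> (tan X \<rhd> flp X) \<bullet> (lft X \<lhd> tan X) = (tan X \<rhd> lft X) \<bullet> flp X"
  "flp X \<bullet> flp X = id2 K (tan X \<odot> tan X)"
  "(tan X \<rhd> flp X) \<bullet> (flp X \<lhd> tan X) \<bullet> (tan X \<rhd> flp X) = (flp X \<lhd> tan X) \<bullet> (tan X \<rhd> flp X) \<bullet> (flp X \<lhd> tan X)"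
  "f \<in> hom1 K Y (base X) \<Longrightarrow>
     is_pullback (hom_cat K Y (base X)) (zer X \<lhd> f) ((tan X \<rhd> prj X) \<lhd> f) (tan2 X \<odot> f)
       ((prj X \<bullet> prA X) \<lhd> f)
       (((tan X \<rhd> pls X) \<bullet> iTT2 ((zer X \<lhd> tan X) \<bullet> prA X) (lft X \<bullet> prB X)) \<lhd> f)"
  using is_tangentad unfolding is_tangentad_def Let_def by blast+

lemma category_hom_tcat:
  assumes "Y \<in> Cell0 K"
  shows "category (hom_tcat K Y X)"
  by (unfold_locales) (auto simp: Hom_iff hom1_iff)

text \<open>The 1-morphism \<open>T\<^sup>m\<close> acts on a hom-category as the \<open>m\<close>-fold iterate of its tangent functor.\<close>

lemma tan_pow_whisk:
  assumes [simp]: "F \<in> Cell1 K" "tgt K F = base X"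
  shows "tan_pow K X m \<in> Cell1 K" "src K (tan_pow K X m) = base X" "tgt K (tan_pow K X m) = base X"
    "tan_pow K X m \<odot> F = (Tob (hom_tcat K Y X) ^^ m) F"
    "\<phi> \<in> Cell2 K \<Longrightarrow> src K (dom2 K \<phi>) = base X \<Longrightarrow> tgt K (dom2 K \<phi>) = base X \<Longrightarrow>
      (tan_pow K X m \<rhd> \<phi>) \<lhd> F = (Tar (hom_tcat K Y X) ^^ m) (\<phi> \<lhd> F)"
proof -
  have [simp]: "tan_pow K X m \<in> Cell1 K \<and> src K (tan_pow K X m) = base X \<and> tgt K (tan_pow K X m) = base X"
    for m by (induction m) (simp_all add: tan_pow_def)
  have [simp]: "tan_pow K X (Suc m) = tan X \<odot> tan_pow K X m" "tan_pow K X 0 = id1 K (base X)" for m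
    by (simp_all add: tan_pow_def)
  show "tan_pow K X m \<in> Cell1 K" "src K (tan_pow K X m) = base X" "tgt K (tan_pow K X m) = base X"
    by simp_all
  show "tan_pow K X m \<odot> F = (Tob (hom_tcat K Y X) ^^ m) F"
    by (induction m) simp_all
  show "(tan_pow K X m \<rhd> \<phi>) \<lhd> F = (Tar (hom_tcat K Y X) ^^ m) (\<phi> \<lhd> F)"
    if [simp]: "\<phi> \<in> Cell2 K" "src K (dom2 K \<phi>) = base X" "tgt K (dom2 K \<phi>) = base X"
    by (induction m) simp_all
qed

text \<open>Since the limits in a tangentad are pointwise, they are limits in every hom-category.\<close>

lemma tan_fold_hom:
  assumes fold: "is_tan_fold K X n P r q" and F: "F \<in> hom1 K Y (base X)"
  shows "is_fold_pullback (hom_tcat K Y X) ((Tar (hom_tcat K Y X) ^^ m) (prj X \<lhd> F)) n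
      ((Tob (hom_tcat K Y X) ^^ m) (P \<odot> F)) (\<lambda>i. (Tar (hom_tcat K Y X) ^^ m) (r i \<lhd> F))
      ((Tar (hom_tcat K Y X) ^^ m) (q \<lhd> F))"
proof -
  have [simp]: "F \<in> Cell1 K" "src K F = Y" "tgt K F = base X"
    "P \<in> Cell1 K" "src K P = base X" "tgt K P = base X"
    "q \<in> Cell2 K" "dom2 K q = P"
    using fold F by (auto simp: is_tan_fold_def hom1_iff hom2_iff)
  have r: "r i \<in> Cell2 K" "dom2 K (r i) = P" if "i < n" for i
    using fold F that by (auto simp: is_tan_fold_def hom1_iff hom2_iff)
  have f: "is_fold_pullback (hom_tcat K Y X) ((tan_pow K X m \<rhd> prj X) \<lhd> F) n
      (tan_pow K X m \<odot> P \<odot> F) (\<lambda>i. (tan_pow K X m \<rhd> r i) \<lhd> F) ((tan_pow K X m \<rhd> q) \<lhd> F)"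
    using fold F unfolding is_tan_fold_def hom_tcat_hom_cat by blast
  have "(tan_pow K X m \<rhd> r i) \<lhd> F = (Tar (hom_tcat K Y X) ^^ m) (r i \<lhd> F)" if "i < n" for i
    by (rule tan_pow_whisk(5)) (use r[OF that] in simp_all)
  then have "is_fold_pullback (hom_tcat K Y X) ((tan_pow K X m \<rhd> prj X) \<lhd> F) n
      (tan_pow K X m \<odot> P \<odot> F) (\<lambda>i. (Tar (hom_tcat K Y X) ^^ m) (r i \<lhd> F)) ((tan_pow K X m \<rhd> q) \<lhd> F)"
    by (rule iffD1[OF is_fold_pullback_cong f])
  then show ?thesis
    using tan_pow_whisk(4)[of "P \<odot> F" m Y] by (simp add: tan_pow_whisk(5)[of F _ m Y])
qed

lemma T2_hom_pullback:
  assumes "F \<in> hom1 K Y (base X)"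
  shows "is_pullback (hom_tcat K Y X) ((Tar (hom_tcat K Y X) ^^ m) (prj X \<lhd> F)) ((Tar (hom_tcat K Y X) ^^ m) (prj X \<lhd> F))
      ((Tob (hom_tcat K Y X) ^^ m) (tan2 X \<odot> F)) ((Tar (hom_tcat K Y X) ^^ m) (prA X \<lhd> F))
      ((Tar (hom_tcat K Y X) ^^ m) (prB X \<lhd> F))"
proof -
  interpret category "hom_tcat K Y X" using assms by (simp add: category_hom_tcat hom1_Cell0)
  have e: "(\<lambda>i. (Tar (hom_tcat K Y X) ^^ m) ((if i = 0 then prA X else prB X) \<lhd> F)) =
    (\<lambda>i::nat. if i = 0 then (Tar (hom_tcat K Y X) ^^ m) (prA X \<lhd> F) else (Tar (hom_tcat K Y X) ^^ m) (prB X \<lhd> F))"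
    by auto
  show ?thesis
    by (rule fold2_pullback) (rule tan_fold_hom[OF tangentad_axioms(1) assms, of m, unfolded e])
qed

text \<open>A pairing formed once in the endomorphisms of the base gives all pairings between its
  whiskerings, by uniqueness.\<close>

lemma into_T2_rwhisk:
  assumes F: "F \<in> hom1 K Y (base X)" and "u \<in> Cell2 K" "v \<in> Cell2 K" "dom2 K u = dom2 K v"
    "cod2 K u = tan X" "cod2 K v = tan X" "prj X \<bullet> u = prj X \<bullet> v"
  shows "iT2 u v \<in> Cell2 K" "dom2 K (iT2 u v) = dom2 K v" "cod2 K (iT2 u v) = tan2 X"
    "prA X \<bullet> iT2 u v = u" "prB X \<bullet> iT2 u v = v"
    "into_T2 (hom_tcat K Y X) F (u \<lhd> F) (v \<lhd> F) = iT2 u v \<lhd> F"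
proof -
  have src: "src K (dom2 K u) = base X" "tgt K (dom2 K u) = base X"
    "src K (dom2 K v) = base X" "tgt K (dom2 K v) = base X"
    using dom_cod2[OF assms(2)] dom_cod2[OF assms(3)] assms by auto
  interpret X: category "hom_tcat K (base X) X" by (simp add: category_hom_tcat)
  have [simp]: "src K F = Y" "F \<in> Cell1 K" "tgt K F = base X"
    using assms by (simp_all add: hom1_iff)
  interpret Y: category "hom_tcat K Y X" using F by (simp add: category_hom_tcat hom1_Cell0)
  note X = X.pairing_pullback[OF T2_hom_pullback[of "id1 K (base X)" "base X" 0, simplified]]
  show 1: "iT2 u v \<in> Cell2 K" "dom2 K (iT2 u v) = dom2 K v" "cod2 K (iT2 u v) = tan2 X"
    "prA X \<bullet> iT2 u v = u" "prB X \<bullet> iT2 u v = v"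
    using X[of u v] assms src by (simp_all add: hom_tcat_hom_cat hom1_iff)
  show "into_T2 (hom_tcat K Y X) F (u \<lhd> F) (v \<lhd> F) = iT2 u v \<lhd> F"
    unfolding into_T2_def hom_tcat_simps
    by (rule Y.pairing_eqI[OF T2_hom_pullback[OF F, of 0, simplified]])
      (use 1 src assms in \<open>simp_all add: hom1_iff flip: whisk_vcomp(2)\<close>)
qed

lemma into_TT2_rwhisk:
  assumes F: "F \<in> hom1 K Y (base X)" and "u \<in> Cell2 K" "v \<in> Cell2 K" "dom2 K u = dom2 K v"
    "cod2 K u = tan X \<odot> tan X" "cod2 K v = tan X \<odot> tan X" "(tan X \<rhd> prj X) \<bullet> u = (tan X \<rhd> prj X) \<bullet> v"
  shows "iTT2 u v \<in> Cell2 K" "dom2 K (iTT2 u v) = dom2 K v" "cod2 K (iTT2 u v) = tan X \<odot> tan2 X"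
    "(tan X \<rhd> prA X) \<bullet> iTT2 u v = u" "(tan X \<rhd> prB X) \<bullet> iTT2 u v = v"
    "into_TT2 (hom_tcat K Y X) F (u \<lhd> F) (v \<lhd> F) = iTT2 u v \<lhd> F"
proof -
  have src: "src K (dom2 K u) = base X" "tgt K (dom2 K u) = base X"
    "src K (dom2 K v) = base X" "tgt K (dom2 K v) = base X"
    using dom_cod2[OF assms(2)] dom_cod2[OF assms(3)] assms by auto
  interpret X: category "hom_tcat K (base X) X" by (simp add: category_hom_tcat)
  have [simp]: "src K F = Y" "F \<in> Cell1 K" "tgt K F = base X"
    using assms by (simp_all add: hom1_iff)
  interpret Y: category "hom_tcat K Y X" using F by (simp add: category_hom_tcat hom1_Cell0)
  note X = X.pairing_pullback[OF T2_hom_pullback[of "id1 K (base X)" "base X" 1, simplified]]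
  show 1: "iTT2 u v \<in> Cell2 K" "dom2 K (iTT2 u v) = dom2 K v" "cod2 K (iTT2 u v) = tan X \<odot> tan2 X"
    "(tan X \<rhd> prA X) \<bullet> iTT2 u v = u" "(tan X \<rhd> prB X) \<bullet> iTT2 u v = v"
    using X[of u v] assms src by (simp_all add: hom_tcat_hom_cat hom1_iff)
  show "into_TT2 (hom_tcat K Y X) F (u \<lhd> F) (v \<lhd> F) = iTT2 u v \<lhd> F"
    unfolding into_TT2_def hom_tcat_simps
    by (rule Y.pairing_eqI[OF T2_hom_pullback[OF F, of 1, simplified]])
      (use 1 src assms in \<open>simp_all add: hom1_iff flip: whisk_vcomp(2) whisk_comp1(3)\<close>)
qed

end

context tangentad
begin

lemma T2ar_hom_tcat:
  assumes [simp]: "\<phi> \<in> Cell2 K" "tgt K (dom2 K \<phi>) = base X" and Y: "src K (dom2 K \<phi>) = Y"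
  shows "T2ar (hom_tcat K Y X) \<phi> = tan2 X \<rhd> \<phi>"
proof -
  have "dom2 K \<phi> \<in> hom1 K Y (base X)" and c: "cod2 K \<phi> \<in> hom1 K Y (base X)"
    using Y by (simp_all add: hom1_iff)
  then interpret category "hom_tcat K Y X" by (simp add: category_hom_tcat hom1_Cell0)
  show ?thesis
    unfolding T2ar_def into_T2_def hom_tcat_simps
    by (rule pairing_eqI[OF T2_hom_pullback[OF c, of 0, simplified]])
      (use Y in \<open>simp_all add: hom1_iff whisk_exchange\<close>)
qed

text \<open>This evaluates an equation between 2-cells of the tangentad at a 1-morphism.\<close>

lemma rwhisk_cong: "\<phi> = \<psi> \<Longrightarrow> \<phi> \<lhd> F = \<psi> \<lhd> F"
  by simp

text \<open>At an object \<open>F\<close>, each condition is an equation of 2-cells or a pointwise pullback that holds in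
  the tangentad, whiskered with \<open>F\<close>; naturality is interchange.\<close>

theorem tangent_calculus_hom_tcat:
  assumes Y: "Y \<in> Cell0 K"
  shows "tangent_calculus (hom_tcat K Y X)"
proof (rule tangent_calculus.intro[OF category_hom_tcat[OF Y] tangent_calculus_axioms.intro], goal_cases)
  case (13 M m)
  then show ?case using T2_hom_pullback[of M Y m] by simp
next
  case (14 f A B)
  then show ?case by (auto simp: Hom_iff hom1_iff whisk_exchange)
next
  case (15 f A B)
  then show ?case using whisk_exchange[of "zer X" f "id1 K (base X)" "tan X" A B] by (auto simp: Hom_iff hom1_iff)
next
  case (16 f A B)
  then show ?case by (auto simp: Hom_iff hom1_iff whisk_exchange T2ar_hom_tcat)
next
  case (17 f A B)
  then show ?case using whisk_exchange[of "lft X" f "tan X" "tan X \<odot> tan X" A B] by (auto simp: Hom_iff hom1_iff)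
next
  case (18 f A B)
  then show ?case using whisk_exchange[of "flp X" f "tan X \<odot> tan X" "tan X \<odot> tan X" A B] by (auto simp: Hom_iff hom1_iff)
next
  case (19 M)
  then show ?case using rwhisk_cong[OF tangentad_axioms(3), of M] by (simp add: hom1_iff)
next
  case (20 M)
  then show ?case using rwhisk_cong[OF tangentad_axioms(4), of M] by (simp add: hom1_iff)
next
  case (21 M)
  then have M: "M \<in> hom1 K Y (base X)" and [simp]: "M \<in> Cell1 K" "src K M = Y" "tgt K M = base X"
    by (simp_all add: hom1_iff)
  have "prj X \<bullet> zer X \<bullet> prj X = prj X \<bullet> id2 K (tan X)"
    using vcomp_assoc[of "prj X" "zer X" "prj X"] by (simp add: tangentad_axioms(3) del: vcomp_assoc)
  note P = into_T2_rwhisk[OF M _ _ _ _ _ this, simplified]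
  show ?case
    using P(6) rwhisk_cong[OF tangentad_axioms(5), of M] P(1-3) by simp
next
  case (22 M)
  then show ?case using rwhisk_cong[OF tangentad_axioms(8), of M] by (simp add: hom1_iff)
next
  case (23 M)
  then show ?case using rwhisk_cong[OF tangentad_axioms(11), of M] by (simp add: hom1_iff)
next
  case (24 M)
  then show ?case using rwhisk_cong[OF tangentad_axioms(12), of M] by (simp add: hom1_iff)
next
  case (25 M)
  then have M: "M \<in> hom1 K Y (base X)" and [simp]: "M \<in> Cell1 K" "src K M = Y" "tgt K M = base X"
    by (simp_all add: hom1_iff)
  let ?u = "flp X \<bullet> (tan X \<rhd> prA X)" and ?v = "flp X \<bullet> (tan X \<rhd> prB X)"
  have T: "tan X \<in> hom1 K (base X) (base X)" and TM: "tan X \<odot> M \<in> hom1 K Y (base X)"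
    by (simp_all add: hom1_iff)
  interpret X: category "hom_tcat K (base X) X" by (simp add: category_hom_tcat)
  interpret Y: category "hom_tcat K Y X" by (rule category_hom_tcat[OF Y])
  have "prj X \<bullet> prA X = prj X \<bullet> prB X"
    using X.pullback_Ar(10)[OF T2_hom_pullback[of "id1 K (base X)" "base X" 0, simplified]]
    by (simp add: hom1_iff)
  then have "tan X \<rhd> (prj X \<bullet> prA X) = tan X \<rhd> (prj X \<bullet> prB X)"
    by simp
  then have ab: "(tan X \<rhd> prj X) \<bullet> (tan X \<rhd> prA X) = (tan X \<rhd> prj X) \<bullet> (tan X \<rhd> prB X)"
    by simp
  have "(prj X \<lhd> tan X) \<bullet> ?u = (prj X \<lhd> tan X) \<bullet> ?v"
    using ab by (simp add: tangentad_axioms(11) flip: vcomp_assoc)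
  then have "Comp (hom_tcat K (base X) X) (prj X \<lhd> tan X) ?u = Comp (hom_tcat K (base X) X) (prj X \<lhd> tan X) ?v"
    by simp
  note P = X.pairing_pullback[OF T2_hom_pullback[OF T, of 0, simplified] _ _ _ _ _ this,
      unfolded hom_tcat_hom_cat, simplified, simplified hom1_iff, simplified]
  have "into_T2 (hom_tcat K Y X) (tan X \<odot> M) (?u \<lhd> M) (?v \<lhd> M) = iT2T ?u ?v \<lhd> M"
    unfolding into_T2_def hom_tcat_simps
    by (rule Y.pairing_eqI[OF T2_hom_pullback[OF TM, of 0, simplified]])
      (use P(1-3) rwhisk_cong[OF P(4), of M] rwhisk_cong[OF P(5), of M] in \<open>simp_all add: hom1_iff\<close>)
  then show ?case
    using rwhisk_cong[OF tangentad_axioms(13), of M] P(1-3) by simp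
next
  case (26 M)
  then show ?case using rwhisk_cong[OF tangentad_axioms(15), of M] by (simp add: hom1_iff)
next
  case (27 M)
  then show ?case using rwhisk_cong[OF tangentad_axioms(16), of M] by (simp add: hom1_iff)
next
  case (28 M)
  then show ?case using rwhisk_cong[OF tangentad_axioms(17), of M] by (simp add: hom1_iff)
next
  case (29 M)
  then show ?case using rwhisk_cong[OF tangentad_axioms(18), of M] by (simp add: hom1_iff)
qed (auto simp: Hom_iff hom1_iff)

text \<open>Precomposition preserves the structure on the nose because the structure acts by
  postcomposition.\<close>

theorem precomposition_strict:
  assumes F: "F \<in> hom1 K Z Y"
  shows "strict_functor (hom_tcat K Y X) (hom_tcat K Z X) (\<lambda>M. M \<odot> F) (\<lambda>\<phi>. \<phi> \<lhd> F)"
proof -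
  have [simp]: "F \<in> Cell1 K" "src K F = Z" "tgt K F = Y"
    using F by (simp_all add: hom1_iff)
  interpret C: tangent_calculus "hom_tcat K Y X"
    using F by (simp add: tangent_calculus_hom_tcat hom1_Cell0)
  interpret D: tangent_calculus "hom_tcat K Z X"
    using F by (simp add: tangent_calculus_hom_tcat hom1_Cell0)
  show ?thesis
    by unfold_locales (auto simp: Hom_iff hom1_iff)
qed

end

section \<open>Lax tangent morphisms\<close>

text \<open>
  Composites of lax tangent morphisms, and the lax tangent morphisms \<open>T F\<close> and \<open>T\<^sub>2 F\<close>, are all of the
  following kind: \<open>F\<close> is followed by a 1-morphism that acts on hom-categories as a lax tangent
  functor. They are therefore treated by a single lemma, \<open>lax_functor_comp\<close>.
\<close>

lemma (in strong) lax: "lax_tangent_functor D D S0 S1 sg"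
  unfolding lax_tangent_functor_def
  using S1_Hom sg_Hom sg_nat p_sg sg_z sg_s l_sg c_sg
  by (auto simp: Hom_iff sg2_def into_T2_def)

lemma (in tangent_calculus) lax_tangent_functor_cong:
  assumes "lax_tangent_functor D E F0 F1 \<alpha>" "\<And>f. f \<in> Ar D \<Longrightarrow> F1 f = F1' f"
  shows "lax_tangent_functor D E F0 F1' \<alpha>"
  using assms unfolding lax_tangent_functor_def by simp

context two_category
begin

lemma act_vcomp [simp]:
  assumes "\<phi> \<in> Cell2 K" "\<psi> \<in> Cell2 K" "cod2 K \<phi> = dom2 K \<psi>"
    "src K (dom2 K \<phi>) = Y" "tgt K (dom2 K \<phi>) = base X"
  shows "act (hom_tcat K Y X) (\<psi> \<bullet> \<phi>) x = act (hom_tcat K Y X) \<psi> (act (hom_tcat K Y X) \<phi> x)"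
proof -
  have "dom2 K \<phi> \<in> hom1 K Y (base X)" "cod2 K \<phi> \<in> hom1 K Y (base X)" "cod2 K \<psi> \<in> hom1 K Y (base X)"
    using assms dom_cod2[of \<phi>] dom_cod2[of \<psi>] by (auto simp: hom1_iff)
  moreover have "category (hom_tcat K Y X)"
    using assms by (unfold_locales) (auto simp: Hom_iff hom1_iff)
  ultimately show ?thesis
    using category.act_comp[of "hom_tcat K Y X" \<phi> \<psi> x] assms by simp
qed

lemma act_ext2:
  assumes "\<phi> \<in> Cell2 K" "\<psi> \<in> Cell2 K" "dom2 K \<phi> = dom2 K \<psi>" "cod2 K \<phi> = cod2 K \<psi>"
    "src K (dom2 K \<phi>) = Y" "tgt K (dom2 K \<phi>) = base X"
    "\<And>x. act (hom_tcat K Y X) \<phi> x = act (hom_tcat K Y X) \<psi> x"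
  shows "\<phi> = \<psi>"
proof -
  have "dom2 K \<phi> \<in> hom1 K Y (base X)" "cod2 K \<phi> \<in> hom1 K Y (base X)"
    using assms dom_cod2[of \<phi>] by (auto simp: hom1_iff)
  moreover have "category (hom_tcat K Y X)"
    using assms by (unfold_locales) (auto simp: Hom_iff hom1_iff)
  ultimately show ?thesis
    using category.act_ext[of "hom_tcat K Y X" \<phi> \<psi>] assms by simp
qed

lemma act_cong2: "\<phi> = \<psi> \<Longrightarrow> act (hom_tcat K Y X) \<phi> x = act (hom_tcat K Y X) \<psi> x"
  by simp

text \<open>The axioms of a lax tangent morphism, whiskered with a 1-morphism \<open>M\<close>, are the axioms of a lax
  tangent functor at \<open>M\<close>. Naturality of the comparison is interchange.\<close>

lemma lax_postcomposition:
  assumes B: "is_tangentad K B" and X: "is_tangentad K X" and L: "lax_tangent_morphism K B X (G, \<beta>)"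
    and Y: "Y \<in> Cell0 K"
  shows "lax_tangent_functor (hom_tcat K Y B) (hom_tcat K Y X) (\<lambda>M. G \<odot> M) (\<lambda>\<phi>. G \<rhd> \<phi>) (\<lambda>M. \<beta> \<lhd> M)"
proof -
  interpret B: tangentad K B by unfold_locales (rule B)
  interpret X: tangentad K X by unfold_locales (rule X)
  have [simp]: "G \<in> Cell1 K" "src K G = base B" "tgt K G = base X"
    "\<beta> \<in> Cell2 K" "dom2 K \<beta> = G \<odot> tan B" "cod2 K \<beta> = tan X \<odot> G"
    using L by (auto simp: lax_tangent_morphism_def hom1_iff hom2_iff)
  have ax: "(prj X \<lhd> G) \<bullet> \<beta> = G \<rhd> prj B" "\<beta> \<bullet> (G \<rhd> zer B) = zer X \<lhd> G"
     "\<beta> \<bullet> (G \<rhd> pls B) = (pls X \<lhd> G) \<bullet> pairing (hom_cat K (base B) (base X)) (tan2 X \<odot> G) (prA X \<lhd> G) (prB X \<lhd> G)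
         (\<beta> \<bullet> (G \<rhd> prA B)) (\<beta> \<bullet> (G \<rhd> prB B))"
     "(lft X \<lhd> G) \<bullet> \<beta> = (tan X \<rhd> \<beta>) \<bullet> (\<beta> \<lhd> tan B) \<bullet> (G \<rhd> lft B)"
     "(flp X \<lhd> G) \<bullet> (tan X \<rhd> \<beta>) \<bullet> (\<beta> \<lhd> tan B) = (tan X \<rhd> \<beta>) \<bullet> (\<beta> \<lhd> tan B) \<bullet> (G \<rhd> flp B)"
    using L by (simp_all add: lax_tangent_morphism_def)
  interpret BX: tangent_calculus "hom_tcat K (base B) X" by (rule X.tangent_calculus_hom_tcat) simp
  interpret BB: tangent_calculus "hom_tcat K (base B) B" by (rule B.tangent_calculus_hom_tcat) simp
  have pab: "prj B \<bullet> prA B = prj B \<bullet> prB B"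
    using BB.p_b[of "id1 K (base B)"] by (simp add: hom1_iff)
  have "(prj X \<lhd> G) \<bullet> \<beta> \<bullet> (G \<rhd> prA B) = G \<rhd> (prj B \<bullet> prA B)"
    by (simp add: ax(1) flip: vcomp_assoc)
  moreover have "(prj X \<lhd> G) \<bullet> \<beta> \<bullet> (G \<rhd> prB B) = G \<rhd> (prj B \<bullet> prB B)"
    by (simp add: ax(1) flip: vcomp_assoc)
  ultimately have e: "(prj X \<lhd> G) \<bullet> \<beta> \<bullet> (G \<rhd> prA B) = (prj X \<lhd> G) \<bullet> \<beta> \<bullet> (G \<rhd> prB B)"
    by (simp only: pab)
  let ?w = "into_T2 (hom_tcat K (base B) X) G (\<beta> \<bullet> (G \<rhd> prA B)) (\<beta> \<bullet> (G \<rhd> prB B))"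
  have w: "?w \<in> Cell2 K" "dom2 K ?w = G \<odot> tan2 B" "cod2 K ?w = tan2 X \<odot> G"
    using BX.into_T2[of G "\<beta> \<bullet> (G \<rhd> prA B)" "\<beta> \<bullet> (G \<rhd> prB B)"] e by (simp_all add: hom1_iff)
  have ax3: "\<beta> \<bullet> (G \<rhd> pls B) = (pls X \<lhd> G) \<bullet> ?w"
    using ax(3) by (simp add: into_T2_def hom_tcat_hom_cat)
  show ?thesis
    unfolding lax_tangent_functor_def hom_tcat_simps
  proof (intro conjI ballI impI, goal_cases)
    case (6 f)
    then show ?case using whisk_exchange[of \<beta> f "G \<odot> tan B" "tan X \<odot> G" "dom2 K f" "cod2 K f"]
      by (auto simp: hom1_iff)
  next
    case (7 M)
    then show ?case using X.rwhisk_cong[OF ax(1), of M] by (simp add: hom1_iff)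
  next
    case (8 M)
    then show ?case using X.rwhisk_cong[OF ax(2), of M] by (simp add: hom1_iff)
  next
    case (9 M)
    then interpret S: strict_functor "hom_tcat K (base B) X" "hom_tcat K Y X" "\<lambda>N. N \<odot> M" "\<lambda>\<phi>. \<phi> \<lhd> M"
      by (intro X.precomposition_strict)
    from 9 have [simp]: "M \<in> Cell1 K" "src K M = Y" "tgt K M = base B"
      by (simp_all add: hom1_iff)
    have "?w \<lhd> M = into_T2 (hom_tcat K Y X) (G \<odot> M) ((\<beta> \<bullet> (G \<rhd> prA B)) \<lhd> M) ((\<beta> \<bullet> (G \<rhd> prB B)) \<lhd> M)"
      by (rule S.F1_into_T2) (use e in \<open>simp_all add: hom1_iff\<close>)
    then show ?case using X.rwhisk_cong[OF ax3, of M] w by (simp add: into_T2_def)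
  next
    case (10 M)
    then show ?case using X.rwhisk_cong[OF ax(4), of M] by (simp add: hom1_iff)
  next
    case (11 M)
    then show ?case using X.rwhisk_cong[OF ax(5), of M] by (simp add: hom1_iff)
  qed (auto simp: hom1_iff Hom_iff)
qed

text \<open>
  The lax functor \<open>G\<close> between hom-categories need not come from a distributive law on \<open>G\<close>: only its
  component \<open>b\<close> at \<open>F\<close>, at \<open>F T\<close> and at \<open>T F\<close> enters, and the last hypothesis says that \<open>b\<close> is
  compatible with precomposition by \<open>T\<close>.
\<close>

lemma lax_functor_comp:
  assumes A: "is_tangentad K A" and B: "is_tangentad K B" and X: "is_tangentad K X"
    and L: "lax_tangent_morphism K A B (F, \<alpha>)" and G: "G \<in> hom1 K (base B) (base X)"
    and lax: "lax_tangent_functor (hom_tcat K (base A) B) (hom_tcat K (base A) X) (\<lambda>M. G \<odot> M) (\<lambda>\<phi>. G \<rhd> \<phi>) b"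
    and bT: "b (F \<odot> tan A) = b F \<lhd> tan A"
  shows "lax_tangent_morphism K A X (G \<odot> F, b F \<bullet> (G \<rhd> \<alpha>))"
proof -
  interpret A: tangentad K A by unfold_locales (rule A)
  interpret B: tangentad K B by unfold_locales (rule B)
  interpret X: tangentad K X by unfold_locales (rule X)
  have F [simp]: "F \<in> Cell1 K" "src K F = base A" "tgt K F = base B"
    "\<alpha> \<in> Cell2 K" "dom2 K \<alpha> = F \<odot> tan A" "cod2 K \<alpha> = tan B \<odot> F"
    using L by (auto simp: lax_tangent_morphism_def hom1_iff hom2_iff)
  have [simp]: "G \<in> Cell1 K" "src K G = base B" "tgt K G = base X"
    using G by (simp_all add: hom1_iff)
  let ?H = "hom_tcat K (base A) X" and ?HB = "hom_tcat K (base A) B"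
  interpret H: tangent_calculus ?H by (rule X.tangent_calculus_hom_tcat) simp
  interpret HB: tangent_calculus ?HB by (rule B.tangent_calculus_hom_tcat) simp
  interpret HA: tangent_calculus "hom_tcat K (base A) A" by (rule A.tangent_calculus_hom_tcat) simp
  have axF: "(prj B \<lhd> F) \<bullet> \<alpha> = F \<rhd> prj A" "\<alpha> \<bullet> (F \<rhd> zer A) = zer B \<lhd> F"
     "\<alpha> \<bullet> (F \<rhd> pls A) = (pls B \<lhd> F) \<bullet> pairing (hom_cat K (base A) (base B)) (tan2 B \<odot> F) (prA B \<lhd> F) (prB B \<lhd> F)
         (\<alpha> \<bullet> (F \<rhd> prA A)) (\<alpha> \<bullet> (F \<rhd> prB A))"
     "(lft B \<lhd> F) \<bullet> \<alpha> = (tan B \<rhd> \<alpha>) \<bullet> (\<alpha> \<lhd> tan A) \<bullet> (F \<rhd> lft A)"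
     "(flp B \<lhd> F) \<bullet> (tan B \<rhd> \<alpha>) \<bullet> (\<alpha> \<lhd> tan A) = (tan B \<rhd> \<alpha>) \<bullet> (\<alpha> \<lhd> tan A) \<bullet> (F \<rhd> flp A)"
    using L by (simp_all add: lax_tangent_morphism_def)
  have pab: "prj A \<bullet> prA A = prj A \<bullet> prB A"
    using HA.p_b[of "id1 K (base A)"] by (simp add: hom1_iff)
  have pabB: "(prj B \<lhd> F) \<bullet> (prA B \<lhd> F) = (prj B \<lhd> F) \<bullet> (prB B \<lhd> F)"
    using HB.p_b[of F] by (simp add: hom1_iff)
  have "(prj B \<lhd> F) \<bullet> \<alpha> \<bullet> (F \<rhd> prA A) = F \<rhd> (prj A \<bullet> prA A)"
    by (simp add: axF(1) flip: vcomp_assoc)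
  moreover have "(prj B \<lhd> F) \<bullet> \<alpha> \<bullet> (F \<rhd> prB A) = F \<rhd> (prj A \<bullet> prB A)"
    by (simp add: axF(1) flip: vcomp_assoc)
  ultimately have e: "(prj B \<lhd> F) \<bullet> \<alpha> \<bullet> (F \<rhd> prA A) = (prj B \<lhd> F) \<bullet> \<alpha> \<bullet> (F \<rhd> prB A)"
    by (simp only: pab)
  let ?w = "into_T2 ?HB F (\<alpha> \<bullet> (F \<rhd> prA A)) (\<alpha> \<bullet> (F \<rhd> prB A))"
  have w [simp]: "?w \<in> Cell2 K" "dom2 K ?w = F \<odot> tan2 A" "cod2 K ?w = tan2 B \<odot> F"
    and wab: "(prA B \<lhd> F) \<bullet> ?w = \<alpha> \<bullet> (F \<rhd> prA A)" "(prB B \<lhd> F) \<bullet> ?w = \<alpha> \<bullet> (F \<rhd> prB A)"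
    using HB.into_T2[of F "\<alpha> \<bullet> (F \<rhd> prA A)" "\<alpha> \<bullet> (F \<rhd> prB A)"] e by (simp_all add: hom1_iff)
  have ax3: "\<alpha> \<bullet> (F \<rhd> pls A) = (pls B \<lhd> F) \<bullet> ?w"
    using axF(3) by (simp add: into_T2_def hom_tcat_hom_cat)
  have b [simp]: "b M \<in> Cell2 K" "dom2 K (b M) = G \<odot> tan B \<odot> M" "cod2 K (b M) = tan X \<odot> G \<odot> M"
    if "M \<in> Cell1 K" "src K M = base A" "tgt K M = base B" for M
    using lax that unfolding lax_tangent_functor_def by (auto simp: hom1_iff Hom_iff)
  have axb: "(prj X \<lhd> (G \<odot> F)) \<bullet> b F = G \<rhd> (prj B \<lhd> F)" "b F \<bullet> (G \<rhd> (zer B \<lhd> F)) = zer X \<lhd> (G \<odot> F)"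
     "b F \<bullet> (G \<rhd> (pls B \<lhd> F)) = (pls X \<lhd> (G \<odot> F)) \<bullet> into_T2 ?H (G \<odot> F) (b F \<bullet> (G \<rhd> (prA B \<lhd> F))) (b F \<bullet> (G \<rhd> (prB B \<lhd> F)))"
     "(lft X \<lhd> (G \<odot> F)) \<bullet> b F = (tan X \<rhd> b F) \<bullet> b (tan B \<odot> F) \<bullet> (G \<rhd> (lft B \<lhd> F))"
     "(flp X \<lhd> (G \<odot> F)) \<bullet> (tan X \<rhd> b F) \<bullet> b (tan B \<odot> F) = (tan X \<rhd> b F) \<bullet> b (tan B \<odot> F) \<bullet> (G \<rhd> (flp B \<lhd> F))"
    using lax unfolding lax_tangent_functor_def hom_tcat_simps into_T2_def by (auto simp: hom1_iff)
  have "\<forall>f\<in>Ar ?HB. (tan X \<rhd> (G \<rhd> f)) \<bullet> b (dom2 K f) = b (cod2 K f) \<bullet> (G \<rhd> (tan B \<rhd> f))"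
    using lax unfolding lax_tangent_functor_def hom_tcat_simps by blast
  moreover have "\<alpha> \<in> Ar ?HB"
    by (simp add: hom1_iff)
  ultimately have axn: "(tan X \<rhd> (G \<rhd> \<alpha>)) \<bullet> b (F \<odot> tan A) = b (tan B \<odot> F) \<bullet> (G \<rhd> (tan B \<rhd> \<alpha>))"
    using bspec[of "Ar ?HB" _ \<alpha>] F(5,6) by metis
  have axTn: "(tan X \<rhd> (tan X \<rhd> (G \<rhd> \<alpha>))) \<bullet> (tan X \<rhd> b (F \<odot> tan A)) =
      (tan X \<rhd> b (tan B \<odot> F)) \<bullet> (tan X \<rhd> (G \<rhd> (tan B \<rhd> \<alpha>)))"
    using arg_cong[OF axn, of "\<lambda>\<phi>. tan X \<rhd> \<phi>"] by simp
  have "(prj X \<lhd> (G \<odot> F)) \<bullet> b F \<bullet> (G \<rhd> (prA B \<lhd> F)) = G \<rhd> ((prj B \<lhd> F) \<bullet> (prA B \<lhd> F))"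
    by (simp add: axb(1) flip: vcomp_assoc)
  moreover have "(prj X \<lhd> (G \<odot> F)) \<bullet> b F \<bullet> (G \<rhd> (prB B \<lhd> F)) = G \<rhd> ((prj B \<lhd> F) \<bullet> (prB B \<lhd> F))"
    by (simp add: axb(1) flip: vcomp_assoc)
  ultimately have eb: "(prj X \<lhd> (G \<odot> F)) \<bullet> b F \<bullet> (G \<rhd> (prA B \<lhd> F)) = (prj X \<lhd> (G \<odot> F)) \<bullet> b F \<bullet> (G \<rhd> (prB B \<lhd> F))"
    by (simp only: pabB)
  let ?v = "into_T2 ?H (G \<odot> F) (b F \<bullet> (G \<rhd> (prA B \<lhd> F))) (b F \<bullet> (G \<rhd> (prB B \<lhd> F)))"
  have v [simp]: "?v \<in> Cell2 K" "dom2 K ?v = G \<odot> tan2 B \<odot> F" "cod2 K ?v = tan2 X \<odot> G \<odot> F"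
    and vab: "(prA X \<lhd> (G \<odot> F)) \<bullet> ?v = b F \<bullet> (G \<rhd> (prA B \<lhd> F))" "(prB X \<lhd> (G \<odot> F)) \<bullet> ?v = b F \<bullet> (G \<rhd> (prB B \<lhd> F))"
    using H.into_T2[of "G \<odot> F" "b F \<bullet> (G \<rhd> (prA B \<lhd> F))" "b F \<bullet> (G \<rhd> (prB B \<lhd> F))"] eb
    by (simp_all add: hom1_iff)
  note actF = axF(1,2,4,5)[THEN arg_cong[of _ _ "\<lambda>\<phi>. G \<rhd> \<phi>"], THEN act_cong2[of _ _ "base A" X], simplified]
    and actw = ax3[THEN arg_cong[of _ _ "\<lambda>\<phi>. G \<rhd> \<phi>"], THEN act_cong2[of _ _ "base A" X], simplified]
      wab[THEN arg_cong[of _ _ "\<lambda>\<phi>. G \<rhd> \<phi>"], THEN act_cong2[of _ _ "base A" X], simplified]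
    and actb = axn[THEN act_cong2[of _ _ "base A" X], simplified] axTn[THEN act_cong2[of _ _ "base A" X], simplified]
      axb[THEN act_cong2[of _ _ "base A" X], simplified]
    and actv = vab[THEN act_cong2[of _ _ "base A" X], simplified]
  let ?g = "b F \<bullet> (G \<rhd> \<alpha>)"
  have "into_T2 ?H (G \<odot> F) (?g \<bullet> (G \<rhd> F \<rhd> prA A)) (?g \<bullet> (G \<rhd> F \<rhd> prB A)) = ?v \<bullet> (G \<rhd> ?w)"
    by (rule H.into_T2_eqI; (rule act_ext2[of _ _ "base A" X])?)
      (simp_all add: hom1_iff actv actw)
  then have s: "(pls X \<lhd> (G \<odot> F)) \<bullet> into_T2 ?H (G \<odot> F) (?g \<bullet> (G \<rhd> F \<rhd> prA A)) (?g \<bullet> (G \<rhd> F \<rhd> prB A)) =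
      ?g \<bullet> (G \<rhd> F \<rhd> pls A)"
    by (simp, intro act_ext2[of _ _ "base A" X]) (simp_all add: actb actw)
  have l: "(lft X \<lhd> (G \<odot> F)) \<bullet> ?g = (tan X \<rhd> ?g) \<bullet> (?g \<lhd> tan A) \<bullet> (G \<rhd> F \<rhd> lft A)"
    by (rule act_ext2[of _ _ "base A" X]) (simp_all add: actb actF bT[symmetric])
  have c: "(flp X \<lhd> (G \<odot> F)) \<bullet> (tan X \<rhd> ?g) \<bullet> (?g \<lhd> tan A) = (tan X \<rhd> ?g) \<bullet> (?g \<lhd> tan A) \<bullet> (G \<rhd> F \<rhd> flp A)"
    by (rule act_ext2[of _ _ "base A" X]) (simp_all add: actb actF bT[symmetric])
  have p: "(prj X \<lhd> (G \<odot> F)) \<bullet> ?g = G \<rhd> F \<rhd> prj A"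
    by (rule act_ext2[of _ _ "base A" X]) (simp_all add: actb actF)
  have z: "?g \<bullet> (G \<rhd> F \<rhd> zer A) = zer X \<lhd> (G \<odot> F)"
    by (rule act_ext2[of _ _ "base A" X]) (simp_all add: actb actF)
  show ?thesis
    unfolding lax_tangent_morphism_def prod.case
    using p z s[symmetric] l c by (simp add: hom1_iff hom2_iff into_T2_def hom_tcat_hom_cat del: vcomp_assoc whisk_vcomp)
qed

lemma lax_comp_lax:
  assumes "is_tangentad K A" "is_tangentad K B" "is_tangentad K X"
    "lax_tangent_morphism K A B M" "lax_tangent_morphism K B X N"
  shows "lax_tangent_morphism K A X (lax_comp K N M)"
proof -
  obtain F \<alpha> G \<beta> where [simp]: "M = (F, \<alpha>)" "N = (G, \<beta>)"
    by (cases M; cases N)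
  interpret A: tangentad K A by unfold_locales (rule assms(1))
  interpret B: tangentad K B by unfold_locales (rule assms(2))
  have "F \<in> hom1 K (base A) (base B)" "G \<in> hom1 K (base B) (base X)" "\<beta> \<in> hom2 K (G \<odot> tan B) (tan X \<odot> G)"
    using assms(4,5) by (auto simp: lax_tangent_morphism_def)
  then show ?thesis
    using lax_functor_comp[OF assms(1-3), of F \<alpha> G "\<lambda>M. \<beta> \<lhd> M"] lax_postcomposition[OF assms(2,3), of G \<beta> "base A"] assms(4,5)
    by (simp add: lax_comp_def hom1_iff hom2_iff)
qed

end

section \<open>The hom tangent category of lax tangent morphisms\<close>

lemma hom_tcat_funs:
  "Tob (hom_tcat K Y X) = (\<lambda>F. tan X \<odot>\<^bsub>K\<^esub> F)" "Tar (hom_tcat K Y X) = (\<lambda>\<phi>. tan X \<rhd>\<^bsub>K\<^esub> \<phi>)"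
  "T2ob (hom_tcat K Y X) = (\<lambda>F. tan2 X \<odot>\<^bsub>K\<^esub> F)" "ct (hom_tcat K Y X) = (\<lambda>F. flp X \<lhd>\<^bsub>K\<^esub> F)"
  by (simp_all add: hom_tcat_def)

lemma (in two_category) act_exchange:
  assumes [simp]: "\<phi> \<in> Cell2 K" "dom2 K \<phi> = F" "cod2 K \<phi> = F'" "\<psi> \<in> Cell2 K" "dom2 K \<psi> = G" "cod2 K \<psi> = G'"
    "tgt K G = src K F" "src K G = Y" "tgt K F = base X"
  shows "act (hom_tcat K Y X) (\<phi> \<lhd> G') (act (hom_tcat K Y X) (F \<rhd> \<psi>) x) =
    act (hom_tcat K Y X) (F' \<rhd> \<psi>) (act (hom_tcat K Y X) (\<phi> \<lhd> G) x)"
proof -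
  have [simp]: "F \<in> Cell1 K" "F' \<in> Cell1 K" "G \<in> Cell1 K" "G' \<in> Cell1 K" "src K F' = src K F" "tgt K F' = base X"
    "src K G' = Y" "tgt K G' = src K F"
    using dom_cod2[OF assms(1)] dom_cod2[OF assms(4)] by simp_all
  show ?thesis
    using act_cong2[OF whisk_exchange[of \<phi> \<psi> F F' G G'], of Y X x] by simp
qed

locale tangentad_pair = tangentad K X for K :: "('o, 'm, 'c) two_cat" (structure) and X +
  fixes A :: "('o, 'm, 'c) tangentad"
  assumes A_tangentad: "is_tangentad K A"
begin

sublocale A: tangentad K A
  by unfold_locales (rule A_tangentad)

sublocale D: tangent_calculus "hom_tcat K (base A) X"
  by (rule tangent_calculus_hom_tcat) simp

abbreviation "H \<equiv> hom_tcat K (base A) X"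
abbreviation "L \<equiv> lax_hom K A X"

lemma lax_Cell:
  assumes "lax_tangent_morphism K A X (F, \<alpha>)"
  shows "F \<in> Cell1 K" "src K F = base A" "tgt K F = base X"
    "\<alpha> \<in> Cell2 K" "dom2 K \<alpha> = F \<odot> tan A" "cod2 K \<alpha> = tan X \<odot> F"
  using assms by (auto simp: lax_tangent_morphism_def hom1_iff hom2_iff)

lemma lax_Cell':
  assumes "lax_tangent_morphism K A X M"
  shows "fst M \<in> Cell1 K" "src K (fst M) = base A" "tgt K (fst M) = base X"
    "snd M \<in> Cell2 K" "dom2 K (snd M) = fst M \<odot> tan A" "cod2 K (snd M) = tan X \<odot> fst M"
  using lax_Cell[of "fst M" "snd M"] assms by simp_all

text \<open>The law of \<open>T F\<close> is that of \<open>F\<close> followed by the strong tangent functor \<open>(T, c)\<close>.\<close>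

lemma lax_tan_lax:
  assumes "lax_tangent_morphism K A X M"
  shows "lax_tangent_morphism K A X (lax_tan K X M)"
proof -
  obtain F \<alpha> where M: "M = (F, \<alpha>)" by (cases M)
  note [simp] = lax_Cell[OF assms[unfolded M]]
  interpret T: tangent_fold H 1 D.To D.T "\<lambda>i M. Idn H (D.To M)" D.p D.c
    by (rule D.fold_T)
  have "lax_tangent_functor H H (\<lambda>M. tan X \<odot> M) (\<lambda>\<phi>. tan X \<rhd> \<phi>) (\<lambda>M. flp X \<lhd> M)"
    using T.F.lax by (simp only: hom_tcat_funs)
  from lax_functor_comp[OF A_tangentad is_tangentad is_tangentad assms[unfolded M] _ this]
  show ?thesis
    by (simp add: M lax_tan_def hom1_iff)
qed

text \<open>The law on \<open>T\<^sub>2 F\<close> that is defined through its projections is that of \<open>F\<close> followed by the strong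
  tangent functor \<open>T\<^sub>2\<close>.\<close>

lemma lax_tan2_eq:
  assumes "lax_tangent_morphism K A X (F, \<alpha>)"
  shows "lax_tan2 K A X (F, \<alpha>) = (tan2 X \<odot> F, D.T2sg F \<bullet> (tan2 X \<rhd> \<alpha>))"
proof -
  note [simp] = lax_Cell[OF assms]
  have [simp]: "F \<in> hom1 K (base A) (base X)" "F \<odot> tan A \<in> hom1 K (base A) (base X)"
    by (simp_all add: hom1_iff)
  note [simp] = D.T2sg_Ar[of F, simplified]
  note ex = act_exchange[of "prA X" "tan2 X" "tan X" \<alpha> "F \<odot> tan A" "tan X \<odot> F" "base A" X, simplified]
    act_exchange[of "prB X" "tan2 X" "tan X" \<alpha> "F \<odot> tan A" "tan X \<odot> F" "base A" X, simplified]
  have "into_TT2 H F (snd (lax_tan K X (F, \<alpha>)) \<bullet> (prA X \<lhd> (F \<odot> tan A)))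
      (snd (lax_tan K X (F, \<alpha>)) \<bullet> (prB X \<lhd> (F \<odot> tan A))) = D.T2sg F \<bullet> (tan2 X \<rhd> \<alpha>)"
    by (rule D.into_TT2_eqI; (rule act_ext2[of _ _ "base A" X])?)
      (simp_all add: lax_tan_def hom1_iff ex)
  then show ?thesis
    by (simp add: lax_tan2_def)
qed

lemma T2sg_Cell:
  assumes "F \<in> Cell1 K" "src K F = base A" "tgt K F = base X"
  shows "D.T2sg F \<in> Cell2 K" "dom2 K (D.T2sg F) = tan2 X \<odot> tan X \<odot> F" "cod2 K (D.T2sg F) = tan X \<odot> tan2 X \<odot> F"
  using D.T2sg_Ar[of F] assms by (simp_all add: hom1_iff)

lemma T2_Cell:
  "f \<in> Ar H \<Longrightarrow> T2ar H f = tan2 X \<rhd> f"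
  by (auto simp: hom1_iff T2ar_hom_tcat)

lemma lax_tan2_lax:
  assumes "lax_tangent_morphism K A X M"
  shows "lax_tangent_morphism K A X (lax_tan2 K A X M)"
proof -
  obtain F \<alpha> where M: "M = (F, \<alpha>)" by (cases M)
  note [simp] = lax_Cell[OF assms[unfolded M]]
  interpret F: tangent_fold H 2 D.T2o D.T2 "\<lambda>i M. if i = 0 then D.a M else D.b M" "\<lambda>M. D.p M \<cdot>\<^bsub>H\<^esub> D.a M" D.T2sg
    by (rule D.fold_T2)
  have "lax_tangent_functor H H (\<lambda>M. tan2 X \<odot> M) (\<lambda>\<phi>. tan2 X \<rhd> \<phi>) D.T2sg"
    using D.lax_tangent_functor_cong[OF F.F.lax T2_Cell] by (simp only: hom_tcat_funs)
  note * = lax_functor_comp[OF A_tangentad is_tangentad is_tangentad assms[unfolded M] _ this]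
  interpret S: strict_functor H H "\<lambda>M. M \<odot> tan A" "\<lambda>\<phi>. \<phi> \<lhd> tan A"
    by (rule precomposition_strict) (simp add: hom1_iff)
  have "F \<in> Ob H"
    by (simp add: hom1_iff)
  from S.F1_T2sg[OF this] * show ?thesis
    unfolding M lax_tan2_eq[OF assms[unfolded M]] by (simp add: hom1_iff)
qed

text \<open>The compatibility condition as an equation of actions, ready for rewriting.\<close>

lemma tangent_two_morphism_iff:
  "tangent_two_morphism K A X M \<phi> N \<longleftrightarrow>
     lax_tangent_morphism K A X M \<and> lax_tangent_morphism K A X N \<and>
     \<phi> \<in> Cell2 K \<and> dom2 K \<phi> = fst M \<and> cod2 K \<phi> = fst N \<and>
     (\<forall>x. act H (tan X \<rhd> \<phi>) (act H (snd M) x) = act H (snd N) (act H (\<phi> \<lhd> tan A) x))"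
proof (cases "lax_tangent_morphism K A X M \<and> lax_tangent_morphism K A X N \<and>
     \<phi> \<in> Cell2 K \<and> dom2 K \<phi> = fst M \<and> cod2 K \<phi> = fst N")
  case True
  then have L: "lax_tangent_morphism K A X M" "lax_tangent_morphism K A X N" and
    [simp]: "\<phi> \<in> Cell2 K" "dom2 K \<phi> = fst M" "cod2 K \<phi> = fst N"
    by auto
  note [simp] = lax_Cell'[OF L(1)] lax_Cell'[OF L(2)]
  have "(tan X \<rhd> \<phi>) \<bullet> snd M = snd N \<bullet> (\<phi> \<lhd> tan A) \<longleftrightarrow>
    (\<forall>x. act H (tan X \<rhd> \<phi>) (act H (snd M) x) = act H (snd N) (act H (\<phi> \<lhd> tan A) x))" (is "?l = ?r \<longleftrightarrow> _")
  proof
    assume "?l = ?r"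
    from act_cong2[OF this, of "base A" X] show "\<forall>x. act H (tan X \<rhd> \<phi>) (act H (snd M) x) = act H (snd N) (act H (\<phi> \<lhd> tan A) x)"
      by simp
  next
    assume "\<forall>x. act H (tan X \<rhd> \<phi>) (act H (snd M) x) = act H (snd N) (act H (\<phi> \<lhd> tan A) x)"
    then show "?l = ?r"
      by (intro act_ext2[of _ _ "base A" X]) simp_all
  qed
  then show ?thesis
    using True by (simp add: tangent_two_morphism_def hom2_iff)
qed (auto simp: tangent_two_morphism_def hom2_iff)

lemma tangent_Cell:
  assumes "tangent_two_morphism K A X M \<phi> N"
  shows "\<phi> \<in> Cell2 K" "dom2 K \<phi> = fst M" "cod2 K \<phi> = fst N" "\<phi> \<in> Ar H"
    "lax_tangent_morphism K A X M" "lax_tangent_morphism K A X N"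
    "act H (tan X \<rhd> \<phi>) (act H (snd M) x) = act H (snd N) (act H (\<phi> \<lhd> tan A) x)"
  using assms lax_Cell'[of M] lax_Cell'[of N] unfolding tangent_two_morphism_iff by (auto simp: hom1_iff)

lemma tangent_comp:
  assumes "tangent_two_morphism K A X M \<phi> N" "tangent_two_morphism K A X N \<psi> P"
  shows "tangent_two_morphism K A X M (\<psi> \<bullet> \<phi>) P"
  unfolding tangent_two_morphism_iff
  using tangent_Cell[OF assms(1)] tangent_Cell[OF assms(2)]
    lax_Cell'[of M] lax_Cell'[of N] lax_Cell'[of P] by simp

lemma tangent_id:
  assumes "lax_tangent_morphism K A X M"
  shows "tangent_two_morphism K A X M (id2 K (fst M)) M"
  unfolding tangent_two_morphism_def using lax_Cell'[OF assms] assms by (simp add: hom2_iff)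

lemma lax_hom_simps [simp]:
  "M \<in> Ob L \<longleftrightarrow> lax_tangent_morphism K A X M"
  "(M, \<phi>, N) \<in> Ar L \<longleftrightarrow> tangent_two_morphism K A X M \<phi> N"
  "Dom L (M, \<phi>, N) = M" "Cod L (M, \<phi>, N) = N" "Idn L M = (M, id2 K (fst M), M)"
  "(N', \<psi>, P) \<cdot>\<^bsub>L\<^esub> (M, \<phi>, N) = (M, \<psi> \<bullet> \<phi>, P)"
  "Tob L M = lax_tan K X M" "Tar L (M, \<phi>, N) = (lax_tan K X M, tan X \<rhd> \<phi>, lax_tan K X N)"
  "T2ob L M = lax_tan2 K A X M"
  "pr1 L M = (lax_tan2 K A X M, prA X \<lhd> fst M, lax_tan K X M)"
  "pr2 L M = (lax_tan2 K A X M, prB X \<lhd> fst M, lax_tan K X M)"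
  "pt L M = (lax_tan K X M, prj X \<lhd> fst M, M)"
  "zt L M = (M, zer X \<lhd> fst M, lax_tan K X M)"
  "st L M = (lax_tan2 K A X M, pls X \<lhd> fst M, lax_tan K X M)"
  "lt L M = (lax_tan K X M, lft X \<lhd> fst M, lax_tan K X (lax_tan K X M))"
  "ct L M = (lax_tan K X (lax_tan K X M), flp X \<lhd> fst M, lax_tan K X (lax_tan K X M))"
  by (simp_all add: lax_hom_def)

lemma fst_lax_tan [simp]:
  "fst (lax_tan K X M) = tan X \<odot> fst M" "fst (lax_tan2 K A X M) = tan2 X \<odot> fst M"
  by (simp_all add: lax_tan_def lax_tan2_def split: prod.splits)

lemma category_lax_hom: "category L"
proof (unfold_locales, goal_cases)
  case (1 f) then show ?case by (cases f) (simp add: tangent_Cell)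
next
  case (2 f) then show ?case by (cases f) (simp add: tangent_Cell)
next
  case (3 M) then show ?case by (simp add: Hom_iff tangent_id)
next
  case (4 f M N g P) then show ?case by (cases f; cases g) (auto simp: Hom_iff intro: tangent_comp)
next
  case (5 f M N) then show ?case by (cases f) (auto simp: Hom_iff tangent_Cell)
next
  case (6 f M N) then show ?case by (cases f) (auto simp: Hom_iff tangent_Cell)
next
  case (7 f M N g P h Q) then show ?case 
    by (cases f; cases g; cases h) (auto simp: Hom_iff tangent_Cell intro!: vcomp_assoc)
qed

lemma tangent_T:
  assumes "tangent_two_morphism K A X M \<phi> N"
  shows "tangent_two_morphism K A X (lax_tan K X M) (tan X \<rhd> \<phi>) (lax_tan K X N)"
proof -
  obtain F \<alpha> G \<beta> where M: "M = (F, \<alpha>)" "N = (G, \<beta>)" by (cases M; cases N)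
  note t = tangent_Cell[OF assms]
  note [simp] = lax_Cell[OF t(5)[unfolded M]] lax_Cell[OF t(6)[unfolded M]] t(1-3)[unfolded M fst_conv]
  have "(tan X \<rhd> \<phi>) \<bullet> \<alpha> = \<beta> \<bullet> (\<phi> \<lhd> tan A)"
    using assms by (simp add: M tangent_two_morphism_def)
  from arg_cong[OF this, of "\<lambda>\<phi>. tan X \<rhd> \<phi>"]
  have e: "(tan X \<rhd> tan X \<rhd> \<phi>) \<bullet> (tan X \<rhd> \<alpha>) = (tan X \<rhd> \<beta>) \<bullet> (tan X \<rhd> (\<phi> \<lhd> tan A))"
    by simp
  note e = act_cong2[OF this, of "base A" X, simplified]
  note c = act_exchange[of "flp X" "tan X \<odot> tan X" "tan X \<odot> tan X" \<phi> F G "base A" X, simplified, symmetric]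
  show ?thesis
    unfolding tangent_two_morphism_iff
    using lax_tan_lax[OF t(5)] lax_tan_lax[OF t(6)]
    by (simp add: M lax_tan_def hom1_iff e c)
qed

lemma tangent_T2:
  assumes "tangent_two_morphism K A X M \<phi> N"
  shows "tangent_two_morphism K A X (lax_tan2 K A X M) (tan2 X \<rhd> \<phi>) (lax_tan2 K A X N)"
proof -
  obtain F \<alpha> G \<beta> where M: "M = (F, \<alpha>)" "N = (G, \<beta>)" by (cases M; cases N)
  note t = tangent_Cell[OF assms]
  note [simp] = lax_Cell[OF t(5)[unfolded M]] lax_Cell[OF t(6)[unfolded M]] t(1-3)[unfolded M fst_conv]
  have "(tan X \<rhd> \<phi>) \<bullet> \<alpha> = \<beta> \<bullet> (\<phi> \<lhd> tan A)"
    using assms by (simp add: M tangent_two_morphism_def)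
  from arg_cong[OF this, of "\<lambda>\<phi>. tan2 X \<rhd> \<phi>"]
  have e: "(tan2 X \<rhd> tan X \<rhd> \<phi>) \<bullet> (tan2 X \<rhd> \<alpha>) = (tan2 X \<rhd> \<beta>) \<bullet> (tan2 X \<rhd> (\<phi> \<lhd> tan A))"
    by simp
  note e = act_cong2[OF this, of "base A" X, simplified]
  interpret F: tangent_fold H 2 D.T2o D.T2 "\<lambda>i M. if i = 0 then D.a M else D.b M" "\<lambda>M. D.p M \<cdot>\<^bsub>H\<^esub> D.a M" D.T2sg
    by (rule D.fold_T2)
  have n: "act H (tan X \<rhd> tan2 X \<rhd> \<phi>) (act H (D.T2sg F) x) = act H (D.T2sg G) (act H (tan2 X \<rhd> tan X \<rhd> \<phi>) x)" for x
    using F.F.sg_act[of \<phi> F x] by (simp add: hom1_iff T2_Cell)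
  note [simp] = T2sg_Cell
  show ?thesis
    unfolding tangent_two_morphism_iff
    using lax_tan2_lax[OF t(5)] lax_tan2_lax[OF t(6)]
    by (simp add: M lax_tan2_eq[OF t(5)[unfolded M]] lax_tan2_eq[OF t(6)[unfolded M]] e n)
qed

text \<open>A structure map at \<open>F\<close> commutes with the law of \<open>F\<close> by interchange, and with the comparisons of
  \<open>id\<close>, \<open>T\<close>, \<open>T\<^sub>2\<close>, \<open>T \<circ> T\<close> for the same reason as it is a connection morphism.\<close>

lemma tangent_structure:
  assumes L: "lax_tangent_morphism K A X M"
  shows "tangent_two_morphism K A X (lax_tan2 K A X M) (prA X \<lhd> fst M) (lax_tan K X M)"
    "tangent_two_morphism K A X (lax_tan2 K A X M) (prB X \<lhd> fst M) (lax_tan K X M)"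
    "tangent_two_morphism K A X (lax_tan K X M) (prj X \<lhd> fst M) M"
    "tangent_two_morphism K A X M (zer X \<lhd> fst M) (lax_tan K X M)"
    "tangent_two_morphism K A X (lax_tan2 K A X M) (pls X \<lhd> fst M) (lax_tan K X M)"
    "tangent_two_morphism K A X (lax_tan K X M) (lft X \<lhd> fst M) (lax_tan K X (lax_tan K X M))"
    "tangent_two_morphism K A X (lax_tan K X (lax_tan K X M)) (flp X \<lhd> fst M) (lax_tan K X (lax_tan K X M))"
proof -
  obtain F \<alpha> where M: "M = (F, \<alpha>)" by (cases M)
  note [simp] = lax_Cell[OF L[unfolded M]]
  have [simp]: "F \<in> hom1 K (base A) (base X)" "F \<odot> tan A \<in> hom1 K (base A) (base X)"
    "tan X \<odot> F \<in> hom1 K (base A) (base X)"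
    by (simp_all add: hom1_iff)
  note [simp] = T2sg_Cell
  note L1 = lax_tan_lax[OF L] and L2 = lax_tan2_lax[OF L]
  note L11 = lax_tan_lax[OF L1]
  note def = M lax_tan_def lax_tan2_eq[OF L[unfolded M]]
  note ex = act_exchange[of "prA X" "tan2 X" "tan X" \<alpha> "F \<odot> tan A" "tan X \<odot> F" "base A" X, simplified]
    act_exchange[of "prB X" "tan2 X" "tan X" \<alpha> "F \<odot> tan A" "tan X \<odot> F" "base A" X, simplified]
    act_exchange[of "pls X" "tan2 X" "tan X" \<alpha> "F \<odot> tan A" "tan X \<odot> F" "base A" X, simplified]
    act_exchange[of "prj X" "tan X" "id1 K (base X)" \<alpha> "F \<odot> tan A" "tan X \<odot> F" "base A" X, simplified]
    act_exchange[of "zer X" "id1 K (base X)" "tan X" \<alpha> "F \<odot> tan A" "tan X \<odot> F" "base A" X, simplified]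
    act_exchange[of "lft X" "tan X" "tan X \<odot> tan X" \<alpha> "F \<odot> tan A" "tan X \<odot> F" "base A" X, simplified, symmetric]
    act_exchange[of "flp X" "tan X \<odot> tan X" "tan X \<odot> tan X" \<alpha> "F \<odot> tan A" "tan X \<odot> F" "base A" X, simplified]
  note sa = D.structure_act[of F, simplified] D.T2sg_Ar(4,5)[of F, simplified] D.Tp_c[of F, simplified]
    D.cTcl_act[of F, simplified] D.braid_act[of F, simplified]
    D.s_tangent[of F, simplified, THEN act_cong2[of _ _ "base A" X], simplified]
    D.z_tangent[of F, simplified, THEN act_cong2[of _ _ "base A" X], simplified]
  show "tangent_two_morphism K A X (lax_tan2 K A X M) (prA X \<lhd> fst M) (lax_tan K X M)"
    "tangent_two_morphism K A X (lax_tan2 K A X M) (prB X \<lhd> fst M) (lax_tan K X M)"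
    "tangent_two_morphism K A X (lax_tan K X M) (prj X \<lhd> fst M) M"
    "tangent_two_morphism K A X M (zer X \<lhd> fst M) (lax_tan K X M)"
    "tangent_two_morphism K A X (lax_tan2 K A X M) (pls X \<lhd> fst M) (lax_tan K X M)"
    "tangent_two_morphism K A X (lax_tan K X M) (lft X \<lhd> fst M) (lax_tan K X (lax_tan K X M))"
    "tangent_two_morphism K A X (lax_tan K X (lax_tan K X M)) (flp X \<lhd> fst M) (lax_tan K X (lax_tan K X M))"
    unfolding tangent_two_morphism_iff using L L1 L2 L11 by (simp_all add: def ex sa)
qed

end

context tangentad_pair
begin

lemma lax_hom_pow:
  "(Tob L ^^ m) M = (lax_tan K X ^^ m) M"
  "(Tar L ^^ m) (M, \<phi>, N) = ((lax_tan K X ^^ m) M, (Tar H ^^ m) \<phi>, (lax_tan K X ^^ m) N)"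
  "fst ((lax_tan K X ^^ m) M) = (Tob H ^^ m) (fst M)"
  by (induction m) simp_all

lemma lax_tan_pow_lax: "lax_tangent_morphism K A X M \<Longrightarrow> lax_tangent_morphism K A X ((lax_tan K X ^^ m) M)"
  by (induction m) (simp_all add: lax_tan_lax)

lemma tangent_pow:
  assumes "tangent_two_morphism K A X M \<phi> N"
  shows "tangent_two_morphism K A X ((lax_tan K X ^^ m) M) ((Tar H ^^ m) \<phi>) ((lax_tan K X ^^ m) N)"
  using assms by (induction m) (auto dest: tangent_T)

text \<open>The condition on \<open>w\<close> is an equation of 2-cells into \<open>T Z\<close>, so it may be checked after
  composition with the images under \<open>T\<close> of two 2-cells, if those are jointly monic.\<close>

lemma tangent_reflect:
  assumes Q: "lax_tangent_morphism K A X Q" and a: "tangent_two_morphism K A X Z a Z1"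
    and b: "tangent_two_morphism K A X Z b Z1"
    and w [simp]: "w \<in> Cell2 K" "dom2 K w = fst Q" "cod2 K w = fst Z"
    and aw: "tangent_two_morphism K A X Q (a \<bullet> w) Z1" and bw: "tangent_two_morphism K A X Q (b \<bullet> w) Z1"
    and mono: "\<And>u v. u \<in> Cell2 K \<Longrightarrow> v \<in> Cell2 K \<Longrightarrow> dom2 K u = dom2 K v \<Longrightarrow> dom2 K u = fst Q \<odot> tan A \<Longrightarrow>
      cod2 K u = tan X \<odot> fst Z \<Longrightarrow> cod2 K v = tan X \<odot> fst Z \<Longrightarrow>
      (tan X \<rhd> a) \<bullet> u = (tan X \<rhd> a) \<bullet> v \<Longrightarrow> (tan X \<rhd> b) \<bullet> u = (tan X \<rhd> b) \<bullet> v \<Longrightarrow> u = v"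
  shows "tangent_two_morphism K A X Q w Z"
proof -
  note ta = tangent_Cell[OF a] and tb = tangent_Cell[OF b]
  note [simp] = ta(1-3) tb(1-3) lax_Cell'[OF Q] lax_Cell'[OF ta(5)] lax_Cell'[OF ta(6)]
  note e = ta(7) tb(7) tangent_Cell(7)[OF aw, simplified] tangent_Cell(7)[OF bw, simplified]
  have "(tan X \<rhd> w) \<bullet> snd Q = snd Z \<bullet> (w \<lhd> tan A)"
  proof (rule mono)
    show "(tan X \<rhd> a) \<bullet> (tan X \<rhd> w) \<bullet> snd Q = (tan X \<rhd> a) \<bullet> snd Z \<bullet> (w \<lhd> tan A)"
      by (rule act_ext2[of _ _ "base A" X]) (simp_all add: e)
    show "(tan X \<rhd> b) \<bullet> (tan X \<rhd> w) \<bullet> snd Q = (tan X \<rhd> b) \<bullet> snd Z \<bullet> (w \<lhd> tan A)"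
      by (rule act_ext2[of _ _ "base A" X]) (simp_all add: e)
  qed simp_all
  then show ?thesis
    using Q ta(5) by (simp add: tangent_two_morphism_def hom2_iff)
qed

text \<open>The pairing is formed in the hom-category; it is a tangent 2-morphism because its two projections
  are, and because \<open>T\<close> preserves the pullback once more.\<close>

lemma lax_hom_pullback:
  assumes M: "lax_tangent_morphism K A X M"
  shows "is_pullback L ((Tar L ^^ m) (pt L M)) ((Tar L ^^ m) (pt L M)) ((Tob L ^^ m) (T2ob L M))
    ((Tar L ^^ m) (pr1 L M)) ((Tar L ^^ m) (pr2 L M))"
proof -
  note [simp] = lax_Cell'[OF M]
  have F: "fst M \<in> Ob H"
    by (simp add: hom1_iff)
  note P = D.T2_pullback[OF F, of m, simplified]
  note P' = D.T2_pullback[OF F, of "Suc m", simplified]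
  let ?Tm = "Tar H ^^ m" and ?Lm = "lax_tan K X ^^ m"
  note t = tangent_structure(1-3)[OF M, THEN tangent_pow, of m]
  note tc = t[THEN tangent_Cell(1)] t[THEN tangent_Cell(2)] t[THEN tangent_Cell(3)]
  have eq: "?Tm (prj X \<lhd> fst M) \<bullet> ?Tm (prA X \<lhd> fst M) = ?Tm (prj X \<lhd> fst M) \<bullet> ?Tm (prB X \<lhd> fst M)"
    using D.pullback_Ar(10)[OF P] by simp
  show ?thesis
    unfolding is_pullback_def
  proof (intro conjI allI impI)
    fix Q u v
    assume H: "u \<in> Hom L Q (Dom L ((Tar L ^^ m) (pt L M))) \<and> v \<in> Hom L Q (Dom L ((Tar L ^^ m) (pt L M))) \<and>
      (Tar L ^^ m) (pt L M) \<cdot>\<^bsub>L\<^esub> u = (Tar L ^^ m) (pt L M) \<cdot>\<^bsub>L\<^esub> v"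
    obtain u' v' where uv: "u = (Q, u', ?Lm (lax_tan K X M))" "v = (Q, v', ?Lm (lax_tan K X M))"
      and u: "tangent_two_morphism K A X Q u' (?Lm (lax_tan K X M))"
      and v: "tangent_two_morphism K A X Q v' (?Lm (lax_tan K X M))"
      and e: "?Tm (prj X \<lhd> fst M) \<bullet> u' = ?Tm (prj X \<lhd> fst M) \<bullet> v'"
      using H by (cases u; cases v) (auto simp: Hom_iff lax_hom_pow)
    note Q = tangent_Cell(5)[OF u]
    note [simp] = lax_Cell'[OF Q] tangent_Cell(1-3)[OF u] tangent_Cell(1-3)[OF v]
    have "\<exists>!w. w \<in> Hom H (fst Q) ((Tob H ^^ m) (tan2 X \<odot> fst M)) \<and>
        ?Tm (prA X \<lhd> fst M) \<cdot>\<^bsub>H\<^esub> w = u' \<and> ?Tm (prB X \<lhd> fst M) \<cdot>\<^bsub>H\<^esub> w = v'"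
      by (rule D.pullback_univ[OF P])
        (use e tangent_Cell(4)[OF u] tangent_Cell(4)[OF v] tc in \<open>simp_all add: Hom_iff lax_hom_pow(3)\<close>)
    then obtain w where w: "w \<in> Hom H (fst Q) ((Tob H ^^ m) (tan2 X \<odot> fst M)) \<and>
        ?Tm (prA X \<lhd> fst M) \<bullet> w = u' \<and> ?Tm (prB X \<lhd> fst M) \<bullet> w = v'"
      and un: "\<forall>w'. w' \<in> Hom H (fst Q) ((Tob H ^^ m) (tan2 X \<odot> fst M)) \<and>
        ?Tm (prA X \<lhd> fst M) \<bullet> w' = u' \<and> ?Tm (prB X \<lhd> fst M) \<bullet> w' = v' \<longrightarrow> w' = w"
      unfolding hom_tcat_simps(5) by (elim ex1E)
    have wT: "tangent_two_morphism K A X Q w (?Lm (lax_tan2 K A X M))"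
    proof (rule tangent_reflect[OF Q t(1) t(2)])
      show "x = y" if "x \<in> Cell2 K" "y \<in> Cell2 K" "dom2 K x = dom2 K y" "dom2 K x = fst Q \<odot> tan A"
        "cod2 K x = tan X \<odot> fst (?Lm (lax_tan2 K A X M))" "cod2 K y = tan X \<odot> fst (?Lm (lax_tan2 K A X M))"
        "(tan X \<rhd> ?Tm (prA X \<lhd> fst M)) \<bullet> x = (tan X \<rhd> ?Tm (prA X \<lhd> fst M)) \<bullet> y"
        "(tan X \<rhd> ?Tm (prB X \<lhd> fst M)) \<bullet> x = (tan X \<rhd> ?Tm (prB X \<lhd> fst M)) \<bullet> y" for x y
      proof -
        have y: "src K (dom2 K y) = base A" "tgt K (dom2 K y) = base X"
          unfolding that(3)[symmetric] that(4) by simp_all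
        show ?thesis
        by (rule D.pullback_eqI[OF P'])
          (use y that(1-3,5-) lax_Cell'[OF lax_tan_pow_lax[OF lax_tan2_lax[OF M]], of m] in
            \<open>simp_all add: lax_hom_pow(3) hom1_iff\<close>)
      qed
    qed (use w u v in \<open>simp_all add: Hom_iff lax_hom_pow\<close>)
    show "\<exists>!w. w \<in> Hom L Q ((Tob L ^^ m) (T2ob L M)) \<and> (Tar L ^^ m) (pr1 L M) \<cdot>\<^bsub>L\<^esub> w = u \<and>
      (Tar L ^^ m) (pr2 L M) \<cdot>\<^bsub>L\<^esub> w = v"
    proof (rule ex1I[of _ "(Q, w, ?Lm (lax_tan2 K A X M))"])
      show "(Q, w, ?Lm (lax_tan2 K A X M)) \<in> Hom L Q ((Tob L ^^ m) (T2ob L M)) \<and>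
          (Tar L ^^ m) (pr1 L M) \<cdot>\<^bsub>L\<^esub> (Q, w, ?Lm (lax_tan2 K A X M)) = u \<and>
          (Tar L ^^ m) (pr2 L M) \<cdot>\<^bsub>L\<^esub> (Q, w, ?Lm (lax_tan2 K A X M)) = v"
        using w wT by (simp add: Hom_iff lax_hom_pow uv)
    next
      fix W
      assume W: "W \<in> Hom L Q ((Tob L ^^ m) (T2ob L M)) \<and> (Tar L ^^ m) (pr1 L M) \<cdot>\<^bsub>L\<^esub> W = u \<and>
        (Tar L ^^ m) (pr2 L M) \<cdot>\<^bsub>L\<^esub> W = v"
      obtain Q' w' Z where WW: "W = (Q', w', Z)" by (cases W)
      have W': "Q' = Q" "Z = ?Lm (lax_tan2 K A X M)" "tangent_two_morphism K A X Q w' (?Lm (lax_tan2 K A X M))"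
        "?Tm (prA X \<lhd> fst M) \<bullet> w' = u'" "?Tm (prB X \<lhd> fst M) \<bullet> w' = v'"
        using W by (auto simp: WW Hom_iff lax_hom_pow uv)
      have "w' = w"
        by (rule un[rule_format]) (use W' tangent_Cell(1-4)[OF W'(3)] in \<open>simp add: Hom_iff lax_hom_pow(3)\<close>)
      then show "W = (Q, w, ?Lm (lax_tan2 K A X M))"
        by (simp add: WW W')
    qed
  qed (use t eq in \<open>simp_all add: Hom_iff lax_hom_pow\<close>)
qed

interpretation Lc: category L by (rule category_lax_hom)

lemma T2ar_lax_hom:
  assumes f: "tangent_two_morphism K A X M \<phi> N"
  shows "T2ar L (M, \<phi>, N) = (lax_tan2 K A X M, tan2 X \<rhd> \<phi>, lax_tan2 K A X N)"
proof -
  note t = tangent_Cell[OF f]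
  note [simp] = t(1-3) lax_Cell'[OF t(5)] lax_Cell'[OF t(6)]
  show ?thesis
    unfolding T2ar_def into_T2_def lax_hom_simps
    by (rule Lc.pairing_eqI[OF lax_hom_pullback[OF t(6), of 0, simplified]])
      (use f t in \<open>simp_all add: tangent_T2 whisk_exchange\<close>)
qed

lemma into_T2_lax_hom:
  assumes M: "lax_tangent_morphism K A X M" and u: "tangent_two_morphism K A X Q u (lax_tan K X M)"
    and v: "tangent_two_morphism K A X Q v (lax_tan K X M)" and e: "(prj X \<lhd> fst M) \<bullet> u = (prj X \<lhd> fst M) \<bullet> v"
  shows "into_T2 L M (Q, u, lax_tan K X M) (Q, v, lax_tan K X M) =
    (Q, into_T2 H (fst M) u v, lax_tan2 K A X M)"
proof -
  note [simp] = lax_Cell'[OF M]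
  let ?w = "into_T2 L M (Q, u, lax_tan K X M) (Q, v, lax_tan K X M)"
  note P = Lc.pairing_pullback[OF lax_hom_pullback[OF M, of 0, simplified],
      of "(Q, u, lax_tan K X M)" "(Q, v, lax_tan K X M)", simplified, OF u v e]
  obtain Q' w Z where w: "?w = (Q', w, Z)" by (cases ?w)
  have W: "Q' = Q" "Z = lax_tan2 K A X M" "tangent_two_morphism K A X Q w (lax_tan2 K A X M)"
    "(prA X \<lhd> fst M) \<bullet> w = u" "(prB X \<lhd> fst M) \<bullet> w = v"
    using P w unfolding into_T2_def by auto
  have "into_T2 H (fst M) u v = w"
    by (rule D.into_T2_eqI) (use W tangent_Cell(1-4)[OF W(3)] in \<open>simp_all add: hom1_iff\<close>)
  then show ?thesis
    by (simp add: w W)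
qed

text \<open>Typing is the only new aspect: the equations hold in the hom-category, and pairings are computed
  there.\<close>

theorem tangent_calculus_lax_hom: "tangent_calculus L"
proof (rule tangent_calculus.intro[OF category_lax_hom tangent_calculus_axioms.intro], goal_cases)
  case (1 M) then show ?case by (simp add: lax_tan_lax)
next
  case (2 M) then show ?case by (simp add: lax_tan2_lax)
next
  case (3 f M N) then show ?case by (cases f) (auto simp: Hom_iff tangent_T)
next
  case (4 M) then show ?case by (simp add: lax_Cell')
next
  case (5 f M N g P) then show ?case
    by (cases f; cases g) (auto simp: Hom_iff tangent_Cell lax_Cell')
next
  case (6 M) then show ?case by (simp add: Hom_iff tangent_structure)
next
  case (7 M) then show ?case by (simp add: Hom_iff tangent_structure)
next
  case (8 M) then show ?case by (simp add: Hom_iff tangent_structure)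
next
  case (9 M) then show ?case by (simp add: Hom_iff tangent_structure)
next
  case (10 M) then show ?case by (simp add: Hom_iff tangent_structure)
next
  case (11 M) then show ?case by (simp add: Hom_iff tangent_structure)
next
  case (12 M) then show ?case by (simp add: Hom_iff tangent_structure)
next
  case (13 M m) then show ?case by (intro lax_hom_pullback) simp
next
  case (14 f M N)
  then obtain \<phi> where f: "f = (M, \<phi>, N)" "tangent_two_morphism K A X M \<phi> N" by (cases f) (auto simp: Hom_iff)
  show ?case using D.p_nat[of \<phi> "fst M" "fst N"] tangent_Cell[OF f(2)] by (simp add: f Hom_iff)
next
  case (15 f M N)
  then obtain \<phi> where f: "f = (M, \<phi>, N)" "tangent_two_morphism K A X M \<phi> N" by (cases f) (auto simp: Hom_iff)
  show ?case using D.z_nat[of \<phi> "fst M" "fst N"] tangent_Cell[OF f(2)] by (simp add: f Hom_iff)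
next
  case (16 f M N)
  then obtain \<phi> where f: "f = (M, \<phi>, N)" "tangent_two_morphism K A X M \<phi> N" by (cases f) (auto simp: Hom_iff)
  show ?case using D.s_nat[of \<phi> "fst M" "fst N"] tangent_Cell[OF f(2)]
    by (simp add: f Hom_iff T2ar_lax_hom[OF f(2)] T2_Cell del: hom_tcat_simps(6))
next
  case (17 f M N)
  then obtain \<phi> where f: "f = (M, \<phi>, N)" "tangent_two_morphism K A X M \<phi> N" by (cases f) (auto simp: Hom_iff)
  show ?case using D.l_nat[of \<phi> "fst M" "fst N"] tangent_Cell[OF f(2)] by (simp add: f Hom_iff)
next
  case (18 f M N)
  then obtain \<phi> where f: "f = (M, \<phi>, N)" "tangent_two_morphism K A X M \<phi> N" by (cases f) (auto simp: Hom_iff)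
  show ?case using D.c_nat[of \<phi> "fst M" "fst N"] tangent_Cell[OF f(2)] by (simp add: f Hom_iff)
next
  case (19 M) then show ?case using D.p_z[of "fst M"] by (simp add: lax_Cell' hom1_iff)
next
  case (20 M) then show ?case using D.p_s[of "fst M"] by (simp add: lax_Cell' hom1_iff)
next
  case (21 M)
  then have M: "lax_tangent_morphism K A X M" by simp
  note [simp] = lax_Cell'[OF M]
  have e: "(prj X \<lhd> fst M) \<bullet> (zer X \<lhd> fst M) \<bullet> (prj X \<lhd> fst M) = (prj X \<lhd> fst M) \<bullet> id2 K (tan X \<odot> fst M)"
    by (rule act_ext2[of _ _ "base A" X]) (simp_all add: D.structure_act[of "fst M", simplified] hom1_iff
        D.act_Idn(1)[of "prj X \<lhd> fst M" "fst M", simplified])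
  have t: "tangent_two_morphism K A X (lax_tan K X M) ((zer X \<lhd> fst M) \<bullet> (prj X \<lhd> fst M)) (lax_tan K X M)"
    "tangent_two_morphism K A X (lax_tan K X M) (id2 K (tan X \<odot> fst M)) (lax_tan K X M)"
    using tangent_comp[OF tangent_structure(3)[OF M] tangent_structure(4)[OF M]] tangent_id[OF lax_tan_lax[OF M]]
    by simp_all
  show ?case
    using D.s_unit[of "fst M"] by (simp add: into_T2_lax_hom[OF M t e] hom1_iff)
next
  case (22 M) then show ?case using D.Tp_l[of "fst M"] by (simp add: lax_Cell' hom1_iff)
next
  case (23 M) then show ?case using D.p_c[of "fst M"] by (simp add: lax_Cell' hom1_iff)
next
  case (24 M) then show ?case using D.c_Tz[of "fst M"] by (simp add: lax_Cell' hom1_iff)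
next
  case (25 M)
  then have M: "lax_tangent_morphism K A X M" by simp
  note [simp] = lax_Cell'[OF M]
  have F [simp]: "fst M \<in> hom1 K (base A) (base X)" by (simp add: hom1_iff)
  let ?u = "(flp X \<lhd> fst M) \<bullet> (tan X \<rhd> (prA X \<lhd> fst M))" and ?v = "(flp X \<lhd> fst M) \<bullet> (tan X \<rhd> (prB X \<lhd> fst M))"
  have e: "(prj X \<lhd> fst (lax_tan K X M)) \<bullet> ?u = (prj X \<lhd> fst (lax_tan K X M)) \<bullet> ?v"
    by (simp, rule act_ext2[of _ _ "base A" X])
      (simp_all add: D.structure_act[of "fst M", simplified] D.T_structure_act[of "fst M", simplified])
  have t: "tangent_two_morphism K A X (lax_tan K X (lax_tan2 K A X M)) ?u (lax_tan K X (lax_tan K X M))"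
     "tangent_two_morphism K A X (lax_tan K X (lax_tan2 K A X M)) ?v (lax_tan K X (lax_tan K X M))"
    using tangent_structure[OF M] by (auto intro: tangent_comp tangent_T)
  show ?case
    using D.c_Ts[of "fst M"] into_T2_lax_hom[OF lax_tan_lax[OF M] t e] by simp
next
  case (26 M) then show ?case using D.c_l[of "fst M"] by (simp add: lax_Cell' hom1_iff)
next
  case (27 M) then show ?case using D.cTcl[of "fst M"] by (simp add: lax_Cell' hom1_iff)
next
  case (28 M) then show ?case using D.c_c[of "fst M"] by (simp add: lax_Cell' hom1_iff)
next
  case (29 M) then show ?case using D.c_braid[of "fst M"] by (simp add: lax_Cell' hom1_iff)
qed

text \<open>Forgetting the distributive laws reduces statements about connections on lax tangent morphisms
  to statements about connections on 1-morphisms.\<close>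

abbreviation "cell \<equiv> \<lambda>f. fst (snd f)"

theorem underlying_strict: "strict_faithful_functor L H fst cell"
proof -
  interpret L: tangent_calculus L by (rule tangent_calculus_lax_hom)
  show ?thesis
  proof (unfold_locales, goal_cases)
    case (1 M) then show ?case by (simp add: lax_Cell' hom1_iff)
  next
    case (2 f M N)
    then obtain \<phi> where f: "f = (M, \<phi>, N)" "tangent_two_morphism K A X M \<phi> N" by (cases f) (auto simp: Hom_iff)
    then show ?case using tangent_Cell[OF f(2)] by (simp add: Hom_iff)
  next
    case (4 f M N g P) then show ?case by (cases f; cases g) (auto simp: Hom_iff)
  next
    case (7 f) then show ?case by (cases f) simp
  next
    case (15 f g) then show ?case by (cases f; cases g) simp
  qed simp_all
qed

end

section \<open>The object of affine connections\<close>

subsection \<open>Equifiers as full subobjects\<close>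

text \<open>
  The 1-morphism \<open>e\<close> exhibits \<open>E\<close> as the full subobject of \<open>B\<close> on the 1-morphisms satisfying \<open>\<Phi>\<close>. An
  equifier has this property with \<open>\<Phi>\<close> the equation it imposes, and the property composes: a tower of
  equifiers is the full subobject for the conjunction of the imposed equations.
\<close>

definition full_sub :: "('o, 'm, 'c) two_cat \<Rightarrow> 'o \<Rightarrow> 'o \<Rightarrow> 'm \<Rightarrow> ('m \<Rightarrow> bool) \<Rightarrow> bool" where
  "full_sub K E B e \<Phi> \<longleftrightarrow> e \<in> hom1 K E B \<and>
     (\<forall>Y. \<forall>H \<in> hom1 K Y E. \<Phi> (e \<odot>\<^bsub>K\<^esub> H)) \<and>
     (\<forall>Y. \<forall>H \<in> hom1 K Y B. \<Phi> H \<longrightarrow> (\<exists>H' \<in> hom1 K Y E. e \<odot>\<^bsub>K\<^esub> H' = H)) \<and>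
     (\<forall>Y. \<forall>H \<in> hom1 K Y E. \<forall>J \<in> hom1 K Y E. e \<odot>\<^bsub>K\<^esub> H = e \<odot>\<^bsub>K\<^esub> J \<longrightarrow> H = J) \<and>
     (\<forall>Y. \<forall>H \<in> hom1 K Y E. \<forall>J \<in> hom1 K Y E. \<forall>\<theta> \<in> hom2 K (e \<odot>\<^bsub>K\<^esub> H) (e \<odot>\<^bsub>K\<^esub> J).
        \<exists>\<theta>' \<in> hom2 K H J. e \<rhd>\<^bsub>K\<^esub> \<theta>' = \<theta>) \<and>
     (\<forall>Y. \<forall>H \<in> hom1 K Y E. \<forall>J \<in> hom1 K Y E. \<forall>\<theta> \<in> hom2 K H J. \<forall>\<theta>' \<in> hom2 K H J.
        e \<rhd>\<^bsub>K\<^esub> \<theta> = e \<rhd>\<^bsub>K\<^esub> \<theta>' \<longrightarrow> \<theta> = \<theta>')"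

lemma full_subD:
  assumes "full_sub K E B e \<Phi>"
  shows "e \<in> hom1 K E B" "H \<in> hom1 K Y E \<Longrightarrow> \<Phi> (e \<odot>\<^bsub>K\<^esub> H)"
    "H \<in> hom1 K Y B \<Longrightarrow> \<Phi> H \<Longrightarrow> \<exists>H' \<in> hom1 K Y E. e \<odot>\<^bsub>K\<^esub> H' = H"
    "H \<in> hom1 K Y E \<Longrightarrow> J \<in> hom1 K Y E \<Longrightarrow> e \<odot>\<^bsub>K\<^esub> H = e \<odot>\<^bsub>K\<^esub> J \<Longrightarrow> H = J"
    "H \<in> hom1 K Y E \<Longrightarrow> J \<in> hom1 K Y E \<Longrightarrow> \<theta> \<in> hom2 K (e \<odot>\<^bsub>K\<^esub> H) (e \<odot>\<^bsub>K\<^esub> J) \<Longrightarrow>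
      \<exists>\<theta>' \<in> hom2 K H J. e \<rhd>\<^bsub>K\<^esub> \<theta>' = \<theta>"
    "H \<in> hom1 K Y E \<Longrightarrow> J \<in> hom1 K Y E \<Longrightarrow> \<theta> \<in> hom2 K H J \<Longrightarrow> \<theta>' \<in> hom2 K H J \<Longrightarrow>
        e \<rhd>\<^bsub>K\<^esub> \<theta> = e \<rhd>\<^bsub>K\<^esub> \<theta>' \<Longrightarrow> \<theta> = \<theta>'"
  using assms unfolding full_sub_def by blast+

lemma ex1_unique: "\<exists>!x. P x \<Longrightarrow> P x \<Longrightarrow> P y \<Longrightarrow> x = y"
  by (elim ex1E) metis

context two_category
begin

lemma hom2_lwhisk: "F \<in> hom1 K B C \<Longrightarrow> \<phi> \<in> hom2 K G H \<Longrightarrow> G \<in> hom1 K A B \<Longrightarrow> F \<rhd> \<phi> \<in> hom2 K (F \<odot> G) (F \<odot> H)"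
  by (auto simp: hom1_iff hom2_iff)

lemma equifier_full_sub:
  assumes eq: "is_equifier K (\<phi>, \<psi>) E e" and B: "src K (dom2 K \<phi>) = B"
  shows "full_sub K E B e (\<lambda>H. \<phi> \<lhd> H = \<psi> \<lhd> H)"
proof -
  have ty: "\<phi> \<in> Cell2 K" "\<psi> \<in> hom2 K (dom2 K \<phi>) (cod2 K \<phi>)" "e \<in> hom1 K E B" "\<phi> \<lhd> e = \<psi> \<lhd> e"
    and e1: "W \<in> hom1 K Y B \<Longrightarrow> \<phi> \<lhd> W = \<psi> \<lhd> W \<Longrightarrow> \<exists>!H. H \<in> hom1 K Y E \<and> e \<odot> H = W"
    and e2: "H \<in> hom1 K Y E \<Longrightarrow> J \<in> hom1 K Y E \<Longrightarrow> \<theta> \<in> hom2 K (e \<odot> H) (e \<odot> J) \<Longrightarrow>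
        \<exists>!\<theta>'. \<theta>' \<in> hom2 K H J \<and> e \<rhd> \<theta>' = \<theta>" for W Y H J \<theta>
    using eq unfolding is_equifier_def B prod.case by blast+
  note [simp] = ty(1) ty(2)[unfolded hom2_iff] ty(3)[unfolded hom1_iff]
  have Phi: "\<phi> \<lhd> (e \<odot> H) = \<psi> \<lhd> (e \<odot> H)" if "H \<in> hom1 K Y E" for Y H
  proof -
    have "(\<phi> \<lhd> e) \<lhd> H = (\<psi> \<lhd> e) \<lhd> H"
      by (simp only: ty(4))
    then show ?thesis
      using that B by (simp add: hom1_iff)
  qed
  show ?thesis
    unfolding full_sub_def
  proof (intro conjI allI ballI impI)
    show "\<exists>H'\<in>hom1 K Y E. e \<odot> H' = H" if "H \<in> hom1 K Y B" "\<phi> \<lhd> H = \<psi> \<lhd> H" for Y H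
      using ex1_implies_ex[OF e1[OF that]] by blast
    show "H = J" if "H \<in> hom1 K Y E" "J \<in> hom1 K Y E" "e \<odot> H = e \<odot> J" for Y H J
      by (rule ex1_unique[OF e1[OF comp1_hom1[OF that(1) ty(3)] Phi[OF that(1)]]])
        (intro conjI that refl that(3)[symmetric])+
    show "\<exists>\<theta>'\<in>hom2 K H J. e \<rhd> \<theta>' = \<theta>" if "H \<in> hom1 K Y E" "J \<in> hom1 K Y E" "\<theta> \<in> hom2 K (e \<odot> H) (e \<odot> J)" for Y H J \<theta>
      using ex1_implies_ex[OF e2[OF that]] by blast
    show "\<theta> = \<theta>'" if "H \<in> hom1 K Y E" "J \<in> hom1 K Y E" "\<theta> \<in> hom2 K H J" "\<theta>' \<in> hom2 K H J" "e \<rhd> \<theta> = e \<rhd> \<theta>'" for Y H J \<theta> \<theta>'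
      by (rule ex1_unique[OF e2[OF that(1,2) hom2_lwhisk[OF ty(3) that(3,1)]]])
        (intro conjI that refl that(5)[symmetric])+
  qed (use ty Phi in auto)
qed

lemma full_sub_cong:
  assumes e: "full_sub K E B e \<Phi>" and eq: "\<And>Y H. H \<in> hom1 K Y B \<Longrightarrow> \<Phi> H \<longleftrightarrow> \<Psi> H"
  shows "full_sub K E B e \<Psi>"
proof -
  note d = full_subD[OF e]
  show ?thesis
    unfolding full_sub_def
  proof (intro conjI allI ballI impI)
    show "\<Psi> (e \<odot> H)" if "H \<in> hom1 K Y E" for Y H
      using eq[OF comp1_hom1[OF that d(1)]] d(2)[OF that] by simp
    show "\<exists>H'\<in>hom1 K Y E. e \<odot> H' = H" if "H \<in> hom1 K Y B" "\<Psi> H" for Y H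
      using d(3)[OF that(1)] eq[OF that(1)] that(2) by simp
  qed (use d in blast)+
qed

lemma full_sub_comp:
  assumes e: "full_sub K E B e \<Phi>" and f: "full_sub K F E f (\<lambda>H. \<Psi> (e \<odot> H))"
  shows "full_sub K F B (e \<odot> f) (\<lambda>H. \<Phi> H \<and> \<Psi> H)"
proof -
  note ed = full_subD[OF e] and fd = full_subD[OF f]
  have as: "(e \<odot> f) \<odot> H = e \<odot> f \<odot> H" "f \<odot> H \<in> hom1 K Y E" if "H \<in> hom1 K Y F" for Y H
    using that ed(1) fd(1) by (auto simp: hom1_iff)
  have aw: "(e \<odot> f) \<rhd> \<theta> = e \<rhd> (f \<rhd> \<theta>)" "f \<rhd> \<theta> \<in> hom2 K (f \<odot> H) (f \<odot> J)"
    if "H \<in> hom1 K Y F" "\<theta> \<in> hom2 K H J" for Y H J \<theta>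
    using that ed(1) fd(1) by (auto simp: hom1_iff hom2_iff)
  show ?thesis
    unfolding full_sub_def
  proof (intro conjI allI ballI impI)
    show "e \<odot> f \<in> hom1 K F B"
      by (rule comp1_hom1[OF fd(1) ed(1)])
    show "\<Phi> ((e \<odot> f) \<odot> H)" "\<Psi> ((e \<odot> f) \<odot> H)" if "H \<in> hom1 K Y F" for Y H
      using as[OF that] ed(2) fd(2)[OF that] by auto
    show "\<exists>H'\<in>hom1 K Y F. (e \<odot> f) \<odot> H' = H" if H: "H \<in> hom1 K Y B" and "\<Phi> H \<and> \<Psi> H" for Y H
      using ed(3)[OF H] fd(3) that(2) as(1) by metis
    show "H = J" if "H \<in> hom1 K Y F" "J \<in> hom1 K Y F" "(e \<odot> f) \<odot> H = (e \<odot> f) \<odot> J" for Y H J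
      using ed(4) fd(4) as that by metis
    show "\<exists>\<theta>'\<in>hom2 K H J. (e \<odot> f) \<rhd> \<theta>' = \<theta>" if "H \<in> hom1 K Y F" "J \<in> hom1 K Y F" "\<theta> \<in> hom2 K ((e \<odot> f) \<odot> H) ((e \<odot> f) \<odot> J)" for Y H J \<theta>
      using ed(5) fd(5) as aw(1) that by metis
    show "\<theta> = \<theta>'" if "H \<in> hom1 K Y F" "J \<in> hom1 K Y F" "\<theta> \<in> hom2 K H J" "\<theta>' \<in> hom2 K H J" "(e \<odot> f) \<rhd> \<theta> = (e \<odot> f) \<rhd> \<theta>'" for Y H J \<theta> \<theta>'
      using ed(6)[OF as(2)[OF that(1)] as(2)[OF that(2)] aw(2)[OF that(1,3)] aw(2)[OF that(1,4)]] fd(6)[OF that(1-4)] aw(1) that by metis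
  qed
qed

text \<open>The universal property of an inserter, restricted to a full subobject of it: a 2-cell
  factors if the 1-morphism classifying it satisfies the imposed equations.\<close>

lemma inserter_restrict:
  assumes ins: "is_inserter K F G I V \<kappa>" and e: "full_sub K E I e \<Phi>"
  shows "W \<in> hom1 K Y (src K F) \<Longrightarrow> \<mu> \<in> hom2 K (F \<odot> W) (G \<odot> W) \<Longrightarrow>
      (\<And>H. H \<in> hom1 K Y I \<Longrightarrow> V \<odot> H = W \<Longrightarrow> \<kappa> \<lhd> H = \<mu> \<Longrightarrow> \<Phi> H) \<Longrightarrow>
      \<exists>H \<in> hom1 K Y E. (V \<odot> e) \<odot> H = W \<and> (\<kappa> \<lhd> e) \<lhd> H = \<mu>"
    "H \<in> hom1 K Y E \<Longrightarrow> J \<in> hom1 K Y E \<Longrightarrow> (V \<odot> e) \<odot> H = (V \<odot> e) \<odot> J \<Longrightarrow> (\<kappa> \<lhd> e) \<lhd> H = (\<kappa> \<lhd> e) \<lhd> J \<Longrightarrow> H = J"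
    "H \<in> hom1 K Y E \<Longrightarrow> J \<in> hom1 K Y E \<Longrightarrow> \<theta> \<in> hom2 K ((V \<odot> e) \<odot> H) ((V \<odot> e) \<odot> J) \<Longrightarrow>
      (G \<rhd> \<theta>) \<bullet> ((\<kappa> \<lhd> e) \<lhd> H) = ((\<kappa> \<lhd> e) \<lhd> J) \<bullet> (F \<rhd> \<theta>) \<Longrightarrow>
      \<exists>\<theta>' \<in> hom2 K H J. (V \<odot> e) \<rhd> \<theta>' = \<theta>"
    "H \<in> hom1 K Y E \<Longrightarrow> J \<in> hom1 K Y E \<Longrightarrow> \<theta>1 \<in> hom2 K H J \<Longrightarrow> \<theta>2 \<in> hom2 K H J \<Longrightarrow>
      (V \<odot> e) \<rhd> \<theta>1 = (V \<odot> e) \<rhd> \<theta>2 \<Longrightarrow> \<theta>1 = \<theta>2"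
proof -
  note ed = full_subD[OF e]
  have ty: "F \<in> Cell1 K" "G \<in> hom1 K (src K F) (tgt K F)" "V \<in> hom1 K I (src K F)" "\<kappa> \<in> hom2 K (F \<odot> V) (G \<odot> V)"
    and i1: "W \<in> hom1 K Y (src K F) \<Longrightarrow> \<mu> \<in> hom2 K (F \<odot> W) (G \<odot> W) \<Longrightarrow> \<exists>!H. H \<in> hom1 K Y I \<and> V \<odot> H = W \<and> \<kappa> \<lhd> H = \<mu>"
    and i2: "H \<in> hom1 K Y I \<Longrightarrow> J \<in> hom1 K Y I \<Longrightarrow> \<theta> \<in> hom2 K (V \<odot> H) (V \<odot> J) \<Longrightarrow>
          (G \<rhd> \<theta>) \<bullet> (\<kappa> \<lhd> H) = (\<kappa> \<lhd> J) \<bullet> (F \<rhd> \<theta>) \<Longrightarrow> (\<exists>!\<theta>'. \<theta>' \<in> hom2 K H J \<and> V \<rhd> \<theta>' = \<theta>)" for W Y \<mu> H J \<theta>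
    using ins unfolding is_inserter_def by blast+
  note [simp] = ty(1) ty(2,3)[unfolded hom1_iff] ty(4)[unfolded hom2_iff] ed(1)[unfolded hom1_iff]
  have H [simp]: "(V \<odot> e) \<odot> H = V \<odot> e \<odot> H" "(\<kappa> \<lhd> e) \<lhd> H = \<kappa> \<lhd> (e \<odot> H)" "e \<odot> H \<in> hom1 K Y I"
    if "H \<in> hom1 K Y E" for Y H
    using that by (simp_all add: hom1_iff)
  show "\<exists>H \<in> hom1 K Y E. (V \<odot> e) \<odot> H = W \<and> (\<kappa> \<lhd> e) \<lhd> H = \<mu>"
    if W: "W \<in> hom1 K Y (src K F)" "\<mu> \<in> hom2 K (F \<odot> W) (G \<odot> W)"
      "\<And>H. H \<in> hom1 K Y I \<Longrightarrow> V \<odot> H = W \<Longrightarrow> \<kappa> \<lhd> H = \<mu> \<Longrightarrow> \<Phi> H"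
  proof -
    obtain H0 where H0: "H0 \<in> hom1 K Y I" "V \<odot> H0 = W" "\<kappa> \<lhd> H0 = \<mu>"
      using ex1_implies_ex[OF i1[OF W(1,2)]] by blast
    then obtain H1 where "H1 \<in> hom1 K Y E" "e \<odot> H1 = H0"
      using ed(3) W(3) by blast
    then show ?thesis
      using H0 by (intro bexI[of _ H1]) simp_all
  qed
  show "H = J" if "H \<in> hom1 K Y E" "J \<in> hom1 K Y E" "(V \<odot> e) \<odot> H = (V \<odot> e) \<odot> J" "(\<kappa> \<lhd> e) \<lhd> H = (\<kappa> \<lhd> e) \<lhd> J"
  proof -
    have VH: "V \<odot> e \<odot> H \<in> hom1 K Y (src K F)" "\<kappa> \<lhd> (e \<odot> H) \<in> hom2 K (F \<odot> V \<odot> e \<odot> H) (G \<odot> V \<odot> e \<odot> H)"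
      using that(1) by (simp_all add: hom1_iff hom2_iff)
    have "e \<odot> H = e \<odot> J"
      using ex1_unique[OF i1[OF VH], of "e \<odot> H" "e \<odot> J"] that by simp
    then show ?thesis
      using ed(4) that by blast
  qed
  show "\<exists>\<theta>' \<in> hom2 K H J. (V \<odot> e) \<rhd> \<theta>' = \<theta>"
    if HJ: "H \<in> hom1 K Y E" "J \<in> hom1 K Y E" and th: "\<theta> \<in> hom2 K ((V \<odot> e) \<odot> H) ((V \<odot> e) \<odot> J)"
      "(G \<rhd> \<theta>) \<bullet> ((\<kappa> \<lhd> e) \<lhd> H) = ((\<kappa> \<lhd> e) \<lhd> J) \<bullet> (F \<rhd> \<theta>)"
  proof -
    have "\<exists>!\<theta>'. \<theta>' \<in> hom2 K (e \<odot> H) (e \<odot> J) \<and> V \<rhd> \<theta>' = \<theta>"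
      using i2[of "e \<odot> H" Y "e \<odot> J" \<theta>] HJ th by simp
    from ex1_implies_ex[OF this] obtain t where t: "t \<in> hom2 K (e \<odot> H) (e \<odot> J)" "V \<rhd> t = \<theta>"
      by blast
    obtain t' where t': "t' \<in> hom2 K H J" "e \<rhd> t' = t"
      using ed(5)[OF HJ t(1)] by blast
    then have "(V \<odot> e) \<rhd> t' = \<theta>"
      using t HJ by (auto simp: hom1_iff hom2_iff)
    then show ?thesis
      using t' by blast
  qed
  show "\<theta>1 = \<theta>2" if HJ: "H \<in> hom1 K Y E" "J \<in> hom1 K Y E" and th: "\<theta>1 \<in> hom2 K H J" "\<theta>2 \<in> hom2 K H J"
      "(V \<odot> e) \<rhd> \<theta>1 = (V \<odot> e) \<rhd> \<theta>2"
  proof -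
    have et: "e \<rhd> t \<in> hom2 K (e \<odot> H) (e \<odot> J)" "(V \<odot> e) \<rhd> t = V \<rhd> (e \<rhd> t)"
      "(G \<rhd> V \<rhd> e \<rhd> t) \<bullet> (\<kappa> \<lhd> (e \<odot> H)) = (\<kappa> \<lhd> (e \<odot> J)) \<bullet> (F \<rhd> V \<rhd> e \<rhd> t)" if "t \<in> hom2 K H J" for t
      using HJ that whisk_exchange[of \<kappa> "e \<rhd> t" "F \<odot> V" "G \<odot> V" "e \<odot> H" "e \<odot> J"]
      by (auto simp: hom1_iff hom2_iff)
    have "V \<rhd> e \<rhd> \<theta>1 \<in> hom2 K (V \<odot> e \<odot> H) (V \<odot> e \<odot> J)"
      using HJ th by (auto simp: hom1_iff hom2_iff)
    then have "\<exists>!\<theta>'. \<theta>' \<in> hom2 K (e \<odot> H) (e \<odot> J) \<and> V \<rhd> \<theta>' = V \<rhd> e \<rhd> \<theta>1"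
      using i2[of "e \<odot> H" Y "e \<odot> J" "V \<rhd> e \<rhd> \<theta>1"] HJ et(3)[OF th(1)] by simp
    from ex1_unique[OF this, of "e \<rhd> \<theta>1" "e \<rhd> \<theta>2"] have "e \<rhd> \<theta>1 = e \<rhd> \<theta>2"
      using et th by metis
    then show ?thesis
      using ed(6)[OF HJ th(1,2)] by blast
  qed
qed

end

context tangentad
begin

text \<open>
  An axiom \<open>ax\<close> yields a pair of 2-cells for every datum \<open>U\<close> in a hom tangent category. If its
  formation commutes with precomposition, its equifier is the full subobject of those 1-morphisms
  along which the datum satisfies the axiom. One well-typed side suffices, because the equifier
  requires both sides to be parallel.
\<close>

lemma axiom_full_sub:
  assumes eq: "is_equifier K (ax (hom_tcat K B X) U) E e"
    and ar: "fst (ax (hom_tcat K B X) U) \<in> Ar (hom_tcat K B X) \<or> snd (ax (hom_tcat K B X) U) \<in> Ar (hom_tcat K B X)"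
    and pre: "\<And>Y H. H \<in> hom1 K Y B \<Longrightarrow> ax (hom_tcat K Y X) (pre U H) =
      map_prod (\<lambda>\<phi>. \<phi> \<lhd> H) (\<lambda>\<phi>. \<phi> \<lhd> H) (ax (hom_tcat K B X) U)"
  shows "full_sub K E B e (\<lambda>H. fst (ax (hom_tcat K (src K H) X) (pre U H)) = snd (ax (hom_tcat K (src K H) X) (pre U H)))"
proof -
  obtain \<phi> \<psi> where ax: "ax (hom_tcat K B X) U = (\<phi>, \<psi>)"
    by (cases "ax (hom_tcat K B X) U")
  have "\<psi> \<in> hom2 K (dom2 K \<phi>) (cod2 K \<phi>)"
    using eq unfolding ax is_equifier_def prod.case by blast
  then have "src K (dom2 K \<phi>) = B"
    using ar by (auto simp: ax hom1_iff hom2_iff)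
  from equifier_full_sub[OF eq[unfolded ax] this]
  have "full_sub K E B e (\<lambda>H. \<phi> \<lhd> H = \<psi> \<lhd> H)" .
  moreover have "(\<phi> \<lhd> H = \<psi> \<lhd> H) \<longleftrightarrow> fst (ax (hom_tcat K (src K H) X) (pre U H)) = snd (ax (hom_tcat K (src K H) X) (pre U H))"
    if "H \<in> hom1 K Y B" for Y H
    using pre[OF that] that by (simp add: ax hom1_iff)
  ultimately show ?thesis
    by (rule full_sub_cong)
qed

end

subsection \<open>Representing affine connections\<close>

text \<open>
  The object \<open>G\<close> represents affine connections: for every \<open>Y\<close>, precomposition of \<open>(U; k, h)\<close> is an
  isomorphism from the category of 1-morphisms \<open>Y \<rightarrow> G\<close> to that of 1-morphisms \<open>Y \<rightarrow> X\<close> equipped with an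
  affine connection. This is all that the construction of the tangentad of affine connections
  needs to know about \<open>G\<close>.
\<close>

locale affine_object = tangentad K X for K :: "('o, 'm, 'c) two_cat" (structure) and X +
  fixes G :: 'o and U :: 'm and k h :: 'c
  assumes universal: "affine_connection (hom_tcat K G X) U k h"
    and factor: "affine_connection (hom_tcat K Y X) W \<kappa> \<eta> \<Longrightarrow>
      \<exists>H \<in> hom1 K Y G. U \<odot> H = W \<and> k \<lhd> H = \<kappa> \<and> h \<lhd> H = \<eta>"
    and factor_unique: "H \<in> hom1 K Y G \<Longrightarrow> J \<in> hom1 K Y G \<Longrightarrow> U \<odot> H = U \<odot> J \<Longrightarrow>
      k \<lhd> H = k \<lhd> J \<Longrightarrow> h \<lhd> H = h \<lhd> J \<Longrightarrow> H = J"
    and factor2: "H \<in> hom1 K Y G \<Longrightarrow> J \<in> hom1 K Y G \<Longrightarrow> \<theta> \<in> hom2 K (U \<odot> H) (U \<odot> J) \<Longrightarrow>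
      (tan X \<rhd> \<theta>) \<bullet> (k \<lhd> H) = (k \<lhd> J) \<bullet> (tan X \<rhd> tan X \<rhd> \<theta>) \<Longrightarrow>
      (tan X \<rhd> tan X \<rhd> \<theta>) \<bullet> (h \<lhd> H) = (h \<lhd> J) \<bullet> (tan2 X \<rhd> \<theta>) \<Longrightarrow>
      \<exists>\<theta>' \<in> hom2 K H J. U \<rhd> \<theta>' = \<theta>"
    and factor2_unique: "H \<in> hom1 K Y G \<Longrightarrow> J \<in> hom1 K Y G \<Longrightarrow> \<theta> \<in> hom2 K H J \<Longrightarrow> \<theta>' \<in> hom2 K H J \<Longrightarrow>
      U \<rhd> \<theta> = U \<rhd> \<theta>' \<Longrightarrow> \<theta> = \<theta>'"

context tangentad
begin

lemma full_sub_id: "A \<in> Cell0 K \<Longrightarrow> full_sub K A A (id1 K A) (\<lambda>H. True)"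
  unfolding full_sub_def by (auto simp: hom1_iff hom2_iff)

lemma axiom_step:
  assumes d: "full_sub K B I d \<Phi>" and eq: "is_equifier K (ax (hom_tcat K B X) d) E e"
    and ar: "fst (ax (hom_tcat K B X) d) \<in> Ar (hom_tcat K B X) \<or> snd (ax (hom_tcat K B X) d) \<in> Ar (hom_tcat K B X)"
    and pre: "\<And>Y H. H \<in> hom1 K Y B \<Longrightarrow> ax (hom_tcat K Y X) (d \<odot> H) =
      map_prod (\<lambda>\<phi>. \<phi> \<lhd> H) (\<lambda>\<phi>. \<phi> \<lhd> H) (ax (hom_tcat K B X) d)"
  shows "e \<in> hom1 K E B"
    and "full_sub K E I (d \<odot> e) (\<lambda>H. \<Phi> H \<and> fst (ax (hom_tcat K (src K H) X) H) = snd (ax (hom_tcat K (src K H) X) H))"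
proof -
  have e: "full_sub K E B e (\<lambda>H. fst (ax (hom_tcat K (src K H) X) (d \<odot> H)) = snd (ax (hom_tcat K (src K H) X) (d \<odot> H)))"
    by (rule axiom_full_sub[where ax = ax and U = d and B = B and pre = "\<lambda>d H. d \<odot> H", OF eq ar pre])
  then show "e \<in> hom1 K E B"
    by (rule full_subD(1))
  show "full_sub K E I (d \<odot> e) (\<lambda>H. \<Phi> H \<and> fst (ax (hom_tcat K (src K H) X) H) = snd (ax (hom_tcat K (src K H) X) H))"
  proof (rule full_sub_comp[OF d])
    show "full_sub K E B e (\<lambda>H. fst (ax (hom_tcat K (src K (d \<odot> H)) X) (d \<odot> H)) = snd (ax (hom_tcat K (src K (d \<odot> H)) X) (d \<odot> H)))"
      by (rule full_sub_cong[OF e]) (use full_subD(1)[OF d] in \<open>simp add: hom1_iff\<close>)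
  qed
qed

end

subsection \<open>The tower of limits\<close>

locale affine_limits = tangentad K X for K :: "('o, 'm, 'c) two_cat" (structure) and X +
  fixes I V\<^sub>0 K\<^sub>0 E\<^sub>1 e\<^sub>1 E\<^sub>2 e\<^sub>2 E\<^sub>3 e\<^sub>3 E\<^sub>4 e\<^sub>4 U_VAC k_VAC
    J W\<^sub>0 H\<^sub>0 F\<^sub>1 f\<^sub>1 F\<^sub>2 f\<^sub>2 F\<^sub>3 f\<^sub>3 F\<^sub>4 f\<^sub>4 U_HAC h_HAC AC\<^sub>0 q q' G\<^sub>1 g\<^sub>1 G\<^sub>2 g\<^sub>2
  assumes insV: "is_inserter K (tan X \<odot> tan X) (tan X) I V\<^sub>0 K\<^sub>0"
    and eqV: "is_equifier K (axV1 (hom_tcat K I X) V\<^sub>0 K\<^sub>0) E\<^sub>1 e\<^sub>1"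
      "is_equifier K (axV2 (hom_tcat K E\<^sub>1 X) (V\<^sub>0 \<odot> e\<^sub>1) (K\<^sub>0 \<lhd> e\<^sub>1)) E\<^sub>2 e\<^sub>2"
      "is_equifier K (axV3 (hom_tcat K E\<^sub>2 X) (V\<^sub>0 \<odot> e\<^sub>1 \<odot> e\<^sub>2) (K\<^sub>0 \<lhd> (e\<^sub>1 \<odot> e\<^sub>2))) E\<^sub>3 e\<^sub>3"
      "is_equifier K (axV4 (hom_tcat K E\<^sub>3 X) (V\<^sub>0 \<odot> e\<^sub>1 \<odot> e\<^sub>2 \<odot> e\<^sub>3) (K\<^sub>0 \<lhd> (e\<^sub>1 \<odot> e\<^sub>2 \<odot> e\<^sub>3))) E\<^sub>4 e\<^sub>4"
    and U_VAC: "U_VAC = V\<^sub>0 \<odot> e\<^sub>1 \<odot> e\<^sub>2 \<odot> e\<^sub>3 \<odot> e\<^sub>4"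
    and k_VAC: "k_VAC = K\<^sub>0 \<lhd> (e\<^sub>1 \<odot> e\<^sub>2 \<odot> e\<^sub>3 \<odot> e\<^sub>4)"
    and insH: "is_inserter K (tan2 X) (tan X \<odot> tan X) J W\<^sub>0 H\<^sub>0"
    and eqH: "is_equifier K (axH1 (hom_tcat K J X) W\<^sub>0 H\<^sub>0) F\<^sub>1 f\<^sub>1"
      "is_equifier K (axH2 (hom_tcat K F\<^sub>1 X) (W\<^sub>0 \<odot> f\<^sub>1) (H\<^sub>0 \<lhd> f\<^sub>1)) F\<^sub>2 f\<^sub>2"
      "is_equifier K (axH3 (hom_tcat K F\<^sub>2 X) (W\<^sub>0 \<odot> f\<^sub>1 \<odot> f\<^sub>2) (H\<^sub>0 \<lhd> (f\<^sub>1 \<odot> f\<^sub>2))) F\<^sub>3 f\<^sub>3"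
      "is_equifier K (axH4 (hom_tcat K F\<^sub>3 X) (W\<^sub>0 \<odot> f\<^sub>1 \<odot> f\<^sub>2 \<odot> f\<^sub>3) (H\<^sub>0 \<lhd> (f\<^sub>1 \<odot> f\<^sub>2 \<odot> f\<^sub>3))) F\<^sub>4 f\<^sub>4"
    and U_HAC: "U_HAC = W\<^sub>0 \<odot> f\<^sub>1 \<odot> f\<^sub>2 \<odot> f\<^sub>3 \<odot> f\<^sub>4"
    and h_HAC: "h_HAC = H\<^sub>0 \<lhd> (f\<^sub>1 \<odot> f\<^sub>2 \<odot> f\<^sub>3 \<odot> f\<^sub>4)"
    and pb: "is_two_pullback K U_VAC U_HAC AC\<^sub>0 q q'"
    and eqA: "is_equifier K (axA1 (hom_tcat K AC\<^sub>0 X) (U_VAC \<odot> q) (k_VAC \<lhd> q) (h_HAC \<lhd> q')) G\<^sub>1 g\<^sub>1"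
      "is_equifier K (axA2 (hom_tcat K G\<^sub>1 X) (U_VAC \<odot> q \<odot> g\<^sub>1)
           (k_VAC \<lhd> (q \<odot> g\<^sub>1)) (h_HAC \<lhd> (q' \<odot> g\<^sub>1))) G\<^sub>2 g\<^sub>2"
begin

lemma V_Cell [simp]:
  "V\<^sub>0 \<in> Cell1 K" "src K V\<^sub>0 = I" "tgt K V\<^sub>0 = base X"
  "K\<^sub>0 \<in> Cell2 K" "dom2 K K\<^sub>0 = tan X \<odot> tan X \<odot> V\<^sub>0" "cod2 K K\<^sub>0 = tan X \<odot> V\<^sub>0"
  using insV unfolding is_inserter_def hom1_iff hom2_iff by simp_all

lemma H_Cell [simp]:
  "W\<^sub>0 \<in> Cell1 K" "src K W\<^sub>0 = J" "tgt K W\<^sub>0 = base X"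
  "H\<^sub>0 \<in> Cell2 K" "dom2 K H\<^sub>0 = tan2 X \<odot> W\<^sub>0" "cod2 K H\<^sub>0 = tan X \<odot> tan X \<odot> W\<^sub>0"
  using insH unfolding is_inserter_def hom1_iff hom2_iff by simp_all

text \<open>One stage of the tower, for an arbitrary full subobject \<open>d\<close> reached so far.\<close>

lemma vertical_step:
  assumes d: "full_sub K B I d \<Phi>" and ax: "ax \<in> {axV1, axV2, axV3, axV4}"
    and eq: "is_equifier K (ax (hom_tcat K B X) (V\<^sub>0 \<odot> d) (K\<^sub>0 \<lhd> d)) E e"
  shows "e \<in> hom1 K E B" and "full_sub K E I (d \<odot> e) (\<lambda>H. \<Phi> H \<and> fst (ax (hom_tcat K (src K H) X) (V\<^sub>0 \<odot> H) (K\<^sub>0 \<lhd> H)) =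
    snd (ax (hom_tcat K (src K H) X) (V\<^sub>0 \<odot> H) (K\<^sub>0 \<lhd> H)))"
proof -
  have [simp]: "d \<in> Cell1 K" "src K d = B" "tgt K d = I"
    using full_subD(1)[OF d] by (simp_all add: hom1_iff)
  have "B \<in> Cell0 K"
    using src_tgt(1)[of d] by simp
  then interpret D: tangent_calculus "hom_tcat K B X" by (rule tangent_calculus_hom_tcat)
  have M: "V\<^sub>0 \<odot> d \<in> Ob (hom_tcat K B X)" and k: "K\<^sub>0 \<lhd> d \<in> Hom (hom_tcat K B X) (D.To (D.To (V\<^sub>0 \<odot> d))) (D.To (V\<^sub>0 \<odot> d))"
    by (simp_all add: hom1_iff Hom_iff)
  have h: "D.l (V\<^sub>0 \<odot> d) \<cdot>\<^bsub>hom_tcat K B X\<^esub> D.a (V\<^sub>0 \<odot> d) \<in> Hom (hom_tcat K B X) (D.T2o (V\<^sub>0 \<odot> d)) (D.To (D.To (V\<^sub>0 \<odot> d)))"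
    by (simp add: hom1_iff Hom_iff)
  note step = axiom_step[OF d, where ax = "\<lambda>D d. ax D (V\<^sub>0 \<odot> d) (K\<^sub>0 \<lhd> d)", OF eq]
  have ar: "fst (ax (hom_tcat K B X) (V\<^sub>0 \<odot> d) (K\<^sub>0 \<lhd> d)) \<in> Ar (hom_tcat K B X) \<or>
      snd (ax (hom_tcat K B X) (V\<^sub>0 \<odot> d) (K\<^sub>0 \<lhd> d)) \<in> Ar (hom_tcat K B X)"
      using ax D.axiom_Ar[OF M k h] by auto
  have pre: "ax (hom_tcat K Y X) (V\<^sub>0 \<odot> d \<odot> H) (K\<^sub>0 \<lhd> (d \<odot> H)) =
        map_prod (\<lambda>\<phi>. \<phi> \<lhd> H) (\<lambda>\<phi>. \<phi> \<lhd> H) (ax (hom_tcat K B X) (V\<^sub>0 \<odot> d) (K\<^sub>0 \<lhd> d))"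
    if H: "H \<in> hom1 K Y B" for Y H
  proof -
    interpret S: strict_functor "hom_tcat K B X" "hom_tcat K Y X" "\<lambda>M. M \<odot> H" "\<lambda>\<phi>. \<phi> \<lhd> H"
      by (rule precomposition_strict[OF H])
    show ?thesis
      using ax S.image_vertical_axioms[OF M k] H by (auto simp: hom1_iff)
  qed
  note step = step[OF ar pre]
  show "e \<in> hom1 K E B"
    by (rule step(1))
  show "full_sub K E I (d \<odot> e) (\<lambda>H. \<Phi> H \<and> fst (ax (hom_tcat K (src K H) X) (V\<^sub>0 \<odot> H) (K\<^sub>0 \<lhd> H)) =
    snd (ax (hom_tcat K (src K H) X) (V\<^sub>0 \<odot> H) (K\<^sub>0 \<lhd> H)))"
    by (rule step(2))
qed

lemma horizontal_step:
  assumes d: "full_sub K B J d \<Phi>" and ax: "ax \<in> {axH1, axH2, axH3, axH4}"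
    and eq: "is_equifier K (ax (hom_tcat K B X) (W\<^sub>0 \<odot> d) (H\<^sub>0 \<lhd> d)) E e"
  shows "e \<in> hom1 K E B" and "full_sub K E J (d \<odot> e) (\<lambda>H. \<Phi> H \<and> fst (ax (hom_tcat K (src K H) X) (W\<^sub>0 \<odot> H) (H\<^sub>0 \<lhd> H)) =
    snd (ax (hom_tcat K (src K H) X) (W\<^sub>0 \<odot> H) (H\<^sub>0 \<lhd> H)))"
proof -
  have [simp]: "d \<in> Cell1 K" "src K d = B" "tgt K d = J"
    using full_subD(1)[OF d] by (simp_all add: hom1_iff)
  have "B \<in> Cell0 K"
    using src_tgt(1)[of d] by simp
  then interpret D: tangent_calculus "hom_tcat K B X" by (rule tangent_calculus_hom_tcat)
  have M: "W\<^sub>0 \<odot> d \<in> Ob (hom_tcat K B X)" and h: "H\<^sub>0 \<lhd> d \<in> Hom (hom_tcat K B X) (D.T2o (W\<^sub>0 \<odot> d)) (D.To (D.To (W\<^sub>0 \<odot> d)))"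
    by (simp_all add: hom1_iff Hom_iff)
  have k: "D.p (D.To (W\<^sub>0 \<odot> d)) \<in> Hom (hom_tcat K B X) (D.To (D.To (W\<^sub>0 \<odot> d))) (D.To (W\<^sub>0 \<odot> d))"
    by (simp add: hom1_iff Hom_iff)
  note step = axiom_step[OF d, where ax = "\<lambda>D d. ax D (W\<^sub>0 \<odot> d) (H\<^sub>0 \<lhd> d)", OF eq]
  have ar: "fst (ax (hom_tcat K B X) (W\<^sub>0 \<odot> d) (H\<^sub>0 \<lhd> d)) \<in> Ar (hom_tcat K B X) \<or>
      snd (ax (hom_tcat K B X) (W\<^sub>0 \<odot> d) (H\<^sub>0 \<lhd> d)) \<in> Ar (hom_tcat K B X)"
      using ax D.axiom_Ar[OF M k h] by auto
  have pre: "ax (hom_tcat K Y X) (W\<^sub>0 \<odot> d \<odot> H) (H\<^sub>0 \<lhd> (d \<odot> H)) =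
        map_prod (\<lambda>\<phi>. \<phi> \<lhd> H) (\<lambda>\<phi>. \<phi> \<lhd> H) (ax (hom_tcat K B X) (W\<^sub>0 \<odot> d) (H\<^sub>0 \<lhd> d))"
    if H: "H \<in> hom1 K Y B" for Y H
  proof -
    interpret S: strict_functor "hom_tcat K B X" "hom_tcat K Y X" "\<lambda>M. M \<odot> H" "\<lambda>\<phi>. \<phi> \<lhd> H"
      by (rule precomposition_strict[OF H])
    show ?thesis
      using ax S.image_horizontal_axioms[OF M h] H by (auto simp: hom1_iff)
  qed
  note step = step[OF ar pre]
  show "e \<in> hom1 K E B"
    by (rule step(1))
  show "full_sub K E J (d \<odot> e) (\<lambda>H. \<Phi> H \<and> fst (ax (hom_tcat K (src K H) X) (W\<^sub>0 \<odot> H) (H\<^sub>0 \<lhd> H)) =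
    snd (ax (hom_tcat K (src K H) X) (W\<^sub>0 \<odot> H) (H\<^sub>0 \<lhd> H)))"
    by (rule step(2))
qed

lemma e_Cell [simp]:
  "e\<^sub>1 \<in> Cell1 K" "src K e\<^sub>1 = E\<^sub>1" "tgt K e\<^sub>1 = I" "e\<^sub>2 \<in> Cell1 K" "src K e\<^sub>2 = E\<^sub>2" "tgt K e\<^sub>2 = E\<^sub>1"
  "e\<^sub>3 \<in> Cell1 K" "src K e\<^sub>3 = E\<^sub>3" "tgt K e\<^sub>3 = E\<^sub>2" "e\<^sub>4 \<in> Cell1 K" "src K e\<^sub>4 = E\<^sub>4" "tgt K e\<^sub>4 = E\<^sub>3"
  and V_full_sub: "full_sub K E\<^sub>4 I (e\<^sub>1 \<odot> e\<^sub>2 \<odot> e\<^sub>3 \<odot> e\<^sub>4) (\<lambda>H. \<forall>ax \<in> {axV1, axV2, axV3, axV4}.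
    fst (ax (hom_tcat K (src K H) X) (V\<^sub>0 \<odot> H) (K\<^sub>0 \<lhd> H)) = snd (ax (hom_tcat K (src K H) X) (V\<^sub>0 \<odot> H) (K\<^sub>0 \<lhd> H)))"
proof -
  have I: "I \<in> Cell0 K"
    using src_tgt(1)[of V\<^sub>0] by simp
  have "is_equifier K (axV1 (hom_tcat K I X) (V\<^sub>0 \<odot> id1 K I) (K\<^sub>0 \<lhd> id1 K I)) E\<^sub>1 e\<^sub>1"
    using eqV(1) by simp
  note s1 = vertical_step[where ax = axV1, OF full_sub_id[OF I] _ this, simplified]
  note [simp] = s1(1)[unfolded hom1_iff]
  note s1 = s1(2)[simplified]
  note s2 = vertical_step[where ax = axV2, OF s1 _ eqV(2), simplified]
  note [simp] = s2(1)[unfolded hom1_iff]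
  note s3 = vertical_step[where ax = axV3, OF s2(2) _ eqV(3), simplified]
  note [simp] = s3(1)[unfolded hom1_iff]
  note s3 = s3(2)[simplified]
  note s4 = vertical_step[where ax = axV4, OF s3 _ eqV(4), simplified]
  note [simp] = s4(1)[unfolded hom1_iff]
  show "e\<^sub>1 \<in> Cell1 K" "src K e\<^sub>1 = E\<^sub>1" "tgt K e\<^sub>1 = I" "e\<^sub>2 \<in> Cell1 K" "src K e\<^sub>2 = E\<^sub>2" "tgt K e\<^sub>2 = E\<^sub>1"
    "e\<^sub>3 \<in> Cell1 K" "src K e\<^sub>3 = E\<^sub>3" "tgt K e\<^sub>3 = E\<^sub>2" "e\<^sub>4 \<in> Cell1 K" "src K e\<^sub>4 = E\<^sub>4" "tgt K e\<^sub>4 = E\<^sub>3"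
    by simp_all
  show "full_sub K E\<^sub>4 I (e\<^sub>1 \<odot> e\<^sub>2 \<odot> e\<^sub>3 \<odot> e\<^sub>4) (\<lambda>H. \<forall>ax \<in> {axV1, axV2, axV3, axV4}.
    fst (ax (hom_tcat K (src K H) X) (V\<^sub>0 \<odot> H) (K\<^sub>0 \<lhd> H)) = snd (ax (hom_tcat K (src K H) X) (V\<^sub>0 \<odot> H) (K\<^sub>0 \<lhd> H)))"
    using s4(2) by simp
qed

lemma f_Cell [simp]:
  "f\<^sub>1 \<in> Cell1 K" "src K f\<^sub>1 = F\<^sub>1" "tgt K f\<^sub>1 = J" "f\<^sub>2 \<in> Cell1 K" "src K f\<^sub>2 = F\<^sub>2" "tgt K f\<^sub>2 = F\<^sub>1"
  "f\<^sub>3 \<in> Cell1 K" "src K f\<^sub>3 = F\<^sub>3" "tgt K f\<^sub>3 = F\<^sub>2" "f\<^sub>4 \<in> Cell1 K" "src K f\<^sub>4 = F\<^sub>4" "tgt K f\<^sub>4 = F\<^sub>3"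
  and H_full_sub: "full_sub K F\<^sub>4 J (f\<^sub>1 \<odot> f\<^sub>2 \<odot> f\<^sub>3 \<odot> f\<^sub>4) (\<lambda>H. \<forall>ax \<in> {axH1, axH2, axH3, axH4}.
    fst (ax (hom_tcat K (src K H) X) (W\<^sub>0 \<odot> H) (H\<^sub>0 \<lhd> H)) = snd (ax (hom_tcat K (src K H) X) (W\<^sub>0 \<odot> H) (H\<^sub>0 \<lhd> H)))"
proof -
  have J: "J \<in> Cell0 K"
    using src_tgt(1)[of W\<^sub>0] by simp
  have "is_equifier K (axH1 (hom_tcat K J X) (W\<^sub>0 \<odot> id1 K J) (H\<^sub>0 \<lhd> id1 K J)) F\<^sub>1 f\<^sub>1"
    using eqH(1) by simp
  note s1 = horizontal_step[where ax = axH1, OF full_sub_id[OF J] _ this, simplified]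
  note [simp] = s1(1)[unfolded hom1_iff]
  note s1 = s1(2)[simplified]
  note s2 = horizontal_step[where ax = axH2, OF s1 _ eqH(2), simplified]
  note [simp] = s2(1)[unfolded hom1_iff]
  note s3 = horizontal_step[where ax = axH3, OF s2(2) _ eqH(3), simplified]
  note [simp] = s3(1)[unfolded hom1_iff]
  note s3 = s3(2)[simplified]
  note s4 = horizontal_step[where ax = axH4, OF s3 _ eqH(4), simplified]
  note [simp] = s4(1)[unfolded hom1_iff]
  show "f\<^sub>1 \<in> Cell1 K" "src K f\<^sub>1 = F\<^sub>1" "tgt K f\<^sub>1 = J" "f\<^sub>2 \<in> Cell1 K" "src K f\<^sub>2 = F\<^sub>2" "tgt K f\<^sub>2 = F\<^sub>1"
    "f\<^sub>3 \<in> Cell1 K" "src K f\<^sub>3 = F\<^sub>3" "tgt K f\<^sub>3 = F\<^sub>2" "f\<^sub>4 \<in> Cell1 K" "src K f\<^sub>4 = F\<^sub>4" "tgt K f\<^sub>4 = F\<^sub>3"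
    by simp_all
  show "full_sub K F\<^sub>4 J (f\<^sub>1 \<odot> f\<^sub>2 \<odot> f\<^sub>3 \<odot> f\<^sub>4) (\<lambda>H. \<forall>ax \<in> {axH1, axH2, axH3, axH4}.
    fst (ax (hom_tcat K (src K H) X) (W\<^sub>0 \<odot> H) (H\<^sub>0 \<lhd> H)) = snd (ax (hom_tcat K (src K H) X) (W\<^sub>0 \<odot> H) (H\<^sub>0 \<lhd> H)))"
    using s4(2) by simp
qed


lemma vertical_representation:
  "U_VAC \<in> hom1 K E\<^sub>4 (base X)"
  "k_VAC \<in> hom2 K (tan X \<odot> tan X \<odot> U_VAC) (tan X \<odot> U_VAC)"
  "H \<in> hom1 K Y E\<^sub>4 \<Longrightarrow> vertical_affine_connection (hom_tcat K Y X) (U_VAC \<odot> H) (k_VAC \<lhd> H)"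
  "vertical_affine_connection (hom_tcat K Y X) W \<kappa> \<Longrightarrow> \<exists>H \<in> hom1 K Y E\<^sub>4. U_VAC \<odot> H = W \<and> k_VAC \<lhd> H = \<kappa>"
proof -
  let ?e = "e\<^sub>1 \<odot> e\<^sub>2 \<odot> e\<^sub>3 \<odot> e\<^sub>4"
  have U: "U_VAC = V\<^sub>0 \<odot> ?e" and k: "k_VAC = K\<^sub>0 \<lhd> ?e"
    by (simp_all add: U_VAC k_VAC)
  show U1: "U_VAC \<in> hom1 K E\<^sub>4 (base X)" and k1: "k_VAC \<in> hom2 K (tan X \<odot> tan X \<odot> U_VAC) (tan X \<odot> U_VAC)"
    by (simp_all add: U k hom1_iff hom2_iff)
  show "vertical_affine_connection (hom_tcat K Y X) (U_VAC \<odot> H) (k_VAC \<lhd> H)" if H: "H \<in> hom1 K Y E\<^sub>4"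
  proof -
    have [simp]: "H \<in> Cell1 K" "src K H = Y" "tgt K H = E\<^sub>4"
      using H by (simp_all add: hom1_iff)
    show ?thesis
      using full_subD(2)[OF V_full_sub H]
      by (simp add: vertical_affine_connection_def U k hom1_iff Hom_iff)
  qed
  show "\<exists>H \<in> hom1 K Y E\<^sub>4. U_VAC \<odot> H = W \<and> k_VAC \<lhd> H = \<kappa>"
    if V: "vertical_affine_connection (hom_tcat K Y X) W \<kappa>"
  proof -
    have W [simp]: "W \<in> Cell1 K" "src K W = Y" "tgt K W = base X" and \<kappa>: "\<kappa> \<in> Cell2 K"
      "dom2 K \<kappa> = tan X \<odot> tan X \<odot> W" "cod2 K \<kappa> = tan X \<odot> W"
      using V by (auto simp: vertical_affine_connection_def hom1_iff Hom_iff)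
    have "\<exists>H \<in> hom1 K Y E\<^sub>4. (V\<^sub>0 \<odot> ?e) \<odot> H = W \<and> (K\<^sub>0 \<lhd> ?e) \<lhd> H = \<kappa>"
    proof (rule inserter_restrict(1)[OF insV V_full_sub])
      show "\<forall>ax \<in> {axV1, axV2, axV3, axV4}. fst (ax (hom_tcat K (src K H) X) (V\<^sub>0 \<odot> H) (K\<^sub>0 \<lhd> H)) =
          snd (ax (hom_tcat K (src K H) X) (V\<^sub>0 \<odot> H) (K\<^sub>0 \<lhd> H))"
        if "H \<in> hom1 K Y I" "V\<^sub>0 \<odot> H = W" "K\<^sub>0 \<lhd> H = \<kappa>" for H
        using that V by (simp add: vertical_affine_connection_def hom1_iff)
    qed (simp_all add: hom1_iff hom2_iff \<kappa>)
    then show ?thesis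
      by (simp only: U k)
  qed
qed

lemma horizontal_representation:
  "U_HAC \<in> hom1 K F\<^sub>4 (base X)"
  "h_HAC \<in> hom2 K (tan2 X \<odot> U_HAC) (tan X \<odot> tan X \<odot> U_HAC)"
  "H \<in> hom1 K Y F\<^sub>4 \<Longrightarrow> horizontal_affine_connection (hom_tcat K Y X) (U_HAC \<odot> H) (h_HAC \<lhd> H)"
  "horizontal_affine_connection (hom_tcat K Y X) W \<eta> \<Longrightarrow> \<exists>H \<in> hom1 K Y F\<^sub>4. U_HAC \<odot> H = W \<and> h_HAC \<lhd> H = \<eta>"
proof -
  let ?e = "f\<^sub>1 \<odot> f\<^sub>2 \<odot> f\<^sub>3 \<odot> f\<^sub>4"
  have U: "U_HAC = W\<^sub>0 \<odot> ?e" and h: "h_HAC = H\<^sub>0 \<lhd> ?e"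
    by (simp_all add: U_HAC h_HAC)
  show U1: "U_HAC \<in> hom1 K F\<^sub>4 (base X)" and h1: "h_HAC \<in> hom2 K (tan2 X \<odot> U_HAC) (tan X \<odot> tan X \<odot> U_HAC)"
    by (simp_all add: U h hom1_iff hom2_iff)
  show "horizontal_affine_connection (hom_tcat K Y X) (U_HAC \<odot> H) (h_HAC \<lhd> H)" if H: "H \<in> hom1 K Y F\<^sub>4"
  proof -
    have [simp]: "H \<in> Cell1 K" "src K H = Y" "tgt K H = F\<^sub>4"
      using H by (simp_all add: hom1_iff)
    show ?thesis
      using full_subD(2)[OF H_full_sub H]
      by (simp add: horizontal_affine_connection_def U h hom1_iff Hom_iff)
  qed
  show "\<exists>H \<in> hom1 K Y F\<^sub>4. U_HAC \<odot> H = W \<and> h_HAC \<lhd> H = \<eta>"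
    if V: "horizontal_affine_connection (hom_tcat K Y X) W \<eta>"
  proof -
    have W [simp]: "W \<in> Cell1 K" "src K W = Y" "tgt K W = base X" and \<eta>: "\<eta> \<in> Cell2 K"
      "dom2 K \<eta> = tan2 X \<odot> W" "cod2 K \<eta> = tan X \<odot> tan X \<odot> W"
      using V by (auto simp: horizontal_affine_connection_def hom1_iff Hom_iff)
    have "\<exists>H \<in> hom1 K Y F\<^sub>4. (W\<^sub>0 \<odot> ?e) \<odot> H = W \<and> (H\<^sub>0 \<lhd> ?e) \<lhd> H = \<eta>"
    proof (rule inserter_restrict(1)[OF insH H_full_sub])
      show "\<forall>ax \<in> {axH1, axH2, axH3, axH4}. fst (ax (hom_tcat K (src K H) X) (W\<^sub>0 \<odot> H) (H\<^sub>0 \<lhd> H)) =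
          snd (ax (hom_tcat K (src K H) X) (W\<^sub>0 \<odot> H) (H\<^sub>0 \<lhd> H))"
        if "H \<in> hom1 K Y J" "W\<^sub>0 \<odot> H = W" "H\<^sub>0 \<lhd> H = \<eta>" for H
        using that V by (simp add: horizontal_affine_connection_def hom1_iff)
    qed (simp_all add: hom1_iff hom2_iff \<eta>)
    then show ?thesis
      by (simp only: U h)
  qed
qed

lemma U_Cell [simp]:
  "U_VAC \<in> Cell1 K" "src K U_VAC = E\<^sub>4" "tgt K U_VAC = base X"
  "k_VAC \<in> Cell2 K" "dom2 K k_VAC = tan X \<odot> tan X \<odot> U_VAC" "cod2 K k_VAC = tan X \<odot> U_VAC"
  "U_HAC \<in> Cell1 K" "src K U_HAC = F\<^sub>4" "tgt K U_HAC = base X"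
  "h_HAC \<in> Cell2 K" "dom2 K h_HAC = tan2 X \<odot> U_HAC" "cod2 K h_HAC = tan X \<odot> tan X \<odot> U_HAC"
  using vertical_representation(1,2) horizontal_representation(1,2) by (simp_all add: hom1_iff hom2_iff)

lemma pbD:
  "q \<in> hom1 K AC\<^sub>0 E\<^sub>4" "q' \<in> hom1 K AC\<^sub>0 F\<^sub>4" "U_VAC \<odot> q = U_HAC \<odot> q'"
  "u \<in> hom1 K Y E\<^sub>4 \<Longrightarrow> v \<in> hom1 K Y F\<^sub>4 \<Longrightarrow> U_VAC \<odot> u = U_HAC \<odot> v \<Longrightarrow>
    \<exists>!H. H \<in> hom1 K Y AC\<^sub>0 \<and> q \<odot> H = u \<and> q' \<odot> H = v"
  "H \<in> hom1 K Y AC\<^sub>0 \<Longrightarrow> L \<in> hom1 K Y AC\<^sub>0 \<Longrightarrow> \<theta> \<in> hom2 K (q \<odot> H) (q \<odot> L) \<Longrightarrow>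
    \<eta> \<in> hom2 K (q' \<odot> H) (q' \<odot> L) \<Longrightarrow> U_VAC \<rhd> \<theta> = U_HAC \<rhd> \<eta> \<Longrightarrow>
    \<exists>!\<zeta>. \<zeta> \<in> hom2 K H L \<and> q \<rhd> \<zeta> = \<theta> \<and> q' \<rhd> \<zeta> = \<eta>"
  using pb unfolding is_two_pullback_def U_Cell by blast+

lemma q_Cell [simp]:
  "q \<in> Cell1 K" "src K q = AC\<^sub>0" "tgt K q = E\<^sub>4" "q' \<in> Cell1 K" "src K q' = AC\<^sub>0" "tgt K q' = F\<^sub>4"
  using pbD(1,2) by (simp_all add: hom1_iff)

text \<open>Both projections of the 2-pullback yield a 1-morphism into the tangentad, and the two agree;
  over it live a vertical and a horizontal connection. Their axioms on the projections of \<open>k\<close> and \<open>h\<close>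
  are what makes the last axiom commute with precomposition.\<close>

lemma affine_step:
  assumes d: "full_sub K B AC\<^sub>0 d \<Phi>" and ax: "ax = axA1 \<or> ax = axA2"
    and eq: "is_equifier K (ax (hom_tcat K B X) (U_VAC \<odot> q \<odot> d) (k_VAC \<lhd> (q \<odot> d)) (h_HAC \<lhd> (q' \<odot> d))) E e"
  shows "e \<in> hom1 K E B" and "full_sub K E AC\<^sub>0 (d \<odot> e) (\<lambda>H. \<Phi> H \<and>
    fst (ax (hom_tcat K (src K H) X) (U_VAC \<odot> q \<odot> H) (k_VAC \<lhd> (q \<odot> H)) (h_HAC \<lhd> (q' \<odot> H))) =
    snd (ax (hom_tcat K (src K H) X) (U_VAC \<odot> q \<odot> H) (k_VAC \<lhd> (q \<odot> H)) (h_HAC \<lhd> (q' \<odot> H))))"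
proof -
  have [simp]: "d \<in> Cell1 K" "src K d = B" "tgt K d = AC\<^sub>0"
    using full_subD(1)[OF d] by (simp_all add: hom1_iff)
  have "B \<in> Cell0 K"
    using src_tgt(1)[of d] by simp
  then interpret D: tangent_calculus "hom_tcat K B X" by (rule tangent_calculus_hom_tcat)
  have UU [simp]: "U_HAC \<odot> q' \<odot> H = U_VAC \<odot> q \<odot> H" if "H \<in> Cell1 K" "tgt K H = AC\<^sub>0" for H
    using arg_cong[OF pbD(3), of "\<lambda>F. F \<odot> H"] that by simp
  have M: "U_VAC \<odot> q \<odot> d \<in> Ob (hom_tcat K B X)"
    and k: "k_VAC \<lhd> (q \<odot> d) \<in> Hom (hom_tcat K B X) (D.To (D.To (U_VAC \<odot> q \<odot> d))) (D.To (U_VAC \<odot> q \<odot> d))"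
    and h: "h_HAC \<lhd> (q' \<odot> d) \<in> Hom (hom_tcat K B X) (D.T2o (U_VAC \<odot> q \<odot> d)) (D.To (D.To (U_VAC \<odot> q \<odot> d)))"
    by (simp_all add: hom1_iff Hom_iff)
  have "q \<odot> d \<in> hom1 K B E\<^sub>4" "q' \<odot> d \<in> hom1 K B F\<^sub>4"
    by (simp_all add: hom1_iff)
  then have VH: "fst (axV2 (hom_tcat K B X) (U_VAC \<odot> q \<odot> d) (k_VAC \<lhd> (q \<odot> d))) =
        snd (axV2 (hom_tcat K B X) (U_VAC \<odot> q \<odot> d) (k_VAC \<lhd> (q \<odot> d)))"
    "fst (axH2 (hom_tcat K B X) (U_VAC \<odot> q \<odot> d) (h_HAC \<lhd> (q' \<odot> d))) =
        snd (axH2 (hom_tcat K B X) (U_VAC \<odot> q \<odot> d) (h_HAC \<lhd> (q' \<odot> d)))"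
    using vertical_representation(3)[of "q \<odot> d" B] horizontal_representation(3)[of "q' \<odot> d" B]
    by (simp_all add: vertical_affine_connection_def horizontal_affine_connection_def)
  have ar: "fst (ax (hom_tcat K B X) (U_VAC \<odot> q \<odot> d) (k_VAC \<lhd> (q \<odot> d)) (h_HAC \<lhd> (q' \<odot> d))) \<in> Ar (hom_tcat K B X) \<or>
      snd (ax (hom_tcat K B X) (U_VAC \<odot> q \<odot> d) (k_VAC \<lhd> (q \<odot> d)) (h_HAC \<lhd> (q' \<odot> d))) \<in> Ar (hom_tcat K B X)"
    using ax D.axiom_Ar[OF M k h] by auto
  have pre: "ax (hom_tcat K Y X) (U_VAC \<odot> q \<odot> d \<odot> H) (k_VAC \<lhd> (q \<odot> d \<odot> H)) (h_HAC \<lhd> (q' \<odot> d \<odot> H)) =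
      map_prod (\<lambda>\<phi>. \<phi> \<lhd> H) (\<lambda>\<phi>. \<phi> \<lhd> H)
        (ax (hom_tcat K B X) (U_VAC \<odot> q \<odot> d) (k_VAC \<lhd> (q \<odot> d)) (h_HAC \<lhd> (q' \<odot> d)))"
    if H: "H \<in> hom1 K Y B" for Y H
  proof -
    interpret S: strict_functor "hom_tcat K B X" "hom_tcat K Y X" "\<lambda>M. M \<odot> H" "\<lambda>\<phi>. \<phi> \<lhd> H"
      by (rule precomposition_strict[OF H])
    show ?thesis
      using ax S.image_A1[OF M k h] S.image_A2[OF M k h VH] H by (auto simp: hom1_iff)
  qed
  note step = axiom_step[OF d, where ax = "\<lambda>D d. ax D (U_VAC \<odot> q \<odot> d) (k_VAC \<lhd> (q \<odot> d)) (h_HAC \<lhd> (q' \<odot> d))", OF eq ar pre]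
  show "e \<in> hom1 K E B"
    by (rule step(1))
  show "full_sub K E AC\<^sub>0 (d \<odot> e) (\<lambda>H. \<Phi> H \<and>
    fst (ax (hom_tcat K (src K H) X) (U_VAC \<odot> q \<odot> H) (k_VAC \<lhd> (q \<odot> H)) (h_HAC \<lhd> (q' \<odot> H))) =
    snd (ax (hom_tcat K (src K H) X) (U_VAC \<odot> q \<odot> H) (k_VAC \<lhd> (q \<odot> H)) (h_HAC \<lhd> (q' \<odot> H))))"
    by (rule step(2))
qed

lemma g_Cell [simp]:
  "g\<^sub>1 \<in> Cell1 K" "src K g\<^sub>1 = G\<^sub>1" "tgt K g\<^sub>1 = AC\<^sub>0" "g\<^sub>2 \<in> Cell1 K" "src K g\<^sub>2 = G\<^sub>2" "tgt K g\<^sub>2 = G\<^sub>1"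
  and A_full_sub: "full_sub K G\<^sub>2 AC\<^sub>0 (g\<^sub>1 \<odot> g\<^sub>2) (\<lambda>H. \<forall>ax \<in> {axA1, axA2}.
    fst (ax (hom_tcat K (src K H) X) (U_VAC \<odot> q \<odot> H) (k_VAC \<lhd> (q \<odot> H)) (h_HAC \<lhd> (q' \<odot> H))) =
    snd (ax (hom_tcat K (src K H) X) (U_VAC \<odot> q \<odot> H) (k_VAC \<lhd> (q \<odot> H)) (h_HAC \<lhd> (q' \<odot> H))))"
proof -
  have AC: "AC\<^sub>0 \<in> Cell0 K"
    using src_tgt(1)[of q] by simp
  have "is_equifier K (axA1 (hom_tcat K AC\<^sub>0 X) (U_VAC \<odot> q \<odot> id1 K AC\<^sub>0) (k_VAC \<lhd> (q \<odot> id1 K AC\<^sub>0)) (h_HAC \<lhd> (q' \<odot> id1 K AC\<^sub>0))) G\<^sub>1 g\<^sub>1"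
    using eqA(1) by simp
  note s1 = affine_step[where ax = axA1, OF full_sub_id[OF AC] _ this, simplified]
  note [simp] = s1(1)[unfolded hom1_iff]
  note s1 = s1(2)[simplified]
  note s2 = affine_step[where ax = axA2, OF s1 _ eqA(2), simplified]
  note [simp] = s2(1)[unfolded hom1_iff]
  show "g\<^sub>1 \<in> Cell1 K" "src K g\<^sub>1 = G\<^sub>1" "tgt K g\<^sub>1 = AC\<^sub>0" "g\<^sub>2 \<in> Cell1 K" "src K g\<^sub>2 = G\<^sub>2" "tgt K g\<^sub>2 = G\<^sub>1"
    by simp_all
  show "full_sub K G\<^sub>2 AC\<^sub>0 (g\<^sub>1 \<odot> g\<^sub>2) (\<lambda>H. \<forall>ax \<in> {axA1, axA2}.
    fst (ax (hom_tcat K (src K H) X) (U_VAC \<odot> q \<odot> H) (k_VAC \<lhd> (q \<odot> H)) (h_HAC \<lhd> (q' \<odot> H))) =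
    snd (ax (hom_tcat K (src K H) X) (U_VAC \<odot> q \<odot> H) (k_VAC \<lhd> (q \<odot> H)) (h_HAC \<lhd> (q' \<odot> H))))"
    using s2(2) by simp
qed

end

context affine_limits
begin

text \<open>
  A vertical and a horizontal connection on the same 1-morphism factor through the two towers,
  hence jointly through the 2-pullback, and the factorization lies in the top equifier exactly if
  the two compatibility axioms hold. In dimension two, a 2-cell commuting with \<open>k\<close> and \<open>h\<close> lifts through
  each inserter, and the two lifts agree below the 2-pullback.
\<close>

theorem represents: "affine_object K X G\<^sub>2 (U_VAC \<odot> q \<odot> g\<^sub>1 \<odot> g\<^sub>2) (k_VAC \<lhd> (q \<odot> g\<^sub>1 \<odot> g\<^sub>2)) (h_HAC \<lhd> (q' \<odot> g\<^sub>1 \<odot> g\<^sub>2))"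
proof -
  let ?g = "g\<^sub>1 \<odot> g\<^sub>2"
  let ?u = "q \<odot> g\<^sub>1 \<odot> g\<^sub>2" and ?v = "q' \<odot> g\<^sub>1 \<odot> g\<^sub>2"
  note A = full_subD[OF A_full_sub]
  note V = inserter_restrict[OF insV V_full_sub] and Hh = inserter_restrict[OF insH H_full_sub]
  have UV: "V\<^sub>0 \<odot> e\<^sub>1 \<odot> e\<^sub>2 \<odot> e\<^sub>3 \<odot> e\<^sub>4 = U_VAC" "K\<^sub>0 \<lhd> (e\<^sub>1 \<odot> e\<^sub>2 \<odot> e\<^sub>3 \<odot> e\<^sub>4) = k_VAC"
    "W\<^sub>0 \<odot> f\<^sub>1 \<odot> f\<^sub>2 \<odot> f\<^sub>3 \<odot> f\<^sub>4 = U_HAC" "H\<^sub>0 \<lhd> (f\<^sub>1 \<odot> f\<^sub>2 \<odot> f\<^sub>3 \<odot> f\<^sub>4) = h_HAC"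
    by (simp_all add: U_VAC k_VAC U_HAC h_HAC)
  note V = V[unfolded UV] and Hh = Hh[unfolded UV]
  have UU: "U_HAC \<odot> q' \<odot> H = U_VAC \<odot> q \<odot> H" if "H \<in> Cell1 K" "tgt K H = AC\<^sub>0" for H
    using arg_cong[OF pbD(3), of "\<lambda>F. F \<odot> H"] that by simp
  have UU2: "U_HAC \<rhd> q' \<rhd> \<theta> = U_VAC \<rhd> q \<rhd> \<theta>" if "\<theta> \<in> Cell2 K" "tgt K (dom2 K \<theta>) = AC\<^sub>0" for \<theta>
    using arg_cong[OF pbD(3), of "\<lambda>F. F \<rhd> \<theta>"] that by simp
  have gH: "?g \<odot> H = g\<^sub>1 \<odot> g\<^sub>2 \<odot> H" "(U_VAC \<odot> ?u) \<odot> H = U_VAC \<odot> q \<odot> g\<^sub>1 \<odot> g\<^sub>2 \<odot> H"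
    "(k_VAC \<lhd> ?u) \<lhd> H = k_VAC \<lhd> (q \<odot> g\<^sub>1 \<odot> g\<^sub>2 \<odot> H)" "(h_HAC \<lhd> ?v) \<lhd> H = h_HAC \<lhd> (q' \<odot> g\<^sub>1 \<odot> g\<^sub>2 \<odot> H)"
    "g\<^sub>1 \<odot> g\<^sub>2 \<odot> H \<in> hom1 K Y AC\<^sub>0" "q \<odot> g\<^sub>1 \<odot> g\<^sub>2 \<odot> H \<in> hom1 K Y E\<^sub>4" "q' \<odot> g\<^sub>1 \<odot> g\<^sub>2 \<odot> H \<in> hom1 K Y F\<^sub>4"
    "U_HAC \<odot> q' \<odot> g\<^sub>1 \<odot> g\<^sub>2 \<odot> H = U_VAC \<odot> q \<odot> g\<^sub>1 \<odot> g\<^sub>2 \<odot> H"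
    if "H \<in> hom1 K Y G\<^sub>2" for Y H
    using that by (simp_all add: hom1_iff UU)
  have univ: "affine_connection (hom_tcat K Y X) ((U_VAC \<odot> ?u) \<odot> H) ((k_VAC \<lhd> ?u) \<lhd> H) ((h_HAC \<lhd> ?v) \<lhd> H)"
    if H: "H \<in> hom1 K Y G\<^sub>2" for Y H
  proof -
    note g = gH[OF H]
    have "src K (?g \<odot> H) = Y" using H by (simp add: hom1_iff)
    with A(2)[OF H] show ?thesis
      using vertical_representation(3)[OF g(6)] horizontal_representation(3)[OF g(7)]
      unfolding affine_connection_def g(1-4,8) by auto
  qed
  show ?thesis
  proof unfold_locales
    show "affine_connection (hom_tcat K G\<^sub>2 X) (U_VAC \<odot> ?u) (k_VAC \<lhd> ?u) (h_HAC \<lhd> ?v)"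
    proof -
      have "G\<^sub>2 \<in> Cell0 K" using src_tgt(1)[of g\<^sub>2] by simp
      then show ?thesis using univ[of "id1 K G\<^sub>2" G\<^sub>2] by (simp add: hom1_iff)
    qed
  next
    fix Y W \<kappa> \<eta>
    assume AC: "affine_connection (hom_tcat K Y X) W \<kappa> \<eta>"
    then obtain u v where u: "u \<in> hom1 K Y E\<^sub>4" "U_VAC \<odot> u = W" "k_VAC \<lhd> u = \<kappa>"
      and v: "v \<in> hom1 K Y F\<^sub>4" "U_HAC \<odot> v = W" "h_HAC \<lhd> v = \<eta>"
      using vertical_representation(4) horizontal_representation(4) unfolding affine_connection_def by meson
    have "\<exists>!H. H \<in> hom1 K Y AC\<^sub>0 \<and> q \<odot> H = u \<and> q' \<odot> H = v"
      by (rule pbD(4)[OF u(1) v(1)]) (simp add: u v)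
    from ex1_implies_ex[OF this] obtain H where H: "H \<in> hom1 K Y AC\<^sub>0" "q \<odot> H = u" "q' \<odot> H = v"
      by blast
    have "src K H = Y" using H by (simp add: hom1_iff)
    then have "\<forall>ax \<in> {axA1, axA2}.
      fst (ax (hom_tcat K (src K H) X) (U_VAC \<odot> q \<odot> H) (k_VAC \<lhd> (q \<odot> H)) (h_HAC \<lhd> (q' \<odot> H))) =
      snd (ax (hom_tcat K (src K H) X) (U_VAC \<odot> q \<odot> H) (k_VAC \<lhd> (q \<odot> H)) (h_HAC \<lhd> (q' \<odot> H)))"
      using AC by (simp add: affine_connection_def H u v)
    from A(3)[OF H(1) this] obtain H' where H': "H' \<in> hom1 K Y G\<^sub>2" "?g \<odot> H' = H" by blast
    show "\<exists>H\<in>hom1 K Y G\<^sub>2. (U_VAC \<odot> ?u) \<odot> H = W \<and> (k_VAC \<lhd> ?u) \<lhd> H = \<kappa> \<and> (h_HAC \<lhd> ?v) \<lhd> H = \<eta>"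
      using H' H u v gH[OF H'(1)] by (intro bexI[of _ H']) simp_all
  next
    fix Y H L
    assume HL: "H \<in> hom1 K Y G\<^sub>2" "L \<in> hom1 K Y G\<^sub>2" and e: "(U_VAC \<odot> ?u) \<odot> H = (U_VAC \<odot> ?u) \<odot> L"
      "(k_VAC \<lhd> ?u) \<lhd> H = (k_VAC \<lhd> ?u) \<lhd> L" "(h_HAC \<lhd> ?v) \<lhd> H = (h_HAC \<lhd> ?v) \<lhd> L"
    note gH1 = gH[OF HL(1)] and gL = gH[OF HL(2)]
    have 1: "q \<odot> g\<^sub>1 \<odot> g\<^sub>2 \<odot> H = q \<odot> g\<^sub>1 \<odot> g\<^sub>2 \<odot> L"
      by (rule V(2)[OF gH1(6) gL(6)]) (use e in \<open>simp_all only: gH1(2,3) gL(2,3)\<close>)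
    have 2: "q' \<odot> g\<^sub>1 \<odot> g\<^sub>2 \<odot> H = q' \<odot> g\<^sub>1 \<odot> g\<^sub>2 \<odot> L"
      by (rule Hh(2)[OF gH1(7) gL(7)]) (use e in \<open>simp_all only: gH1(2,4,8) gL(2,4,8)\<close>)
    have "g\<^sub>1 \<odot> g\<^sub>2 \<odot> H = g\<^sub>1 \<odot> g\<^sub>2 \<odot> L"
      by (rule ex1_unique[OF pbD(4)[OF gL(6,7) gL(8)[symmetric]]]) (simp_all add: gH1(5) gL(5) 1 2)
    then show "H = L"
      using A(4)[OF HL] gH1(1) gL(1) by simp
  next
    fix Y H L \<theta>
    assume HL: "H \<in> hom1 K Y G\<^sub>2" "L \<in> hom1 K Y G\<^sub>2" and th: "\<theta> \<in> hom2 K ((U_VAC \<odot> ?u) \<odot> H) ((U_VAC \<odot> ?u) \<odot> L)"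
      "(tan X \<rhd> \<theta>) \<bullet> ((k_VAC \<lhd> ?u) \<lhd> H) = ((k_VAC \<lhd> ?u) \<lhd> L) \<bullet> (tan X \<rhd> tan X \<rhd> \<theta>)"
      "(tan X \<rhd> tan X \<rhd> \<theta>) \<bullet> ((h_HAC \<lhd> ?v) \<lhd> H) = ((h_HAC \<lhd> ?v) \<lhd> L) \<bullet> (tan2 X \<rhd> \<theta>)"
    note gH1 = gH[OF HL(1)] and gL = gH[OF HL(2)]
    note th = th[unfolded gH1(2-4) gL(2-4)]
    have [simp]: "\<theta> \<in> Cell2 K" "tgt K (dom2 K \<theta>) = base X"
      using th(1) HL by (auto simp: hom2_iff hom1_iff)
    obtain t1 where t1: "t1 \<in> hom2 K (q \<odot> g\<^sub>1 \<odot> g\<^sub>2 \<odot> H) (q \<odot> g\<^sub>1 \<odot> g\<^sub>2 \<odot> L)" "U_VAC \<rhd> t1 = \<theta>"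
      using V(3)[OF gH1(6) gL(6) th(1)] th(2) by auto
    obtain t2 where t2: "t2 \<in> hom2 K (q' \<odot> g\<^sub>1 \<odot> g\<^sub>2 \<odot> H) (q' \<odot> g\<^sub>1 \<odot> g\<^sub>2 \<odot> L)" "U_HAC \<rhd> t2 = \<theta>"
      using Hh(3)[OF gH1(7) gL(7), of \<theta>] th(1,3) gH1(8) gL(8) by auto
    have "\<exists>!\<zeta>. \<zeta> \<in> hom2 K (g\<^sub>1 \<odot> g\<^sub>2 \<odot> H) (g\<^sub>1 \<odot> g\<^sub>2 \<odot> L) \<and> q \<rhd> \<zeta> = t1 \<and> q' \<rhd> \<zeta> = t2"
      by (rule pbD(5)[OF gH1(5) gL(5) t1(1) t2(1)]) (simp add: t1 t2)
    from ex1_implies_ex[OF this] obtain t where t: "t \<in> hom2 K (g\<^sub>1 \<odot> g\<^sub>2 \<odot> H) (g\<^sub>1 \<odot> g\<^sub>2 \<odot> L)" "q \<rhd> t = t1"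
      by blast
    obtain t' where t': "t' \<in> hom2 K H L" "?g \<rhd> t' = t"
      using A(5)[OF HL, of t] t gH1(1) gL(1) by auto
    have "(U_VAC \<odot> ?u) \<rhd> t' = U_VAC \<rhd> q \<rhd> ?g \<rhd> t'"
      using t'(1) HL by (auto simp: hom1_iff hom2_iff)
    then have "(U_VAC \<odot> ?u) \<rhd> t' = \<theta>"
      by (simp only: t'(2) t(2) t1(2))
    then show "\<exists>\<theta>'\<in>hom2 K H L. (U_VAC \<odot> ?u) \<rhd> \<theta>' = \<theta>"
      using t' by blast
  next
    fix Y H L \<theta> \<theta>'
    assume HL: "H \<in> hom1 K Y G\<^sub>2" "L \<in> hom1 K Y G\<^sub>2" and th: "\<theta> \<in> hom2 K H L" "\<theta>' \<in> hom2 K H L"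
      "(U_VAC \<odot> ?u) \<rhd> \<theta> = (U_VAC \<odot> ?u) \<rhd> \<theta>'"
    note gH1 = gH[OF HL(1)] and gL = gH[OF HL(2)]
    have w: "?g \<rhd> t \<in> hom2 K (g\<^sub>1 \<odot> g\<^sub>2 \<odot> H) (g\<^sub>1 \<odot> g\<^sub>2 \<odot> L)" "(U_VAC \<odot> ?u) \<rhd> t = U_VAC \<rhd> q \<rhd> ?g \<rhd> t"
        "U_HAC \<rhd> q' \<rhd> ?g \<rhd> t = U_VAC \<rhd> q \<rhd> ?g \<rhd> t"
        "q \<rhd> ?g \<rhd> t \<in> hom2 K (q \<odot> g\<^sub>1 \<odot> g\<^sub>2 \<odot> H) (q \<odot> g\<^sub>1 \<odot> g\<^sub>2 \<odot> L)"
        "q' \<rhd> ?g \<rhd> t \<in> hom2 K (q' \<odot> g\<^sub>1 \<odot> g\<^sub>2 \<odot> H) (q' \<odot> g\<^sub>1 \<odot> g\<^sub>2 \<odot> L)"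
      if "t \<in> hom2 K H L" for t
      using that HL UU2[of "?g \<rhd> t"] by (auto simp: hom1_iff hom2_iff)
    have e: "U_VAC \<rhd> q \<rhd> ?g \<rhd> \<theta> = U_VAC \<rhd> q \<rhd> ?g \<rhd> \<theta>'"
      using th(3) by (simp only: w(2)[OF th(1)] w(2)[OF th(2)])
    have 1: "q \<rhd> ?g \<rhd> \<theta> = q \<rhd> ?g \<rhd> \<theta>'"
      by (rule V(4)[OF gH1(6) gL(6) w(4)[OF th(1)] w(4)[OF th(2)] e])
    have "U_HAC \<rhd> q' \<rhd> ?g \<rhd> \<theta> = U_HAC \<rhd> q' \<rhd> ?g \<rhd> \<theta>'"
      by (simp only: w(3)[OF th(1)] w(3)[OF th(2)] e)
    then have 2: "q' \<rhd> ?g \<rhd> \<theta> = q' \<rhd> ?g \<rhd> \<theta>'"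
      by (rule Hh(4)[OF gH1(7) gL(7) w(5)[OF th(1)] w(5)[OF th(2)]])
    have "?g \<rhd> \<theta> = ?g \<rhd> \<theta>'"
      by (rule ex1_unique[OF pbD(5)[OF gH1(5) gL(5) w(4)[OF th(1)] w(5)[OF th(1)] w(3)[OF th(1), symmetric]]])
        (intro conjI w(1)[OF th(1)] w(1)[OF th(2)] refl 1[symmetric] 2[symmetric])+
    then show "\<theta> = \<theta>'"
      by (rule A(6)[OF HL th(1,2)])
  qed
qed

end

section \<open>The vertical lift\<close>

context tangent_calculus
begin

text \<open>The arrow \<open>T\<^sub>2 M \<rightarrow> T T M\<close> of the universality square of the vertical lift. It differs from \<open>\<xi>\<close> by
  the order of the two components.\<close>

definition vl :: "'a \<Rightarrow> 'f" where
  "vl M = T (s M) \<cdot> zl M"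

lemma vl_Ar [simp]:
  assumes "M \<in> Ob D"
  shows "vl M \<in> Ar D" "Dom D (vl M) = T2o M" "Cod D (vl M) = To (To M)"
  using assms by (simp_all add: vl_def)

definition monic :: "'f \<Rightarrow> bool" where
  "monic f \<longleftrightarrow> (\<forall>u v. u \<in> Ar D \<and> v \<in> Ar D \<and> Dom D u = Dom D v \<and> Cod D u = Dom D f \<and> Cod D v = Dom D f \<and>
     f \<cdot> u = f \<cdot> v \<longrightarrow> u = v)"

lemma monicD:
  "monic f \<Longrightarrow> u \<in> Ar D \<Longrightarrow> v \<in> Ar D \<Longrightarrow> Dom D u = Dom D v \<Longrightarrow> Cod D u = Dom D f \<Longrightarrow> Cod D v = Dom D f \<Longrightarrow>
     f \<cdot> u = f \<cdot> v \<Longrightarrow> u = v"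
  by (simp add: monic_def)

text \<open>The other leg of the pullback square takes values in the base, and the base point of a vector
  can be recovered from its vertical lift. So the vertical lift alone is monic.\<close>

lemma vl_monic:
  assumes pb: "is_pullback D (z M) (T (p M)) (T2o M) (p M \<cdot> a M) (vl M)" and [simp]: "M \<in> Ob D"
  shows "monic (vl M)"
  unfolding monic_def
proof (intro allI impI, elim conjE)
  fix u v
  assume [simp]: "u \<in> Ar D" "v \<in> Ar D" "Dom D u = Dom D v" "Cod D u = Dom D (vl M)" "Cod D v = Dom D (vl M)"
    and e: "vl M \<cdot> u = vl M \<cdot> v"
  have 1: "p M \<ast> p (To M) \<ast> vl M \<ast> x = p M \<ast> a M \<ast> x" for x
  proof -
    have "p M \<ast> a M \<ast> p (T2o M) \<ast> y = p M \<ast> p (To M) \<ast> T (a M) \<ast> y" for y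
      by (simp add: p_act)
    then have "p M \<ast> a M \<ast> p (T2o M) \<ast> zl M \<ast> x = p M \<ast> p (To M) \<ast> T (a M) \<ast> zl M \<ast> x" .
    also have "\<dots> = p M \<ast> a M \<ast> x"
      by (simp add: structure_act)
    finally show ?thesis
      by (simp add: vl_def p_act structure_act)
  qed
  have "(p M \<cdot> a M) \<cdot> u = (p M \<cdot> a M) \<cdot> v"
  proof (rule act_ext)
    fix x
    have "p M \<ast> p (To M) \<ast> vl M \<ast> u \<ast> x = p M \<ast> p (To M) \<ast> vl M \<ast> v \<ast> x"
      using act_cong[OF e, of x] by simp
    then show "((p M \<cdot> a M) \<cdot> u) \<ast> x = ((p M \<cdot> a M) \<cdot> v) \<ast> x"
      by (simp add: 1)
  qed simp_all
  then show "u = v"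
    by (intro pullback_eqI[OF pb _ _ _ _ _ _ e]) simp_all
qed

lemma monic_transfer:
  assumes mono: "monic g" and x: "is_iso D x" "Cod D x = Dom D g" and f: "f \<in> Ar D" "Dom D f = Dom D x"
    and y: "y \<in> Ar D" "Dom D y = Cod D f" and g: "g \<in> Ar D" and e: "g \<cdot> x = y \<cdot> f"
  shows "monic f"
  unfolding monic_def
proof (intro allI impI, elim conjE)
  fix u v
  assume uv: "u \<in> Ar D" "v \<in> Ar D" "Dom D u = Dom D v" "Cod D u = Dom D f" "Cod D v = Dom D f"
    and fuv: "f \<cdot> u = f \<cdot> v"
  obtain i where i: "i \<in> Ar D" "Dom D i = Cod D x" "Cod D i = Dom D x" "i \<cdot> x = Idn D (Dom D x)" "x \<in> Ar D"
    using iso_obtain[OF x(1)] by metis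
  have "g \<cdot> (x \<cdot> u) = (g \<cdot> x) \<cdot> u" "g \<cdot> (x \<cdot> v) = (g \<cdot> x) \<cdot> v"
    "(y \<cdot> f) \<cdot> u = y \<cdot> (f \<cdot> u)" "(y \<cdot> f) \<cdot> v = y \<cdot> (f \<cdot> v)"
    by (rule comp_assoc[symmetric] comp_assoc; use uv i f g y x in simp)+
  then have "g \<cdot> (x \<cdot> u) = g \<cdot> (x \<cdot> v)"
    by (simp only: e fuv)
  from monicD[OF mono _ _ _ _ _ this] have "x \<cdot> u = x \<cdot> v"
    using uv i f g x by simp
  then have "i \<cdot> (x \<cdot> u) = i \<cdot> (x \<cdot> v)"
    by simp
  moreover have "i \<cdot> (x \<cdot> u) = (i \<cdot> x) \<cdot> u" "i \<cdot> (x \<cdot> v) = (i \<cdot> x) \<cdot> v"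
    by (rule comp_assoc[symmetric]; use uv i f in simp)+
  ultimately have "(i \<cdot> x) \<cdot> u = (i \<cdot> x) \<cdot> v"
    by simp
  then show "u = v"
    using uv f by (simp add: i(4))
qed

text \<open>
  The universality square is not assumed to be preserved by \<open>T\<close>. Still, the image under \<open>T\<close> of the
  vertical lift at \<open>M\<close> is, up to the flip, the vertical lift at \<open>T M\<close>, because \<open>(T, c)\<close> is a strong
  tangent functor. So it is monic.
\<close>

lemma T_vl_monic:
  assumes [simp]: "M \<in> Ob D"
  shows "monic (vl (To M)) \<Longrightarrow> monic (T (vl M))"
    and "monic (T (vl (To M))) \<Longrightarrow> monic (T (T (vl M)))"
proof -
  interpret T: tangent_fold D 1 To T "\<lambda>i M. Idn D (To M)" p c
    by (rule fold_T)
  have e: "vl (To M) \<cdot> T.F.sg2 M = T.F.sgTT M \<cdot> T (vl M)"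
    by (rule act_ext) (simp_all add: vl_def T.F.sg_zl_act T.F.sg_structure_act(5) T.F.sgTT_def T.F.sg_act)
  show "monic (vl (To M)) \<Longrightarrow> monic (T (vl M))"
    by (rule monic_transfer[OF _ T.F.sg2_iso'[of M] _ _ _ _ _ _ e]) simp_all
  have "T (vl (To M)) \<cdot> T (T.F.sg2 M) = T (T.F.sgTT M) \<cdot> T (T (vl M))"
    using arg_cong[OF e, of T] by simp
  from monic_transfer[OF _ T.F.T_iso[OF T.F.sg2_iso'[of M]] _ _ _ _ _ _ this]
  show "monic (T (vl (To M))) \<Longrightarrow> monic (T (T (vl M)))"
    by simp
qed

lemma into_T2_comp:
  assumes "M \<in> Ob D" "u \<in> Ar D" "v \<in> Ar D" "Dom D u = Dom D v" "Cod D u = To M" "Cod D v = To M"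
    "p M \<cdot> u = p M \<cdot> v" "w \<in> Ar D" "Cod D w = Dom D v"
  shows "into_T2 D M u v \<cdot> w = into_T2 D M (u \<cdot> w) (v \<cdot> w)"
proof (rule into_T2_eqI[symmetric])
  note P = into_T2[OF assms(1-7)]
  show "a M \<cdot> (into_T2 D M u v \<cdot> w) = u \<cdot> w" "b M \<cdot> (into_T2 D M u v \<cdot> w) = v \<cdot> w"
    using comp_assoc[of w "into_T2 D M u v" "a M"] comp_assoc[of w "into_T2 D M u v" "b M"] P assms by simp_all
qed (use into_T2(1-3)[OF assms(1-7)] assms in simp_all)

end

context tangentad
begin

lemma vl_hom:
  assumes F: "F \<in> hom1 K Y (base X)"
  shows "tangent_calculus.vl (hom_tcat K Y X) F = ((tan X \<rhd> pls X) \<bullet> iTT2 ((zer X \<lhd> tan X) \<bullet> prA X) (lft X \<bullet> prB X)) \<lhd> F"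
    and "is_pullback (hom_tcat K Y X) (zer X \<lhd> F) (tan X \<rhd> (prj X \<lhd> F)) (tan2 X \<odot> F) ((prj X \<lhd> F) \<bullet> (prA X \<lhd> F))
      (tangent_calculus.vl (hom_tcat K Y X) F)"
proof -
  interpret D: tangent_calculus "hom_tcat K Y X"
    by (rule tangent_calculus_hom_tcat[OF hom1_Cell0(1)[OF F]])
  interpret X: tangent_calculus "hom_tcat K (base X) X"
    by (rule tangent_calculus_hom_tcat) simp
  have [simp]: "F \<in> Cell1 K" "src K F = Y" "tgt K F = base X"
    using F by (simp_all add: hom1_iff)
  let ?u = "(zer X \<lhd> tan X) \<bullet> prA X" and ?v = "lft X \<bullet> prB X"
  have I: "id1 K (base X) \<in> hom1 K (base X) (base X)"
    by (simp add: hom1_iff)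
  have e: "(tan X \<rhd> prj X) \<bullet> ?u = (tan X \<rhd> prj X) \<bullet> ?v"
    by (rule act_ext2[of _ _ "base X" X])
     (use X.structure_act[of "id1 K (base X)"] X.z_act[of "prj X" "id1 K (base X)", symmetric] in \<open>simp_all add: hom1_iff\<close>)
  note P = into_TT2_rwhisk[OF F _ _ _ _ _ e, simplified]
  show v: "D.vl F = ((tan X \<rhd> pls X) \<bullet> iTT2 ?u ?v) \<lhd> F"
    unfolding D.vl_def D.zl_def using P(1-3) P(6) by simp
  show "is_pullback (hom_tcat K Y X) (zer X \<lhd> F) (tan X \<rhd> (prj X \<lhd> F)) (tan2 X \<odot> F) ((prj X \<lhd> F) \<bullet> (prA X \<lhd> F)) (D.vl F)"
    using tangentad_axioms(19)[OF F] unfolding v hom_tcat_hom_cat by simp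
qed

lemma vl_hom_monic:
  assumes F: "F \<in> hom1 K Y (base X)"
  shows "tangent_calculus.monic (hom_tcat K Y X) (tangent_calculus.vl (hom_tcat K Y X) F)"
    and "tangent_calculus.monic (hom_tcat K Y X) (tan X \<rhd> tangent_calculus.vl (hom_tcat K Y X) F)"
    and "tangent_calculus.monic (hom_tcat K Y X) (tan X \<rhd> tan X \<rhd> tangent_calculus.vl (hom_tcat K Y X) F)"
proof -
  interpret D: tangent_calculus "hom_tcat K Y X"
    by (rule tangent_calculus_hom_tcat[OF hom1_Cell0(1)[OF F]])
  have 1: "D.monic (D.vl F)" if "F \<in> hom1 K Y (base X)" for F
    using D.vl_monic[of F] vl_hom(2)[OF that] that by simp
  have TF: "tan X \<odot> F \<in> hom1 K Y (base X)" if "F \<in> hom1 K Y (base X)" for F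
    using that by (simp add: hom1_iff)
  have 2: "D.monic (tan X \<rhd> D.vl F)" if "F \<in> hom1 K Y (base X)" for F
    using D.T_vl_monic(1)[of F] 1[OF TF[OF that]] that by simp
  show "D.monic (D.vl F)" "D.monic (tan X \<rhd> D.vl F)"
    using 1 2 F by blast+
  show "D.monic (tan X \<rhd> tan X \<rhd> D.vl F)"
    using D.T_vl_monic(2)[of F] 2[OF TF[OF F]] F by simp
qed

text \<open>The comparison for a fibred power \<open>P\<close> is the arrow into \<open>T P\<close> induced by the flips; it exists because
  \<open>T\<close> preserves the pullback.\<close>

lemma tan_fold_tangent_fold:
  assumes fold: "is_tan_fold K X n P r q" and Y: "Y \<in> Cell0 K"
  obtains sg where "tangent_fold (hom_tcat K Y X) n (\<lambda>M. P \<odot> M) (\<lambda>\<phi>. P \<rhd> \<phi>) (\<lambda>i M. r i \<lhd> M) (\<lambda>M. q \<lhd> M) sg"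
proof -
  interpret D: tangent_calculus "hom_tcat K Y X"
    by (rule tangent_calculus_hom_tcat[OF Y])
  have [simp]: "P \<in> Cell1 K" "src K P = base X" "tgt K P = base X" "q \<in> Cell2 K" "dom2 K q = P" "cod2 K q = id1 K (base X)"
    using fold by (simp_all add: is_tan_fold_def hom1_iff hom2_iff)
  have r [simp]: "r i \<in> Cell2 K" "dom2 K (r i) = P" "cod2 K (r i) = tan X" if "i < n" for i
    using fold that by (simp_all add: is_tan_fold_def hom2_iff)
  have "\<exists>w. w \<in> Hom (hom_tcat K Y X) (P \<odot> tan X \<odot> M) (tan X \<odot> P \<odot> M) \<and> (tan X \<rhd> (q \<lhd> M)) \<bullet> w = q \<lhd> (tan X \<odot> M) \<and>
      (\<forall>i<n. (tan X \<rhd> (r i \<lhd> M)) \<bullet> w = (flp X \<lhd> M) \<bullet> (r i \<lhd> (tan X \<odot> M)))" if M: "M \<in> hom1 K Y (base X)" for M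
  proof -
    have [simp]: "M \<in> Cell1 K" "src K M = Y" "tgt K M = base X"
      using M by (simp_all add: hom1_iff)
    have TM: "tan X \<odot> M \<in> hom1 K Y (base X)" by (simp add: hom1_iff)
    have pr: "(tan X \<rhd> (prj X \<lhd> M)) \<bullet> (flp X \<lhd> M) \<bullet> (r i \<lhd> (tan X \<odot> M)) = q \<lhd> (tan X \<odot> M)" if i: "i < n" for i
    proof -
      have "(prj X \<lhd> (tan X \<odot> M)) \<bullet> (r i \<lhd> (tan X \<odot> M)) = q \<lhd> (tan X \<odot> M)"
        using D.fold_Ar(8)[OF tan_fold_hom[OF fold TM, of 0] i] by simp
      from act_cong2[OF this, of Y X] show ?thesis
        by (intro act_ext2[of _ _ Y X]) (simp_all add: i D.Tp_c[of M, simplified] hom1_iff)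
    qed
    obtain w where "w \<in> Ar (hom_tcat K Y X)" "Dom (hom_tcat K Y X) w = Dom (hom_tcat K Y X) (q \<lhd> (tan X \<odot> M))"
      "Cod (hom_tcat K Y X) w = tan X \<odot> P \<odot> M" "(tan X \<rhd> (q \<lhd> M)) \<bullet> w = q \<lhd> (tan X \<odot> M)"
      "\<And>i. i < n \<Longrightarrow> (tan X \<rhd> (r i \<lhd> M)) \<bullet> w = (flp X \<lhd> M) \<bullet> (r i \<lhd> (tan X \<odot> M))"
      using D.fold_obtain[OF tan_fold_hom[OF fold M, of 1, simplified], of "q \<lhd> (tan X \<odot> M)"
          "\<lambda>i. (flp X \<lhd> M) \<bullet> (r i \<lhd> (tan X \<odot> M))"] pr by (auto simp: hom1_iff)
    then show ?thesis
      by (intro exI[of _ w]) (auto simp: Hom_iff)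
  qed
  then obtain sg where sg: "\<And>M. M \<in> hom1 K Y (base X) \<Longrightarrow> sg M \<in> Hom (hom_tcat K Y X) (P \<odot> tan X \<odot> M) (tan X \<odot> P \<odot> M) \<and>
     (tan X \<rhd> (q \<lhd> M)) \<bullet> sg M = q \<lhd> (tan X \<odot> M) \<and>
      (\<forall>i<n. (tan X \<rhd> (r i \<lhd> M)) \<bullet> sg M = (flp X \<lhd> M) \<bullet> (r i \<lhd> (tan X \<odot> M)))"
    by metis
  have "tangent_fold (hom_tcat K Y X) n (\<lambda>M. P \<odot> M) (\<lambda>\<phi>. P \<rhd> \<phi>) (\<lambda>i M. r i \<lhd> M) (\<lambda>M. q \<lhd> M) sg"
  proof (unfold_locales, goal_cases)
    case (5 f A B)
    then show ?case using whisk_exchange[of q f P "id1 K (base X)" A B] by (auto simp: Hom_iff hom1_iff)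
  next
    case (6 i f A B)
    then show ?case using whisk_exchange[of "r i" f P "tan X" A B] by (auto simp: Hom_iff hom1_iff)
  next
    case (7 M m)
    then show ?case using tan_fold_hom[OF fold, of M Y m] by simp
  qed (use sg in \<open>auto simp: Hom_iff hom1_iff\<close>)
  then show ?thesis
    by (rule that)
qed

end

section \<open>The tangent structure on the object of affine connections\<close>

context affine_object
begin

lemma U_Cell [simp]:
  "U \<in> Cell1 K" "src K U = G" "tgt K U = base X" "G \<in> Cell0 K"
  "k \<in> Cell2 K" "dom2 K k = tan X \<odot> tan X \<odot> U" "cod2 K k = tan X \<odot> U"
  "h \<in> Cell2 K" "dom2 K h = tan2 X \<odot> U" "cod2 K h = tan X \<odot> tan X \<odot> U"
proof -
  show U: "U \<in> Cell1 K" "src K U = G" "tgt K U = base X"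
    using universal by (simp_all add: affine_connection_def vertical_affine_connection_def hom1_iff)
  then show "G \<in> Cell0 K"
    using src_tgt(1)[of U] by simp
  show "k \<in> Cell2 K" "dom2 K k = tan X \<odot> tan X \<odot> U" "cod2 K k = tan X \<odot> U"
    "h \<in> Cell2 K" "dom2 K h = tan2 X \<odot> U" "cod2 K h = tan X \<odot> tan X \<odot> U"
    using universal by (auto simp: affine_connection_def vertical_affine_connection_def
        horizontal_affine_connection_def Hom_iff)
qed

lemma faithful:
  assumes "\<theta> \<in> Cell2 K" "\<theta>' \<in> Cell2 K" "dom2 K \<theta> = dom2 K \<theta>'" "cod2 K \<theta> = cod2 K \<theta>'"
    "tgt K (dom2 K \<theta>) = G" "U \<rhd> \<theta> = U \<rhd> \<theta>'"
  shows "\<theta> = \<theta>'"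
  using factor2_unique[of "dom2 K \<theta>" "src K (dom2 K \<theta>)" "cod2 K \<theta>" \<theta> \<theta>'] assms by (simp add: hom1_iff hom2_iff)

text \<open>
  A 2-cell lifts along \<open>U\<close> if it is a morphism of connections. The two equations this amounts to
  are equations of 2-cells into \<open>T U J\<close> and \<open>T\<^sup>2 U J\<close>, so they may be checked after composition with a
  family of liftable 2-cells whose images under \<open>T\<close> and under \<open>T\<^sup>2\<close> are jointly monic. This is how limits
  are lifted along \<open>U\<close>.
\<close>

lemma lift_jointly_monic:
  assumes H: "H \<in> hom1 K Y G" and J: "J \<in> hom1 K Y G" and u: "u \<in> hom2 K (U \<odot> H) (U \<odot> J)"
    and S: "\<And>\<phi>. \<phi> \<in> S \<Longrightarrow> \<phi> \<in> Cell2 K \<and> dom2 K \<phi> = J \<and>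
      (\<exists>\<psi>. \<psi> \<in> Cell2 K \<and> dom2 K \<psi> = H \<and> cod2 K \<psi> = cod2 K \<phi> \<and> (U \<rhd> \<phi>) \<bullet> u = U \<rhd> \<psi>)"
    and mono1: "\<And>x y. x \<in> Cell2 K \<Longrightarrow> y \<in> Cell2 K \<Longrightarrow> dom2 K x = dom2 K y \<Longrightarrow> dom2 K y \<in> hom1 K Y (base X) \<Longrightarrow>
      cod2 K x = tan X \<odot> U \<odot> J \<Longrightarrow> cod2 K y = tan X \<odot> U \<odot> J \<Longrightarrow>
      (\<And>\<phi>. \<phi> \<in> S \<Longrightarrow> (tan X \<rhd> U \<rhd> \<phi>) \<bullet> x = (tan X \<rhd> U \<rhd> \<phi>) \<bullet> y) \<Longrightarrow> x = y"
    and mono2: "\<And>x y. x \<in> Cell2 K \<Longrightarrow> y \<in> Cell2 K \<Longrightarrow> dom2 K x = dom2 K y \<Longrightarrow> dom2 K y \<in> hom1 K Y (base X) \<Longrightarrow>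
      cod2 K x = tan X \<odot> tan X \<odot> U \<odot> J \<Longrightarrow> cod2 K y = tan X \<odot> tan X \<odot> U \<odot> J \<Longrightarrow>
      (\<And>\<phi>. \<phi> \<in> S \<Longrightarrow> (tan X \<rhd> tan X \<rhd> U \<rhd> \<phi>) \<bullet> x = (tan X \<rhd> tan X \<rhd> U \<rhd> \<phi>) \<bullet> y) \<Longrightarrow> x = y"
  shows "\<exists>u' \<in> hom2 K H J. U \<rhd> u' = u"
proof -
  have [simp]: "H \<in> Cell1 K" "src K H = Y" "tgt K H = G" "J \<in> Cell1 K" "src K J = Y" "tgt K J = G"
    "u \<in> Cell2 K" "dom2 K u = U \<odot> H" "cod2 K u = U \<odot> J"
    using H J u by (simp_all add: hom1_iff hom2_iff)
  have key: "(tan X \<rhd> U \<rhd> \<phi>) \<bullet> (tan X \<rhd> u) \<bullet> (k \<lhd> H) = (tan X \<rhd> U \<rhd> \<phi>) \<bullet> (k \<lhd> J) \<bullet> (tan X \<rhd> tan X \<rhd> u)"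
    "(tan X \<rhd> tan X \<rhd> U \<rhd> \<phi>) \<bullet> (tan X \<rhd> tan X \<rhd> u) \<bullet> (h \<lhd> H) = (tan X \<rhd> tan X \<rhd> U \<rhd> \<phi>) \<bullet> (h \<lhd> J) \<bullet> (tan2 X \<rhd> u)"
    if "\<phi> \<in> S" for \<phi>
  proof -
    obtain \<psi> where [simp]: "\<phi> \<in> Cell2 K" "dom2 K \<phi> = J" "\<psi> \<in> Cell2 K" "dom2 K \<psi> = H" "cod2 K \<psi> = cod2 K \<phi>"
      and e: "(U \<rhd> \<phi>) \<bullet> u = U \<rhd> \<psi>"
      using S[OF \<open>\<phi> \<in> S\<close>] by blast
    let ?Z = "cod2 K \<phi>" and ?a = "act (hom_tcat K Y X)"
    have [simp]: "?Z \<in> Cell1 K" "src K ?Z = Y" "tgt K ?Z = G"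
      by simp_all
    note e1 = act_cong2[OF arg_cong[OF e, of "\<lambda>\<phi>. tan X \<rhd> \<phi>"], of Y X, simplified]
      act_cong2[OF arg_cong[OF e, of "\<lambda>\<phi>. tan X \<rhd> tan X \<rhd> \<phi>"], of Y X, simplified]
      act_cong2[OF arg_cong[OF e, of "\<lambda>\<phi>. tan2 X \<rhd> \<phi>"], of Y X, simplified]
    have ex: "?a (k \<lhd> ?Z) (?a (tan X \<rhd> tan X \<rhd> U \<rhd> \<xi>) x) = ?a (tan X \<rhd> U \<rhd> \<xi>) (?a (k \<lhd> dom2 K \<xi>) x)"
      "?a (h \<lhd> ?Z) (?a (tan2 X \<rhd> U \<rhd> \<xi>) x) = ?a (tan X \<rhd> tan X \<rhd> U \<rhd> \<xi>) (?a (h \<lhd> dom2 K \<xi>) x)"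
      if "\<xi> \<in> Cell2 K" "cod2 K \<xi> = ?Z" "tgt K (dom2 K \<xi>) = G" "src K (dom2 K \<xi>) = Y" for \<xi> x
      using act_exchange[of k "tan X \<odot> tan X \<odot> U" "tan X \<odot> U" \<xi> "dom2 K \<xi>" ?Z Y X x]
        act_exchange[of h "tan2 X \<odot> U" "tan X \<odot> tan X \<odot> U" \<xi> "dom2 K \<xi>" ?Z Y X x] that by simp_all
    note ex' = ex[of \<phi>, simplified, symmetric] and ex'' = ex[of \<psi>, simplified]
    show "(tan X \<rhd> U \<rhd> \<phi>) \<bullet> (tan X \<rhd> u) \<bullet> (k \<lhd> H) = (tan X \<rhd> U \<rhd> \<phi>) \<bullet> (k \<lhd> J) \<bullet> (tan X \<rhd> tan X \<rhd> u)"
      by (rule act_ext2[of _ _ Y X]) (simp_all add: e1 ex' ex'')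
    show "(tan X \<rhd> tan X \<rhd> U \<rhd> \<phi>) \<bullet> (tan X \<rhd> tan X \<rhd> u) \<bullet> (h \<lhd> H) = (tan X \<rhd> tan X \<rhd> U \<rhd> \<phi>) \<bullet> (h \<lhd> J) \<bullet> (tan2 X \<rhd> u)"
      by (rule act_ext2[of _ _ Y X]) (simp_all add: e1 ex' ex'')
  qed
  have "(tan X \<rhd> u) \<bullet> (k \<lhd> H) = (k \<lhd> J) \<bullet> (tan X \<rhd> tan X \<rhd> u)"
    by (rule mono1[OF _ _ _ _ _ _ key(1)]) (simp_all add: hom1_iff)
  moreover have "(tan X \<rhd> tan X \<rhd> u) \<bullet> (h \<lhd> H) = (h \<lhd> J) \<bullet> (tan2 X \<rhd> u)"
    by (rule mono2[OF _ _ _ _ _ _ key(2)]) (simp_all add: hom1_iff)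
  ultimately show ?thesis
    by (rule factor2[OF H J u])
qed

end

text \<open>A lift along \<open>U\<close> of the data of the tangent structure of \<open>X\<close>, including the cones of all its fibred
  powers. Such a lift is automatically a tangentad, since \<open>U\<close> is faithful and creates the limits involved.\<close>

locale lifted_tangent = affine_object K X G U k h
  for K :: "('o, 'm, 'c) two_cat" (structure) and X G U k h +
  fixes E :: "('o, 'm, 'c) tangentad"
  assumes base_E [simp]: "base E = G"
    and E_hom: "tan E \<in> hom1 K G G" "tan2 E \<in> hom1 K G G"
      "prA E \<in> hom2 K (tan2 E) (tan E)" "prB E \<in> hom2 K (tan2 E) (tan E)"
      "prj E \<in> hom2 K (tan E) (id1 K G)" "zer E \<in> hom2 K (id1 K G) (tan E)" "pls E \<in> hom2 K (tan2 E) (tan E)"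
      "lft E \<in> hom2 K (tan E) (tan E \<odot> tan E)" "flp E \<in> hom2 K (tan E \<odot> tan E) (tan E \<odot> tan E)"
    and U_tan: "U \<odot> tan E = tan X \<odot> U" "U \<odot> tan2 E = tan2 X \<odot> U"
    and U_cell [simp]: "U \<rhd> prA E = prA X \<lhd> U" "U \<rhd> prB E = prB X \<lhd> U" "U \<rhd> prj E = prj X \<lhd> U"
      "U \<rhd> zer E = zer X \<lhd> U" "U \<rhd> pls E = pls X \<lhd> U" "U \<rhd> lft E = lft X \<lhd> U" "U \<rhd> flp E = flp X \<lhd> U"
    and folds: "is_tan_fold K X n P r q \<Longrightarrow> \<exists>P' r' q'. P' \<in> hom1 K G G \<and> U \<odot> P' = P \<odot> U \<and>
      q' \<in> hom2 K P' (id1 K G) \<and> U \<rhd> q' = q \<lhd> U \<and> (\<forall>i<n. r' i \<in> hom2 K P' (tan E) \<and> U \<rhd> r' i = r i \<lhd> U)"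
begin

lemma E_Cell [simp]:
  "tan E \<in> Cell1 K" "src K (tan E) = G" "tgt K (tan E) = G"
  "tan2 E \<in> Cell1 K" "src K (tan2 E) = G" "tgt K (tan2 E) = G"
  "prA E \<in> Cell2 K" "dom2 K (prA E) = tan2 E" "cod2 K (prA E) = tan E"
  "prB E \<in> Cell2 K" "dom2 K (prB E) = tan2 E" "cod2 K (prB E) = tan E"
  "prj E \<in> Cell2 K" "dom2 K (prj E) = tan E" "cod2 K (prj E) = id1 K G"
  "zer E \<in> Cell2 K" "dom2 K (zer E) = id1 K G" "cod2 K (zer E) = tan E"
  "pls E \<in> Cell2 K" "dom2 K (pls E) = tan2 E" "cod2 K (pls E) = tan E"
  "lft E \<in> Cell2 K" "dom2 K (lft E) = tan E" "cod2 K (lft E) = tan E \<odot> tan E"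
  "flp E \<in> Cell2 K" "dom2 K (flp E) = tan E \<odot> tan E" "cod2 K (flp E) = tan E \<odot> tan E"
  using E_hom by (simp_all add: hom1_iff hom2_iff)

lemma U_tan_comp [simp]:
  "U \<odot> tan E = tan X \<odot> U" "U \<odot> tan2 E = tan2 X \<odot> U"
  "F \<in> Cell1 K \<Longrightarrow> tgt K F = G \<Longrightarrow> U \<odot> tan E \<odot> F = tan X \<odot> U \<odot> F"
  "F \<in> Cell1 K \<Longrightarrow> tgt K F = G \<Longrightarrow> U \<odot> tan2 E \<odot> F = tan2 X \<odot> U \<odot> F"
  "\<phi> \<in> Cell2 K \<Longrightarrow> tgt K (dom2 K \<phi>) = G \<Longrightarrow> U \<rhd> tan E \<rhd> \<phi> = tan X \<rhd> U \<rhd> \<phi>"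
proof -
  show "U \<odot> tan E = tan X \<odot> U" "U \<odot> tan2 E = tan2 X \<odot> U"
    by (fact U_tan)+
  show "U \<odot> tan E \<odot> F = tan X \<odot> U \<odot> F" "U \<odot> tan2 E \<odot> F = tan2 X \<odot> U \<odot> F" if "F \<in> Cell1 K" "tgt K F = G"
    using arg_cong[OF U_tan(1), of "\<lambda>G. G \<odot> F"] arg_cong[OF U_tan(2), of "\<lambda>G. G \<odot> F"] that by simp_all
  show "U \<rhd> tan E \<rhd> \<phi> = tan X \<rhd> U \<rhd> \<phi>" if "\<phi> \<in> Cell2 K" "tgt K (dom2 K \<phi>) = G"
    using arg_cong[OF U_tan(1), of "\<lambda>G. G \<rhd> \<phi>"] that by simp
qed

lemma U_rwhisk:
  assumes "U \<rhd> \<phi> = \<psi> \<lhd> U" "\<phi> \<in> Cell2 K" "src K (dom2 K \<phi>) = G" "tgt K (dom2 K \<phi>) = G"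
    "\<psi> \<in> Cell2 K" "src K (dom2 K \<psi>) = base X" "F \<in> Cell1 K" "tgt K F = G"
  shows "U \<rhd> (\<phi> \<lhd> F) = \<psi> \<lhd> (U \<odot> F)"
  using rwhisk_cong[OF assms(1), of F] assms(2-) by simp

lemma U_cell_rwhisk [simp]:
  assumes "F \<in> Cell1 K" "tgt K F = G"
  shows "U \<rhd> (prA E \<lhd> F) = prA X \<lhd> (U \<odot> F)" "U \<rhd> (prB E \<lhd> F) = prB X \<lhd> (U \<odot> F)"
    "U \<rhd> (prj E \<lhd> F) = prj X \<lhd> (U \<odot> F)" "U \<rhd> (zer E \<lhd> F) = zer X \<lhd> (U \<odot> F)"
    "U \<rhd> (pls E \<lhd> F) = pls X \<lhd> (U \<odot> F)" "U \<rhd> (lft E \<lhd> F) = lft X \<lhd> (U \<odot> F)"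
    "U \<rhd> (flp E \<lhd> F) = flp X \<lhd> (U \<odot> F)"
  using assms by (simp_all add: U_rwhisk)

lemma pow_simps [simp]:
  "tan_pow K E m \<in> Cell1 K" "src K (tan_pow K E m) = G" "tgt K (tan_pow K E m) = G"
  "F \<in> Cell1 K \<Longrightarrow> tgt K F = G \<Longrightarrow> U \<odot> tan_pow K E m \<odot> F = tan_pow K X m \<odot> U \<odot> F"
  "\<phi> \<in> Cell2 K \<Longrightarrow> tgt K (dom2 K \<phi>) = G \<Longrightarrow> U \<rhd> tan_pow K E m \<rhd> \<phi> = tan_pow K X m \<rhd> U \<rhd> \<phi>"
proof -
  have S: "tan_pow K Z (Suc m) = tan Z \<odot> tan_pow K Z m" "tan_pow K Z 0 = id1 K (base Z)" for m and Z :: "('o, 'm, 'c) tangentad"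
    by (simp_all add: tan_pow_def)
  have [simp]: "tan_pow K E m \<in> Cell1 K \<and> src K (tan_pow K E m) = G \<and> tgt K (tan_pow K E m) = G" for m
    by (induction m) (simp_all add: S)
  have [simp]: "tan_pow K X m \<in> Cell1 K \<and> src K (tan_pow K X m) = base X \<and> tgt K (tan_pow K X m) = base X" for m
    by (induction m) (simp_all add: S)
  show "tan_pow K E m \<in> Cell1 K" "src K (tan_pow K E m) = G" "tgt K (tan_pow K E m) = G"
    by simp_all
  show "U \<odot> tan_pow K E m \<odot> F = tan_pow K X m \<odot> U \<odot> F" if "F \<in> Cell1 K" "tgt K F = G"
    by (induction m) (simp_all add: S that)
  show "U \<rhd> tan_pow K E m \<rhd> \<phi> = tan_pow K X m \<rhd> U \<rhd> \<phi>" if "\<phi> \<in> Cell2 K" "tgt K (dom2 K \<phi>) = G"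
    by (induction m) (simp_all add: S that)
qed

lemma powX_simps [simp]:
  "tan_pow K X m \<in> Cell1 K" "src K (tan_pow K X m) = base X" "tgt K (tan_pow K X m) = base X"
  using tan_pow_whisk(1-3)[of "id1 K (base X)" m] by simp_all

lemma powX_Suc:
  "F \<in> Cell1 K \<Longrightarrow> tgt K F = base X \<Longrightarrow> tan_pow K X (Suc m) \<odot> F = tan X \<odot> tan_pow K X m \<odot> F"
  "\<phi> \<in> Cell2 K \<Longrightarrow> tgt K (dom2 K \<phi>) = base X \<Longrightarrow> tan_pow K X (Suc m) \<rhd> \<phi> = tan X \<rhd> tan_pow K X m \<rhd> \<phi>"
  using powX_simps[of m] by (simp_all add: tan_pow_def)

text \<open>The mediating 2-cell exists downstairs and lifts because the projections of the fibred power remain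
  jointly monic under two further applications of \<open>T\<close>.\<close>

lemma lifted_fold:
  assumes fold: "is_tan_fold K X n P r q" and P': "P' \<in> hom1 K G G" "U \<odot> P' = P \<odot> U"
    and q': "q' \<in> hom2 K P' (id1 K G)" "U \<rhd> q' = q \<lhd> U"
    and r': "\<And>i. i < n \<Longrightarrow> r' i \<in> hom2 K P' (tan E)" "\<And>i. i < n \<Longrightarrow> U \<rhd> r' i = r i \<lhd> U"
  shows "is_tan_fold K E n P' r' q'"
  unfolding is_tan_fold_def base_E
proof (intro conjI allI impI)
  fix m Y f
  assume f: "f \<in> hom1 K Y G"
  have [simp]: "f \<in> Cell1 K" "src K f = Y" "tgt K f = G"
    using f by (simp_all add: hom1_iff)
  have Y: "Y \<in> Cell0 K"
    using hom1_Cell0(1)[OF f] .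
  have [simp]: "P \<in> Cell1 K" "src K P = base X" "tgt K P = base X" "q \<in> Cell2 K" "dom2 K q = P" "cod2 K q = id1 K (base X)"
    using fold by (simp_all add: is_tan_fold_def hom1_iff hom2_iff)
  have [simp]: "r i \<in> Cell2 K" "dom2 K (r i) = P" "cod2 K (r i) = tan X" if "i < n" for i
    using fold that by (simp_all add: is_tan_fold_def hom2_iff)
  have [simp]: "P' \<in> Cell1 K" "src K P' = G" "tgt K P' = G" "q' \<in> Cell2 K" "dom2 K q' = P'" "cod2 K q' = id1 K G"
    using P' q' by (simp_all add: hom1_iff hom2_iff)
  have [simp]: "r' i \<in> Cell2 K" "dom2 K (r' i) = P'" "cod2 K (r' i) = tan E" if "i < n" for i
    using r' that by (simp_all add: hom2_iff)
  have [simp]: "U \<odot> P' \<odot> f = P \<odot> U \<odot> f"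
    using arg_cong[OF P'(2), of "\<lambda>G. G \<odot> f"] by simp
  have [simp]: "U \<rhd> (q' \<lhd> f) = q \<lhd> (U \<odot> f)" "i < n \<Longrightarrow> U \<rhd> (r' i \<lhd> f) = r i \<lhd> (U \<odot> f)" for i
    using q'(2) r'(2) by (simp_all add: U_rwhisk)
  let ?C = "hom_cat K Y G" and ?D = "hom_tcat K Y X"
  interpret C: category ?C by (rule category_hom_cat[OF Y]) simp
  interpret D: category ?D by (rule category_hom_tcat[OF Y])
  let ?TE = "tan_pow K E m"
  have UF: "U \<odot> f \<in> hom1 K Y (base X)"
    by (simp add: hom1_iff)
  have DF: "is_fold_pullback ?D (tan_pow K X j \<rhd> (prj X \<lhd> (U \<odot> f))) n (tan_pow K X j \<odot> P \<odot> U \<odot> f)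
      (\<lambda>i. (tan_pow K X j \<rhd> r i) \<lhd> (U \<odot> f)) (tan_pow K X j \<rhd> (q \<lhd> (U \<odot> f)))" for j
  proof -
    have "is_fold_pullback (hom_cat K Y (base X)) ((tan_pow K X j \<rhd> prj X) \<lhd> (U \<odot> f)) n
       (tan_pow K X j \<odot> P \<odot> U \<odot> f) (\<lambda>i. (tan_pow K X j \<rhd> r i) \<lhd> (U \<odot> f)) ((tan_pow K X j \<rhd> q) \<lhd> (U \<odot> f))"
      using fold UF unfolding is_tan_fold_def by blast
    then show ?thesis
      by (simp add: hom_tcat_hom_cat)
  qed
  let ?S = "insert (?TE \<rhd> (q' \<lhd> f)) ((\<lambda>i. ?TE \<rhd> (r' i \<lhd> f)) ` {..<n})"
  show "is_fold_pullback ?C ((?TE \<rhd> prj E) \<lhd> f) n (?TE \<odot> P' \<odot> f) (\<lambda>i. (?TE \<rhd> r' i) \<lhd> f) ((?TE \<rhd> q') \<lhd> f)"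
  proof (rule C.fold_pullbackI)
    fix i assume i: "i < n"
    have "((?TE \<rhd> prj E) \<lhd> f) \<bullet> ((?TE \<rhd> r' i) \<lhd> f) = (?TE \<rhd> q') \<lhd> f"
    proof (rule faithful)
      show "U \<rhd> (((?TE \<rhd> prj E) \<lhd> f) \<bullet> ((?TE \<rhd> r' i) \<lhd> f)) = U \<rhd> ((?TE \<rhd> q') \<lhd> f)"
        using D.fold_Ar(8)[OF DF i, of m] i by simp
    qed (simp_all add: i)
    then show "(?TE \<rhd> r' i) \<lhd> f \<in> Ar ?C \<and> Dom ?C ((?TE \<rhd> r' i) \<lhd> f) = ?TE \<odot> P' \<odot> f \<and>
      Cod ?C ((?TE \<rhd> r' i) \<lhd> f) = Dom ?C ((?TE \<rhd> prj E) \<lhd> f) \<and> ((?TE \<rhd> prj E) \<lhd> f) \<cdot>\<^bsub>?C\<^esub> ((?TE \<rhd> r' i) \<lhd> f) = (?TE \<rhd> q') \<lhd> f"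
      using i by (simp add: hom1_iff)
  next
    fix v w
    assume v: "v \<in> Ar ?C" "Cod ?C v = Cod ?C ((?TE \<rhd> prj E) \<lhd> f)"
      and w: "\<And>i. i < n \<Longrightarrow> w i \<in> Ar ?C \<and> Dom ?C (w i) = Dom ?C v \<and>
        Cod ?C (w i) = Dom ?C ((?TE \<rhd> prj E) \<lhd> f) \<and> ((?TE \<rhd> prj E) \<lhd> f) \<cdot>\<^bsub>?C\<^esub> w i = v"
    define Q where "Q = dom2 K v"
    have [simp]: "v \<in> Cell2 K" "dom2 K v = Q" "cod2 K v = ?TE \<odot> f" "Q \<in> Cell1 K" "src K Q = Y" "tgt K Q = G"
      using v by (simp_all add: Q_def hom1_iff)
    have w': "w i \<in> Cell2 K" "dom2 K (w i) = Q" "cod2 K (w i) = ?TE \<odot> tan E \<odot> f"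
      "(?TE \<rhd> (prj E \<lhd> f)) \<bullet> w i = v" if "i < n" for i
      using w[OF that] by simp_all
    have Uw: "(tan_pow K X m \<rhd> (prj X \<lhd> (U \<odot> f))) \<bullet> (U \<rhd> w i) = U \<rhd> v" if "i < n" for i
      using arg_cong[OF w'(4)[OF that], of "\<lambda>\<phi>. U \<rhd> \<phi>"] w'(1-3)[OF that] by simp
    obtain u where u: "u \<in> Ar ?D" "Dom ?D u = Dom ?D (U \<rhd> v)" "Cod ?D u = tan_pow K X m \<odot> P \<odot> U \<odot> f"
      "(tan_pow K X m \<rhd> (q \<lhd> (U \<odot> f))) \<cdot>\<^bsub>?D\<^esub> u = U \<rhd> v"
      "\<And>i. i < n \<Longrightarrow> ((tan_pow K X m \<rhd> r i) \<lhd> (U \<odot> f)) \<cdot>\<^bsub>?D\<^esub> u = U \<rhd> w i"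
      by (rule D.fold_obtain[OF DF, of "U \<rhd> v" m "\<lambda>i. U \<rhd> w i"]) (use w' Uw in \<open>simp_all add: hom1_iff\<close>)
    have J: "?TE \<odot> P' \<odot> f \<in> hom1 K Y G" and Q: "Q \<in> hom1 K Y G"
      by (simp_all add: hom1_iff)
    have "\<exists>u' \<in> hom2 K Q (?TE \<odot> P' \<odot> f). U \<rhd> u' = u"
    proof (rule lift_jointly_monic[OF Q J, of _ ?S])
      show "u \<in> hom2 K (U \<odot> Q) (U \<odot> ?TE \<odot> P' \<odot> f)"
        using u by (simp add: hom2_iff)
      show "\<phi> \<in> Cell2 K \<and> dom2 K \<phi> = ?TE \<odot> P' \<odot> f \<and>
        (\<exists>\<psi>. \<psi> \<in> Cell2 K \<and> dom2 K \<psi> = Q \<and> cod2 K \<psi> = cod2 K \<phi> \<and> (U \<rhd> \<phi>) \<bullet> u = U \<rhd> \<psi>)" if "\<phi> \<in> ?S" for \<phi>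
        using that
      proof (elim insertE imageE)
        assume [simp]: "\<phi> = ?TE \<rhd> (q' \<lhd> f)"
        show ?thesis
          using u by (intro conjI exI[of _ v]) simp_all
      next
        fix i assume [simp]: "\<phi> = ?TE \<rhd> (r' i \<lhd> f)" and i: "i \<in> {..<n}"
        then show ?thesis
          using u(5)[of i] w'[of i] by (intro conjI exI[of _ "w i"]) simp_all
      qed
      show "x = y" if xy: "x \<in> Cell2 K" "y \<in> Cell2 K" "dom2 K x = dom2 K y" "dom2 K y \<in> hom1 K Y (base X)"
          "cod2 K x = tan X \<odot> U \<odot> ?TE \<odot> P' \<odot> f" "cod2 K y = tan X \<odot> U \<odot> ?TE \<odot> P' \<odot> f"
          and e: "\<And>\<phi>. \<phi> \<in> ?S \<Longrightarrow> (tan X \<rhd> U \<rhd> \<phi>) \<bullet> x = (tan X \<rhd> U \<rhd> \<phi>) \<bullet> y" for x y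
      proof -
        have er: "(tan X \<rhd> U \<rhd> ?TE \<rhd> (r' i \<lhd> f)) \<bullet> x = (tan X \<rhd> U \<rhd> ?TE \<rhd> (r' i \<lhd> f)) \<bullet> y" if "i < n" for i
          by (rule e) (use that in simp)
        show ?thesis
          by (rule D.fold_eqI[OF DF[of "Suc m"]])
            (use xy e[of "?TE \<rhd> (q' \<lhd> f)"] er in \<open>simp_all add: hom1_iff powX_Suc\<close>)
      qed
      show "x = y" if xy: "x \<in> Cell2 K" "y \<in> Cell2 K" "dom2 K x = dom2 K y" "dom2 K y \<in> hom1 K Y (base X)"
          "cod2 K x = tan X \<odot> tan X \<odot> U \<odot> ?TE \<odot> P' \<odot> f" "cod2 K y = tan X \<odot> tan X \<odot> U \<odot> ?TE \<odot> P' \<odot> f"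
          and e: "\<And>\<phi>. \<phi> \<in> ?S \<Longrightarrow> (tan X \<rhd> tan X \<rhd> U \<rhd> \<phi>) \<bullet> x = (tan X \<rhd> tan X \<rhd> U \<rhd> \<phi>) \<bullet> y" for x y
      proof -
        have er: "(tan X \<rhd> tan X \<rhd> U \<rhd> ?TE \<rhd> (r' i \<lhd> f)) \<bullet> x = (tan X \<rhd> tan X \<rhd> U \<rhd> ?TE \<rhd> (r' i \<lhd> f)) \<bullet> y" if "i < n" for i
          by (rule e) (use that in simp)
        show ?thesis
          by (rule D.fold_eqI[OF DF[of "Suc (Suc m)"]])
            (use xy e[of "?TE \<rhd> (q' \<lhd> f)"] er in \<open>simp_all add: hom1_iff powX_Suc\<close>)
      qed
    qed
    then obtain u' where u': "u' \<in> Cell2 K" "dom2 K u' = Q" "cod2 K u' = ?TE \<odot> P' \<odot> f" "U \<rhd> u' = u"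
      by (auto simp: hom2_iff)
    have "(?TE \<rhd> (q' \<lhd> f)) \<bullet> u' = v"
      by (rule faithful) (use u u' in simp_all)
    moreover have "(?TE \<rhd> (r' i \<lhd> f)) \<bullet> u' = w i" if "i < n" for i
      by (rule faithful) (use u(5)[OF that] u' w'[OF that] that in simp_all)
    ultimately show "\<exists>u. u \<in> Ar ?C \<and> Dom ?C u = Dom ?C v \<and> Cod ?C u = ?TE \<odot> P' \<odot> f \<and>
        ((?TE \<rhd> q') \<lhd> f) \<cdot>\<^bsub>?C\<^esub> u = v \<and> (\<forall>i<n. ((?TE \<rhd> r' i) \<lhd> f) \<cdot>\<^bsub>?C\<^esub> u = w i)"
      using u' by (intro exI[of _ u']) (simp add: hom1_iff)
  next
    fix u u'
    assume u: "u \<in> Ar ?C" "u' \<in> Ar ?C" "Dom ?C u = Dom ?C u'" "Cod ?C u = ?TE \<odot> P' \<odot> f" "Cod ?C u' = ?TE \<odot> P' \<odot> f"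
      "((?TE \<rhd> q') \<lhd> f) \<cdot>\<^bsub>?C\<^esub> u = ((?TE \<rhd> q') \<lhd> f) \<cdot>\<^bsub>?C\<^esub> u'"
      and ru: "\<And>i. i < n \<Longrightarrow> ((?TE \<rhd> r' i) \<lhd> f) \<cdot>\<^bsub>?C\<^esub> u = ((?TE \<rhd> r' i) \<lhd> f) \<cdot>\<^bsub>?C\<^esub> u'"
    have [simp]: "u \<in> Cell2 K" "u' \<in> Cell2 K" "dom2 K u = dom2 K u'" "cod2 K u = ?TE \<odot> P' \<odot> f" "cod2 K u' = ?TE \<odot> P' \<odot> f"
      "src K (dom2 K u') = Y" "tgt K (dom2 K u') = G"
      using u by (simp_all add: hom1_iff)
    show "u = u'"
    proof (rule faithful)
      show "U \<rhd> u = U \<rhd> u'"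
      proof (rule D.fold_eqI[OF DF[of m]])
        show "(tan_pow K X m \<rhd> (q \<lhd> (U \<odot> f))) \<cdot>\<^bsub>?D\<^esub> (U \<rhd> u) = (tan_pow K X m \<rhd> (q \<lhd> (U \<odot> f))) \<cdot>\<^bsub>?D\<^esub> (U \<rhd> u')"
          using arg_cong[OF u(6), of "\<lambda>\<phi>. U \<rhd> \<phi>"] by simp
        show "((tan_pow K X m \<rhd> r i) \<lhd> (U \<odot> f)) \<cdot>\<^bsub>?D\<^esub> (U \<rhd> u) = ((tan_pow K X m \<rhd> r i) \<lhd> (U \<odot> f)) \<cdot>\<^bsub>?D\<^esub> (U \<rhd> u')" if "i < n" for i
          using arg_cong[OF ru[OF that], of "\<lambda>\<phi>. U \<rhd> \<phi>"] that by simp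
      qed (simp_all add: hom1_iff)
    qed simp_all
  qed (simp_all add: hom1_iff)
qed (use P' q' r' in simp_all)

end

lemma (in category) pullbackI:
  assumes ty: "f \<in> Ar C" "g \<in> Ar C" "Cod C f = Cod C g" "u \<in> Ar C" "Dom C u = P" "Cod C u = Dom C f"
    "v \<in> Ar C" "Dom C v = P" "Cod C v = Dom C g" "f \<cdot> u = g \<cdot> v"
    and ex: "\<And>x y. x \<in> Ar C \<Longrightarrow> y \<in> Ar C \<Longrightarrow> Dom C x = Dom C y \<Longrightarrow> Cod C x = Dom C f \<Longrightarrow> Cod C y = Dom C g \<Longrightarrow>
      f \<cdot> x = g \<cdot> y \<Longrightarrow> \<exists>w. w \<in> Ar C \<and> Dom C w = Dom C y \<and> Cod C w = P \<and> u \<cdot> w = x \<and> v \<cdot> w = y"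
    and un: "\<And>w w'. w \<in> Ar C \<Longrightarrow> w' \<in> Ar C \<Longrightarrow> Dom C w = Dom C w' \<Longrightarrow> Cod C w = P \<Longrightarrow> Cod C w' = P \<Longrightarrow>
      u \<cdot> w = u \<cdot> w' \<Longrightarrow> v \<cdot> w = v \<cdot> w' \<Longrightarrow> w = w'"
  shows "is_pullback C f g P u v"
  unfolding is_pullback_def Hom_iff
proof (intro conjI allI impI)
  fix Q x y
  assume H: "(x \<in> Ar C \<and> Dom C x = Q \<and> Cod C x = Dom C f) \<and> (y \<in> Ar C \<and> Dom C y = Q \<and> Cod C y = Dom C g) \<and>
    f \<cdot> x = g \<cdot> y"
  then obtain w where "w \<in> Ar C" "Dom C w = Q" "Cod C w = P" "u \<cdot> w = x" "v \<cdot> w = y"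
    using ex[of x y] by auto
  then show "\<exists>!w. (w \<in> Ar C \<and> Dom C w = Q \<and> Cod C w = P) \<and> u \<cdot> w = x \<and> v \<cdot> w = y"
    by (intro ex1I[of _ w]) (simp, rule un, simp_all)
qed (use ty in simp_all)

context lifted_tangent
begin

interpretation D: tangent_calculus "hom_tcat K G X"
  by (rule tangent_calculus_hom_tcat) simp

interpretation E: category "hom_cat K G G"
  by (rule category_hom_cat) simp_all

lemma U_hom: "U \<in> hom1 K G (base X)" "tan X \<odot> U \<in> hom1 K G (base X)"
  by (simp_all add: hom1_iff)

lemma E_fold2: "is_tan_fold K E 2 (tan2 E) (\<lambda>i. if i = 0 then prA E else prB E) (prj E \<bullet> prA E)"
  by (rule lifted_fold[OF tangentad_axioms(1)]) (simp_all add: hom1_iff hom2_iff)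

lemma E_pullback:
  assumes "f \<in> hom1 K Y G"
  shows "is_pullback (hom_cat K Y G) ((tan_pow K E m \<rhd> prj E) \<lhd> f) ((tan_pow K E m \<rhd> prj E) \<lhd> f)
    (tan_pow K E m \<odot> tan2 E \<odot> f) ((tan_pow K E m \<rhd> prA E) \<lhd> f) ((tan_pow K E m \<rhd> prB E) \<lhd> f)"
proof -
  interpret C: category "hom_cat K Y G"
    using assms by (intro category_hom_cat) (simp_all add: hom1_Cell0)
  have "(\<lambda>i. (tan_pow K E m \<rhd> (if i = 0 then prA E else prB E)) \<lhd> f) =
    (\<lambda>i::nat. if i = 0 then (tan_pow K E m \<rhd> prA E) \<lhd> f else (tan_pow K E m \<rhd> prB E) \<lhd> f)"
    by auto
  moreover have "is_fold_pullback (hom_cat K Y G) ((tan_pow K E m \<rhd> prj E) \<lhd> f) 2 (tan_pow K E m \<odot> tan2 E \<odot> f)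
      (\<lambda>i. (tan_pow K E m \<rhd> (if i = 0 then prA E else prB E)) \<lhd> f) ((tan_pow K E m \<rhd> (prj E \<bullet> prA E)) \<lhd> f)"
    using E_fold2 assms unfolding is_tan_fold_def base_E by blast
  ultimately show ?thesis
    by (intro C.fold2_pullback) simp
qed

lemma E_pow [simp]: "tan_pow K E 0 = id1 K G" "tan_pow K E 1 = tan E"
  by (simp_all add: tan_pow_def)

text \<open>The three pairings that occur in the axioms of a tangentad; \<open>U\<close> takes them to the corresponding
  pairings for \<open>X\<close>.\<close>

abbreviation "jT2 \<equiv> pairing (hom_cat K G G) (tan2 E) (prA E) (prB E)"
abbreviation "jT2T \<equiv> pairing (hom_cat K G G) (tan2 E \<odot> tan E) (prA E \<lhd> tan E) (prB E \<lhd> tan E)"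
abbreviation "jTT2 \<equiv> pairing (hom_cat K G G) (tan E \<odot> tan2 E) (tan E \<rhd> prA E) (tan E \<rhd> prB E)"

lemma jT2:
  assumes "u \<in> Cell2 K" "v \<in> Cell2 K" "dom2 K u = dom2 K v" "src K (dom2 K v) = G" "cod2 K u = tan E" "cod2 K v = tan E"
    "prj E \<bullet> u = prj E \<bullet> v"
  shows "jT2 u v \<in> Cell2 K" "dom2 K (jT2 u v) = dom2 K v" "cod2 K (jT2 u v) = tan2 E"
    "prA E \<bullet> jT2 u v = u" "prB E \<bullet> jT2 u v = v"
    "U \<rhd> jT2 u v = into_T2 (hom_tcat K G X) U (U \<rhd> u) (U \<rhd> v)"
proof -
  have t: "tgt K (dom2 K v) = G"
    using dom_cod2(4)[OF assms(2)] assms(6) by simp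
  have I: "id1 K G \<in> hom1 K G G" by (simp add: hom1_iff)
  note P = E.pairing_pullback[OF E_pullback[OF I, of 0, simplified], of u v]
  show 1: "jT2 u v \<in> Cell2 K" "dom2 K (jT2 u v) = dom2 K v" "cod2 K (jT2 u v) = tan2 E"
    and e: "prA E \<bullet> jT2 u v = u" "prB E \<bullet> jT2 u v = v"
    using P assms t by (simp_all add: hom1_iff)
  note e' = e[THEN arg_cong[of _ _ "\<lambda>\<phi>. U \<rhd> \<phi>"]]
  show "U \<rhd> jT2 u v = into_T2 (hom_tcat K G X) U (U \<rhd> u) (U \<rhd> v)"
    by (rule D.into_T2_eqI[symmetric]) (use 1 e' t assms(2,4) in \<open>simp_all add: hom1_iff\<close>)
qed

lemma jTT2:
  assumes "u \<in> Cell2 K" "v \<in> Cell2 K" "dom2 K u = dom2 K v" "src K (dom2 K v) = G"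
    "cod2 K u = tan E \<odot> tan E" "cod2 K v = tan E \<odot> tan E" "(tan E \<rhd> prj E) \<bullet> u = (tan E \<rhd> prj E) \<bullet> v"
  shows "jTT2 u v \<in> Cell2 K" "dom2 K (jTT2 u v) = dom2 K v" "cod2 K (jTT2 u v) = tan E \<odot> tan2 E"
    "U \<rhd> jTT2 u v = into_TT2 (hom_tcat K G X) U (U \<rhd> u) (U \<rhd> v)"
proof -
  have t: "tgt K (dom2 K v) = G"
    using dom_cod2(4)[OF assms(2)] assms(6) by simp
  have I: "id1 K G \<in> hom1 K G G" by (simp add: hom1_iff)
  note P = E.pairing_pullback[OF E_pullback[OF I, of 1, unfolded E_pow, simplified], of u v]
  have 1: "jTT2 u v \<in> Cell2 K" "dom2 K (jTT2 u v) = dom2 K v" "cod2 K (jTT2 u v) = tan E \<odot> tan2 E"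
    and e: "(tan E \<rhd> prA E) \<bullet> jTT2 u v = u" "(tan E \<rhd> prB E) \<bullet> jTT2 u v = v"
    using P assms t by (simp_all add: hom1_iff)
  show "jTT2 u v \<in> Cell2 K" "dom2 K (jTT2 u v) = dom2 K v" "cod2 K (jTT2 u v) = tan E \<odot> tan2 E"
    by (fact 1)+
  note e' = e[THEN arg_cong[of _ _ "\<lambda>\<phi>. U \<rhd> \<phi>"]]
  show "U \<rhd> jTT2 u v = into_TT2 (hom_tcat K G X) U (U \<rhd> u) (U \<rhd> v)"
    by (rule D.into_TT2_eqI[symmetric]) (use 1 e' t assms(2,4) in \<open>simp_all add: hom1_iff\<close>)
qed

lemma jT2T:
  assumes "u \<in> Cell2 K" "v \<in> Cell2 K" "dom2 K u = dom2 K v" "src K (dom2 K v) = G"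
    "cod2 K u = tan E \<odot> tan E" "cod2 K v = tan E \<odot> tan E" "(prj E \<lhd> tan E) \<bullet> u = (prj E \<lhd> tan E) \<bullet> v"
  shows "jT2T u v \<in> Cell2 K" "dom2 K (jT2T u v) = dom2 K v" "cod2 K (jT2T u v) = tan2 E \<odot> tan E"
    "U \<rhd> jT2T u v = into_T2 (hom_tcat K G X) (tan X \<odot> U) (U \<rhd> u) (U \<rhd> v)"
proof -
  have t: "tgt K (dom2 K v) = G"
    using dom_cod2(4)[OF assms(2)] assms(6) by simp
  have I: "tan E \<in> hom1 K G G" by (simp add: hom1_iff)
  note P = E.pairing_pullback[OF E_pullback[OF I, of 0, simplified], of u v]
  have 1: "jT2T u v \<in> Cell2 K" "dom2 K (jT2T u v) = dom2 K v" "cod2 K (jT2T u v) = tan2 E \<odot> tan E"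
    and e: "(prA E \<lhd> tan E) \<bullet> jT2T u v = u" "(prB E \<lhd> tan E) \<bullet> jT2T u v = v"
    using P assms t by (simp_all add: hom1_iff)
  show "jT2T u v \<in> Cell2 K" "dom2 K (jT2T u v) = dom2 K v" "cod2 K (jT2T u v) = tan2 E \<odot> tan E"
    by (fact 1)+
  note e' = e[THEN arg_cong[of _ _ "\<lambda>\<phi>. U \<rhd> \<phi>"]]
  show "U \<rhd> jT2T u v = into_T2 (hom_tcat K G X) (tan X \<odot> U) (U \<rhd> u) (U \<rhd> v)"
    by (rule D.into_T2_eqI[symmetric]) (use 1 e' t assms(2,4) in \<open>simp_all add: hom1_iff\<close>)
qed

text \<open>Each equation is the corresponding equation for \<open>X\<close>, whiskered with \<open>U\<close> and pulled back along the
  faithful \<open>U\<close>.\<close>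

lemma pairing_free_axioms:
  "prj E \<bullet> zer E = id2 K (id1 K G)"
  "prj E \<bullet> pls E = prj E \<bullet> prA E"
  "prj E \<bullet> prB E = prj E \<bullet> prA E"
  "(tan E \<rhd> prj E) \<bullet> lft E = zer E \<bullet> prj E"
  "lft E \<bullet> zer E = (tan E \<rhd> zer E) \<bullet> zer E"
  "(prj E \<lhd> tan E) \<bullet> flp E = tan E \<rhd> prj E"
  "flp E \<bullet> (tan E \<rhd> zer E) = zer E \<lhd> tan E"
  "(tan E \<rhd> lft E) \<bullet> lft E = (lft E \<lhd> tan E) \<bullet> lft E"
  "flp E \<bullet> lft E = lft E"
  "(flp E \<lhd> tan E) \<bullet> (tan E \<rhd> flp E) \<bullet> (lft E \<lhd> tan E) = (tan E \<rhd> lft E) \<bullet> flp E"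
  "flp E \<bullet> flp E = id2 K (tan E \<odot> tan E)"
  "(tan E \<rhd> flp E) \<bullet> (flp E \<lhd> tan E) \<bullet> (tan E \<rhd> flp E) = (flp E \<lhd> tan E) \<bullet> (tan E \<rhd> flp E) \<bullet> (flp E \<lhd> tan E)"
  using rwhisk_cong[OF tangentad_axioms(3), of U] rwhisk_cong[OF tangentad_axioms(4), of U] D.p_b[of U]
    rwhisk_cong[OF tangentad_axioms(8), of U] rwhisk_cong[OF tangentad_axioms(9), of U]
    rwhisk_cong[OF tangentad_axioms(11), of U] rwhisk_cong[OF tangentad_axioms(12), of U]
    rwhisk_cong[OF tangentad_axioms(14), of U] rwhisk_cong[OF tangentad_axioms(15), of U]
    rwhisk_cong[OF tangentad_axioms(16), of U] rwhisk_cong[OF tangentad_axioms(17), of U]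
    rwhisk_cong[OF tangentad_axioms(18), of U] U_hom
  by - (rule faithful; simp)+

lemma unit_axiom: "pls E \<bullet> jT2 (zer E \<bullet> prj E) (id2 K (tan E)) = id2 K (tan E)"
proof -
  have "prj E \<bullet> zer E \<bullet> prj E = prj E \<bullet> id2 K (tan E)"
    using vcomp_assoc[of "prj E" "zer E" "prj E"] by (simp add: pairing_free_axioms(1) del: vcomp_assoc)
  note P = jT2[OF _ _ _ _ _ _ this, simplified]
  show ?thesis
    by (rule faithful) (use P(1-3,6) D.s_unit[of U] U_hom in simp_all)
qed

lemma comm_axiom: "pls E \<bullet> jT2 (prB E) (prA E) = pls E"
proof -
  note P = jT2[OF _ _ _ _ _ _ pairing_free_axioms(3), simplified]
  have e: "prj X \<bullet> prB X = prj X \<bullet> prA X"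
  proof -
    interpret X: tangent_calculus "hom_tcat K (base X) X"
      by (rule tangent_calculus_hom_tcat) simp
    show ?thesis
      using X.p_b[of "id1 K (base X)"] by (simp add: hom1_iff)
  qed
  note Q = into_T2_rwhisk[OF U_hom(1) _ _ _ _ _ e, simplified]
  show ?thesis
    by (rule faithful) (use P(1-3,6) Q(1-3) Q(6) rwhisk_cong[OF tangentad_axioms(6), of U] in simp_all)
qed

lemma lift_add_axiom: "lft E \<bullet> pls E = (tan E \<rhd> pls E) \<bullet> jTT2 (lft E \<bullet> prA E) (lft E \<bullet> prB E)"
proof -
  have "(tan E \<rhd> prj E) \<bullet> lft E \<bullet> prA E = (tan E \<rhd> prj E) \<bullet> lft E \<bullet> prB E"
  proof -
    have "((tan E \<rhd> prj E) \<bullet> lft E) \<bullet> prA E = ((tan E \<rhd> prj E) \<bullet> lft E) \<bullet> prB E"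
      unfolding pairing_free_axioms(4) by (simp add: pairing_free_axioms(3))
    then show ?thesis by simp
  qed
  note P = jTT2[OF _ _ _ _ _ _ this, simplified]
  have e: "(tan X \<rhd> prj X) \<bullet> lft X \<bullet> prA X = (tan X \<rhd> prj X) \<bullet> lft X \<bullet> prB X"
  proof -
    interpret X: tangent_calculus "hom_tcat K (base X) X"
      by (rule tangent_calculus_hom_tcat) simp
    have "prj X \<bullet> prB X = prj X \<bullet> prA X"
      using X.p_b[of "id1 K (base X)"] by (simp add: hom1_iff)
    then have "((tan X \<rhd> prj X) \<bullet> lft X) \<bullet> prA X = ((tan X \<rhd> prj X) \<bullet> lft X) \<bullet> prB X"
      unfolding tangentad_axioms(8) by simp
    then show ?thesis by simp
  qed
  note Q = into_TT2_rwhisk[OF U_hom(1) _ _ _ _ _ e, simplified]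
  show ?thesis
    by (rule faithful) (use P Q(1-3) Q(6) rwhisk_cong[OF tangentad_axioms(10), of U] in simp_all)
qed

lemma flip_add_axiom:
  "flp E \<bullet> (tan E \<rhd> pls E) = (pls E \<lhd> tan E) \<bullet> jT2T (flp E \<bullet> (tan E \<rhd> prA E)) (flp E \<bullet> (tan E \<rhd> prB E))"
proof -
  have "tan E \<rhd> (prj E \<bullet> prA E) = tan E \<rhd> (prj E \<bullet> prB E)"
    by (simp only: pairing_free_axioms(3))
  then have "((prj E \<lhd> tan E) \<bullet> flp E) \<bullet> (tan E \<rhd> prA E) = ((prj E \<lhd> tan E) \<bullet> flp E) \<bullet> (tan E \<rhd> prB E)"
    unfolding pairing_free_axioms(6) by simp
  then have "(prj E \<lhd> tan E) \<bullet> flp E \<bullet> (tan E \<rhd> prA E) = (prj E \<lhd> tan E) \<bullet> flp E \<bullet> (tan E \<rhd> prB E)"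
    by simp
  note P = jT2T[OF _ _ _ _ _ _ this, simplified]
  show ?thesis
    by (rule faithful) (use P D.c_Ts[of U] U_hom in simp_all)
qed

text \<open>
  Associativity is stated for a threefold fibred power of \<open>E\<close> that need not be the lift of one of \<open>X\<close>.
  Its projections, applied to \<open>U\<close>, form a cone over a threefold fibred power of \<open>X\<close>, and associativity
  for \<open>X\<close> is precomposed with the mediating 2-cell.
\<close>

lemma assoc_axiom:
  assumes fold: "is_tan_fold K E 3 P r q"
  shows "pls E \<bullet> jT2 (pls E \<bullet> jT2 (r 0) (r 1)) (r 2) = pls E \<bullet> jT2 (r 0) (pls E \<bullet> jT2 (r 1) (r 2))"
proof -
  have [simp]: "P \<in> Cell1 K" "src K P = G" "tgt K P = G" "q \<in> Cell2 K" "dom2 K q = P" "cod2 K q = id1 K G"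
    using fold by (simp_all add: is_tan_fold_def hom1_iff hom2_iff)
  have r: "r i \<in> Cell2 K \<and> dom2 K (r i) = P \<and> cod2 K (r i) = tan E" if "i < 3" for i
    using fold that by (simp add: is_tan_fold_def hom2_iff)
  note [simp] = r[of 0, simplified] r[of 1, simplified] r[of 2, simplified]
  have I: "id1 K G \<in> hom1 K G G" by (simp add: hom1_iff)
  have "is_fold_pullback (hom_cat K G G) ((tan_pow K E 0 \<rhd> prj E) \<lhd> id1 K G) 3
          (tan_pow K E 0 \<odot> P \<odot> id1 K G) (\<lambda>i. (tan_pow K E 0 \<rhd> r i) \<lhd> id1 K G) ((tan_pow K E 0 \<rhd> q) \<lhd> id1 K G)"
    using fold I unfolding is_tan_fold_def base_E by blast
  note E_fold = this
  have pr: "prj E \<bullet> r i = q" if "i < 3" for i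
    using E.fold_Ar(8)[OF E_fold that] r[OF that] by simp
  obtain P' r' q' where X: "is_tan_fold K X 3 P' r' q'"
    using tangentad_axioms(2) by blast
  have [simp]: "P' \<in> Cell1 K" "src K P' = base X" "tgt K P' = base X" "q' \<in> Cell2 K" "dom2 K q' = P'" "cod2 K q' = id1 K (base X)"
    using X by (simp_all add: is_tan_fold_def hom1_iff hom2_iff)
  have r': "r' i \<in> Cell2 K \<and> dom2 K (r' i) = P' \<and> cod2 K (r' i) = tan X" if "i < 3" for i
    using X that by (simp add: is_tan_fold_def hom2_iff)
  note [simp] = r'[of 0, simplified] r'[of 1, simplified] r'[of 2, simplified]
  interpret X: tangent_calculus "hom_tcat K (base X) X"
    by (rule tangent_calculus_hom_tcat) simp
  have IX: "id1 K (base X) \<in> hom1 K (base X) (base X)" by (simp add: hom1_iff)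
  have pr': "prj X \<bullet> r' i = q'" if "i < 3" for i
    using X.fold_Ar(8)[OF tan_fold_hom[OF X IX, of 0] that] r'[OF that] by simp
  have Upr: "(prj X \<lhd> U) \<bullet> (U \<rhd> r i) = U \<rhd> q" if "i < 3" for i
    using arg_cong[OF pr[OF that], of "\<lambda>\<phi>. U \<rhd> \<phi>"] r[OF that] by simp
  obtain w where w: "w \<in> Ar (hom_tcat K G X)" "Dom (hom_tcat K G X) w = Dom (hom_tcat K G X) (U \<rhd> q)"
      "Cod (hom_tcat K G X) w = P' \<odot> U" "(q' \<lhd> U) \<cdot>\<^bsub>hom_tcat K G X\<^esub> w = U \<rhd> q"
    and rw: "\<And>i. i < 3 \<Longrightarrow> (r' i \<lhd> U) \<cdot>\<^bsub>hom_tcat K G X\<^esub> w = U \<rhd> r i"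
    by (rule D.fold_obtain[OF tan_fold_hom[OF X U_hom(1), of 0, simplified], of "U \<rhd> q" "\<lambda>i. U \<rhd> r i"])
      (use Upr r in \<open>simp_all add: hom1_iff\<close>)
  have [simp]: "w \<in> Cell2 K" "dom2 K w = U \<odot> P" "cod2 K w = P' \<odot> U"
    using w by simp_all
  note rw = rw[unfolded hom_tcat_simps]
  have p_pls: "prj X \<bullet> pls X \<bullet> \<phi> = prj X \<bullet> prA X \<bullet> \<phi>" if "\<phi> \<in> Cell2 K" "cod2 K \<phi> = tan2 X" for \<phi>
    using vcomp_assoc[of \<phi> "pls X" "prj X"] vcomp_assoc[of \<phi> "prA X" "prj X"] that
    by (simp add: tangentad_axioms(4) del: vcomp_assoc)
  have p_plsE: "prj E \<bullet> pls E \<bullet> \<phi> = prj E \<bullet> prA E \<bullet> \<phi>" if "\<phi> \<in> Cell2 K" "cod2 K \<phi> = tan2 E" for \<phi>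
    using vcomp_assoc[of \<phi> "pls E" "prj E"] vcomp_assoc[of \<phi> "prA E" "prj E"] that
    by (simp add: pairing_free_axioms(2) del: vcomp_assoc)
  note Q01 = into_T2_rwhisk[OF U_hom(1) _ _ _ _ _ trans[OF pr'[of 0] pr'[of 1, symmetric]], simplified]
  note Q12 = into_T2_rwhisk[OF U_hom(1) _ _ _ _ _ trans[OF pr'[of 1] pr'[of 2, symmetric]], simplified]
  note [simp] = Q01(1-3) Q12(1-3)
  have x1: "prj X \<bullet> pls X \<bullet> iT2 (r' 0) (r' 1) = prj X \<bullet> r' 2" "prj X \<bullet> r' 0 = prj X \<bullet> pls X \<bullet> iT2 (r' 1) (r' 2)"
    using p_pls[of "iT2 (r' 0) (r' 1)"] p_pls[of "iT2 (r' 1) (r' 2)"] by (simp_all add: Q01(4) Q12(4) pr')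
  note Qa = into_T2_rwhisk[OF U_hom(1) _ _ _ _ _ x1(1), simplified]
  note Qb = into_T2_rwhisk[OF U_hom(1) _ _ _ _ _ x1(2), simplified]
  note [simp] = Qa(1-3) Qb(1-3)
  note P01 = jT2[OF _ _ _ _ _ _ trans[OF pr[of 0] pr[of 1, symmetric]], simplified]
  note P12 = jT2[OF _ _ _ _ _ _ trans[OF pr[of 1] pr[of 2, symmetric]], simplified]
  note [simp] = P01(1-3) P12(1-3)
  have e1: "prj E \<bullet> pls E \<bullet> jT2 (r 0) (r 1) = prj E \<bullet> r 2" "prj E \<bullet> r 0 = prj E \<bullet> pls E \<bullet> jT2 (r 1) (r 2)"
    using p_plsE[of "jT2 (r 0) (r 1)"] p_plsE[of "jT2 (r 1) (r 2)"] by (simp_all add: P01(4) P12(4) pr)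
  note Pa = jT2[OF _ _ _ _ _ _ e1(1), simplified]
  note Pb = jT2[OF _ _ _ _ _ _ e1(2), simplified]
  note [simp] = Pa(1-3) Pb(1-3)
  let ?i = "into_T2 (hom_tcat K G X) U"
  have comp: "?i u v \<bullet> w = ?i (u \<bullet> w) (v \<bullet> w)"
    if "u \<in> Cell2 K" "v \<in> Cell2 K" "dom2 K u = P' \<odot> U" "dom2 K v = P' \<odot> U" "cod2 K u = tan X \<odot> U" "cod2 K v = tan X \<odot> U"
      "(prj X \<lhd> U) \<bullet> u = (prj X \<lhd> U) \<bullet> v" for u v
    using D.into_T2_comp[of U u v w] that by (simp add: hom1_iff)
  have x1': "((prj X \<bullet> pls X \<bullet> iT2 (r' 0) (r' 1)) \<lhd> U) = ((prj X \<bullet> r' 2) \<lhd> U)"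
    "((prj X \<bullet> r' 0) \<lhd> U) = ((prj X \<bullet> pls X \<bullet> iT2 (r' 1) (r' 2)) \<lhd> U)"
    "((prj X \<bullet> r' 0) \<lhd> U) = ((prj X \<bullet> r' 1) \<lhd> U)" "((prj X \<bullet> r' 1) \<lhd> U) = ((prj X \<bullet> r' 2) \<lhd> U)"
  proof -
    have "prj X \<bullet> r' 0 = q'" "prj X \<bullet> r' 1 = q'" "prj X \<bullet> r' 2 = q'"
      by (rule pr'; simp)+
    then show "((prj X \<bullet> r' 0) \<lhd> U) = ((prj X \<bullet> r' 1) \<lhd> U)" "((prj X \<bullet> r' 1) \<lhd> U) = ((prj X \<bullet> r' 2) \<lhd> U)"
      by (simp_all only:)
    show "((prj X \<bullet> pls X \<bullet> iT2 (r' 0) (r' 1)) \<lhd> U) = ((prj X \<bullet> r' 2) \<lhd> U)"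
      by (simp only: x1(1))
    show "((prj X \<bullet> r' 0) \<lhd> U) = ((prj X \<bullet> pls X \<bullet> iT2 (r' 1) (r' 2)) \<lhd> U)"
      by (simp only: x1(2))
  qed
  have c01: "(iT2 (r' 0) (r' 1) \<lhd> U) \<bullet> w = ?i (U \<rhd> r 0) (U \<rhd> r 1)"
    and c12: "(iT2 (r' 1) (r' 2) \<lhd> U) \<bullet> w = ?i (U \<rhd> r 1) (U \<rhd> r 2)"
    using comp[of "r' 0 \<lhd> U" "r' 1 \<lhd> U"] comp[of "r' 1 \<lhd> U" "r' 2 \<lhd> U"] x1'(3,4)
    by (simp_all add: rw Q01(6)[symmetric] Q12(6)[symmetric])
  have "(iT2 (pls X \<bullet> iT2 (r' 0) (r' 1)) (r' 2) \<lhd> U) \<bullet> w = ?i ((pls X \<lhd> U) \<bullet> ?i (U \<rhd> r 0) (U \<rhd> r 1)) (U \<rhd> r 2)"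
    using comp[of "(pls X \<bullet> iT2 (r' 0) (r' 1)) \<lhd> U" "r' 2 \<lhd> U"] x1'(1)
    by (simp add: rw c01[simplified] Qa(6)[symmetric])
  moreover have "(iT2 (r' 0) (pls X \<bullet> iT2 (r' 1) (r' 2)) \<lhd> U) \<bullet> w = ?i (U \<rhd> r 0) ((pls X \<lhd> U) \<bullet> ?i (U \<rhd> r 1) (U \<rhd> r 2))"
    using comp[of "r' 0 \<lhd> U" "(pls X \<bullet> iT2 (r' 1) (r' 2)) \<lhd> U"] x1'(2)
    by (simp add: rw c12[simplified] Qb(6)[symmetric])
  moreover have "((pls X \<bullet> iT2 (pls X \<bullet> iT2 (r' 0) (r' 1)) (r' 2)) \<lhd> U) \<bullet> w = ((pls X \<bullet> iT2 (r' 0) (pls X \<bullet> iT2 (r' 1) (r' 2))) \<lhd> U) \<bullet> w"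
    using tangentad_axioms(7)[OF X] by simp
  ultimately have main: "(pls X \<lhd> U) \<bullet> ?i ((pls X \<lhd> U) \<bullet> ?i (U \<rhd> r 0) (U \<rhd> r 1)) (U \<rhd> r 2) =
      (pls X \<lhd> U) \<bullet> ?i (U \<rhd> r 0) ((pls X \<lhd> U) \<bullet> ?i (U \<rhd> r 1) (U \<rhd> r 2))"
    by simp
  show ?thesis
    by (rule faithful) (use main Pa(6) Pb(6) P01(6) P12(6) in simp_all)
qed

text \<open>The mediating 2-cell for \<open>X\<close> lifts along \<open>U\<close>, since its composite with the vertical lift does and the
  images of the vertical lift under \<open>T\<close> and \<open>T\<^sup>2\<close> are monic.\<close>

lemma vertical_lift_axiom:
  assumes f: "f \<in> hom1 K Y G"
  shows "is_pullback (hom_cat K Y G) (zer E \<lhd> f) ((tan E \<rhd> prj E) \<lhd> f) (tan2 E \<odot> f) ((prj E \<bullet> prA E) \<lhd> f)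
    (((tan E \<rhd> pls E) \<bullet> jTT2 ((zer E \<lhd> tan E) \<bullet> prA E) (lft E \<bullet> prB E)) \<lhd> f)"
proof -
  have [simp]: "f \<in> Cell1 K" "src K f = Y" "tgt K f = G"
    using f by (simp_all add: hom1_iff)
  have Y: "Y \<in> Cell0 K"
    using hom1_Cell0(1)[OF f] .
  interpret C: category "hom_cat K Y G" by (rule category_hom_cat[OF Y]) simp
  interpret DY: tangent_calculus "hom_tcat K Y X" by (rule tangent_calculus_hom_tcat[OF Y])
  have Uf: "U \<odot> f \<in> hom1 K Y (base X)" by (simp add: hom1_iff)
  let ?u = "(zer E \<lhd> tan E) \<bullet> prA E" and ?v = "lft E \<bullet> prB E"
  let ?j = "(tan E \<rhd> pls E) \<bullet> jTT2 ?u ?v"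
  let ?V = "(tan X \<rhd> pls X) \<bullet> iTT2 ((zer X \<lhd> tan X) \<bullet> prA X) (lft X \<bullet> prB X)"
  have ec: "(tan E \<rhd> prj E) \<bullet> ?u = (tan E \<rhd> prj E) \<bullet> ?v"
  proof (rule faithful)
    have "act (hom_tcat K G X) (U \<rhd> ((tan E \<rhd> prj E) \<bullet> ?u)) x = act (hom_tcat K G X) (U \<rhd> ((tan E \<rhd> prj E) \<bullet> ?v)) x" for x
      using D.structure_act[of U] D.z_act[of "prj X \<lhd> U" U, symmetric] U_hom by (simp add: hom1_iff)
    then show "U \<rhd> ((tan E \<rhd> prj E) \<bullet> ?u) = U \<rhd> ((tan E \<rhd> prj E) \<bullet> ?v)"
      by (intro act_ext2[of _ _ G X]) simp_all
  qed simp_all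
  note P = jTT2[OF _ _ _ _ _ _ ec, simplified]
  note [simp] = P(1-3)
  note vU = vl_hom[OF U_hom(1)] and vf = vl_hom[OF Uf]
  have V [simp]: "?V \<in> Cell2 K" "dom2 K ?V = tan2 X" "cod2 K ?V = tan X \<odot> tan X"
  proof -
    interpret X: tangent_calculus "hom_tcat K (base X) X" by (rule tangent_calculus_hom_tcat) simp
    have I: "id1 K (base X) \<in> hom1 K (base X) (base X)" by (simp add: hom1_iff)
    have "(tan X \<rhd> prj X) \<bullet> (zer X \<lhd> tan X) \<bullet> prA X = (tan X \<rhd> prj X) \<bullet> lft X \<bullet> prB X"
      by (rule act_ext2[of _ _ "base X" X])
        (use X.structure_act[of "id1 K (base X)"] X.z_act[of "prj X" "id1 K (base X)", symmetric] in \<open>simp_all add: hom1_iff\<close>)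
    from into_TT2_rwhisk(1-3)[OF I _ _ _ _ _ this] show "?V \<in> Cell2 K" "dom2 K ?V = tan2 X" "cod2 K ?V = tan X \<odot> tan X"
      by simp_all
  qed
  have "U \<rhd> ?j = ?V \<lhd> U"
    using P(4) unfolding vU(1)[symmetric] D.vl_def D.zl_def by simp
  then have Uj [simp]: "U \<rhd> (?j \<lhd> f) = DY.vl (U \<odot> f)"
    unfolding vf(1) by (rule U_rwhisk) simp_all
  have vlC [simp]: "DY.vl (U \<odot> f) \<in> Cell2 K" "dom2 K (DY.vl (U \<odot> f)) = tan2 X \<odot> U \<odot> f" "cod2 K (DY.vl (U \<odot> f)) = tan X \<odot> tan X \<odot> U \<odot> f"
    unfolding vf(1) using rwhisk_simps[of "U \<odot> f" ?V] V by simp_all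
  have jf [simp]: "?j \<lhd> f \<in> Cell2 K" "dom2 K (?j \<lhd> f) = tan2 E \<odot> f" "cod2 K (?j \<lhd> f) = tan E \<odot> tan E \<odot> f"
    using rwhisk_simps[of f ?j] by simp_all
  note monic = vl_hom_monic[OF Uf]
  define jf where "jf = ?j \<lhd> f"
  note [simp] = Uj[folded jf_def] jf[folded jf_def]
  have sq: "(zer E \<lhd> f) \<bullet> ((prj E \<bullet> prA E) \<lhd> f) = ((tan E \<rhd> prj E) \<lhd> f) \<bullet> jf"
    by (rule faithful) (use DY.pullback_Ar(10)[OF vf(2)] in simp_all)
  show ?thesis
    unfolding jf_def[symmetric]
  proof (rule C.pullbackI)
    fix x y
    assume xy: "x \<in> Ar (hom_cat K Y G)" "y \<in> Ar (hom_cat K Y G)" "Dom (hom_cat K Y G) x = Dom (hom_cat K Y G) y"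
      "Cod (hom_cat K Y G) x = Dom (hom_cat K Y G) (zer E \<lhd> f)" "Cod (hom_cat K Y G) y = Dom (hom_cat K Y G) ((tan E \<rhd> prj E) \<lhd> f)"
      and e: "(zer E \<lhd> f) \<cdot>\<^bsub>hom_cat K Y G\<^esub> x = ((tan E \<rhd> prj E) \<lhd> f) \<cdot>\<^bsub>hom_cat K Y G\<^esub> y"
    define Q where "Q = dom2 K y"
    have [simp]: "x \<in> Cell2 K" "y \<in> Cell2 K" "dom2 K x = Q" "dom2 K y = Q" "cod2 K x = f" "cod2 K y = tan E \<odot> tan E \<odot> f"
      "Q \<in> Cell1 K" "src K Q = Y" "tgt K Q = G"
      using xy by (simp_all add: Q_def hom1_iff)
    have "(zer X \<lhd> (U \<odot> f)) \<bullet> (U \<rhd> x) = (tan X \<rhd> (prj X \<lhd> (U \<odot> f))) \<bullet> (U \<rhd> y)"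
      using arg_cong[OF e, of "\<lambda>\<phi>. U \<rhd> \<phi>"] by simp
    note PP = DY.pairing_pullback[OF vf(2), of "U \<rhd> x" "U \<rhd> y", simplified, OF _ _ this]
    define w where "w = pairing (hom_tcat K Y X) (tan2 X \<odot> U \<odot> f) ((prj X \<lhd> (U \<odot> f)) \<bullet> (prA X \<lhd> (U \<odot> f))) (DY.vl (U \<odot> f)) (U \<rhd> x) (U \<rhd> y)"
    have w [simp]: "w \<in> Cell2 K" "dom2 K w = U \<odot> Q" "cod2 K w = tan2 X \<odot> U \<odot> f"
      and w2: "(prj X \<lhd> (U \<odot> f)) \<bullet> (prA X \<lhd> (U \<odot> f)) \<bullet> w = U \<rhd> x" "DY.vl (U \<odot> f) \<bullet> w = U \<rhd> y"
      using PP unfolding w_def[symmetric] by (simp_all add: hom1_iff)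
    have Q: "Q \<in> hom1 K Y G" and J: "tan2 E \<odot> f \<in> hom1 K Y G"
      by (simp_all add: hom1_iff)
    have "\<exists>u' \<in> hom2 K Q (tan2 E \<odot> f). U \<rhd> u' = w"
    proof (rule lift_jointly_monic[OF Q J, of _ "{jf}"])
      show "w \<in> hom2 K (U \<odot> Q) (U \<odot> tan2 E \<odot> f)"
        by (simp add: hom2_iff)
      show "\<phi> \<in> Cell2 K \<and> dom2 K \<phi> = tan2 E \<odot> f \<and>
        (\<exists>\<psi>. \<psi> \<in> Cell2 K \<and> dom2 K \<psi> = Q \<and> cod2 K \<psi> = cod2 K \<phi> \<and> (U \<rhd> \<phi>) \<bullet> w = U \<rhd> \<psi>)" if "\<phi> \<in> {jf}" for \<phi>
        using that w2 by (auto intro!: exI[of _ y])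
      show "s = t" if "s \<in> Cell2 K" "t \<in> Cell2 K" "dom2 K s = dom2 K t" "dom2 K t \<in> hom1 K Y (base X)"
        "cod2 K s = tan X \<odot> U \<odot> tan2 E \<odot> f" "cod2 K t = tan X \<odot> U \<odot> tan2 E \<odot> f"
        "\<And>\<phi>. \<phi> \<in> {jf} \<Longrightarrow> (tan X \<rhd> U \<rhd> \<phi>) \<bullet> s = (tan X \<rhd> U \<rhd> \<phi>) \<bullet> t" for s t
        using DY.monicD[OF monic(2), of s t] that by (simp add: hom1_iff)
      show "s = t" if "s \<in> Cell2 K" "t \<in> Cell2 K" "dom2 K s = dom2 K t" "dom2 K t \<in> hom1 K Y (base X)"
        "cod2 K s = tan X \<odot> tan X \<odot> U \<odot> tan2 E \<odot> f" "cod2 K t = tan X \<odot> tan X \<odot> U \<odot> tan2 E \<odot> f"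
        "\<And>\<phi>. \<phi> \<in> {jf} \<Longrightarrow> (tan X \<rhd> tan X \<rhd> U \<rhd> \<phi>) \<bullet> s = (tan X \<rhd> tan X \<rhd> U \<rhd> \<phi>) \<bullet> t" for s t
        using DY.monicD[OF monic(3), of s t] that by (simp add: hom1_iff)
    qed
    then obtain w' where w': "w' \<in> Cell2 K" "dom2 K w' = Q" "cod2 K w' = tan2 E \<odot> f" "U \<rhd> w' = w"
      by (auto simp: hom2_iff)
    have "((prj E \<bullet> prA E) \<lhd> f) \<bullet> w' = x"
      by (rule faithful) (use w' w2 in simp_all)
    moreover have "jf \<bullet> w' = y"
      by (rule faithful) (use w' w2 in simp_all)
    ultimately show "\<exists>w. w \<in> Ar (hom_cat K Y G) \<and> Dom (hom_cat K Y G) w = Dom (hom_cat K Y G) y \<and> Cod (hom_cat K Y G) w = tan2 E \<odot> f \<and>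
        ((prj E \<bullet> prA E) \<lhd> f) \<cdot>\<^bsub>hom_cat K Y G\<^esub> w = x \<and> jf \<cdot>\<^bsub>hom_cat K Y G\<^esub> w = y"
      using w' by (intro exI[of _ w']) (simp add: hom1_iff)
  next
    fix w w'
    assume w: "w \<in> Ar (hom_cat K Y G)" "w' \<in> Ar (hom_cat K Y G)" "Dom (hom_cat K Y G) w = Dom (hom_cat K Y G) w'"
      "Cod (hom_cat K Y G) w = tan2 E \<odot> f" "Cod (hom_cat K Y G) w' = tan2 E \<odot> f"
      and e: "jf \<cdot>\<^bsub>hom_cat K Y G\<^esub> w = jf \<cdot>\<^bsub>hom_cat K Y G\<^esub> w'"
    have [simp]: "w \<in> Cell2 K" "w' \<in> Cell2 K" "dom2 K w = dom2 K w'" "cod2 K w = tan2 E \<odot> f" "cod2 K w' = tan2 E \<odot> f"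
      "src K (dom2 K w') = Y" "tgt K (dom2 K w') = G"
      using w by (simp_all add: hom1_iff)
    have "DY.vl (U \<odot> f) \<bullet> (U \<rhd> w) = DY.vl (U \<odot> f) \<bullet> (U \<rhd> w')"
      using arg_cong[OF e, of "\<lambda>\<phi>. U \<rhd> \<phi>"] by simp
    then have "U \<rhd> w = U \<rhd> w'"
      using DY.monicD[OF monic(1), of "U \<rhd> w" "U \<rhd> w'"] by (simp add: hom1_iff)
    from faithful[OF _ _ _ _ _ this] show "w = w'"
      by simp
  qed (use sq in \<open>simp_all add: hom1_iff\<close>)
qed

theorem lifted_tangentad: "is_tangentad K E"
  unfolding is_tangentad_def Let_def base_E
proof (intro conjI allI impI)
  show "\<exists>P r q. is_tan_fold K E n P r q" for n
  proof -
    obtain P r q where X: "is_tan_fold K X n P r q"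
      using tangentad_axioms(2) by blast
    from folds[OF X] obtain P' r' q' where "P' \<in> hom1 K G G" "U \<odot> P' = P \<odot> U" "q' \<in> hom2 K P' (id1 K G)"
      "U \<rhd> q' = q \<lhd> U" "\<forall>i<n. r' i \<in> hom2 K P' (tan E) \<and> U \<rhd> r' i = r i \<lhd> U"
      by blast
    then have "is_tan_fold K E n P' r' q'"
      by (intro lifted_fold[OF X]) simp_all
    then show ?thesis by blast
  qed
next
  fix P r q
  assume "is_tan_fold K E 3 P r q"
  from assoc_axiom[OF this]
  show "pls E \<bullet> jT2 (pls E \<bullet> jT2 (r 0) (r 1)) (r 2) = pls E \<bullet> jT2 (r 0) (pls E \<bullet> jT2 (r 1) (r 2))" .
next
  show "is_pullback (hom_cat K Y G) (zer E \<lhd> f) ((tan E \<rhd> prj E) \<lhd> f) (tan2 E \<odot> f) ((prj E \<bullet> prA E) \<lhd> f)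
    (((tan E \<rhd> pls E) \<bullet> jTT2 ((zer E \<lhd> tan E) \<bullet> prA E) (lft E \<bullet> prB E)) \<lhd> f)" if "f \<in> hom1 K Y G" for Y f
    by (rule vertical_lift_axiom[OF that])
qed (fact E_hom E_fold2 pairing_free_axioms unit_axiom comm_axiom lift_add_axiom flip_add_axiom U_Cell(4))+

end

context affine_object
begin

lemma lift_conn_mor:
  assumes H: "H \<in> hom1 K Y G" and J: "J \<in> hom1 K Y G"
    and m: "tangent_calculus.conn_mor (hom_tcat K Y X) (U \<odot> H, k \<lhd> H, h \<lhd> H) \<theta> (U \<odot> J, k \<lhd> J, h \<lhd> J)"
  shows "\<exists>\<theta>' \<in> hom2 K H J. U \<rhd> \<theta>' = \<theta>"
proof -
  interpret DY: tangent_calculus "hom_tcat K Y X"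
    by (rule tangent_calculus_hom_tcat[OF hom1_Cell0(1)[OF H]])
  have "\<theta> \<in> hom2 K (U \<odot> H) (U \<odot> J)"
    using m by (auto simp: DY.conn_mor_def Hom_iff hom2_iff)
  moreover have "tgt K (dom2 K \<theta>) = base X" "src K (dom2 K \<theta>) = Y" "\<theta> \<in> Cell2 K"
    using m by (auto simp: DY.conn_mor_def Hom_iff hom1_iff)
  ultimately show ?thesis
    using m by (intro factor2[OF H J]) (simp_all add: DY.conn_mor_def T2ar_hom_tcat)
qed

text \<open>
  The universal connection on \<open>U\<close> is transported to \<open>T U\<close> and to all fibred powers \<open>P U\<close>, and there
  classified by 1-morphisms \<open>G \<rightarrow> G\<close>: the tangent functor of \<open>G\<close> and its fibred powers. The structure
  maps, being connection morphisms, lift along \<open>U\<close>. With this choice \<open>U\<close> is strict, and the formula for the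
  tangent connection says exactly that \<open>k\<close> and \<open>h\<close> are tangent 2-morphisms.
\<close>

theorem induced_exists: "\<exists>E. base E = G \<and> is_induced_tangentad K X U k h E"
proof -
  let ?D = "hom_tcat K G X"
  interpret D: tangent_calculus ?D
    by (rule tangent_calculus_hom_tcat) simp
  have UO: "U \<in> hom1 K G (base X)" and I: "id1 K G \<in> hom1 K G G"
    by (simp_all add: hom1_iff)
  note pre = D.affine_pre_connection[OF universal]
  obtain kT hT where AT: "AC_tan ?D (U, k, h) = (tan X \<odot> U, kT, hT)"
    using D.AC_tan_image[OF pre] by (metis hom_tcat_simps(7))
  obtain TE where TE: "TE \<in> hom1 K G G" "U \<odot> TE = tan X \<odot> U" "k \<lhd> TE = kT" "h \<lhd> TE = hT"
    using factor[OF D.AC_tan_affine[OF universal AT]] by blast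
  obtain k2 h2 where A2: "AC_tan2 ?D (U, k, h) = (tan2 X \<odot> U, k2, h2)"
    using D.AC_tan2_image[OF pre] by (metis hom_tcat_simps(9))
  obtain T2E where T2E: "T2E \<in> hom1 K G G" "U \<odot> T2E = tan2 X \<odot> U" "k \<lhd> T2E = k2" "h \<lhd> T2E = h2"
    using factor[OF D.AC_tan2_affine[OF universal A2]] by blast
  have [simp]: "TE \<in> Cell1 K" "src K TE = G" "tgt K TE = G" "T2E \<in> Cell1 K" "src K T2E = G" "tgt K T2E = G"
    using TE T2E by (simp_all add: hom1_iff)
  define cn where "cn H = (U \<odot> H, k \<lhd> H, h \<lhd> H)" for H
  have lift: "\<exists>\<theta>' \<in> hom2 K H J. U \<rhd> \<theta>' = \<theta>"
    if "H \<in> hom1 K G G" "J \<in> hom1 K G G" "D.conn_mor (cn H) \<theta> (cn J)" for H J \<theta>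
    using lift_conn_mor[of H G J \<theta>] that by (simp add: cn_def)
  have cn: "cn (id1 K G) = (U, k, h)" "cn TE = AC_tan ?D (U, k, h)" "cn T2E = AC_tan2 ?D (U, k, h)"
    by (simp_all add: cn_def AT A2 TE T2E)
  interpret S: strict_functor ?D ?D "\<lambda>M. M \<odot> TE" "\<lambda>\<phi>. \<phi> \<lhd> TE"
    by (rule precomposition_strict[OF TE(1)])
  \<comment> \<open>Precomposition with the tangent functor commutes with taking tangent connections.\<close>
  have cnTT: "cn (TE \<odot> TE) = AC_tan ?D (AC_tan ?D (U, k, h))"
  proof -
    have "AC_tan ?D (cn TE) = ((tan X \<odot> U) \<odot> TE, kT \<lhd> TE, hT \<lhd> TE)"
      unfolding cn_def by (rule S.image_AC_tan[OF pre AT])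
    moreover have "U \<odot> TE \<odot> TE = tan X \<odot> U \<odot> TE"
      using arg_cong[OF TE(2), of "\<lambda>F. F \<odot> TE"] by simp
    ultimately show ?thesis
      unfolding cn(2)[symmetric] by (simp add: cn_def flip: TE(3,4))
  qed
  have TTE: "TE \<odot> TE \<in> hom1 K G G"
    by (simp add: hom1_iff)
  note st = D.structure_conn_mor[OF pre, of U, simplified fst_conv, OF refl, folded cn cnTT, simplified]
  obtain pE where pE: "pE \<in> hom2 K TE (id1 K G)" "U \<rhd> pE = prj X \<lhd> U" using lift[OF TE(1) I st(1)] by blast
  obtain zE where zE: "zE \<in> hom2 K (id1 K G) TE" "U \<rhd> zE = zer X \<lhd> U" using lift[OF I TE(1) st(2)] by blast
  obtain aE where aE: "aE \<in> hom2 K T2E TE" "U \<rhd> aE = prA X \<lhd> U" using lift[OF T2E(1) TE(1) st(3)] by blast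
  obtain bE where bE: "bE \<in> hom2 K T2E TE" "U \<rhd> bE = prB X \<lhd> U" using lift[OF T2E(1) TE(1) st(4)] by blast
  obtain sE where sE: "sE \<in> hom2 K T2E TE" "U \<rhd> sE = pls X \<lhd> U" using lift[OF T2E(1) TE(1) st(5)] by blast
  obtain lE where lE: "lE \<in> hom2 K TE (TE \<odot> TE)" "U \<rhd> lE = lft X \<lhd> U" using lift[OF TE(1) TTE st(6)] by blast
  obtain cE where cE: "cE \<in> hom2 K (TE \<odot> TE) (TE \<odot> TE)" "U \<rhd> cE = flp X \<lhd> U" using lift[OF TTE TTE st(7)] by blast
  define E where "E = \<lparr>base = G, tan = TE, tan2 = T2E, prA = aE, prB = bE, prj = pE, zer = zE, pls = sE, lft = lE, flp = cE\<rparr>"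
  have E [simp]: "base E = G" "tan E = TE" "tan2 E = T2E" "prA E = aE" "prB E = bE" "prj E = pE" "zer E = zE"
    "pls E = sE" "lft E = lE" "flp E = cE"
    by (simp_all add: E_def)
  have folds: "\<exists>P' r' q'. P' \<in> hom1 K G G \<and> U \<odot> P' = P \<odot> U \<and> q' \<in> hom2 K P' (id1 K G) \<and> U \<rhd> q' = q \<lhd> U \<and>
      (\<forall>i<n. r' i \<in> hom2 K P' TE \<and> U \<rhd> r' i = r i \<lhd> U)" if X: "is_tan_fold K X n P r q" for n P r q
  proof -
    obtain sg where "tangent_fold ?D n (\<lambda>M. P \<odot> M) (\<lambda>\<phi>. P \<rhd> \<phi>) (\<lambda>i M. r i \<lhd> M) (\<lambda>M. q \<lhd> M) sg"
      by (rule tan_fold_tangent_fold[OF X, of G]) simp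
    then interpret F: tangent_fold ?D n "\<lambda>M. P \<odot> M" "\<lambda>\<phi>. P \<rhd> \<phi>" "\<lambda>i M. r i \<lhd> M" "\<lambda>M. q \<lhd> M" sg .
    obtain k' h' where im: "F.F.image U k h k' h'"
      using F.F.image_exists[of U k h] pre by (auto simp: D.pre_connection_def)
    obtain P' where P': "P' \<in> hom1 K G G" "U \<odot> P' = P \<odot> U" "k \<lhd> P' = k'" "h \<lhd> P' = h'"
      using factor[OF F.F.affine_connection_image[OF universal im]] by blast
    have cP: "cn P' = (P \<odot> U, k', h')"
      by (simp add: cn_def P')
    obtain q' where "q' \<in> hom2 K P' (id1 K G)" "U \<rhd> q' = q \<lhd> U"
      using lift[OF P'(1) I] F.proj_conn_mor(2)[OF pre im] unfolding cP cn by blast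
    moreover have "\<exists>\<theta>. \<theta> \<in> hom2 K P' TE \<and> U \<rhd> \<theta> = r i \<lhd> U" if "i < n" for i
      using lift[OF P'(1) TE(1)] F.proj_conn_mor(1)[OF pre im that] unfolding cP cn by blast
    ultimately show ?thesis
      using P'(1,2) by metis
  qed
  interpret E: lifted_tangent K X G U k h E
    apply unfold_locales
    apply (simp_all only: E TE T2E aE bE pE zE sE lE cE)
    apply (rule folds, assumption)
    done
  have tE: "is_tangentad K E"
    by (rule E.lifted_tangentad)
  interpret EX: tangentad_pair K X E
    by unfold_locales (rule tE)
  let ?M = "strict_lax K X U"
  have ip: "into_T2 ?D U (prA X \<lhd> U) (prB X \<lhd> U) = id2 K (tan2 X \<odot> U)"
    by (rule D.into_T2_eqI) (simp_all add: hom1_iff)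
  have strict: "strict_tangent_morphism K E X U"
    unfolding strict_tangent_morphism_def lax_tangent_morphism_def
    using ip aE bE pE zE sE lE cE TE by (simp add: hom1_iff hom2_iff into_T2_def hom_tcat_hom_cat)
  have M: "lax_tangent_morphism K E X ?M"
    using strict by (simp add: strict_tangent_morphism_def strict_lax_def)
  have kT: "kT = (flp X \<lhd> U) \<bullet> (tan X \<rhd> k) \<bullet> (flp X \<lhd> (tan X \<odot> U)) \<bullet> (tan X \<rhd> (flp X \<lhd> U))"
    and hT: "hT = (tan X \<rhd> (flp X \<lhd> U)) \<bullet> (flp X \<lhd> (tan X \<odot> U)) \<bullet> (tan X \<rhd> h) \<bullet> D.T2sg U"
    using AT by (simp_all add: AC_tan_def D.T2sg_def)
  have c [simp]: "snd (lax_tan K X ?M) = flp X \<lhd> U" "fst (lax_tan K X ?M) = tan X \<odot> U" "fst ?M = U"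
    "snd (lax_tan K X (lax_tan K X ?M)) = (flp X \<lhd> (tan X \<odot> U)) \<bullet> (tan X \<rhd> (flp X \<lhd> U))"
    by (simp_all add: lax_tan_def strict_lax_def)
  have c2: "lax_tan2 K E X ?M = (tan2 X \<odot> U, D.T2sg U)"
    using EX.lax_tan2_eq[of U "id2 K (tan X \<odot> U)"] M EX.T2sg_Cell[of U] by (simp add: strict_lax_def)
  have sgC [simp]: "D.T2sg U \<in> Cell2 K" "dom2 K (D.T2sg U) = tan2 X \<odot> tan X \<odot> U" "cod2 K (D.T2sg U) = tan X \<odot> tan2 X \<odot> U"
    using EX.T2sg_Cell[of U] by simp_all
  have v: "tangent_two_morphism K E X (lax_tan K X (lax_tan K X ?M)) k (lax_tan K X ?M)"
    unfolding EX.tangent_two_morphism_iff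
    using EX.lax_tan_lax[OF M] EX.lax_tan_lax[OF EX.lax_tan_lax[OF M]] D.structure_act(8)[of U] D.act_Idn UO
    by (simp add: TE kT hom1_iff)
  have "tangent_two_morphism K E X (lax_tan2 K E X ?M) h (lax_tan K X (lax_tan K X ?M))"
    unfolding EX.tangent_two_morphism_iff
    using EX.lax_tan2_lax[OF M] EX.lax_tan_lax[OF EX.lax_tan_lax[OF M]] D.structure_act(8)[of "tan X \<odot> U"] D.T_structure_act(8)[of U] D.act_Idn UO
    by (simp add: c2 TE hT hom1_iff)
  then have "is_induced_tangentad K X U k h E"
    using v tE strict by (simp add: is_induced_tangentad_def vert_arrow_def horiz_arrow_def Let_def)
  then show ?thesis
    using E(1) by blast
qed

end

section \<open>Tangent functors into the category of affine connections\<close>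

context tangent_calculus
begin

lemma AC_simps:
  "Dom (AC_cat D) (A, f, B) = A" "Cod (AC_cat D) (A, f, B) = B"
  "Idn (AC_cat D) A = (A, Idn D (fst A), A)"
  "Comp (AC_cat D) (A', g, B) (A, f, B') = (A, g \<cdot> f, B)"
  "Tob (AC_cat D) A = AC_tan D A" "Tar (AC_cat D) (A, f, B) = (AC_tan D A, T f, AC_tan D B)"
  "pr1 (AC_cat D) A = (AC_tan2 D A, a (fst A), AC_tan D A)"
  "pr2 (AC_cat D) A = (AC_tan2 D A, b (fst A), AC_tan D A)"
  "pt (AC_cat D) A = (AC_tan D A, p (fst A), A)"
  "zt (AC_cat D) A = (A, z (fst A), AC_tan D A)"
  "st (AC_cat D) A = (AC_tan2 D A, s (fst A), AC_tan D A)"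
  "lt (AC_cat D) A = (AC_tan D A, l (fst A), AC_tan D (AC_tan D A))"
  "ct (AC_cat D) A = (AC_tan D (AC_tan D A), c (fst A), AC_tan D (AC_tan D A))"
  by (simp_all add: AC_cat_def)

lemma AC_Ob_fst: "A \<in> Ob (AC_cat D) \<Longrightarrow> fst A \<in> Ob D"
  by (cases A) (auto simp: AC_Ob_iff dest!: affine_pre_connection simp: pre_connection_def)

lemma AC_Idn_Hom:
  assumes A: "A \<in> Ob (AC_cat D)"
  shows "Idn (AC_cat D) A \<in> Hom (AC_cat D) A A"
proof -
  obtain M k h where AM: "A = (M, k, h)" by (cases A)
  have "pre_connection (M, k, h)"
    using A affine_pre_connection by (simp add: AM AC_Ob_iff)
  then have [simp]: "M \<in> Ob D" "k \<in> Ar D" "Dom D k = To (To M)" "Cod D k = To M" 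
    "h \<in> Ar D" "Dom D h = T2o M" "Cod D h = To (To M)"
    by (auto simp: pre_connection_def Hom_iff)
  have "T2 (Idn D M) = Idn D (T2o M)"
    unfolding T2ar_def by (rule into_T2_eqI) simp_all
  then have "conn_mor A (Idn D M) A"
    by (simp add: AM conn_mor_def Hom_iff)
  then show ?thesis
    using A by (simp add: Hom_def AC_simps AC_Ar_iff AM)
qed

lemma AC_tan_fst: "fst (AC_tan D A) = To (fst A)"
  by (cases A) (simp add: AC_tan_def)

text \<open>
  If the values of a functor into \<open>D\<close> carry affine connections that are natural and compatible with the
  tangent functors, then the lifted functor has an identity as comparison, and its axioms reduce to
  those below. The functor need not send the chosen \<open>T\<^sub>2\<close> to the chosen \<open>T\<^sub>2\<close>: the two differ by the
  pairing of the projections, which is what the axiom on the addition allows for.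
\<close>

lemma lifted_functor_lax:
  fixes C :: "('c, 'd) tcat"
  assumes C: "tangent_calculus C"
    and Ob: "\<And>M. M \<in> Ob C \<Longrightarrow> G0 M \<in> Ob (AC_cat D)"
    and Ar: "\<And>f. f \<in> Ar C \<Longrightarrow> conn_mor (G0 (Dom C f)) (F1 f) (G0 (Cod C f))"
    and Idn: "\<And>M. M \<in> Ob C \<Longrightarrow> F1 (Idn C M) = Idn D (fst (G0 M))"
    and Comp: "\<And>f g. f \<in> Ar C \<Longrightarrow> g \<in> Ar C \<Longrightarrow> Cod C f = Dom C g \<Longrightarrow> F1 (g \<cdot>\<^bsub>C\<^esub> f) = F1 g \<cdot> F1 f"
    and tan: "\<And>M. M \<in> Ob C \<Longrightarrow> AC_tan D (G0 M) = G0 (Tob C M)"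
    and Tar: "\<And>f. f \<in> Ar C \<Longrightarrow> F1 (Tar C f) = T (F1 f)"
    and str: "\<And>M. M \<in> Ob C \<Longrightarrow> F1 (pt C M) = p (fst (G0 M))" "\<And>M. M \<in> Ob C \<Longrightarrow> F1 (zt C M) = z (fst (G0 M))"
      "\<And>M. M \<in> Ob C \<Longrightarrow> F1 (lt C M) = l (fst (G0 M))" "\<And>M. M \<in> Ob C \<Longrightarrow> F1 (ct C M) = c (fst (G0 M))"
      "\<And>M. M \<in> Ob C \<Longrightarrow> F1 (st C M) = s (fst (G0 M)) \<cdot> into_T2 D (fst (G0 M)) (F1 (pr1 C M)) (F1 (pr2 C M))"
    and alpha: "\<And>M. M \<in> Ob C \<Longrightarrow> \<alpha> M = Idn (AC_cat D) (AC_tan D (G0 M))"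
  shows "lax_tangent_functor C (AC_cat D) G0 (\<lambda>f. (G0 (Dom C f), F1 f, G0 (Cod C f))) \<alpha>"
proof -
  interpret C: tangent_calculus C by (rule C)
  note [simp] = alpha
  have fst [simp]: "fst (G0 M) \<in> Ob D" if "M \<in> Ob C" for M
    using AC_Ob_fst[OF Ob[OF that]] .
  have fst_tan [simp]: "fst (G0 (Tob C M)) = To (fst (G0 M))" if "M \<in> Ob C" for M
    using AC_tan_fst[of "G0 M"] tan[OF that] by simp
  have F1 [simp]: "F1 f \<in> Ar D" "Dom D (F1 f) = fst (G0 (Dom C f))" "Cod D (F1 f) = fst (G0 (Cod C f))"
    if "f \<in> Ar C" for f
    using Ar[OF that] by (auto simp: conn_mor_def Hom_iff split: prod.splits)
  have arr: "(G0 (Dom C f), F1 f, G0 (Cod C f)) \<in> Ar (AC_cat D)" if "f \<in> Ar C" for f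
    using Ar Ob that by (simp add: AC_Ar_iff)
  have id: "Idn D (Cod D f) \<cdot> f = f" "f \<cdot> Idn D (Dom D f) = f" if "f \<in> Ar D" for f
    using that by (simp_all add: Idn_left Idn_right Hom_iff)
  show ?thesis
    unfolding lax_tangent_functor_def
  proof (intro conjI ballI impI, goal_cases)
    case (1 M) then show ?case by (rule Ob)
  next
    case (2 M) then show ?case by (simp add: Idn AC_simps)
  next
    case (3 f) then show ?case using arr by (simp add: Hom_def AC_simps)
  next
    case (4 f g) then show ?case by (simp add: AC_simps Comp)
  next
    case (5 M) then show ?case using AC_Idn_Hom[OF Ob[of "Tob C M"]] by (simp add: tan AC_simps(5))
  next
    case (6 f) then show ?case
      using id[of "T (F1 f)"] by (simp add: AC_simps tan Tar)
  next
    case (7 M) then show ?case using id[of "p (fst (G0 M))"] by (simp add: AC_simps tan str)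
  next
    case (8 M) then show ?case using id[of "z (fst (G0 M))"] by (simp add: AC_simps tan str)
  next
    case (9 M)
    note [simp] = 9
    have t: "AC_tan D (G0 M) = G0 (Tob C M)" by (simp add: tan)
    have pr: "(G0 (T2ob C M), F1 (pr1 C M), AC_tan D (G0 M)) \<in> Ar (AC_cat D)"
      "(G0 (T2ob C M), F1 (pr2 C M), AC_tan D (G0 M)) \<in> Ar (AC_cat D)"
      using arr[of "pr1 C M"] arr[of "pr2 C M"] by (simp_all add: t)
    have "C.p M \<cdot>\<^bsub>C\<^esub> C.a M = C.p M \<cdot>\<^bsub>C\<^esub> C.b M"
      using C.T2_pullback[OF 9, of 0] by (simp add: is_pullback_def)
    from arg_cong[OF this, of F1] have e: "p (fst (G0 M)) \<cdot> F1 (pr1 C M) = p (fst (G0 M)) \<cdot> F1 (pr2 C M)"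
      by (simp add: Comp str)
    have "into_T2 D (fst (G0 M)) (F1 (pr1 C M)) (F1 (pr2 C M)) \<in> Ar D"
      "Dom D (into_T2 D (fst (G0 M)) (F1 (pr1 C M)) (F1 (pr2 C M))) = fst (G0 (T2ob C M))"
      "Cod D (into_T2 D (fst (G0 M)) (F1 (pr1 C M)) (F1 (pr2 C M))) = T2o (fst (G0 M))"
      using into_T2(1-3)[OF _ _ _ _ _ _ e] by simp_all
    then show ?case
      using AC_pairing[OF Ob[OF 9] pr e] id[of "F1 (pr1 C M)"] id[of "F1 (pr2 C M)"] id[of "F1 (st C M)"]
      by (simp add: AC_simps t str(5))
  next
    case (10 M) then show ?case using id[of "l (fst (G0 M))"] by (simp add: AC_simps tan str)
  next
    case (11 M) then show ?case using id[of "c (fst (G0 M))"] by (simp add: AC_simps tan str)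
  qed
qed

lemma AC_iso_Idn:
  assumes "A \<in> Ob (AC_cat D)"
  shows "is_iso (AC_cat D) (Idn (AC_cat D) A)"
proof -
  have "Comp (AC_cat D) (Idn (AC_cat D) A) (Idn (AC_cat D) A) = Idn (AC_cat D) A"
    using AC_Ob_fst[OF assms] by (simp add: AC_simps Idn_left Idn_Hom)
  then show ?thesis
    using AC_Idn_Hom[OF assms] unfolding is_iso_def by (intro conjI bexI[of _ "Idn (AC_cat D) A"]) (simp_all add: Hom_def)
qed

end

section \<open>Whiskering by lax tangent morphisms\<close>

locale tangentad_triple = EX: tangentad_pair K X E + BX: tangentad_pair K X B + BE: tangentad_pair K E B
  for K :: "('o, 'm, 'c) two_cat" (structure) and X E B
begin

lemma lax_comp_Ob: "lax_tangent_morphism K E X N \<Longrightarrow> lax_tangent_morphism K B E M \<Longrightarrow>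
    lax_tangent_morphism K B X (lax_comp K N M)"
  using EX.lax_comp_lax[OF BX.A_tangentad EX.A_tangentad EX.is_tangentad] by blast

lemma fst_lax_comp [simp]: "fst (lax_comp K N M) = fst N \<odot> fst M"
  by (simp add: lax_comp_def split: prod.splits)

text \<open>The tangent structure acts on the left of a lax tangent morphism, so it commutes with
  composition on the right.\<close>

lemma lax_comp_tan:
  assumes N: "lax_tangent_morphism K E X N" and M: "lax_tangent_morphism K B E M"
  shows "lax_comp K (lax_tan K X N) M = lax_tan K X (lax_comp K N M)"
    "lax_comp K (lax_tan2 K E X N) M = lax_tan2 K B X (lax_comp K N M)"
proof -
  obtain G \<beta> F \<alpha> where [simp]: "N = (G, \<beta>)" "M = (F, \<alpha>)"
    by (cases N; cases M)
  note [simp] = EX.lax_Cell[of G \<beta>, OF N[simplified]] BE.lax_Cell[of F \<alpha>, OF M[simplified]]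
  show "lax_comp K (lax_tan K X N) M = lax_tan K X (lax_comp K N M)"
    by (simp add: lax_comp_def lax_tan_def)
  interpret S: strict_functor "hom_tcat K (base E) X" "hom_tcat K (base B) X" "\<lambda>M. M \<odot> F" "\<lambda>\<phi>. \<phi> \<lhd> F"
    by (rule EX.precomposition_strict) (simp add: hom1_iff)
  have "G \<in> Ob (hom_tcat K (base E) X)"
    by (simp add: hom1_iff)
  note sg = S.F1_T2sg[OF this] and [simp] = EX.T2sg_Cell[of G] BX.T2sg_Cell[of "G \<odot> F"]
  show "lax_comp K (lax_tan2 K E X N) M = lax_tan2 K B X (lax_comp K N M)"
    using lax_comp_Ob[OF N M] EX.lax_tan2_eq[OF N[simplified]] BX.lax_tan2_eq[of "G \<odot> F" "(\<beta> \<lhd> F) \<bullet> (G \<rhd> \<alpha>)"] sg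
    by (simp add: lax_comp_def)
qed

lemma tangent_rwhisk:
  assumes f: "tangent_two_morphism K E X N \<phi> N'" and M: "lax_tangent_morphism K B E M"
  shows "tangent_two_morphism K B X (lax_comp K N M) (\<phi> \<lhd> fst M) (lax_comp K N' M)"
proof -
  obtain G \<beta> G' \<beta>' F \<alpha> where d: "N = (G, \<beta>)" "N' = (G', \<beta>')" "M = (F, \<alpha>)"
    by (cases N; cases M; cases N')
  note t = EX.tangent_Cell[OF f]
  note [simp] = EX.lax_Cell[OF t(5)[unfolded d]] EX.lax_Cell[OF t(6)[unfolded d]]
    BE.lax_Cell[OF M[unfolded d]] t(1-3)[unfolded d fst_conv]
  have "(tan X \<rhd> \<phi>) \<bullet> \<beta> = \<beta>' \<bullet> (\<phi> \<lhd> tan E)"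
    using f by (simp add: d tangent_two_morphism_def)
  from arg_cong[OF this, of "\<lambda>\<phi>. \<phi> \<lhd> F"]
  have e: "(tan X \<rhd> \<phi> \<lhd> F) \<bullet> (\<beta> \<lhd> F) = (\<beta>' \<lhd> F) \<bullet> (\<phi> \<lhd> (tan E \<odot> F))"
    by simp
  note e = EX.act_cong2[OF this, of "base B" X, simplified]
  note c = EX.act_exchange[of \<phi> G G' \<alpha> "F \<odot> tan B" "tan E \<odot> F" "base B" X, simplified]
  show ?thesis
    unfolding BX.tangent_two_morphism_iff
    using lax_comp_Ob[OF t(5) M] lax_comp_Ob[OF t(6) M]
    by (simp add: d lax_comp_def hom1_iff e c)
qed

lemma tangent_lwhisk:
  assumes f: "tangent_two_morphism K B E M \<phi> M'" and N: "lax_tangent_morphism K E X N"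
  shows "tangent_two_morphism K B X (lax_comp K N M) (fst N \<rhd> \<phi>) (lax_comp K N M')"
proof -
  obtain G \<beta> F \<alpha> F' \<alpha>' where d: "N = (G, \<beta>)" "M = (F, \<alpha>)" "M' = (F', \<alpha>')"
    by (cases N; cases M; cases M')
  note t = BE.tangent_Cell[OF f]
  note [simp] = BE.lax_Cell[OF t(5)[unfolded d]] BE.lax_Cell[OF t(6)[unfolded d]]
    EX.lax_Cell[OF N[unfolded d]] t(1-3)[unfolded d fst_conv]
  have "(tan E \<rhd> \<phi>) \<bullet> \<alpha> = \<alpha>' \<bullet> (\<phi> \<lhd> tan B)"
    using f by (simp add: d tangent_two_morphism_def)
  from arg_cong[OF this, of "\<lambda>\<phi>. G \<rhd> \<phi>"]
  have e: "(G \<rhd> tan E \<rhd> \<phi>) \<bullet> (G \<rhd> \<alpha>) = (G \<rhd> \<alpha>') \<bullet> (G \<rhd> \<phi> \<lhd> tan B)"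
    by simp
  note e = EX.act_cong2[OF this, of "base B" X, simplified]
  note c = EX.act_exchange[of \<beta> "G \<odot> tan E" "tan X \<odot> G" \<phi> F F' "base B" X, simplified, symmetric]
  show ?thesis
    unfolding BX.tangent_two_morphism_iff
    using lax_comp_Ob[OF N t(5)] lax_comp_Ob[OF N t(6)]
    by (simp add: d lax_comp_def hom1_iff e c)
qed

end

section \<open>Precomposition with the universal affine connection\<close>

text \<open>
  From here on \<open>E\<close> is any tangentad on \<open>G\<close> for which \<open>U\<close> is strict and \<open>k\<close>, \<open>h\<close> are tangent. Strictness
  concerns \<open>T\<close> but not the chosen pullback \<open>T\<^sub>2\<close>, so the addition of \<open>E\<close> is related to that of \<open>X\<close> only up to a
  pairing.
\<close>

locale induced_tangentad = affine_object K X G U k h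
  for K :: "('o, 'm, 'c) two_cat" (structure) and X G U k h +
  fixes E :: "('o, 'm, 'c) tangentad"
  assumes base_E [simp]: "base E = G"
    and induced: "is_induced_tangentad K X U k h E"
begin

sublocale EX: tangentad_pair K X E
  by unfold_locales (use induced in \<open>simp add: is_induced_tangentad_def\<close>)

abbreviation "Uo \<equiv> strict_lax K X U"

lemma Uo_lax: "lax_tangent_morphism K E X Uo" and U_tan: "U \<odot> tan E = tan X \<odot> U"
  using induced by (simp_all add: is_induced_tangentad_def strict_tangent_morphism_def strict_lax_def)

lemma fst_Uo [simp]: "fst Uo = U" "snd Uo = id2 K (tan X \<odot> U)"
  by (simp_all add: strict_lax_def)

lemma U_cell [simp]:
  "U \<rhd> prj E = prj X \<lhd> U" "U \<rhd> zer E = zer X \<lhd> U" "U \<rhd> lft E = lft X \<lhd> U" "U \<rhd> flp E = flp X \<lhd> U"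
  and U_pls: "U \<rhd> pls E = (pls X \<lhd> U) \<bullet> into_T2 (hom_tcat K G X) U (U \<rhd> prA E) (U \<rhd> prB E)"
proof -
  have "U \<odot> tan E \<odot> tan E = tan X \<odot> U \<odot> tan E"
    using arg_cong[OF U_tan, of "\<lambda>F. F \<odot> tan E"] by simp
  note [simp] = this U_tan
  have "lax_tangent_morphism K E X (U, id2 K (tan X \<odot> U))"
    using Uo_lax by (simp add: strict_lax_def)
  then show "U \<rhd> prj E = prj X \<lhd> U" "U \<rhd> zer E = zer X \<lhd> U" "U \<rhd> lft E = lft X \<lhd> U" "U \<rhd> flp E = flp X \<lhd> U"
    "U \<rhd> pls E = (pls X \<lhd> U) \<bullet> into_T2 (hom_tcat K G X) U (U \<rhd> prA E) (U \<rhd> prB E)"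
    unfolding lax_tangent_morphism_def by (simp_all add: into_T2_def hom_tcat_hom_cat hom1_iff hom2_iff)
qed

lemma U_tan_comp [simp]:
  "U \<odot> tan E = tan X \<odot> U"
  "F \<in> Cell1 K \<Longrightarrow> tgt K F = G \<Longrightarrow> U \<odot> tan E \<odot> F = tan X \<odot> U \<odot> F"
  "\<phi> \<in> Cell2 K \<Longrightarrow> tgt K (dom2 K \<phi>) = G \<Longrightarrow> U \<rhd> tan E \<rhd> \<phi> = tan X \<rhd> U \<rhd> \<phi>"
proof -
  show "U \<odot> tan E = tan X \<odot> U"
    by (rule U_tan)
  show "U \<odot> tan E \<odot> F = tan X \<odot> U \<odot> F" if "F \<in> Cell1 K" "tgt K F = G"
    using arg_cong[OF U_tan, of "\<lambda>G. G \<odot> F"] that by simp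
  show "U \<rhd> tan E \<rhd> \<phi> = tan X \<rhd> U \<rhd> \<phi>" if "\<phi> \<in> Cell2 K" "tgt K (dom2 K \<phi>) = G"
    using arg_cong[OF U_tan, of "\<lambda>G. G \<rhd> \<phi>"] that by simp
qed

lemma U_cell_comp [simp]:
  assumes F: "F \<in> Cell1 K" "tgt K F = G"
  shows "U \<rhd> (prj E \<lhd> F) = prj X \<lhd> (U \<odot> F)" "U \<rhd> (zer E \<lhd> F) = zer X \<lhd> (U \<odot> F)"
    "U \<rhd> (lft E \<lhd> F) = lft X \<lhd> (U \<odot> F)" "U \<rhd> (flp E \<lhd> F) = flp X \<lhd> (U \<odot> F)"
  using U_cell[THEN arg_cong[of _ _ "\<lambda>\<phi>. \<phi> \<lhd> F"]] F by (simp_all del: U_cell)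

text \<open>That \<open>k\<close> and \<open>h\<close> are tangent 2-morphisms says that they restrict along \<open>tan E\<close> to the
  tangent connection.\<close>

lemma connection_tan: "AC_tan (hom_tcat K G X) (U, k, h) = (tan X \<odot> U, k \<lhd> tan E, h \<lhd> tan E)"
proof -
  have v: "tangent_two_morphism K E X (lax_tan K X (lax_tan K X Uo)) k (lax_tan K X Uo)"
    and h: "tangent_two_morphism K E X (lax_tan2 K E X Uo) h (lax_tan K X (lax_tan K X Uo))"
    using induced by (simp_all add: is_induced_tangentad_def vert_arrow_def horiz_arrow_def Let_def)
  have c [simp]: "snd (lax_tan K X Uo) = flp X \<lhd> U"
    "snd (lax_tan K X (lax_tan K X Uo)) = (flp X \<lhd> (tan X \<odot> U)) \<bullet> (tan X \<rhd> (flp X \<lhd> U))"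
    by (simp_all add: lax_tan_def strict_lax_def)
  have c2: "snd (lax_tan2 K E X Uo) = EX.D.T2sg U"
    using EX.lax_tan2_eq[of U "id2 K (tan X \<odot> U)"] Uo_lax EX.T2sg_Cell[of U] by (simp add: strict_lax_def)
  have UO: "U \<in> Ob (hom_tcat K (base E) X)"
    by (simp add: hom1_iff)
  note v' = EX.tangent_Cell[OF v] and h' = EX.tangent_Cell[OF h]
  have act: "act (hom_tcat K G X) (tan X \<rhd> k) (act (hom_tcat K G X) (flp X \<lhd> (tan X \<odot> U)) (act (hom_tcat K G X) (tan X \<rhd> (flp X \<lhd> U)) x)) =
      act (hom_tcat K G X) (flp X \<lhd> U) (act (hom_tcat K G X) (k \<lhd> tan E) x)"
    "act (hom_tcat K G X) (tan X \<rhd> h) (act (hom_tcat K G X) (EX.D.T2sg U) x) =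
      act (hom_tcat K G X) (flp X \<lhd> (tan X \<odot> U)) (act (hom_tcat K G X) (tan X \<rhd> (flp X \<lhd> U)) (act (hom_tcat K G X) (h \<lhd> tan E) x))" for x
    using v'(7)[of x] h'(7)[of x] by (simp_all add: c2)
  have hk: "k \<lhd> tan E = (flp X \<lhd> U) \<bullet> (tan X \<rhd> k) \<bullet> (flp X \<lhd> (tan X \<odot> U)) \<bullet> (tan X \<rhd> (flp X \<lhd> U))"
    using act(1) EX.D.structure_act(8)[of U] EX.D.act_Idn UO v'(1-3)
    by (intro act_ext2[of _ _ G X]) (simp_all add: hom1_iff)
  have hh: "h \<lhd> tan E = (tan X \<rhd> (flp X \<lhd> U)) \<bullet> (flp X \<lhd> (tan X \<odot> U)) \<bullet> (tan X \<rhd> h) \<bullet> EX.D.T2sg U"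
    using act(2) EX.D.structure_act(8)[of "tan X \<odot> U"] EX.D.T_structure_act(8)[of U] EX.D.act_Idn UO h'(1-3) EX.T2sg_Cell[of U]
    by (intro act_ext2[of _ _ G X]) (simp_all add: hom1_iff)
  show ?thesis
    using hk hh EX.D.T2sg_def[of U] by (simp add: AC_tan_def)
qed

end

locale precomposition = induced_tangentad K X G U k h E + tangentad_triple K X E B
  for K :: "('o, 'm, 'c) two_cat" (structure) and X G U k h E B
begin

sublocale L: tangent_calculus BX.L
  by (rule BX.tangent_calculus_lax_hom)

abbreviation "ku \<equiv> vert_arrow K X U k"
abbreviation "hu \<equiv> horiz_arrow K E X U h"
abbreviation "pre_ob \<equiv> precomp_ob K Uo ku hu"
abbreviation "pre_lax \<equiv> lax_comp K Uo"

lemma lax_Cell_E [simp]: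
  assumes "lax_tangent_morphism K B E M"
  shows "fst M \<in> Cell1 K" "src K (fst M) = base B" "tgt K (fst M) = G"
    "snd M \<in> Cell2 K" "dom2 K (snd M) = fst M \<odot> tan B" "cod2 K (snd M) = tan E \<odot> fst M"
  using BE.lax_Cell'[OF assms] by simp_all

lemma pre_lax_eq: "lax_tangent_morphism K B E M \<Longrightarrow> pre_lax M = (U \<odot> fst M, U \<rhd> snd M)"
  using lax_Cell_E[of M] by (cases M) (simp add: lax_comp_def strict_lax_def)

lemma pre_lax_Ob: "lax_tangent_morphism K B E M \<Longrightarrow> lax_tangent_morphism K B X (pre_lax M)"
  by (rule lax_comp_Ob[OF Uo_lax])

lemma pre_lax_tan: "lax_tangent_morphism K B E M \<Longrightarrow> pre_lax (lax_tan K E M) = lax_tan K X (pre_lax M)"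
  using pre_lax_eq[of M] pre_lax_eq[of "lax_tan K E M"] BE.lax_tan_lax[of M] lax_Cell_E[of M]
  by (cases M) (simp add: lax_tan_def)

lemma pre_ob_eq:
  assumes "lax_tangent_morphism K B E M"
  shows "pre_ob M = (pre_lax M, (lax_tan K X (lax_tan K X (pre_lax M)), k \<lhd> fst M, lax_tan K X (pre_lax M)),
    (lax_tan2 K B X (pre_lax M), h \<lhd> fst M, lax_tan K X (lax_tan K X (pre_lax M))))"
  using lax_comp_tan[OF Uo_lax assms] lax_comp_tan[OF EX.lax_tan_lax[OF Uo_lax] assms]
  by (simp add: precomp_ob_def lax_whisk_def vert_arrow_def horiz_arrow_def Let_def)

lemma connection_tangent:
  "tangent_two_morphism K E X (lax_tan K X (lax_tan K X Uo)) k (lax_tan K X Uo)"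
  "tangent_two_morphism K E X (lax_tan2 K E X Uo) h (lax_tan K X (lax_tan K X Uo))"
  using induced by (simp_all add: is_induced_tangentad_def vert_arrow_def horiz_arrow_def Let_def)

text \<open>The distributive laws add typing conditions to a connection but no equations.\<close>

lemma universal_lax: "affine_connection (lax_hom K E X) Uo ku hu"
proof -
  interpret S: strict_faithful_functor EX.L EX.H fst BX.cell
    by (rule EX.underlying_strict)
  show ?thesis
    by (rule S.reflect_affine_connection)
      (use Uo_lax connection_tangent universal in
        \<open>simp_all add: S.C.pre_connection_def Hom_iff vert_arrow_def horiz_arrow_def Let_def\<close>)
qed

lemma pre_ob_pre_connection:
  assumes M: "lax_tangent_morphism K B E M"
  shows "L.pre_connection (pre_ob M)"
  using pre_lax_Ob[OF M] tangent_rwhisk[OF connection_tangent(1) M] tangent_rwhisk[OF connection_tangent(2) M]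
    lax_comp_tan[OF Uo_lax M] lax_comp_tan[OF EX.lax_tan_lax[OF Uo_lax] M]
  by (simp add: pre_ob_eq[OF M] L.pre_connection_def Hom_iff)

lemma pre_ob_Ob:
  assumes M: "lax_tangent_morphism K B E M"
  shows "pre_ob M \<in> Ob (AC_cat BX.L)"
proof -
  interpret S: strict_faithful_functor BX.L BX.H fst BX.cell
    by (rule BX.underlying_strict)
  interpret P: strict_functor EX.H BX.H "\<lambda>N. N \<odot> fst M" "\<lambda>\<phi>. \<phi> \<lhd> fst M"
    by (rule precomposition_strict) (simp add: hom1_iff M)
  have "affine_connection BX.H (U \<odot> fst M) (k \<lhd> fst M) (h \<lhd> fst M)"
    by (rule P.image_affine_connection) (use universal in simp)
  then show ?thesis
    using S.reflect_affine_connection[OF pre_ob_pre_connection[OF M, unfolded pre_ob_eq[OF M]]]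
    by (simp add: pre_ob_eq[OF M] L.AC_Ob_iff)
qed

text \<open>Both connections have the same underlying 2-cells: restricting \<open>k\<close> along \<open>tan E\<close> gives the tangent
  connection, and precomposition preserves tangent connections.\<close>

lemma pre_ob_tan:
  assumes M: "lax_tangent_morphism K B E M"
  shows "AC_tan BX.L (pre_ob M) = pre_ob (lax_tan K E M)"
proof -
  interpret S: strict_faithful_functor BX.L BX.H fst BX.cell
    by (rule BX.underlying_strict)
  interpret P: strict_functor EX.H BX.H "\<lambda>N. N \<odot> fst M" "\<lambda>\<phi>. \<phi> \<lhd> fst M"
    by (rule precomposition_strict) (simp add: hom1_iff M)
  obtain k' h' where AT: "AC_tan BX.L (pre_ob M) = (lax_tan K X (pre_lax M), k', h')"
    using L.AC_tan_fst[of "pre_ob M"] by (cases "AC_tan BX.L (pre_ob M)") (simp add: pre_ob_eq[OF M])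
  have "L.pre_connection (AC_tan BX.L (pre_ob M))"
    by (rule L.AC_tan_pre_connection[OF pre_ob_pre_connection[OF M]])
  then obtain k'' h'' where
    k'': "k' = (lax_tan K X (lax_tan K X (lax_tan K X (pre_lax M))), k'', lax_tan K X (lax_tan K X (pre_lax M)))"
    and h'': "h' = (lax_tan2 K B X (lax_tan K X (pre_lax M)), h'', lax_tan K X (lax_tan K X (lax_tan K X (pre_lax M))))"
    unfolding AT by (cases k'; cases h') (simp add: L.pre_connection_def Hom_iff)
  have "AC_tan BX.H (U \<odot> fst M, k \<lhd> fst M, h \<lhd> fst M) = (tan X \<odot> U \<odot> fst M, k'', h'')"
    using S.image_AC_tan[OF pre_ob_pre_connection[OF M, unfolded pre_ob_eq[OF M]] AT[unfolded pre_ob_eq[OF M]]]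
    by (simp add: k'' h'')
  moreover have "AC_tan BX.H (U \<odot> fst M, k \<lhd> fst M, h \<lhd> fst M) =
      ((tan X \<odot> U) \<odot> fst M, k \<lhd> tan E \<lhd> fst M, h \<lhd> tan E \<lhd> fst M)"
    by (rule P.image_AC_tan) (use connection_tan EX.D.affine_pre_connection universal in simp_all)
  ultimately have "k'' = k \<lhd> (tan E \<odot> fst M)" "h'' = h \<lhd> (tan E \<odot> fst M)"
    using M by simp_all
  then show ?thesis
    by (simp add: AT k'' h'' pre_ob_eq BE.lax_tan_lax[OF M] pre_lax_tan[OF M])
qed

text \<open>This is the interchange of \<open>k\<close>, or of \<open>h\<close>, with \<open>\<phi>\<close>.\<close>

lemma connection_natural:
  assumes f: "tangent_two_morphism K B E M \<phi> N"
  shows "L.conn_mor (pre_ob M) (pre_lax M, U \<rhd> \<phi>, pre_lax N) (pre_ob N)"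
proof -
  note t = BE.tangent_Cell[OF f]
  note [simp] = t(1-3) lax_Cell_E[OF t(5)] lax_Cell_E[OF t(6)]
  have g: "tangent_two_morphism K B X (pre_lax M) (U \<rhd> \<phi>) (pre_lax N)"
    using tangent_lwhisk[OF f Uo_lax] by simp
  show ?thesis
    using g whisk_exchange[of k \<phi> "tan X \<odot> tan X \<odot> U" "tan X \<odot> U" "fst M" "fst N"]
      whisk_exchange[of h \<phi> "tan2 X \<odot> U" "tan X \<odot> tan X \<odot> U" "fst M" "fst N"]
    by (simp add: pre_ob_eq t(5,6) L.conn_mor_def Hom_iff BX.T2ar_lax_hom[OF g])
qed

lemma precomp_ar_eq:
  "precomp_ar K Uo ku hu = (\<lambda>f. (pre_ob (Dom BE.L f), (pre_lax (Dom BE.L f), U \<rhd> BX.cell f, pre_lax (Cod BE.L f)), pre_ob (Cod BE.L f)))"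
proof (rule ext)
  fix f :: "('m \<times> 'c) \<times> 'c \<times> ('m \<times> 'c)"
  obtain M \<phi> N where "f = (M, \<phi>, N)" by (cases f)
  then show "precomp_ar K Uo ku hu f =
      (pre_ob (Dom BE.L f), (pre_lax (Dom BE.L f), U \<rhd> BX.cell f, pre_lax (Cod BE.L f)), pre_ob (Cod BE.L f))"
    by (simp add: precomp_ar_def)
qed

lemma pre_projections:
  "(prj X \<lhd> U) \<bullet> (U \<rhd> prA E) = (prj X \<lhd> U) \<bullet> (U \<rhd> prB E)"
  "F \<in> Cell1 K \<Longrightarrow> tgt K F = G \<Longrightarrow>
    (prj X \<lhd> (U \<odot> F)) \<bullet> (U \<rhd> (prA E \<lhd> F)) = (prj X \<lhd> (U \<odot> F)) \<bullet> (U \<rhd> (prB E \<lhd> F))"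
proof -
  interpret DE: tangent_calculus "hom_tcat K G E"
    by (rule EX.A.tangent_calculus_hom_tcat) simp
  have "id1 K G \<in> Ob (hom_tcat K G E)"
    by (simp add: hom1_iff)
  from DE.T2_pullback[OF this, of 0] have "prj E \<bullet> prA E = prj E \<bullet> prB E"
    by (simp add: is_pullback_def)
  from arg_cong[OF this, of "\<lambda>\<phi>. U \<rhd> \<phi>"]
  show e: "(prj X \<lhd> U) \<bullet> (U \<rhd> prA E) = (prj X \<lhd> U) \<bullet> (U \<rhd> prB E)"
    by simp
  show "(prj X \<lhd> (U \<odot> F)) \<bullet> (U \<rhd> (prA E \<lhd> F)) = (prj X \<lhd> (U \<odot> F)) \<bullet> (U \<rhd> (prB E \<lhd> F))"
    if "F \<in> Cell1 K" "tgt K F = G"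
    using arg_cong[OF e, of "\<lambda>\<phi>. \<phi> \<lhd> F"] that by simp
qed

lemma U_pls_comp:
  assumes F [simp]: "F \<in> Cell1 K" "src K F = base B" "tgt K F = G"
  shows "U \<rhd> (pls E \<lhd> F) = (pls X \<lhd> (U \<odot> F)) \<bullet>
    into_T2 BX.H (U \<odot> F) (U \<rhd> (prA E \<lhd> F)) (U \<rhd> (prB E \<lhd> F))"
proof -
  interpret P: strict_functor EX.H BX.H "\<lambda>N. N \<odot> F" "\<lambda>\<phi>. \<phi> \<lhd> F"
    by (rule precomposition_strict) (simp add: hom1_iff)
  note e = pre_projections(1)
  have P: "into_T2 EX.H U (U \<rhd> prA E) (U \<rhd> prB E) \<lhd> F =
      into_T2 BX.H (U \<odot> F) ((U \<rhd> prA E) \<lhd> F) ((U \<rhd> prB E) \<lhd> F)"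
    by (rule P.F1_into_T2) (use e in \<open>simp_all add: hom1_iff\<close>)
  have i: "into_T2 EX.H U (U \<rhd> prA E) (U \<rhd> prB E) \<in> Ar EX.H" "dom2 K (into_T2 EX.H U (U \<rhd> prA E) (U \<rhd> prB E)) = U \<odot> tan2 E"
    "cod2 K (into_T2 EX.H U (U \<rhd> prA E) (U \<rhd> prB E)) = tan2 X \<odot> U"
    using EX.D.into_T2(1-3)[of U "U \<rhd> prA E" "U \<rhd> prB E"] e by (simp_all add: hom1_iff)
  show ?thesis
    using arg_cong[OF U_pls, of "\<lambda>\<phi>. \<phi> \<lhd> F"] P i by (simp add: hom1_iff)
qed

text \<open>The comparison is an identity because \<open>U\<close> is strict.\<close>

lemma precomp_lax_eq:
  assumes M: "lax_tangent_morphism K B E M"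
  shows "precomp_lax K B E X Uo ku hu M = Idn (AC_cat BX.L) (AC_tan BX.L (pre_ob M))"
proof -
  have "fst (pre_ob N) = pre_lax N" for N
    by (simp add: precomp_ob_def)
  then show ?thesis
    using M by (simp add: precomp_lax_def L.AC_simps pre_ob_tan pre_lax_tan)
qed

theorem precomposition_lax:
  "lax_tangent_functor BE.L (AC_cat BX.L) pre_ob (precomp_ar K Uo ku hu) (precomp_lax K B E X Uo ku hu)"
  unfolding precomp_ar_eq
proof (rule L.lifted_functor_lax[OF BE.tangent_calculus_lax_hom], goal_cases)
  case (1 M)
  then show ?case by (simp add: pre_ob_Ob)
next
  case (2 f)
  moreover obtain M \<phi> N where "f = (M, \<phi>, N)" by (cases f)
  ultimately show ?case by (simp add: connection_natural)
next
  case (3 M)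
  then show ?case by (simp add: pre_ob_eq)
next
  case (4 f g)
  moreover obtain M \<phi> N N' \<psi> P where "f = (M, \<phi>, N)" "g = (N', \<psi>, P)" by (cases f; cases g)
  ultimately show ?case
    using BE.tangent_Cell[of M \<phi> N] BE.tangent_Cell[of N \<psi> P] by simp
next
  case (5 M)
  then show ?case by (simp add: pre_ob_tan)
next
  case (6 f)
  moreover obtain M \<phi> N where "f = (M, \<phi>, N)" by (cases f)
  ultimately show ?case
    using BE.tangent_Cell[of M \<phi> N] by (simp add: pre_lax_tan)
next
  case (7 M)
  then show ?case by (simp add: pre_ob_eq pre_lax_tan)
next
  case (8 M)
  then show ?case by (simp add: pre_ob_eq pre_lax_tan)
next
  case (9 M)
  then show ?case by (simp add: pre_ob_eq pre_lax_tan BE.lax_tan_lax)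
next
  case (10 M)
  then show ?case by (simp add: pre_ob_eq pre_lax_tan BE.lax_tan_lax)
next
  case (11 M)
  then have M: "lax_tangent_morphism K B E M" by simp
  note st = BE.tangent_structure[OF M]
  have a: "tangent_two_morphism K B X (pre_lax (lax_tan2 K B E M)) (U \<rhd> (prA E \<lhd> fst M)) (lax_tan K X (pre_lax M))"
    "tangent_two_morphism K B X (pre_lax (lax_tan2 K B E M)) (U \<rhd> (prB E \<lhd> fst M)) (lax_tan K X (pre_lax M))"
    using tangent_lwhisk[OF st(1) Uo_lax] tangent_lwhisk[OF st(2) Uo_lax] by (simp_all add: pre_lax_tan[OF M])
  have e: "(prj X \<lhd> fst (pre_lax M)) \<bullet> (U \<rhd> (prA E \<lhd> fst M)) = (prj X \<lhd> fst (pre_lax M)) \<bullet> (U \<rhd> (prB E \<lhd> fst M))"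
    using pre_projections(2)[of "fst M"] M by (simp add: pre_lax_eq)
  show ?case
    using BX.into_T2_lax_hom[OF pre_lax_Ob[OF M] a e] U_pls_comp[of "fst M"]
    by (simp add: pre_ob_eq M pre_lax_tan)
next
  case (12 M)
  then show ?case
    by (simp add: precomp_lax_eq)
qed

end

context precomposition
begin

lemma inj_pre_ob: "inj_on pre_ob (Ob BE.L)"
proof (rule inj_onI)
  fix M N
  assume "M \<in> Ob BE.L" "N \<in> Ob BE.L" and e: "pre_ob M = pre_ob N"
  then have M: "lax_tangent_morphism K B E M" and N: "lax_tangent_morphism K B E N"
    by simp_all
  have e: "U \<odot> fst M = U \<odot> fst N" "k \<lhd> fst M = k \<lhd> fst N" "h \<lhd> fst M = h \<lhd> fst N" "U \<rhd> snd M = U \<rhd> snd N"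
    using e by (simp_all add: pre_ob_eq M N pre_lax_eq)
  have "fst M = fst N"
    by (rule factor_unique[of _ "base B"]) (fact e | simp add: hom1_iff M N)+
  moreover from this have "snd M = snd N"
    by (intro faithful[OF _ _ _ _ _ e(4)]) (simp_all add: M N)
  ultimately show "M = N"
    by (rule prod_eqI)
qed

text \<open>
  The underlying connection of a connection on a lax tangent morphism \<open>(W, \<mu>)\<close> is classified by some
  \<open>F\<close>. Its arrows being tangent 2-morphisms means, after a flip is cancelled, that \<open>\<mu> : W T \<rightarrow> T W\<close> is a
  connection morphism from the restricted connection to the tangent connection. So \<open>\<mu>\<close> lifts to a law \<open>\<alpha>\<close>
  on \<open>F\<close>, and the axioms for \<open>\<alpha>\<close> follow from those for \<open>\<mu>\<close> since \<open>U\<close> is faithful.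
\<close>

lemma surj_pre_ob:
  assumes A: "A \<in> Ob (AC_cat BX.L)"
  obtains M where "lax_tangent_morphism K B E M" "pre_ob M = A"
proof -
  interpret S: strict_faithful_functor BX.L BX.H fst BX.cell
    by (rule BX.underlying_strict)
  obtain N \<kappa>' \<eta>' where A': "A = (N, \<kappa>', \<eta>')" by (cases A)
  have AC: "affine_connection BX.L N \<kappa>' \<eta>'"
    using A by (simp add: A' L.AC_Ob_iff)
  from L.affine_pre_connection[OF this]
  have N: "lax_tangent_morphism K B X N" and "\<kappa>' \<in> Hom BX.L (lax_tan K X (lax_tan K X N)) (lax_tan K X N)"
    "\<eta>' \<in> Hom BX.L (lax_tan2 K B X N) (lax_tan K X (lax_tan K X N))"
    by (simp_all add: L.pre_connection_def)
  then obtain \<kappa> \<eta> where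
    \<kappa>': "\<kappa>' = (lax_tan K X (lax_tan K X N), \<kappa>, lax_tan K X N)" 
    and \<eta>': "\<eta>' = (lax_tan2 K B X N, \<eta>, lax_tan K X (lax_tan K X N))"
    and \<kappa>: "tangent_two_morphism K B X (lax_tan K X (lax_tan K X N)) \<kappa> (lax_tan K X N)"
    and \<eta>: "tangent_two_morphism K B X (lax_tan2 K B X N) \<eta> (lax_tan K X (lax_tan K X N))"
    by (cases \<kappa>'; cases \<eta>') (simp add: Hom_iff)
  obtain W \<mu> where N': "N = (W, \<mu>)" by (cases N)
  note [simp] = BX.lax_Cell[OF N[unfolded N']]
  have AH: "affine_connection BX.H W \<kappa> \<eta>"
    using S.image_affine_connection[OF AC] by (simp add: \<kappa>' \<eta>' N')
  obtain F where F: "F \<in> hom1 K (base B) G" "U \<odot> F = W" "k \<lhd> F = \<kappa>" "h \<lhd> F = \<eta>"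
    using factor[OF AH] by blast
  have [simp]: "F \<in> Cell1 K" "src K F = base B" "tgt K F = G"
    using F(1) by (simp_all add: hom1_iff)
  have UF [simp]: "U \<odot> F \<odot> H = W \<odot> H" if "H \<in> Cell1 K" "tgt K H = base B" for H
    using arg_cong[OF F(2), of "\<lambda>G. G \<odot> H"] that by simp
  have UFw [simp]: "U \<rhd> F \<rhd> \<phi> = W \<rhd> \<phi>" if "\<phi> \<in> Cell2 K" "tgt K (dom2 K \<phi>) = base B" for \<phi>
    using arg_cong[OF F(2), of "\<lambda>G. G \<rhd> \<phi>"] that by simp
  interpret P: strict_functor EX.H BX.H "\<lambda>N. N \<odot> F" "\<lambda>\<phi>. \<phi> \<lhd> F"
    by (rule precomposition_strict) (simp add: hom1_iff)
  have T: "AC_tan BX.H (W, \<kappa>, \<eta>) = ((tan X \<odot> U) \<odot> F, k \<lhd> tan E \<lhd> F, h \<lhd> tan E \<lhd> F)"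
    unfolding F(2-4)[symmetric]
    by (rule P.image_AC_tan) (use connection_tan EX.D.affine_pre_connection universal in simp_all)
  have kT: "k \<lhd> (tan E \<odot> F) = (flp X \<lhd> W) \<bullet> (tan X \<rhd> \<kappa>) \<bullet> (flp X \<lhd> (tan X \<odot> W)) \<bullet> (tan X \<rhd> (flp X \<lhd> W))"
    and hT: "h \<lhd> (tan E \<odot> F) = (tan X \<rhd> (flp X \<lhd> W)) \<bullet> (flp X \<lhd> (tan X \<odot> W)) \<bullet> (tan X \<rhd> \<eta>) \<bullet> BX.D.T2sg W"
    using T by (simp_all add: AC_tan_def BX.D.T2sg_def F(2))
  have kB: "k \<lhd> (F \<odot> tan B) = \<kappa> \<lhd> tan B" and hB: "h \<lhd> (F \<odot> tan B) = \<eta> \<lhd> tan B"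
    by (simp_all flip: F(3,4))
  have kc: "\<kappa> \<in> Cell2 K" "dom2 K \<kappa> = tan X \<odot> tan X \<odot> W" "cod2 K \<kappa> = tan X \<odot> W"
    and hc: "\<eta> \<in> Cell2 K" "dom2 K \<eta> = tan2 X \<odot> W" "cod2 K \<eta> = tan X \<odot> tan X \<odot> W"
    using BX.tangent_Cell(1-3)[OF \<kappa>] BX.tangent_Cell(1-3)[OF \<eta>] by (simp_all add: N')
  note [simp] = kc hc
  have WO: "W \<in> Ob BX.H"
    by (simp add: hom1_iff)
  note [simp] = BX.T2sg_Cell[of W]
  have k: "(tan X \<rhd> \<mu>) \<bullet> (k \<lhd> (F \<odot> tan B)) = (k \<lhd> (tan E \<odot> F)) \<bullet> (tan X \<rhd> tan X \<rhd> \<mu>)"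
    unfolding kB kT
    using BX.tangent_Cell(7)[OF \<kappa>] BX.D.structure_act(8)[of W] BX.D.act_Idn WO
    by (intro act_ext2[of _ _ "base B" X]) (simp_all add: N' lax_tan_def hom1_iff)
  have h: "(tan X \<rhd> tan X \<rhd> \<mu>) \<bullet> (h \<lhd> (F \<odot> tan B)) = (h \<lhd> (tan E \<odot> F)) \<bullet> (tan2 X \<rhd> \<mu>)"
    unfolding hB hT
    using BX.tangent_Cell(7)[OF \<eta>] BX.D.structure_act(8)[of "tan X \<odot> W"] BX.D.T_structure_act(8)[of W] BX.D.act_Idn WO
      BX.lax_tan2_eq[OF N[unfolded N']]
    by (intro act_ext2[of _ _ "base B" X]) (simp_all add: N' lax_tan_def hom1_iff)
  have "\<mu> \<in> hom2 K (U \<odot> F \<odot> tan B) (U \<odot> tan E \<odot> F)"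
    by (simp add: hom2_iff F(2))
  then obtain \<alpha> where \<alpha>: "\<alpha> \<in> hom2 K (F \<odot> tan B) (tan E \<odot> F)" "U \<rhd> \<alpha> = \<mu>"
    using factor2[of "F \<odot> tan B" "base B" "tan E \<odot> F" \<mu>] k h by (auto simp: hom1_iff)
  have [simp]: "\<alpha> \<in> Cell2 K" "dom2 K \<alpha> = F \<odot> tan B" "cod2 K \<alpha> = tan E \<odot> F"
    using \<alpha>(1) by (simp_all add: hom2_iff)
  have n: "(prj X \<lhd> W) \<bullet> \<mu> = W \<rhd> prj B" "\<mu> \<bullet> (W \<rhd> zer B) = zer X \<lhd> W"
    "\<mu> \<bullet> (W \<rhd> pls B) = (pls X \<lhd> W) \<bullet> into_T2 BX.H W (\<mu> \<bullet> (W \<rhd> prA B)) (\<mu> \<bullet> (W \<rhd> prB B))"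
    "(lft X \<lhd> W) \<bullet> \<mu> = (tan X \<rhd> \<mu>) \<bullet> (\<mu> \<lhd> tan B) \<bullet> (W \<rhd> lft B)"
    "(flp X \<lhd> W) \<bullet> (tan X \<rhd> \<mu>) \<bullet> (\<mu> \<lhd> tan B) = (tan X \<rhd> \<mu>) \<bullet> (\<mu> \<lhd> tan B) \<bullet> (W \<rhd> flp B)"
    using N unfolding lax_tangent_morphism_def N' prod.case
    by (simp_all add: into_T2_def hom_tcat_hom_cat)
  have \<alpha>B: "U \<rhd> (\<alpha> \<lhd> tan B) = \<mu> \<lhd> tan B"
    using arg_cong[OF \<alpha>(2), of "\<lambda>\<phi>. \<phi> \<lhd> tan B"] by simp
  note up = \<alpha>(2) \<alpha>B F(2) n(1,2,4,5)
  have p: "(prj E \<lhd> F) \<bullet> \<alpha> = F \<rhd> prj B"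
    by (rule faithful) (simp_all add: up)
  have z: "\<alpha> \<bullet> (F \<rhd> zer B) = zer E \<lhd> F"
    by (rule faithful) (simp_all add: up)
  have l: "(lft E \<lhd> F) \<bullet> \<alpha> = (tan E \<rhd> \<alpha>) \<bullet> (\<alpha> \<lhd> tan B) \<bullet> (F \<rhd> lft B)"
    by (rule faithful) (simp_all add: up)
  have c: "(flp E \<lhd> F) \<bullet> (tan E \<rhd> \<alpha>) \<bullet> (\<alpha> \<lhd> tan B) = (tan E \<rhd> \<alpha>) \<bullet> (\<alpha> \<lhd> tan B) \<bullet> (F \<rhd> flp B)"
    by (rule faithful) (simp_all add: up)
  have s: "\<alpha> \<bullet> (F \<rhd> pls B) = (pls E \<lhd> F) \<bullet> into_T2 BE.H F (\<alpha> \<bullet> (F \<rhd> prA B)) (\<alpha> \<bullet> (F \<rhd> prB B))"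
  proof -
    let ?x = "\<alpha> \<bullet> (F \<rhd> prA B)" and ?y = "\<alpha> \<bullet> (F \<rhd> prB B)"
    interpret DB: tangent_calculus "hom_tcat K (base B) B"
      by (rule BX.A.tangent_calculus_hom_tcat) simp
    have "id1 K (base B) \<in> Ob (hom_tcat K (base B) B)"
      by (simp add: hom1_iff)
    from DB.T2_pullback[OF this, of 0] have "prj B \<bullet> prA B = prj B \<bullet> prB B"
      by (simp add: is_pullback_def)
    from arg_cong[OF this, of "\<lambda>\<phi>. F \<rhd> \<phi>"] have e: "(prj E \<lhd> F) \<bullet> ?x = (prj E \<lhd> F) \<bullet> ?y"
      using arg_cong[OF p, of "\<lambda>\<phi>. \<phi> \<bullet> (F \<rhd> prA B)"] arg_cong[OF p, of "\<lambda>\<phi>. \<phi> \<bullet> (F \<rhd> prB B)"] by simp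
    have P: "into_T2 BE.H F ?x ?y \<in> Cell2 K" "dom2 K (into_T2 BE.H F ?x ?y) = F \<odot> tan2 B"
      "cod2 K (into_T2 BE.H F ?x ?y) = tan2 E \<odot> F"
      "(prA E \<lhd> F) \<bullet> into_T2 BE.H F ?x ?y = ?x" "(prB E \<lhd> F) \<bullet> into_T2 BE.H F ?x ?y = ?y"
      using BE.D.into_T2[of F ?x ?y] e by (simp_all add: hom1_iff)
    note [simp] = P(1-3)
    have ab: "(U \<rhd> (prA E \<lhd> F)) \<bullet> (U \<rhd> into_T2 BE.H F ?x ?y) = \<mu> \<bullet> (W \<rhd> prA B)"
      "(U \<rhd> (prB E \<lhd> F)) \<bullet> (U \<rhd> into_T2 BE.H F ?x ?y) = \<mu> \<bullet> (W \<rhd> prB B)"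
      using P(4,5)[THEN arg_cong[of _ _ "\<lambda>\<phi>. U \<rhd> \<phi>"]] by (simp_all add: \<alpha>(2))
    have i: "into_T2 BX.H W (U \<rhd> (prA E \<lhd> F)) (U \<rhd> (prB E \<lhd> F)) \<in> Ar BX.H"
      "dom2 K (into_T2 BX.H W (U \<rhd> (prA E \<lhd> F)) (U \<rhd> (prB E \<lhd> F))) = U \<odot> tan2 E \<odot> F"
      "cod2 K (into_T2 BX.H W (U \<rhd> (prA E \<lhd> F)) (U \<rhd> (prB E \<lhd> F))) = tan2 X \<odot> W"
      and "into_T2 BX.H W (U \<rhd> (prA E \<lhd> F)) (U \<rhd> (prB E \<lhd> F)) \<bullet> (U \<rhd> into_T2 BE.H F ?x ?y) =
        into_T2 BX.H W (\<mu> \<bullet> (W \<rhd> prA B)) (\<mu> \<bullet> (W \<rhd> prB B))"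
      using BX.D.into_T2_comp[of W "U \<rhd> (prA E \<lhd> F)" "U \<rhd> (prB E \<lhd> F)" "U \<rhd> into_T2 BE.H F ?x ?y"]
        BX.D.into_T2(1-3)[of W "U \<rhd> (prA E \<lhd> F)" "U \<rhd> (prB E \<lhd> F)"] pre_projections(2)[of F] ab
      by (simp_all add: hom1_iff F(2))
    moreover have "U \<rhd> (pls E \<lhd> F) = (pls X \<lhd> W) \<bullet> into_T2 BX.H W (U \<rhd> (prA E \<lhd> F)) (U \<rhd> (prB E \<lhd> F))"
      using U_pls_comp[of F] by (simp add: F(2))
    ultimately have eq: "U \<rhd> (\<alpha> \<bullet> (F \<rhd> pls B)) = U \<rhd> ((pls E \<lhd> F) \<bullet> into_T2 BE.H F ?x ?y)"
      by (simp add: hom1_iff up n(3))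
    show ?thesis
      by (rule faithful[OF _ _ _ _ _ eq]) simp_all
  qed
  have lax: "lax_tangent_morphism K B E (F, \<alpha>)"
    using p z l c s by (simp add: lax_tangent_morphism_def hom1_iff hom2_iff into_T2_def hom_tcat_hom_cat)
  have "pre_ob (F, \<alpha>) = A"
    using F \<alpha>(2) by (simp add: pre_ob_eq[OF lax] pre_lax_eq[OF lax] A' \<kappa>' \<eta>' N')
  then show thesis
    using that lax by blast
qed

theorem bij_pre_ob: "bij_betw pre_ob (Ob BE.L) (Ob (AC_cat BX.L))"
  unfolding bij_betw_def
proof (intro conjI inj_pre_ob set_eqI iffI)
  fix A
  assume "A \<in> Ob (AC_cat BX.L)"
  then show "A \<in> pre_ob ` Ob BE.L"
    by (rule surj_pre_ob) auto
qed (auto simp: pre_ob_Ob)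

text \<open>A morphism of connections lifts to a 2-cell along \<open>U\<close>, and the lift is tangent because its image is
  and \<open>U\<close> is faithful.\<close>

theorem bij_precomp_ar: "bij_betw (precomp_ar K Uo ku hu) (Ar BE.L) (Ar (AC_cat BX.L))"
  unfolding bij_betw_def
proof (intro conjI inj_onI set_eqI iffI)
  fix f g
  assume fg: "f \<in> Ar BE.L" "g \<in> Ar BE.L" and e: "precomp_ar K Uo ku hu f = precomp_ar K Uo ku hu g"
  obtain M \<phi> N M' \<psi> N' where d: "f = (M, \<phi>, N)" "g = (M', \<psi>, N')"
    by (cases f; cases g)
  have "tangent_two_morphism K B E M \<phi> N" "tangent_two_morphism K B E M' \<psi> N'"
    using fg by (simp_all add: d)
  note t = this[THEN BE.tangent_Cell(1)] this[THEN BE.tangent_Cell(2)] this[THEN BE.tangent_Cell(3)]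
    this[THEN BE.tangent_Cell(5)] this[THEN BE.tangent_Cell(6)]
  have MN: "pre_ob M = pre_ob M'" "pre_ob N = pre_ob N'" "U \<rhd> \<phi> = U \<rhd> \<psi>"
    using e by (simp_all add: d precomp_ar_def)
  have "M = M'" "N = N'"
    using inj_onD[OF inj_pre_ob MN(1)] inj_onD[OF inj_pre_ob MN(2)] t by simp_all
  moreover from this have "\<phi> = \<psi>"
    using t by (intro faithful[OF _ _ _ _ _ MN(3)]) simp_all
  ultimately show "f = g"
    by (simp add: d)
next
  fix g
  assume "g \<in> precomp_ar K Uo ku hu ` Ar BE.L"
  then obtain M \<phi> N where "g = precomp_ar K Uo ku hu (M, \<phi>, N)" "tangent_two_morphism K B E M \<phi> N"
    by auto
  then show "g \<in> Ar (AC_cat BX.L)"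
    using connection_natural[of M \<phi> N] BE.tangent_Cell(5,6)[of M \<phi> N]
    by (simp add: precomp_ar_def L.AC_Ar_iff pre_ob_Ob)
next
  fix g
  assume g: "g \<in> Ar (AC_cat BX.L)"
  obtain A f A' where gA: "g = (A, f, A')" by (cases g)
  have A: "A \<in> Ob (AC_cat BX.L)" "A' \<in> Ob (AC_cat BX.L)" and f: "L.conn_mor A f A'"
    using g by (simp_all add: gA L.AC_Ar_iff)
  obtain M where M: "lax_tangent_morphism K B E M" "pre_ob M = A"
    using surj_pre_ob[OF A(1)] .
  obtain N where N: "lax_tangent_morphism K B E N" "pre_ob N = A'"
    using surj_pre_ob[OF A(2)] .
  note [simp] = lax_Cell_E[OF M(1)] lax_Cell_E[OF N(1)]
  obtain \<theta> where fth: "f = (pre_lax M, \<theta>, pre_lax N)" and th: "tangent_two_morphism K B X (pre_lax M) \<theta> (pre_lax N)"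
  proof -
    have "f \<in> Hom BX.L (pre_lax M) (pre_lax N)"
      using f unfolding M(2)[symmetric] N(2)[symmetric] pre_ob_eq[OF M(1)] pre_ob_eq[OF N(1)]
      by (simp add: L.conn_mor_def)
    then show thesis
      using that by (cases f) (auto simp: Hom_iff)
  qed
  note t = BX.tangent_Cell[OF th]
  have \<theta> [simp]: "\<theta> \<in> Cell2 K" "dom2 K \<theta> = U \<odot> fst M" "cod2 K \<theta> = U \<odot> fst N"
    using t(1-3) by (simp_all add: pre_lax_eq M(1) N(1))
  have e: "(tan X \<rhd> \<theta>) \<bullet> (k \<lhd> fst M) = (k \<lhd> fst N) \<bullet> (tan X \<rhd> tan X \<rhd> \<theta>)"
    "(tan X \<rhd> tan X \<rhd> \<theta>) \<bullet> (h \<lhd> fst M) = (h \<lhd> fst N) \<bullet> (tan2 X \<rhd> \<theta>)"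
    using f unfolding M(2)[symmetric] N(2)[symmetric] pre_ob_eq[OF M(1)] pre_ob_eq[OF N(1)]
    by (simp_all add: L.conn_mor_def fth BX.T2ar_lax_hom[OF th])
  obtain \<phi> where \<phi>: "\<phi> \<in> hom2 K (fst M) (fst N)" "U \<rhd> \<phi> = \<theta>"
    using factor2[of "fst M" "base B" "fst N" \<theta>] e by (auto simp: hom1_iff hom2_iff)
  have [simp]: "\<phi> \<in> Cell2 K" "dom2 K \<phi> = fst M" "cod2 K \<phi> = fst N"
    using \<phi>(1) by (simp_all add: hom2_iff)
  have "(tan X \<rhd> \<theta>) \<bullet> (U \<rhd> snd M) = (U \<rhd> snd N) \<bullet> (\<theta> \<lhd> tan B)"
    using th M(1) N(1) by (simp add: tangent_two_morphism_def pre_lax_eq)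
  then have "U \<rhd> ((tan E \<rhd> \<phi>) \<bullet> snd M) = U \<rhd> (snd N \<bullet> (\<phi> \<lhd> tan B))"
    by (simp flip: \<phi>(2))
  then have "(tan E \<rhd> \<phi>) \<bullet> snd M = snd N \<bullet> (\<phi> \<lhd> tan B)"
    by (rule faithful[rotated -1]) simp_all
  then have "tangent_two_morphism K B E M \<phi> N"
    using M(1) N(1) by (simp add: tangent_two_morphism_def hom2_iff)
  moreover have "g = precomp_ar K Uo ku hu (M, \<phi>, N)"
    by (simp add: gA precomp_ar_def M N fth \<phi>)
  ultimately show "g \<in> precomp_ar K Uo ku hu ` Ar BE.L"
    by (intro image_eqI[of _ _ "(M, \<phi>, N)"]) simp_all
qed

theorem precomposition_isomorphism:
  "tangent_isomorphism BE.L (AC_cat BX.L) pre_ob (precomp_ar K Uo ku hu) (precomp_lax K B E X Uo ku hu)"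
  unfolding tangent_isomorphism_def
proof (intro conjI ballI precomposition_lax bij_pre_ob bij_precomp_ar)
  fix M
  assume "M \<in> Ob BE.L"
  then have M: "lax_tangent_morphism K B E M" by simp
  have "precomp_lax K B E X Uo ku hu M = Idn (AC_cat BX.L) (AC_tan BX.L (pre_ob M))"
    by (rule precomp_lax_eq[OF M])
  then show "is_iso (AC_cat BX.L) (precomp_lax K B E X Uo ku hu M)"
    using L.AC_iso_Idn[of "AC_tan BX.L (pre_ob M)"] M by (simp add: pre_ob_tan pre_ob_Ob BE.lax_tan_lax)
qed

end

section \<open>The construction of affine connections\<close>

theorem (in induced_tangentad) affine_connection_construction:
  "is_AC_construction K X E Uo (vert_arrow K X U k) (horiz_arrow K E X U h)"
proof -
  have iso: "tangent_isomorphism (lax_hom K B E) (AC_cat (lax_hom K B X))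
      (precomp_ob K Uo (vert_arrow K X U k) (horiz_arrow K E X U h))
      (precomp_ar K Uo (vert_arrow K X U k) (horiz_arrow K E X U h))
      (precomp_lax K B E X Uo (vert_arrow K X U k) (horiz_arrow K E X U h))
    \<and> affine_connection (lax_hom K E X) Uo (vert_arrow K X U k) (horiz_arrow K E X U h)"
    if "is_tangentad K B" for B
  proof -
    interpret precomposition K X G U k h E B
      by unfold_locales (use that EX.A_tangentad in simp_all)
    show ?thesis
      using precomposition_isomorphism universal_lax by blast
  qed
  then show ?thesis
    using EX.A_tangentad Uo_lax unfolding is_AC_construction_def by blast
qed

theorem theorem5p57:
  fixes K :: "('o, 'm, 'c) two_cat" (structure)
    and X :: "('o, 'm, 'c) tangentad"
  assumes "two_category K"
    and "is_tangentad K X"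
    \<comment> \<open>vertical affine connections\<close>
    and "is_inserter K (tan X \<odot> tan X) (tan X) I V\<^sub>0 K\<^sub>0"
    and "is_equifier K (axV1 (hom_tcat K I X) V\<^sub>0 K\<^sub>0) E\<^sub>1 e\<^sub>1"
    and "is_equifier K (axV2 (hom_tcat K E\<^sub>1 X) (V\<^sub>0 \<odot> e\<^sub>1) (K\<^sub>0 \<lhd> e\<^sub>1)) E\<^sub>2 e\<^sub>2"
    and "is_equifier K (axV3 (hom_tcat K E\<^sub>2 X) (V\<^sub>0 \<odot> e\<^sub>1 \<odot> e\<^sub>2) (K\<^sub>0 \<lhd> (e\<^sub>1 \<odot> e\<^sub>2))) E\<^sub>3 e\<^sub>3"
    and "is_equifier K (axV4 (hom_tcat K E\<^sub>3 X) (V\<^sub>0 \<odot> e\<^sub>1 \<odot> e\<^sub>2 \<odot> e\<^sub>3) (K\<^sub>0 \<lhd> (e\<^sub>1 \<odot> e\<^sub>2 \<odot> e\<^sub>3))) E\<^sub>4 e\<^sub>4"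
    and U_VAC: "U_VAC = V\<^sub>0 \<odot> e\<^sub>1 \<odot> e\<^sub>2 \<odot> e\<^sub>3 \<odot> e\<^sub>4"
    and k_VAC: "k_VAC = K\<^sub>0 \<lhd> (e\<^sub>1 \<odot> e\<^sub>2 \<odot> e\<^sub>3 \<odot> e\<^sub>4)"
    \<comment> \<open>horizontal affine connections\<close>
    and "is_inserter K (tan2 X) (tan X \<odot> tan X) J W\<^sub>0 H\<^sub>0"
    and "is_equifier K (axH1 (hom_tcat K J X) W\<^sub>0 H\<^sub>0) F\<^sub>1 f\<^sub>1"
    and "is_equifier K (axH2 (hom_tcat K F\<^sub>1 X) (W\<^sub>0 \<odot> f\<^sub>1) (H\<^sub>0 \<lhd> f\<^sub>1)) F\<^sub>2 f\<^sub>2"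
    and "is_equifier K (axH3 (hom_tcat K F\<^sub>2 X) (W\<^sub>0 \<odot> f\<^sub>1 \<odot> f\<^sub>2) (H\<^sub>0 \<lhd> (f\<^sub>1 \<odot> f\<^sub>2))) F\<^sub>3 f\<^sub>3"
    and "is_equifier K (axH4 (hom_tcat K F\<^sub>3 X) (W\<^sub>0 \<odot> f\<^sub>1 \<odot> f\<^sub>2 \<odot> f\<^sub>3) (H\<^sub>0 \<lhd> (f\<^sub>1 \<odot> f\<^sub>2 \<odot> f\<^sub>3))) F\<^sub>4 f\<^sub>4"
    and U_HAC: "U_HAC = W\<^sub>0 \<odot> f\<^sub>1 \<odot> f\<^sub>2 \<odot> f\<^sub>3 \<odot> f\<^sub>4"
    and h_HAC: "h_HAC = H\<^sub>0 \<lhd> (f\<^sub>1 \<odot> f\<^sub>2 \<odot> f\<^sub>3 \<odot> f\<^sub>4)"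
    \<comment> \<open>affine connections\<close>
    and "is_two_pullback K U_VAC U_HAC AC\<^sub>0 q q'"
    and "is_equifier K (axA1 (hom_tcat K AC\<^sub>0 X) (U_VAC \<odot> q) (k_VAC \<lhd> q) (h_HAC \<lhd> q')) G\<^sub>1 g\<^sub>1"
    and "is_equifier K (axA2 (hom_tcat K G\<^sub>1 X) (U_VAC \<odot> q \<odot> g\<^sub>1)
           (k_VAC \<lhd> (q \<odot> g\<^sub>1)) (h_HAC \<lhd> (q' \<odot> g\<^sub>1))) G\<^sub>2 g\<^sub>2"
    and U: "U = U_VAC \<odot> q \<odot> g\<^sub>1 \<odot> g\<^sub>2"
    and k: "k = k_VAC \<lhd> (q \<odot> g\<^sub>1 \<odot> g\<^sub>2)"
    and h: "h = h_HAC \<lhd> (q' \<odot> g\<^sub>1 \<odot> g\<^sub>2)"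
  shows "admits_AC K X \<and>
    (\<exists>E. base E = G\<^sub>2 \<and> is_induced_tangentad K X U k h E) \<and>
    (\<forall>E. base E = G\<^sub>2 \<and> is_induced_tangentad K X U k h E \<longrightarrow>
       is_AC_construction K X E (strict_lax K X U) (vert_arrow K X U k) (horiz_arrow K E X U h))"
proof -
  interpret affine_limits K X I V\<^sub>0 K\<^sub>0 E\<^sub>1 e\<^sub>1 E\<^sub>2 e\<^sub>2 E\<^sub>3 e\<^sub>3 E\<^sub>4 e\<^sub>4 U_VAC k_VAC J W\<^sub>0 H\<^sub>0 F\<^sub>1 f\<^sub>1 F\<^sub>2 f\<^sub>2 F\<^sub>3 f\<^sub>3 F\<^sub>4 f\<^sub>4
      U_HAC h_HAC AC\<^sub>0 q q' G\<^sub>1 g\<^sub>1 G\<^sub>2 g\<^sub>2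
    by (intro affine_limits.intro tangentad.intro tangentad_axioms.intro affine_limits_axioms.intro) (fact assms)+
  interpret affine_object K X G\<^sub>2 U k h
    unfolding U k h by (rule represents)
  have construction: "is_AC_construction K X E (strict_lax K X U) (vert_arrow K X U k) (horiz_arrow K E X U h)"
    if "base E = G\<^sub>2" "is_induced_tangentad K X U k h E" for E
  proof -
    interpret induced_tangentad K X G\<^sub>2 U k h E
      by unfold_locales (fact that)+
    show ?thesis
      by (rule affine_connection_construction)
  qed
  then show ?thesis
    using induced_exists unfolding admits_AC_def by blast
qed

end
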